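(* Let $d\ge1$, let $B\in C^1_b(\mathbb{R}^d,\mathbb{R}^d)$, let $\mu_0$ be a probability measure on $\mathbb{R}^d$, let $X$ be the solution of $dX_t=B(X_t)dt+dW_t$ with $X_0\sim\mu_0$ independent of the $d$-dimensional Brownian motion $W$, and let $M_t=\sup_{0\le s\le t}X^1_s$. Then the density $p_V(\cdot;t)$ of $(M_t,X_t)$, $t>0$, satisfies: (i) for every $T>0$, the map $(t,m,\tilde x)\mapsto\sup_{u>0}p_V(m,m-u,\tilde x;t)$ belongs to $L^1([0,T]\times\mathbb{R}^d,dt\,dm\,d\tilde x)$; (ii) for all $t>0$, for Lebesgue-almost every $(m,\tilde x)\in\mathbb{R}^d$, the limit $p_V(m,m,\tilde x;t):=\lim_{u\to0^+}p_V(m,m-u,\tilde x;t)$ exists. As a consequence, for every $F\in C^2_b(\mathbb{R}^{d+1},\mathbb{R})$ and $t>0$, $$\mathbb{E}[F(M_t,X_t)]=\mathbb{E}[F(X^1_0,X_0)]+\int_0^t\mathbb{E}[\mathcal{L}(F)(M_s,X_s)]\,ds+\frac12\int_0^t\mathbb{E}\left[\partial_mF(X^1_s,X_s)\,\frac{p_V(X^1_s,X_s;s)}{p_X(X_s;s)}\right]ds .$$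
   Context: $C^i_b(\mathbb{R}^d,\mathbb{R}^n)$ is the set of $i$ times (continuously) differentiable bounded functions with bounded derivatives. Points of $\mathbb{R}^{d+1}$ are written $(m,x)$ with $m\in\mathbb{R}$, $x=(x^1,\dots,x^d)\in\mathbb{R}^d$, and $\tilde x=(x^2,\dots,x^d)$; $\partial_m$ is the derivative in the first variable. For $\Phi\in C^2(\mathbb{R}^{d+1},\mathbb{R})$, $\mathcal{L}(\Phi)(m,x)=\sum_iB^i(x)\partial_{x_i}\Phi(m,x)+\frac12\sum_{i}\partial^2_{x_ix_i}\Phi(m,x)$ (no derivative in $m$). It is known that for every $t>0$ the law of $V_t=(M_t,X_t)$ has a density $p_V(\cdot;t)$ with respect to Lebesgue measure on $\mathbb{R}^{d+1}$, supported in $\{(m,x): m\ge x^1\}$, and that $X_t$ has a positive density $p_X(\cdot;t)$ on $\mathbb{R}^d$. Statements (i) and (ii) are understood for a suitable version of the density $p_V$. The notation $p_V(X^1_s,X_s;s)$ means $p_V(m,m,\tilde x;s)$ at $(m,\tilde x)=X_s$. *)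

theory Defs
  imports "HOL-Probability.Probability"
begin

definition C1_b :: "('a::real_normed_vector \<Rightarrow> 'b::real_normed_vector) \<Rightarrow> bool" where
  "C1_b f \<longleftrightarrow> bounded (range f) \<and>
     (\<exists>f' :: 'a \<Rightarrow> 'a \<Rightarrow>\<^sub>L 'b. (\<forall>x. (f has_derivative blinfun_apply (f' x)) (at x)) \<and>
        continuous_on UNIV f' \<and> bounded (range f'))"

definition C2_b :: "('a::real_normed_vector \<Rightarrow> 'b::real_normed_vector) \<Rightarrow> bool" where
  "C2_b f \<longleftrightarrow> bounded (range f) \<and>
     (\<exists>f' :: 'a \<Rightarrow> 'a \<Rightarrow>\<^sub>L 'b. (\<forall>x. (f has_derivative blinfun_apply (f' x)) (at x)) \<and> C1_b f')"

text \<open>Points of $R^{d+1}$ are pairs $(m,x)$ of type \<^typ>\<open>real \<times> (real ^ 'd)\<close>, so $d$ is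
  the cardinality of \<^typ>\<open>'d\<close>.\<close>

definition dir_deriv :: "'a::real_normed_vector \<Rightarrow> ('a \<Rightarrow> real) \<Rightarrow> 'a \<Rightarrow> real" where
  "dir_deriv v f z = deriv (\<lambda>h. f (z + h *\<^sub>R v)) 0"

abbreviation partial_m :: "(real \<times> (real ^ 'd) \<Rightarrow> real) \<Rightarrow> real \<times> (real ^ 'd) \<Rightarrow> real" where
  "partial_m \<equiv> dir_deriv (1, 0)"

abbreviation partial_x :: "'d \<Rightarrow> (real \<times> (real ^ 'd) \<Rightarrow> real) \<Rightarrow> real \<times> (real ^ 'd) \<Rightarrow> real" where
  "partial_x i \<equiv> dir_deriv (0, axis i 1)"

definition generator ::
  "(real ^ 'd \<Rightarrow> real ^ 'd) \<Rightarrow> (real \<times> (real ^ 'd) \<Rightarrow> real) \<Rightarrow> real \<times> (real ^ 'd) \<Rightarrow> real" where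
  "generator B \<Phi> z =
     (\<Sum>i\<in>UNIV. B (snd z) $ i * partial_x i \<Phi> z) +
     1/2 * (\<Sum>i\<in>UNIV. partial_x i (partial_x i \<Phi>) z)"

text \<open>Standard Brownian motion started at 0, indexed by the times $t \ge 0$; values at
  negative times are irrelevant.\<close>

definition brownian_motion :: "'w measure \<Rightarrow> (real \<Rightarrow> 'w \<Rightarrow> real ^ 'd) \<Rightarrow> bool" where
  "brownian_motion M W \<longleftrightarrow>
     (\<forall>t\<ge>0. W t \<in> borel_measurable M) \<and>
     (AE \<omega> in M. W 0 \<omega> = 0 \<and> continuous_on {0..} (\<lambda>t. W t \<omega>)) \<and>
     (\<forall>s t. 0 \<le> s \<and> s < t \<longrightarrow>
        distributed M lborel (\<lambda>\<omega>. W t \<omega> - W s \<omega>)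
          (\<lambda>x. ennreal (\<Prod>i\<in>UNIV. normal_density 0 (sqrt (t - s)) (x $ i)))) \<and>
     (\<forall>(n::nat) \<tau>. 0 \<le> \<tau> 0 \<and> (\<forall>i<n. \<tau> i < \<tau> (Suc i)) \<longrightarrow>
        prob_space.indep_vars M (\<lambda>_. borel) (\<lambda>i \<omega>. W (\<tau> (Suc i)) \<omega> - W (\<tau> i) \<omega>) {..<n})"

text \<open>The noise is additive, so the equation $dX_t = B(X_t)\,dt + dW_t$ needs no stochastic
  integral. The initial value is independent of the sigma-algebra generated by the whole
  process $W$. Paths of $X$ are continuous for every outcome, which
  makes the running maximum measurable without completing the probability space.\<close>

definition sde_solution ::
  "'w measure \<Rightarrow> (real ^ 'd \<Rightarrow> real ^ 'd) \<Rightarrow> (real ^ 'd) measure \<Rightarrow> (real \<Rightarrow> 'w \<Rightarrow> real ^ 'd) \<Rightarrow>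
   (real \<Rightarrow> 'w \<Rightarrow> real ^ 'd) \<Rightarrow> bool" where
  "sde_solution M B \<mu>0 W X \<longleftrightarrow>
     (\<forall>t\<ge>0. X t \<in> borel_measurable M) \<and>
     (\<forall>\<omega>\<in>space M. continuous_on {0..} (\<lambda>t. X t \<omega>)) \<and>
     distr M borel (X 0) = \<mu>0 \<and>
     prob_space.indep_set M
       (sets (vimage_algebra (space M) (X 0) borel))
       (sets (vimage_algebra (space M) (\<lambda>\<omega>. \<lambda>t\<in>{0..}. W t \<omega>) (PiM {0..} (\<lambda>_. borel)))) \<and>
     (AE \<omega> in M. \<forall>t\<ge>0. X t \<omega> = X 0 \<omega> + integral {0..t} (\<lambda>s. B (X s \<omega>)) + W t \<omega>)"

text \<open>The index \<open>k\<close> plays the role of the distinguished first coordinate.\<close>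

definition running_max :: "'d \<Rightarrow> (real \<Rightarrow> 'w \<Rightarrow> real ^ 'd) \<Rightarrow> real \<Rightarrow> 'w \<Rightarrow> real" where
  "running_max k X t \<omega> = (SUP s\<in>{0..t}. X s \<omega> $ k)"

definition has_density :: "'w measure \<Rightarrow> ('w \<Rightarrow> 'a::euclidean_space) \<Rightarrow> ('a \<Rightarrow> real) \<Rightarrow> bool" where
  "has_density M Y f \<longleftrightarrow> (\<forall>z. 0 \<le> f z) \<and> distributed M lborel Y (\<lambda>z. ennreal (f z))"

text \<open>A pair $(m,\tilde x)$ is encoded as the vector \<open>y\<close> with \<open>y $ k\<close> equal to $m$ and the
  other coordinates given by $\tilde x$; then \<open>below_diag k y u\<close> is $(m, m-u, \tilde x)$.\<close>

definition below_diag :: "'d \<Rightarrow> real ^ 'd \<Rightarrow> real \<Rightarrow> real \<times> (real ^ 'd)" where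
  "below_diag k y u = (y $ k, y - u *\<^sub>R axis k 1)"

definition diag_trace :: "'d \<Rightarrow> (real \<times> (real ^ 'd) \<Rightarrow> real) \<Rightarrow> real ^ 'd \<Rightarrow> real" where
  "diag_trace k q y = Lim (at_right 0) (\<lambda>u. q (below_diag k y u))"

end

theory Submission imports Defs begin

text \<open>Without drift, the joint density of the running maximum and the position is explicit by reflection.
 The drift is treated as a perturbation: a parametrix series \<open>\<Sum>n. p\<^sub>n\<close>, built from the heat kernel absorbed
 at a level \<open>c\<close>, converges with the bound \<open>const * t powr (-1/2)\<close> times a Gaussian average of the initial law,
 uniformly in the distance to the diagonal, and its terms are continuous up to the diagonal. Up to the first
 passage over \<open>c\<close>, the process satisfies the same Duhamel equation as the partial sums, tested against bounded
 continuous functions; iterating it, the difference contracts to 0, so the series is the density. No stochastic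
 calculus is needed: independence of past and future comes from the Euler scheme.

 For the formula, \<open>E[F(M\<^sub>t, X\<^sub>t)]\<close> is the limit of averaged difference quotients over a step \<open>h\<close>. Moving \<open>X\<close>
 gives the generator by a Taylor expansion. Moving \<open>M\<close> gives \<open>E[\<partial>\<^sub>m F (S\<^sub>h - D)\<^sup>+] / h\<close>, where \<open>D = M\<^sub>s - X\<^sub>s\<close> in the
 distinguished coordinate and \<open>S\<^sub>h\<close> is the maximum of the noise, distributed as \<open>sqrt h\<close> times the modulus of a
 Gaussian; rescaling \<open>D\<close> by \<open>sqrt h\<close> yields half the trace of the density on the diagonal.\<close>

text \<open>The event \<open>{M_t < c}\<close> says that the level \<open>c\<close> is not reached
  by time \<open>t\<close>, so the joint density is the derivative in \<open>c\<close> of the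
  density of the position on that event; \<open>qq\<close> integrates the former back to the latter.
  The obstacle is that the drift kernel differentiated in the level has size
  \<open>1 / \<tau>\<close>, which is not integrable in time. In the differentiated equation it is
  multiplied by the mass of past maxima between \<open>a $ k\<close> and the level \<open>m\<close>,
  at most \<open>m - a $ k\<close> times a bound on the density; this distance turns
  \<open>1 / \<tau>\<close> into \<open>1 / sqrt \<tau>\<close>. The Gaussian average is taken at
  the mirror image of the position: convolution with the kernel bounds reproduces this quantity, and
  it decays with the distance to the diagonal, so a single estimate gives the supremum, the total
  mass and the trace. Polynomial factors are paid for by doubling the variance, hence the
  \<open>2 * t\<close> in all bounds. The final 1/2 is half the second moment of a standard Gaussian
  \<open>Z\<close>, obtained by integrating the mean of \<open>max 0 (\<bar>Z\<bar> - v)\<close>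
  over the rescaled distance \<open>v > 0\<close>.\<close>

abbreviation (input) limseq (infix "---->" 60) where "f ----> l \<equiv> f \<longlonglongrightarrow> l"
abbreviation (input) nn_lborel :: "('a::euclidean_space \<Rightarrow> ennreal) \<Rightarrow> ennreal" (binder "NN " 10) where "nn_lborel f \<equiv> integral\<^sup>N lborel f"
abbreviation (input) ind :: "real \<Rightarrow> real \<Rightarrow> 'a::zero_neq_one" where "ind t s \<equiv> indicator {0<..<t} s"

lemmas lint_cong = Bochner_Integration.integral_cong and lint_bound = Bochner_Integration.integrable_bound

section \<open>Gaussian kernels\<close>

text \<open>The heat kernel, with variance \<open>t\<close> in each coordinate. It sees the point
  only through its norm, so reflections and sign changes cost nothing.\<close>

definition gd :: "real => 'a::euclidean_space => real" where
 "gd t x = (1 / sqrt (2 * pi * t)) ^ DIM('a) * exp (- (norm x)\<^sup>2 / (2 * t))"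

lemma gd_nonneg [simp]: "0 <= t ==> 0 <= gd t x"
 unfolding gd_def by simp

lemma gd_measurable [measurable (raw)]:
 assumes [measurable]: "f \<in> borel_measurable M" "g \<in> borel_measurable M"
 shows "(%x. gd (f x) (g x :: 'a::euclidean_space)) \<in> borel_measurable M"
 unfolding gd_def by measurable

lemma gd_cong_norm: "norm (x :: 'a::euclidean_space) = norm y ==> gd t x = gd t (y :: 'a)"
 unfolding gd_def by simp

lemma gd_minus_commute: "gd t (x - y) = gd t (y - x :: 'a::euclidean_space)"
 by (rule gd_cong_norm) (rule norm_minus_commute)

lemma gd_mono: "0 < t ==> norm x <= norm (y :: 'a::euclidean_space) ==> gd t y <= gd t (x :: 'a)"
 unfolding gd_def by (intro mult_left_mono) (auto intro!: divide_right_mono power_mono)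

lemma gd_le_peak: "0 < t ==> gd t (x :: 'a::euclidean_space) <= (1 / sqrt (2 * pi * t)) ^ DIM('a)"
 unfolding gd_def by (intro mult_left_le) auto

lemma gd_prod:
 assumes "0 < t"
 shows "gd t (x :: 'a::euclidean_space) = (\<Prod>b\<in>Basis. normal_density 0 (sqrt t) (x \<bullet> b))"
proof -
 have "(norm x)\<^sup>2 = (\<Sum>b\<in>Basis. (x \<bullet> b)\<^sup>2)"
  unfolding power2_norm_eq_inner by (subst euclidean_inner) (simp add: power2_eq_square)
 hence "- (norm x)\<^sup>2 / (2 * t) = (\<Sum>b\<in>Basis. - (x \<bullet> b)\<^sup>2 / (2 * t))"
  by (simp add: sum_negf sum_divide_distrib[symmetric])
 hence "exp (- (norm x)\<^sup>2 / (2 * t)) = (\<Prod>b\<in>Basis. exp (- (x \<bullet> b)\<^sup>2 / (2 * t)))"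
  by (simp add: exp_sum)
 thus ?thesis
  using assms unfolding gd_def normal_density_def
  by (simp add: prod.distrib power_mult_distrib power_divide prod_dividef)
qed

lemma nn_integral_lborel_shift:
 fixes c :: "'a::euclidean_space"
 assumes [measurable]: "f \<in> borel_measurable borel"
 shows "(NN x. f (c + x)) = (NN x. f x)"
proof -
 have "(NN x. f x) = (\<integral>\<^sup>+x. f x \<partial>distr lborel borel ((+) c))"
  by (simp only: lborel_distr_plus)
 thus ?thesis by (simp add: nn_integral_distr)
qed

text \<open>Both kernels are products over the basis, so the integral splits into one-dimensional
  convolutions of centred normal densities.\<close>

lemma nn_integral_gd_conv:
 assumes "0 < s" "0 < t"
 shows "(NN a. ennreal (gd s (x - a) * gd t (a - z :: 'a::euclidean_space))) = ennreal (gd (s + t) (x - z))"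
proof -
 have "(NN a. ennreal (gd s (x - a) * gd t (a - z)))
   = (NN a. ennreal (gd s (x - (z + a)) * gd t ((z + a) - z)))"
  by (rule nn_integral_lborel_shift[symmetric]) measurable
 also have "... = (NN a. (\<Prod>b\<in>Basis. (%b y. ennreal (normal_density 0 (sqrt s) ((x - z) \<bullet> b - y)
    * normal_density 0 (sqrt t) y)) b (a \<bullet> b)))"
  using assms
  by (intro nn_integral_cong)
   (simp add: gd_prod prod.distrib prod_ennreal ennreal_mult'[symmetric] prod_nonneg inner_diff_left inner_add_left diff_diff_eq)
 also have "... = (\<Prod>b\<in>(Basis::'a set). (NN y. (%b y. ennreal (normal_density 0 (sqrt s) ((x - z) \<bullet> b - y)
    * normal_density 0 (sqrt t) y)) b y))"
  by (rule nn_integral_lborel_prod) auto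
 also have "... = (\<Prod>b\<in>(Basis::'a set). ennreal (normal_density 0 (sqrt (s + t)) ((x - z) \<bullet> b)))"
  using assms conv_normal_density_zero_mean[of "sqrt s" "sqrt t"]
  by (intro prod.cong) (simp_all add: fun_eq_iff)
 also have "... = ennreal (gd (s + t) (x - z))"
  using assms by (simp add: gd_prod prod_ennreal)
 finally show ?thesis .
qed

lemma nn_integral_gd_0:
 assumes "0 < t" shows "(NN x. ennreal (gd t (x :: 'a::euclidean_space))) = 1"
proof -
 have "(NN x. ennreal (gd t (x::'a))) = (\<integral>\<^sup>+x. (\<Prod>b\<in>Basis. (%b y. ennreal (normal_density 0 (sqrt t) y)) b (x \<bullet> b)) \<partial>(lborel::'a measure))"
  using assms by (intro nn_integral_cong) (simp add: gd_prod prod_ennreal)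
 also have "... = (\<Prod>b\<in>(Basis::'a set). (NN y. (%b y. ennreal (normal_density 0 (sqrt t) y)) b y))"
  by (rule nn_integral_lborel_prod) auto
 also have "... = 1"
  using assms by (simp add: nn_integral_eq_integral)
 finally show ?thesis .
qed

lemma nn_integral_gd:
 assumes "0 < t"
 shows "(NN x. ennreal (gd t (x - z :: 'a::euclidean_space))) = 1"
  "(NN x. ennreal (gd t (z - x :: 'a::euclidean_space))) = 1"
proof -
 show "(NN x. ennreal (gd t (x - z))) = 1"
  using nn_integral_lborel_shift[of "%x. ennreal (gd t x)" "-z"] nn_integral_gd_0[OF assms] by simp
 thus "(NN x. ennreal (gd t (z - x))) = 1"
  by (simp add: gd_minus_commute)
qed

lemma
 fixes z :: "'a::euclidean_space"
 assumes t: "0 < t"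
 shows integrable_gd: "integrable lborel (%x. gd t (x - z))"
  and integral_gd: "(LBINT x. gd t (x - z)) = 1"
proof -
 show i: "integrable lborel (%x. gd t (x - z))"
  using t by (intro integrableI_nonneg) (auto simp: nn_integral_gd)
 have "ennreal (LBINT x. gd t (x - z)) = 1"
  using nn_integral_eq_integral[OF i] t by (simp add: nn_integral_gd)
 thus "(LBINT x. gd t (x - z)) = 1"
  using ennreal_eq_1 by auto
qed

text \<open>With \<open>y = r ^ j\<close>, use \<open>y <= 1 + y\<^sup>2\<close>; the square is
  \<open>4 ^ j * fact j\<close> times a single term of the exponential series at
  \<open>r\<^sup>2 / 4\<close>.\<close>

lemma power_le_exp_square: "r ^ j <= (1 + 4 ^ j * fact j) * exp (r\<^sup>2 / 4)" if "0 <= (r::real)"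
proof -
 have e: "(r\<^sup>2/4) ^ j / fact j <= exp (r\<^sup>2/4)"
 proof -
  have "(\<Sum>n\<in>{j}. (r\<^sup>2/4) ^ n /\<^sub>R fact n) <= (\<Sum>n. (r\<^sup>2/4) ^ n /\<^sub>R fact n)"
   by (rule sum_le_suminf) (use summable_exp_generic[of "r\<^sup>2/4"] in auto)
  moreover have "(\<Sum>n\<in>{j}. (r\<^sup>2/4) ^ n /\<^sub>R fact n) = (r\<^sup>2/4) ^ j / fact j"
   unfolding scaleR_conv_of_real divide_inverse by (simp only: sum.insert sum.empty finite.intros empty_iff not_False_eq_True add_0_right mult.commute of_real_eq_id id_apply)
  ultimately show ?thesis unfolding exp_def by (simp only:)
 qed
 have "y <= 1 + y\<^sup>2" for y :: real
  using zero_le_power2[of "y - 1/2"] by (simp add: power2_eq_square algebra_simps)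
 hence "r ^ j <= 1 + (r ^ j)\<^sup>2" .
 also have "(r ^ j)\<^sup>2 = 4 ^ j * fact j * ((r\<^sup>2/4) ^ j / fact j)"
  by (simp add: power_divide) (simp only: power_mult[symmetric] mult.commute)
 also have "1 + ... <= exp (r\<^sup>2/4) + 4 ^ j * fact j * exp (r\<^sup>2/4)"
  by (intro add_mono mult_left_mono e) auto
 finally show ?thesis by (simp add: algebra_simps)
qed

lemma gd_double: "0 < t ==> gd t x = sqrt 2 ^ DIM('a) * exp (- (norm x)\<^sup>2 / (4 * t)) * gd (2 * t) (x :: 'a::euclidean_space)"
proof -
 assume t: "0 < t"
 have "exp (- (norm x)\<^sup>2 / (2 * t)) = exp (- (norm x)\<^sup>2 / (4 * t)) * exp (- (norm x)\<^sup>2 / (2 * (2 * t)))"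
  unfolding exp_add[symmetric] by simp
 moreover have "1 / sqrt (2 * pi * t) = sqrt 2 * (1 / sqrt (2 * pi * (2 * t)))"
  using t by (simp add: real_sqrt_mult field_simps)
 ultimately show ?thesis
  unfolding gd_def by (simp only: power_mult_distrib mult_ac)
qed

text \<open>Half of the Gaussian exponent is set aside by \<open>gd_double\<close> and absorbs the
  power of \<open>norm x / sqrt t\<close>; the price is the doubled variance in every later
  bound.\<close>

lemma gd_poly:
 obtains C where "0 <= C" "!!t (x :: 'a::euclidean_space). 0 < t ==> norm x ^ j * gd t x <= C * sqrt t ^ j * gd (2 * t) x"
proof
 show "0 <= (1 + 4 ^ j * fact j) * sqrt 2 ^ DIM('a)" by simp
 fix t :: real and x :: 'a assume t: "0 < t"
 let ?r = "norm x / sqrt t"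
 have "norm x ^ j * gd t x = sqrt t ^ j * (?r ^ j * exp (- (?r\<^sup>2 / 4))) * (sqrt 2 ^ DIM('a) * gd (2 * t) x)"
  unfolding gd_double[OF t, of x] using t by (simp add: power_divide)
 also have "... <= sqrt t ^ j * (1 + 4 ^ j * fact j) * (sqrt 2 ^ DIM('a) * gd (2 * t) x)"
 proof (intro mult_right_mono mult_left_mono)
  have "?r ^ j * exp (- (?r\<^sup>2 / 4)) <= ((1 + 4 ^ j * fact j) * exp (?r\<^sup>2 / 4)) * exp (- (?r\<^sup>2 / 4))"
   using t by (intro mult_right_mono power_le_exp_square) auto
  thus "?r ^ j * exp (- (?r\<^sup>2 / 4)) <= 1 + 4 ^ j * fact j"
   by (simp add: mult.assoc flip: exp_add)
 qed (use t in auto)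
 finally show "norm x ^ j * gd t x <= (1 + 4 ^ j * fact j) * sqrt 2 ^ DIM('a) * sqrt t ^ j * gd (2 * t) x"
  by (simp add: mult_ac)
qed


section \<open>Reflection in a hyperplane\<close>

definition mirror :: "'d::finite => real => real ^ 'd => real ^ 'd" where
 "mirror k c x = x + (2 * (c - x $ k)) *\<^sub>R axis k 1"

lemma mirror_nth: "mirror k c x $ i = (if i = k then 2 * c - x $ k else x $ i)"
 by (simp add: mirror_def axis_def)

lemma mirror_mirror [simp]: "mirror k c (mirror k c x) = x"
 by (simp add: vec_eq_iff mirror_nth)

lemma mirror_hyperplane: "x $ k = c ==> mirror k c x = x"
 by (simp add: vec_eq_iff mirror_nth)

lemma vec_nth_measurable [measurable (raw)]:
 fixes f :: "'a => real ^ 'd::finite"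
 assumes "f \<in> borel_measurable M"
 shows "(%x. f x $ k) \<in> borel_measurable M"
 by (rule borel_measurable_continuous_on[OF _ assms]) (intro continuous_intros)

lemma mirror_measurable [measurable (raw)]:
 assumes [measurable]: "f \<in> borel_measurable M" "g \<in> borel_measurable M"
 shows "(%x. mirror k (f x) (g x)) \<in> borel_measurable M"
 unfolding mirror_def by (intro borel_measurable_add borel_measurable_scaleR) auto

lemma norm_mirror_diff: "norm (mirror k c x - mirror k c y) = norm (x - y)"
 unfolding norm_vec_def by (rule L2_set_cong) (auto simp: mirror_nth)

lemma norm_mirror_swap: "norm (mirror k c x - y) = norm (x - mirror k c y)"
 using norm_mirror_diff[of k c x "mirror k c y"] by simp

lemma norm_diff_le_mirror:
 assumes "x $ k <= c" "y $ k <= c"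
 shows "norm (x - y) <= norm (mirror k c x - y)"
 unfolding norm_vec_def using assms by (intro L2_set_mono) (auto simp: mirror_nth)

lemma power2_norm_vec: "(norm (x :: real ^ 'd::finite))\<^sup>2 = (\<Sum>i\<in>UNIV. (x $ i)\<^sup>2)"
 unfolding norm_vec_def by (simp add: L2_set_def sum_nonneg)

text \<open>\<open>x + (m - x $ k) *\<^sub>R axis k 1\<close> is the projection of \<open>x\<close>
  to the hyperplane at height \<open>m\<close>. Only coordinate \<open>k\<close> matters, and there
  the square of a sum of two nonnegative numbers is at least the sum of their squares. The decay of
  the density away from the diagonal comes from here.\<close>

lemma norm_mirror_lower:
 fixes x :: "real ^ 'd::finite"
 assumes "x $ k <= m" "z $ k <= m"
 shows "(norm (x + (m - x $ k) *\<^sub>R axis k 1 - z))\<^sup>2 + (m - x $ k)\<^sup>2 <= (norm (mirror k m x - z))\<^sup>2"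
proof -
 have "(\<Sum>i\<in>UNIV - {k}. ((x + (m - x $ k) *\<^sub>R axis k 1 - z) $ i)\<^sup>2) = (\<Sum>i\<in>UNIV - {k}. ((mirror k m x - z) $ i)\<^sup>2)"
  by (intro sum.cong) (auto simp: mirror_nth axis_def)
 moreover have "(m - z $ k)\<^sup>2 + (m - x $ k)\<^sup>2 <= (2 * m - x $ k - z $ k)\<^sup>2"
  using mult_nonneg_nonneg[of "m - x $ k" "m - z $ k"] assms by (simp add: power2_eq_square algebra_simps)
 ultimately show ?thesis
  unfolding power2_norm_vec by (subst (1 2) sum.remove[of _ k]) (auto simp: mirror_nth)
qed

lemma distr_lborel_mirror: "distr lborel borel (mirror k c) = (lborel :: (real ^ 'd::finite) measure)"
proof -
 let ?c = "%j :: real ^ 'd. if j = axis k 1 then -1 else 1 :: real"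
 have e: "axis k (1::real) \<in> Basis" by (simp add: axis_in_Basis_iff)
 \<comment> \<open>The reflection as an affine map: a sign change in coordinate \<open>k\<close>
   followed by a translation, with determinant of modulus 1.\<close>
 have "(2 * c) *\<^sub>R axis k 1 + (\<Sum>j\<in>Basis. (?c j * (x \<bullet> j)) *\<^sub>R j) = mirror k c x" for x :: "real ^ 'd"
 proof -
  have "(\<Sum>j\<in>Basis. (?c j * (x \<bullet> j)) *\<^sub>R j) = (\<Sum>j\<in>Basis. (x \<bullet> j) *\<^sub>R j - (if j = axis k 1 then (2 * (x \<bullet> j)) *\<^sub>R j else 0))"
   by (intro sum.cong) (auto simp: scaleR_left_diff_distrib[symmetric])
  also have "... = x - (2 * x $ k) *\<^sub>R axis k 1"
   using e by (simp add: sum_subtractf euclidean_representation inner_axis)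
  finally show ?thesis by (simp add: mirror_def algebra_simps)
 qed
 moreover have "(\<Prod>j\<in>(Basis :: (real ^ 'd) set). \<bar>?c j\<bar>) = 1"
  by (intro prod.neutral) auto
 ultimately show ?thesis
  using lborel_affine_euclidean[where c="?c" and t="(2 * c) *\<^sub>R axis k 1"]
  by (simp add: density_1)
qed

lemma nn_integral_mirror:
 assumes [measurable]: "f \<in> borel_measurable borel"
 shows "(NN x. f (mirror k c x)) = (NN x. f x)"
 by (subst distr_lborel_mirror[symmetric, of k c], subst nn_integral_distr) auto

lemma integral_mirror:
 fixes f :: "real ^ 'd::finite => real"
 assumes [measurable]: "f \<in> borel_measurable borel"
 shows "(LBINT x. f (mirror k c x)) = (LBINT x. f x)"
proof -
 have "(LBINT x. f x) = (\<integral>x. f x \<partial>distr lborel borel (mirror k c))"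
  by (simp only: distr_lborel_mirror)
 also have "... = (LBINT x. f (mirror k c x))"
  by (rule integral_distr) auto
 finally show ?thesis ..
qed

section \<open>Distance to the diagonal as a coordinate\<close>

lemma below_diag_measurable [measurable (raw)]:
 assumes [measurable]: "f \<in> borel_measurable M" "g \<in> borel_measurable M"
 shows "(%x. below_diag k (f x) (g x)) \<in> borel_measurable M"
 unfolding below_diag_def borel_prod[symmetric] by measurable

text \<open>The passage from distance \<open>u\<close> and boundary point \<open>y\<close> to
  maximum and position is a shear: translate \<open>y\<close> for fixed \<open>u\<close>, then
  \<open>u\<close> for fixed position. Integrals near the diagonal are computed in these
  coordinates.\<close>

lemma distr_lborel_below_diag:
 "distr lborel borel (%(u, y). below_diag k y u) = (lborel :: (real \<times> (real ^ 'd::finite)) measure)"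
proof (rule measure_eqI)
 fix A :: "(real \<times> (real ^ 'd)) set"
 assume "A \<in> sets (distr lborel borel (%(u, y). below_diag k y u))"
 hence [measurable]: "A \<in> sets borel" by simp
 let ?f = "indicator A :: _ => ennreal"
 have "(%(u, y). below_diag k y u) \<in> borel_measurable (borel \<Otimes>\<^sub>M borel)"
  by measurable
 hence m0: "(%(u, y :: real ^ 'd). below_diag k y u) \<in> borel_measurable borel"
  by (simp only: borel_prod)
 have m1: "(%(u, y). ?f (below_diag k y u)) \<in> borel_measurable (lborel \<Otimes>\<^sub>M lborel)"
  unfolding case_prod_beta by (rule measurable_compose[OF _ borel_measurable_indicator[of A borel]]) measurable
 have m2: "(%(u, x). ?f (x $ k + u, x)) \<in> borel_measurable (lborel \<Otimes>\<^sub>M lborel)"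
  unfolding case_prod_beta by (rule measurable_compose[OF _ borel_measurable_indicator[of A borel]]) measurable
 have m3: "(%u. ?f (u, x)) \<in> borel_measurable borel" for x
  by (rule measurable_compose[OF _ borel_measurable_indicator[of A borel]]) measurable
 have m4: "(%y. ?f (below_diag k y u)) \<in> borel_measurable borel" for u
  by (rule measurable_compose[OF _ borel_measurable_indicator[of A borel]]) measurable
 have "emeasure (distr lborel borel (%(u, y). below_diag k y u)) A = (\<integral>\<^sup>+(u, y). ?f (below_diag k y u) \<partial>(lborel \<Otimes>\<^sub>M lborel))"
  unfolding lborel_prod by (subst nn_integral_indicator[symmetric], simp, subst nn_integral_distr)
   (use m0 in \<open>auto simp: case_prod_unfold\<close>)
 also have "... = (NN u. \<integral>\<^sup>+y. ?f (below_diag k y u) \<partial>lborel)"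
  using lborel.nn_integral_fst[OF m1] by simp
 also have "... = (NN u. \<integral>\<^sup>+x. ?f (x $ k + u, x) \<partial>lborel)"
 proof (rule nn_integral_cong)
  fix u :: real
  show "(NN y. ?f (below_diag k y u)) = (NN x. ?f (x $ k + u, x))"
   using nn_integral_lborel_shift[OF m4[of u], of "u *\<^sub>R axis k 1"]
   by (simp add: below_diag_def axis_def add.commute)
 qed
 also have "... = (NN x. \<integral>\<^sup>+u. ?f (x $ k + u, x) \<partial>lborel)"
  using lborel_pair.Fubini'[OF m2] by simp
 also have "... = (NN x. \<integral>\<^sup>+u. ?f (u, x) \<partial>lborel)"
  by (rule nn_integral_cong, rule nn_integral_lborel_shift[OF m3])
 also have "... = (\<integral>\<^sup>+z. ?f z \<partial>(lborel \<Otimes>\<^sub>M lborel))"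
  using lborel_pair.nn_integral_snd[of ?f] by (simp add: lborel_prod)
 finally show "emeasure (distr lborel borel (%(u, y). below_diag k y u)) A = emeasure lborel A"
  by (simp add: lborel_prod)
qed simp

text \<open>Pratt's lemma.\<close>
lemma integral_dominated_convergence_varying:
 fixes f :: "nat => 'a => real"
 assumes [measurable]: "!!n. f n \<in> borel_measurable M" "g \<in> borel_measurable M"
  and D: "!!n. integrable M (D n)" "integrable M E"
  and lim: "AE x in M. (%n. f n x) ----> g x" "AE x in M. (%n. D n x) ----> E x"
  and bound: "!!n. AE x in M. \<bar>f n x\<bar> <= D n x"
  and limD: "(%n. \<integral>x. D n x \<partial>M) ----> (LINT x|M. E x)"
 shows "(%n. \<integral>x. f n x \<partial>M) ----> (LINT x|M. g x)"
proof -
 have bound': "AE x in M. \<forall>n. \<bar>f n x\<bar> <= D n x"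
  using bound by (simp add: AE_all_countable)
 have [measurable]: "!!n. D n \<in> borel_measurable M" "E \<in> borel_measurable M"
  using D by auto
 have gE: "AE x in M. \<bar>g x\<bar> <= E x"
  using lim bound'
 proof eventually_elim
  case (elim x)
  thus ?case by (intro LIMSEQ_le[OF tendsto_rabs[of _ "g x"]]) auto
 qed
 have fint: "integrable M (f n)" for n
  by (rule lint_bound[OF D(1)[of n]]) (use bound[of n] in auto)
 \<comment> \<open>Truncated at the limit bound \<open>E\<close>, the functions converge by ordinary
   dominated convergence. The truncation removes at most the positive part of
   \<open>D n x - E x\<close>, whose integral tends to 0.\<close>
 let ?h = "%n x. max (- E x) (min (E x) (f n x))"
 have hint: "integrable M (?h n)" for n
  by (rule lint_bound[OF D(2)]) (use gE in \<open>auto elim!: eventually_mono\<close>)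
 have 1: "(%n. \<integral>x. ?h n x \<partial>M) ----> (LINT x|M. g x)"
 proof (rule integral_dominated_convergence[where w=E])
  show "AE x in M. (%n. ?h n x) ----> g x"
   using lim(1) gE
  proof eventually_elim
   case (elim x)
   have "(%n. ?h n x) ----> max (- E x) (min (E x) (g x))"
    by (intro tendsto_intros elim)
   thus ?case using elim by (simp add: min_absorb2 max_absorb2 abs_le_iff)
  qed
  show "AE x in M. norm (?h n x) <= E x" for n
   using gE by eventually_elim auto
 qed (use D in auto)
 have 2: "(%n. \<integral>x. max 0 (E x - D n x) \<partial>M) ----> (LINT x|M. 0)"
 proof (rule integral_dominated_convergence[where w=E])
  show "AE x in M. (%n. max 0 (E x - D n x)) ----> 0"
   using lim(2)
  proof eventually_elim
   case (elim x)
   have "(%n. max 0 (E x - D n x)) ----> max 0 (E x - E x)"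
    by (intro tendsto_intros elim)
   thus ?case by simp
  qed
  show "AE x in M. norm (max 0 (E x - D n x)) <= E x" for n
   using gE bound' by eventually_elim (auto simp: abs_le_iff, smt (verit))
 qed (use D in auto)
 have i2: "integrable M (%x. max 0 (E x - D n x))" for n
  using D by auto
 have "(%n. (LINT x|M. D n x) - (LINT x|M. E x) + (LINT x|M. max 0 (E x - D n x))) ----> (LINT x|M. E x) - (LINT x|M. E x) + 0"
  by (intro tendsto_intros limD) (use 2 in simp)
 hence 3: "(%n. \<integral>x. D n x - E x + max 0 (E x - D n x) \<partial>M) ----> 0"
  using D i2 by simp
 have 4: "(%n. (LINT x|M. f n x) - (LINT x|M. ?h n x)) ----> 0"
 proof (rule Lim_null_comparison[OF always_eventually 3], rule allI)
  fix n
  have "norm ((LINT x|M. f n x) - (LINT x|M. ?h n x)) = norm (LINT x|M. f n x - ?h n x)"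
   using fint hint by simp
  also have "... <= (LINT x|M. norm (f n x - ?h n x))"
   by (rule integral_norm_bound)
  also have "... <= (LINT x|M. D n x - E x + max 0 (E x - D n x))"
   by (rule integral_mono_AE) (use D i2 fint hint bound[of n] gE in \<open>auto elim!: eventually_elim2\<close>)
  finally show "norm ((LINT x|M. f n x) - (LINT x|M. ?h n x)) <= (LINT x|M. D n x - E x + max 0 (E x - D n x))" .
 qed
 show ?thesis using tendsto_add[OF 4 1] by simp
qed

text \<open>A fundamental theorem of calculus without a derivative: after a shift of the variable,
  the difference quotient integrates to the mean of \<open>g\<close> over
  \<open>[t, t + h n)\<close> minus its mean over \<open>[0, h n)\<close>, and right-continuity at
  the two endpoints gives the limit.\<close>

lemma average_increment_tendsto:
 fixes g :: "real => real"
 assumes [measurable]: "g \<in> borel_measurable borel" and bd: "!!s. \<bar>g s\<bar> <= C"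
  and lim0: "(g \<longlongrightarrow> g 0) (at_right 0)" and limt: "(g \<longlongrightarrow> g t) (at_right t)"
  and t: "0 <= t" and h: "!!n. 0 < h n" "h ----> 0"
 shows "(%n. \<integral>s. ind t s * ((g (s + h n) - g s) / h n) \<partial>lborel) ----> g t - g 0"
proof -
 have int: "integrable lborel (%s. indicator S s * g s)" if "bounded S" "S \<in> sets borel" for S
 proof -
  have "integrable lborel (%s. C * indicator S s)"
   using that by (intro integrable_mult_right integrable_real_indicator) (use emeasure_bounded_finite[of S] in auto)
  hence "set_integrable lborel S g"
   unfolding set_integrable_def
   by (rule lint_bound) (use that bd in \<open>auto split: split_indicator intro!: AE_I2 order_trans[OF bd]\<close>)
  thus ?thesis by (simp add: set_integrable_def)
 qed
 have avg: "(%n. (LBINT s. indicator {a..<a + h n} s * g s) / h n) ----> g a"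
  if "(g \<longlongrightarrow> g a) (at_right a)" for a
 proof -
  have eq: "(LBINT s. indicator {a..<a + h n} s * g s) / h n = (LBINT \<theta>. indicator {0..<1} \<theta> * g (a + h n * \<theta>))" for n
   using h(1)[of n]
   by (subst lborel_integral_real_affine[where c="h n" and t=a])
    (auto intro!: lint_cong simp: field_simps zero_le_mult_iff split: split_indicator)
  have "(%n. \<integral>\<theta>. indicator {0..<1} \<theta> * g (a + h n * \<theta>) \<partial>lborel) ----> (LBINT \<theta>. indicator {0..<1::real} \<theta> * g a)"
  proof (rule integral_dominated_convergence[where w="%\<theta>. C * indicator {0..<1} \<theta>"])
   have "(%n. g (a + h n * \<theta>)) ----> g a" if "0 <= \<theta>" for \<theta>
   proof (cases "\<theta> = 0")
    case False
    hence "filterlim (%n. a + h n * \<theta>) (at_right a) sequentially"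
     unfolding filterlim_at using that h
     by (auto intro!: tendsto_eq_intros simp: less_imp_neq[THEN not_sym])
    with \<open>(g \<longlongrightarrow> g a) (at_right a)\<close> show ?thesis by (rule filterlim_compose)
   qed simp
   thus "AE \<theta> in lborel. (%n. indicator {0..<1} \<theta> * g (a + h n * \<theta>)) ----> indicator {0..<1} \<theta> * g a"
    by (auto simp: indicator_def)
  qed (use bd in \<open>auto split: split_indicator intro!: integrable_real_indicator\<close>)
  thus ?thesis by (simp add: eq)
 qed
 have sh: "(LBINT s. ind t s * g (s + d)) = (LBINT s. indicator {d<..<t+d} s * g s)"
   and shi: "integrable lborel (%s. ind t s * g (s + d))" for d
 proof -
  show "(LBINT s. ind t s * g (s + d)) = (LBINT s. indicator {d<..<t+d} s * g s)"
   by (subst lborel_integral_real_affine[where c=1 and t="-d"])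
    (auto intro!: lint_cong split: split_indicator)
  have "integrable lborel (%s. (%s. indicator {d<..<t+d} s * g s) (d + 1 * s))"
   by (rule lborel_integrable_real_affine) (use int[of "{d<..<t+d}"] in auto)
  thus "integrable lborel (%s. ind t s * g (s + d))"
   by (rule Bochner_Integration.integrable_cong[THEN iffD1, rotated -1])
    (auto simp: add.commute split: split_indicator)
 qed
 have "(LBINT s. ind t s * ((g (s + h n) - g s) / h n))
   = (LBINT s. indicator {t..<t + h n} s * g s) / h n - (LBINT s. indicator {0..<0 + h n} s * g s) / h n" for n
 proof -
  have "(LBINT s. ind t s * ((g (s + h n) - g s) / h n))
    = (LBINT s. (ind t s * g (s + h n) - ind t s * g s) / h n)"
   by (intro lint_cong) (auto simp: field_simps)
  also have "... = ((LBINT s. indicator {h n<..<t + h n} s * g s) - (LBINT s. ind t s * g s)) / h n"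
   using shi[of "h n"] int[of "{0<..<t}"] sh[of "h n"] by simp
  also have "(LBINT s. indicator {h n<..<t + h n} s * g s) - (LBINT s. ind t s * g s)
    = (LBINT s. indicator {h n<..<t + h n} s * g s - ind t s * g s)"
   by (rule Bochner_Integration.integral_diff[symmetric]) (auto intro!: int)
  also have "... = (LBINT s. indicator {t..<t + h n} s * g s - indicator {0..<0 + h n} s * g s)"
  proof (rule integral_cong_AE)
   show "AE s in lborel. indicator {h n<..<t + h n} s * g s - ind t s * g s
     = indicator {t..<t + h n} s * g s - indicator {0..<0 + h n} s * g s"
    using AE_lborel_singleton[of 0] AE_lborel_singleton[of "h n"]
    by eventually_elim (use h(1)[of n] t in \<open>auto split: split_indicator\<close>)
  qed auto
  also have "... = (LBINT s. indicator {t..<t + h n} s * g s) - (LBINT s. indicator {0..<0 + h n} s * g s)"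
   by (rule Bochner_Integration.integral_diff) (auto intro!: int)
  finally show ?thesis by (simp add: diff_divide_distrib)
 qed
 thus ?thesis
  using tendsto_diff[OF avg[OF limt] avg[OF lim0]] by simp
qed


section \<open>Weakly singular time integrals\<close>

lemma nn_integral_inverse_sqrt:
 assumes "0 <= b"
 shows "(NN s. ennreal (ind b s * (1 / sqrt s))) <= ennreal (2 * sqrt b)"
proof -
 have "((%s. s powr (-1/2)) has_integral (b powr (-1/2 + 1) / (-1/2 + 1))) {0..b}"
  using assms by (intro has_integral_powr_from_0) auto
 hence "(NN s. ennreal (indicator {0..b} s * s powr (-1/2))) = ennreal (2 * sqrt b)"
  using nn_integral_has_integral_lebesgue[of "{0..b}" "%s. s powr (-1/2)"] assms
  by (simp add: powr_half_sqrt mult.commute)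
 moreover have "(NN s. ennreal (ind b s * (1 / sqrt s))) <= (NN s. ennreal (indicator {0..b} s * s powr (-1/2)))"
  by (intro nn_integral_mono ennreal_leI)
   (auto split: split_indicator simp: powr_minus_divide powr_half_sqrt)
 ultimately show ?thesis by simp
qed

lemma nn_integral_exp_decay:
 assumes "0 < l" "0 < t"
 shows "(NN s. ennreal (ind t s * exp (- l * (t - s)))) <= ennreal (1 / l)"
proof -
 have "((%s. exp (- l * (t - s))) has_integral (exp (- l * (t - t)) / l - exp (- l * (t - 0)) / l)) {0..t}"
  using assms
  by (intro fundamental_theorem_of_calculus)
   (auto intro!: derivative_eq_intros simp flip: has_real_derivative_iff_has_vector_derivative)
 hence "(NN s. ennreal (indicator {0..t} s * exp (- l * (t - s)))) = ennreal (exp (- l * (t - t)) / l - exp (- l * (t - 0)) / l)"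
  by (intro nn_integral_has_integral_lebesgue) auto
 also have "... <= ennreal (1 / l)"
  using assms by (intro ennreal_leI) auto
 finally have "(NN s. ennreal (indicator {0..t} s * exp (- l * (t - s)))) <= ennreal (1 / l)" .
 moreover have "(NN s. ennreal (ind t s * exp (- l * (t - s)))) <= (NN s. ennreal (indicator {0..t} s * exp (- l * (t - s))))"
  by (intro nn_integral_mono ennreal_leI) (auto split: split_indicator)
 ultimately show ?thesis by simp
qed

lemma nn_integral_time_reversal:
 fixes t :: real
 assumes [measurable]: "f \<in> borel_measurable borel"
 shows "(NN s. f (t - s)) = (NN s. f s)"
 using nn_integral_real_affine[of f "-1" t] by simp

lemma nn_integral_exp_decay_singular:
 assumes l: "0 < l" and t: "0 < t"
 shows "(NN s. ennreal (ind t s * (exp (- l * (t - s)) / sqrt s))) <= ennreal (3 / sqrt l)" (is ?A)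
  and "(NN s. ennreal (ind t s * (exp (- l * (t - s)) / sqrt (t - s)))) <= ennreal (3 / sqrt l)" (is ?B)
proof -
 have key: "(NN s. ennreal (ind t s * (f s / sqrt s))) <= ennreal (3 / sqrt l)"
  if [measurable]: "f \<in> borel_measurable borel" and f: "!!s. 0 < s ==> s < t ==> 0 <= f s \<and> f s <= 1"
   and fi: "(NN s. ennreal (ind t s * f s)) <= ennreal (1 / l)" for f :: "real => real"
 proof -
  \<comment> \<open>Split at \<open>s = 1 / l\<close>: below, the singularity costs
    \<open>2 * sqrt (1 / l)\<close>; above, \<open>1 / sqrt s <= sqrt l\<close> multiplies an
    integral of at most \<open>1 / l\<close>. The sum is \<open>3 / sqrt l\<close>.\<close>
  have pw: "ind t s * (f s / sqrt s) <= indicator {0<..<1/l} s * (1 / sqrt s) + sqrt l * (ind t s * f s)" for s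
  proof (cases "0 < s \<and> s < t")
   case True
   show ?thesis
   proof (cases "s < 1 / l")
    case True
    with \<open>0 < s \<and> s < t\<close> f[of s] l have "f s / sqrt s <= 1 / sqrt s" "0 <= sqrt l * f s"
     by (auto intro!: divide_right_mono)
    thus ?thesis using True \<open>0 < s \<and> s < t\<close> by (simp add: indicator_def)
   next
    case False
    hence "1 / l <= s" by simp
    hence "sqrt (1 / l) <= sqrt s" by (rule real_sqrt_le_mono)
    hence "1 / sqrt s <= sqrt l" using l True by (simp add: real_sqrt_divide field_simps)
    hence "f s * (1 / sqrt s) <= f s * sqrt l" using f[of s] True by (intro mult_left_mono) auto
    thus ?thesis using True False by (simp add: indicator_def mult.commute)
   qed
  qed (use l in \<open>auto simp: indicator_def\<close>)
  have "(NN s. ennreal (ind t s * (f s / sqrt s)))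
    <= (NN s. ennreal (indicator {0<..<1/l} s * (1 / sqrt s)) + ennreal (sqrt l) * ennreal (ind t s * f s))"
   using f l pw
   by (intro nn_integral_mono) (auto simp: ennreal_plus[symmetric] ennreal_mult[symmetric] indicator_def simp del: ennreal_plus intro!: ennreal_leI)
  also have "... = (NN s. ennreal (indicator {0<..<1/l} s * (1 / sqrt s))) + ennreal (sqrt l) * (NN s. ennreal (ind t s * f s))"
   by (subst nn_integral_add) (auto simp: nn_integral_cmult)
  also have "... <= ennreal (2 * sqrt (1 / l)) + ennreal (sqrt l) * ennreal (1 / l)"
   using l by (intro add_mono mult_left_mono fi nn_integral_inverse_sqrt) auto
  also have "... = ennreal (2 * sqrt (1 / l) + sqrt l * (1 / l))"
   using l by (simp add: ennreal_mult[symmetric] ennreal_plus[symmetric] del: ennreal_plus)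
  also have "2 * sqrt (1 / l) + sqrt l * (1 / l) = 3 / sqrt l"
   using l by (simp add: real_sqrt_divide field_simps)
  finally show ?thesis .
 qed
 show ?A by (rule key) (use l nn_integral_exp_decay[OF l t] in auto)
 have "(NN s. ennreal (ind t s * (exp (- l * (t - s)) / sqrt (t - s))))
   = (NN s. ennreal (ind t s * (exp (- l * s) / sqrt s)))"
  by (subst nn_integral_time_reversal[symmetric, of _ t]) (auto intro!: nn_integral_cong simp: indicator_def)
 also have "... <= ennreal (3 / sqrt l)"
 proof (rule key)
  have "(NN s. ennreal (ind t s * exp (- l * s))) = (NN s. ennreal (ind t s * exp (- l * (t - s))))"
   by (subst nn_integral_time_reversal[symmetric, of _ t]) (auto intro!: nn_integral_cong simp: indicator_def)
  thus "(NN s. ennreal (ind t s * exp (- l * s))) <= ennreal (1 / l)"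
   using nn_integral_exp_decay[OF l t] by simp
 qed (use l in auto)
 finally show ?B .
qed

text \<open>An exponential weight in time makes the weakly singular Volterra kernels contractive.\<close>
lemma singular_kernel_contraction:
 fixes C :: real assumes C: "0 <= C"
 obtains l where "0 < l"
  "!!t. 0 < t ==> (NN s. ennreal (ind t s * (C / sqrt (t - s) * exp (l * s)))) <= ennreal (exp (l * t) / 2)"
  "!!t. 0 < t ==> (NN s. ennreal (ind t s * (C / sqrt (t - s) * (exp (l * s) / sqrt s)))) <= ennreal (exp (l * t) / sqrt t / 2)"
proof
 \<comment> \<open>The two estimates need \<open>3 * C / sqrt l <= 1 / 2\<close> and
   \<open>6 * C / sqrt l <= 1 / 2\<close>; the summand 1 keeps \<open>l\<close> positive for
   \<open>C = 0\<close>.\<close>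
 define l where "l = (12 * C + 1)\<^sup>2"
 show l: "0 < l" using C by (simp add: l_def)
 have sl: "sqrt l = 12 * C + 1" using C by (simp add: l_def)
 fix t :: real assume t: "0 < t"
 have e: "exp (l * s) = exp (l * t) * exp (- l * (t - s))" for s
  by (simp add: exp_add[symmetric] algebra_simps)
 have e1: "C / sqrt (t - s) * exp (l * s) = C * exp (l * t) * (exp (- l * (t - s)) / sqrt (t - s))" for s
  unfolding e[of s] by simp
 note I = nn_integral_exp_decay_singular[OF l t]
 have "(NN s. ennreal (ind t s * (C / sqrt (t - s) * exp (l * s))))
   = (NN s. ennreal (C * exp (l * t)) * ennreal (ind t s * (exp (- l * (t - s)) / sqrt (t - s))))"
  unfolding e1 using C by (intro nn_integral_cong) (simp add: ennreal_mult'[symmetric] mult.left_commute)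
 also have "... <= ennreal (C * exp (l * t)) * ennreal (3 / sqrt l)"
  by (subst nn_integral_cmult) (simp, intro mult_left_mono I, simp)
 also have "... = ennreal (exp (l * t) * (C * (3 / sqrt l)))"
  using C l by (simp add: ennreal_mult[symmetric] mult_ac)
 also have "... <= ennreal (exp (l * t) * (1 / 2))"
  using C by (intro ennreal_leI mult_left_mono) (auto simp: sl field_simps)
 finally show "(NN s. ennreal (ind t s * (C / sqrt (t - s) * exp (l * s)))) <= ennreal (exp (l * t) / 2)"
  by simp
 \<comment> \<open>By \<open>sqrt t <= sqrt s + sqrt (t - s)\<close>, the product of singularities
   at both ends splits into two one-sided ones, and the factor \<open>1 / sqrt t\<close> of the
   conclusion comes out.\<close>
 have pw: "C / sqrt (t - s) * (exp (l * s) / sqrt s)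
   <= C * exp (l * t) / sqrt t * (exp (- l * (t - s)) / sqrt s + exp (- l * (t - s)) / sqrt (t - s))" if s: "0 < s" "s < t" for s
 proof -
  have "sqrt t <= sqrt s + sqrt (t - s)"
   using sqrt_add_le_add_sqrt[of s "t - s"] s by simp
  hence "1 / (sqrt (t - s) * sqrt s) <= (sqrt s + sqrt (t - s)) / sqrt t / (sqrt (t - s) * sqrt s)"
   using s by (intro divide_right_mono) (auto simp: field_simps)
  also have "... = (1 / sqrt s + 1 / sqrt (t - s)) / sqrt t"
   using s by (simp add: field_simps)
  finally have "C * exp (l * s) * (1 / (sqrt (t - s) * sqrt s)) <= C * exp (l * s) * ((1 / sqrt s + 1 / sqrt (t - s)) / sqrt t)"
   using C by (intro mult_left_mono) auto
  thus ?thesis unfolding e[of s] by (simp add: field_simps)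
 qed
 have "(NN s. ennreal (ind t s * (C / sqrt (t - s) * (exp (l * s) / sqrt s))))
   <= (NN s. ennreal (C * exp (l * t) / sqrt t) * (ennreal (ind t s * (exp (- l * (t - s)) / sqrt s))
     + ennreal (ind t s * (exp (- l * (t - s)) / sqrt (t - s)))))"
  using C t pw by (intro nn_integral_mono)
   (auto simp: ennreal_mult[symmetric] ennreal_plus[symmetric] indicator_def simp del: ennreal_plus intro!: ennreal_leI)
 also have "... <= ennreal (C * exp (l * t) / sqrt t) * (ennreal (3 / sqrt l) + ennreal (3 / sqrt l))"
  by (subst nn_integral_cmult, simp, subst nn_integral_add, simp, simp, intro mult_left_mono add_mono I, simp)
 also have "... = ennreal (exp (l * t) / sqrt t * (C * (6 / sqrt l)))"
  using C l t by (simp add: ennreal_mult[symmetric] ennreal_plus[symmetric] mult_ac del: ennreal_plus)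
 also have "... <= ennreal (exp (l * t) / sqrt t * (1 / 2))"
  using C t by (intro ennreal_leI mult_left_mono) (auto simp: sl field_simps)
 finally show "(NN s. ennreal (ind t s * (C / sqrt (t - s) * (exp (l * s) / sqrt s)))) <= ennreal (exp (l * t) / sqrt t / 2)"
  by simp
qed

section \<open>The parametrix kernels\<close>

lemma borel_measurable_fst_borel [measurable]:
 "fst \<in> borel_measurable (borel :: ('a::second_countable_topology \<times> 'b::second_countable_topology) measure)"
 by (intro borel_measurable_continuous_onI continuous_intros)

lemma borel_measurable_snd_borel [measurable]:
 "snd \<in> borel_measurable (borel :: ('a::second_countable_topology \<times> 'b::second_countable_topology) measure)"
 by (intro borel_measurable_continuous_onI continuous_intros)

lemma continuous_gd:
 assumes "(f \<longlongrightarrow> t) F" "(g \<longlongrightarrow> x) F" "0 < t"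
 shows "((%j. gd (f j) (g j :: 'a::euclidean_space)) \<longlongrightarrow> gd t x) F"
 unfolding gd_def using assms by (intro tendsto_intros) auto

lemma tendsto_mirror:
 assumes "(f \<longlongrightarrow> c) F" "(g \<longlongrightarrow> x) F"
 shows "((%j. mirror k (f j) (g j)) \<longlongrightarrow> mirror k c x) F"
 unfolding mirror_def using assms by (intro tendsto_intros)

lemma AE_hyperplane: "AE a :: real ^ 'd::finite in lborel. a $ k \<noteq> (c::real)"
proof -
 have "negligible {x :: real ^ 'd. x \<bullet> axis k 1 = c}"
  by (rule negligible_standard_hyperplane) (simp add: axis_in_Basis_iff)
 hence "{x :: real ^ 'd. x $ k = c} \<in> null_sets lebesgue"
  by (simp add: inner_axis negligible_iff_null_sets)
 moreover have "{x :: real ^ 'd. x $ k = c} \<in> sets lborel"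
  using borel_closed[of "{x :: real ^ 'd. x $ k = c}"] by (auto intro!: closed_Collect_eq continuous_intros)
 ultimately have "{x :: real ^ 'd. x $ k = c} \<in> null_sets lborel"
  by (simp add: null_sets_completion_iff)
 thus ?thesis
  by (rule AE_I'[THEN AE_mp[rotated]]) auto
qed

lemma gd_le_peak_vec: "0 < t ==> gd t (x :: real ^ 'd::finite) <= (1 / sqrt (2 * pi * t)) ^ CARD('d)"
 using gd_le_peak[of t x] by simp

lemma abs_integral_interval_le:
 fixes h :: "real => real"
 assumes [measurable]: "h \<in> borel_measurable borel" and "l <= u" "0 <= K"
  and bd: "!!b. l < b ==> b < u ==> \<bar>h b\<bar> <= K"
 shows "integrable lborel (%b. indicator {l<..<u} b * h b)"
  and "\<bar>LBINT b. indicator {l<..<u} b * h b\<bar> <= K * (u - l)"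
proof -
 have K: "integrable lborel (%b. K * indicator {l<..<u} b)"
  by (intro integrable_mult_right integrable_real_indicator) (use assms in auto)
 thus i: "integrable lborel (%b. indicator {l<..<u} b * h b)"
  by (rule lint_bound) (use assms in \<open>auto simp: indicator_def\<close>)
 have "\<bar>LBINT b. indicator {l<..<u} b * h b\<bar> <= (LBINT b. \<bar>indicator {l<..<u} b * h b\<bar>)"
  using integral_norm_bound[of lborel "%b. indicator {l<..<u} b * h b"] by simp
 also have "... <= (LBINT b. K * indicator {l<..<u} b)"
  using i K assms by (intro integral_mono) (auto simp: indicator_def)
 also have "... = K * (u - l)" using assms by simp
 finally show "\<bar>LBINT b. indicator {l<..<u} b * h b\<bar> <= K * (u - l)" .
qed

lemma integral_indicator_FTC:
 fixes F f :: "real => real"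
 assumes "a <= b" "!!x. (F has_real_derivative f x) (at x)" "continuous_on UNIV f"
 shows "(LBINT x. indicator {a<..<b} x * f x) = F b - F a"
proof -
 have [measurable]: "f \<in> borel_measurable borel" by (rule borel_measurable_continuous_onI) fact
 have "(LBINT x. indicator {a<..<b} x * f x) = (LBINT x. f x * indicator {a..b} x)"
  using AE_lborel_singleton[of a] AE_lborel_singleton[of b]
  by (intro integral_cong_AE) (auto elim!: eventually_elim2 simp: indicator_def)
 also have "... = F b - F a"
  by (rule integral_FTC_Icc_real)
   (use assms in \<open>auto intro: has_field_derivative_at_within simp: continuous_on_eq_continuous_at\<close>)
 finally show ?thesis .
qed

text \<open>Integration by parts for a \<open>Q\<close> that has only the bounded measurable density
  \<open>f\<close>: rather than differentiating \<open>Q\<close>, write it as an integral and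
  exchange the order of integration.\<close>

lemma integral_by_parts_indefinite:
 fixes f \<kappa> \<kappa>' :: "real => real"
 assumes [measurable]: "f \<in> borel_measurable borel" and K: "0 <= K" "!!b. l < b ==> b < c ==> \<bar>f b\<bar> <= K"
  and d: "!!x. (\<kappa> has_real_derivative \<kappa>' x) (at x)" "continuous_on UNIV \<kappa>'"
  and lm: "l <= m0" "m0 <= c"
 defines "Q \<equiv> %m. \<integral>b. indicator {l<..<m} b * f b \<partial>lborel"
 shows "(LBINT m. indicator {m0<..<c} m * (f m * \<kappa> m + Q m * \<kappa>' m)) = Q c * \<kappa> c - Q m0 * \<kappa> m0"
proof -
 have c\<kappa>: "continuous_on UNIV \<kappa>"
  using d(1) by (intro continuous_at_imp_continuous_on ballI DERIV_isCont)
 have [measurable]: "\<kappa>' \<in> borel_measurable borel" "\<kappa> \<in> borel_measurable borel"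
  by (rule borel_measurable_continuous_onI, fact)+
 have [measurable]: "Q \<in> borel_measurable borel"
  unfolding Q_def indicator_def greaterThanLessThan_iff by measurable
 obtain K1 where K1: "0 <= K1" "!!x. m0 <= x ==> x <= c ==> \<bar>\<kappa> x\<bar> <= K1"
 proof -
  have "bounded (\<kappa> ` {m0..c})" by (intro compact_imp_bounded compact_continuous_image continuous_on_subset[OF c\<kappa>]) auto
  then obtain r where "\<forall>y\<in>\<kappa> ` {m0..c}. norm y <= r" unfolding bounded_iff by blast
  thus ?thesis by (intro that[of "max r 0"]) force+
 qed
 obtain K2 where K2: "0 <= K2" "!!x. m0 <= x ==> x <= c ==> \<bar>\<kappa>' x\<bar> <= K2"
 proof -
  have "bounded (\<kappa>' ` {m0..c})" by (intro compact_imp_bounded compact_continuous_image continuous_on_subset[OF d(2)]) auto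
  then obtain r where "\<forall>y\<in>\<kappa>' ` {m0..c}. norm y <= r" unfolding bounded_iff by blast
  thus ?thesis by (intro that[of "max r 0"]) force+
 qed
 have Qi: "integrable lborel (%b. indicator {l<..<m} b * f b)"
  and Qb: "\<bar>Q m\<bar> <= K * (c - l)" if "l <= m" "m <= c" for m
 proof -
  show "integrable lborel (%b. indicator {l<..<m} b * f b)"
   by (rule abs_integral_interval_le) (use K that in auto)
  have "\<bar>Q m\<bar> <= K * (m - l)" unfolding Q_def
   by (rule abs_integral_interval_le) (use K that in auto)
  also have "... <= K * (c - l)" using that K by (intro mult_left_mono) auto
  finally show "\<bar>Q m\<bar> <= K * (c - l)" .
 qed
 have i1: "integrable lborel (%m. indicator {m0<..<c} m * (f m * \<kappa> m))"
  by (rule abs_integral_interval_le[where K="K * K1"])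
   (use K K1 lm in \<open>auto simp: abs_mult intro!: mult_mono\<close>)
 have i2: "integrable lborel (%m. indicator {m0<..<c} m * (Q m * \<kappa>' m))"
  by (rule abs_integral_interval_le[where K="K * (c - l) * K2"])
   (use K K2 lm Qb in \<open>auto simp: abs_mult intro!: mult_mono\<close>)
 let ?F = "%(b, m). indicator {l<..<c} b * f b * (indicator {max m0 b<..<c} m * \<kappa>' m)"
 have F: "integrable (lborel \<Otimes>\<^sub>M lborel) ?F"
 proof -
  have "integrable (lborel \<Otimes>\<^sub>M lborel) (%x. (K * K2) * indicator ({l<..<c} \<times> {m0<..<c}) x :: real)"
   by (intro integrable_mult_right integrable_real_indicator)
    (use lm in \<open>auto simp: lborel.emeasure_pair_measure_Times ennreal_mult[symmetric]\<close>)
  thus ?thesis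
  proof (rule lint_bound)
   show "?F \<in> borel_measurable (lborel \<Otimes>\<^sub>M lborel)"
    unfolding indicator_def greaterThanLessThan_iff by measurable
   show "AE x in lborel \<Otimes>\<^sub>M lborel. norm (?F x) <= norm ((K * K2) * indicator ({l<..<c} \<times> {m0<..<c}) x :: real)"
    using K K2 by (intro AE_I2) (auto simp: indicator_def abs_mult intro!: mult_mono)
  qed
 qed
 have "(LBINT m. indicator {m0<..<c} m * (Q m * \<kappa>' m)) = (LBINT m. (LBINT b. ?F (b, m)))"
 proof (rule lint_cong)
  fix m
  have "(LBINT b. ?F (b, m)) = (LBINT b. (indicator {m0<..<c} m * \<kappa>' m) * (indicator {l<..<m} b * f b))"
   by (rule lint_cong) (auto simp: indicator_def)
  thus "indicator {m0<..<c} m * (Q m * \<kappa>' m) = (LBINT b. ?F (b, m))"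
   by (simp add: Q_def)
 qed simp
 also have "... = (LBINT b. (LBINT m. ?F (b, m)))"
  using lborel_pair.Fubini_integral[of "%b m. ?F (b, m)"] F by (simp add: case_prod_unfold)
 also have "... = (LBINT b. indicator {l<..<c} b * f b * (\<kappa> c - \<kappa> (max m0 b)))"
 proof (rule lint_cong)
  fix b
  have "b < c ==> (LBINT m. indicator {max m0 b<..<c} m * \<kappa>' m) = \<kappa> c - \<kappa> (max m0 b)"
   using lm by (intro integral_indicator_FTC d) auto
  thus "(LBINT m. ?F (b, m)) = indicator {l<..<c} b * f b * (\<kappa> c - \<kappa> (max m0 b))"
   by (auto simp: indicator_def)
 qed simp
 also have "... = (LBINT b. \<kappa> c * (indicator {l<..<c} b * f b) - (\<kappa> m0 * (indicator {l<..<m0} b * f b) + indicator {m0<..<c} b * (f b * \<kappa> b)))"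
  using AE_lborel_singleton[of m0]
  by (intro integral_cong_AE) (use lm in \<open>auto elim!: eventually_mono simp: indicator_def algebra_simps max_def\<close>)
 also have "... = \<kappa> c * Q c - (\<kappa> m0 * Q m0 + (LBINT b. indicator {m0<..<c} b * (f b * \<kappa> b)))"
  unfolding Q_def using i1 Qi[of c] Qi[of m0] lm by simp
 finally show ?thesis
  using i1 i2 by (simp add: distrib_left mult.commute)
qed

section \<open>Reflected drift kernels\<close>

locale parametrix =
 fixes k :: "'d::finite" and B :: "real ^ 'd => real ^ 'd" and \<mu>0 :: "(real ^ 'd) measure" and L :: real
 assumes prob: "prob_space \<mu>0" and sets_\<mu>0 [measurable_cong]: "sets \<mu>0 = sets borel"
  and B_measurable [measurable]: "B \<in> borel_measurable borel"
  and B_bound: "!!x. norm (B x) <= L"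
begin

sublocale init: prob_space \<mu>0 by (rule prob)

lemma space_\<mu>0 [simp]: "space \<mu>0 = UNIV"
 using sets_eq_imp_space_eq[OF sets_\<mu>0] by simp

lemma L_nonneg: "0 <= L"
 using B_bound[of undefined] norm_ge_zero order_trans by blast

text \<open>The derivative of the heat kernel \<open>gd \<tau> (z - a)\<close> in its starting
  point, along the vector \<open>B a\<close> held fixed.\<close>

definition psi :: "real => real ^ 'd => real ^ 'd => real" where
 "psi \<tau> a z = ((z - a) \<bullet> B a / \<tau>) * gd \<tau> (z - a)"

text \<open>The derivative of \<open>psi\<close> in coordinate \<open>k\<close> of \<open>z\<close>.
  When the level moves, the mirror image moves along that axis at speed 2, whence the factor in
  \<open>dkap\<close>.\<close>

definition chi :: "real => real ^ 'd => real ^ 'd => real" where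
 "chi \<tau> a z = (B a $ k / \<tau> - ((z - a) \<bullet> B a) * (z - a) $ k / \<tau>\<^sup>2) * gd \<tau> (z - a)"

text \<open>\<open>kap\<close> is the drift term of the heat kernel absorbed at the level \<open>m\<close>, built by reflection, and
 \<open>dkap\<close> is its derivative in \<open>m\<close>.\<close>
definition kap :: "real => real => real ^ 'd => real ^ 'd => real" where
 "kap m \<tau> a x = psi \<tau> a x - psi \<tau> a (mirror k m x)"

definition dkap :: "real => real => real ^ 'd => real ^ 'd => real" where
 "dkap m \<tau> a x = - 2 * chi \<tau> a (mirror k m x)"

lemma psi_measurable [measurable (raw)]:
 assumes [measurable]: "f \<in> borel_measurable M" "g \<in> borel_measurable M" "h \<in> borel_measurable M"
 shows "(%x. psi (f x) (g x) (h x)) \<in> borel_measurable M"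
 unfolding psi_def by measurable

lemma chi_measurable [measurable (raw)]:
 assumes [measurable]: "f \<in> borel_measurable M" "g \<in> borel_measurable M" "h \<in> borel_measurable M"
 shows "(%x. chi (f x) (g x) (h x)) \<in> borel_measurable M"
 unfolding chi_def by measurable

lemma kap_measurable [measurable (raw)]:
 assumes [measurable]: "c \<in> borel_measurable M" "f \<in> borel_measurable M" "g \<in> borel_measurable M" "h \<in> borel_measurable M"
 shows "(%x. kap (c x) (f x) (g x) (h x)) \<in> borel_measurable M"
 unfolding kap_def by measurable

lemma dkap_measurable [measurable (raw)]:
 assumes [measurable]: "c \<in> borel_measurable M" "f \<in> borel_measurable M" "g \<in> borel_measurable M" "h \<in> borel_measurable M"
 shows "(%x. dkap (c x) (f x) (g x) (h x)) \<in> borel_measurable M"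
 unfolding dkap_def by measurable

text \<open>\<open>chi\<close> alone is of order \<open>1 / \<tau>\<close>, which is not integrable
  up to 0. The factor \<open>norm (z - a)\<close> is worth \<open>sqrt \<tau>\<close> and gives
  \<open>chi\<close> the same bound as \<open>psi\<close>.\<close>

lemma kernel_bound_ex:
 "\<exists>C\<ge>0. \<forall>\<tau>>0. \<forall>a z. \<bar>psi \<tau> a z\<bar> <= C / sqrt \<tau> * gd (2 * \<tau>) (z - a) \<and>
   norm (z - a) * \<bar>chi \<tau> a z\<bar> <= C / sqrt \<tau> * gd (2 * \<tau>) (z - a)"
proof -
 obtain C1 where C1: "0 <= C1" "!!t (x :: real ^ 'd). 0 < t ==> norm x ^ 1 * gd t x <= C1 * sqrt t ^ 1 * gd (2 * t) x"
  using gd_poly by blast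
 obtain C3 where C3: "0 <= C3" "!!t (x :: real ^ 'd). 0 < t ==> norm x ^ 3 * gd t x <= C3 * sqrt t ^ 3 * gd (2 * t) x"
  using gd_poly by blast
 show ?thesis
 proof (intro exI[of _ "L * (C1 + C3)"] conjI allI impI)
  show "0 <= L * (C1 + C3)" using L_nonneg C1 C3 by simp
  fix \<tau> :: real and a z :: "real ^ 'd" assume \<tau>: "0 < \<tau>"
  let ?w = "z - a" and ?g = "gd (2 * \<tau>) (z - a)"
  have ip: "\<bar>?w \<bullet> B a\<bar> <= norm ?w * L"
   by (rule order_trans[OF Cauchy_Schwarz_ineq2]) (intro mult_left_mono B_bound norm_ge_zero)
  have "\<bar>psi \<tau> a z\<bar> = \<bar>?w \<bullet> B a\<bar> / \<tau> * gd \<tau> ?w"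
   using \<tau> by (simp add: psi_def abs_mult)
  also have "... <= norm ?w * L / \<tau> * gd \<tau> ?w"
   using \<tau> by (intro mult_right_mono divide_right_mono ip) auto
  also have "... = L / \<tau> * (norm ?w ^ 1 * gd \<tau> ?w)" by simp
  also have "... <= L / \<tau> * (C1 * sqrt \<tau> ^ 1 * ?g)"
   using \<tau> L_nonneg by (intro mult_left_mono C1) auto
  also have "... = L * C1 / sqrt \<tau> * ?g"
   using \<tau> by (simp add: field_simps real_sqrt_mult_self)
  finally have p: "\<bar>psi \<tau> a z\<bar> <= L * C1 / sqrt \<tau> * ?g" .
  also have "... <= L * (C1 + C3) / sqrt \<tau> * ?g"
   using \<tau> L_nonneg C1 C3 by (intro mult_right_mono divide_right_mono mult_left_mono) auto
  finally show "\<bar>psi \<tau> a z\<bar> <= L * (C1 + C3) / sqrt \<tau> * ?g" .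
  have Bk: "\<bar>B a $ k\<bar> <= L" using component_le_norm_cart[of "B a" k] B_bound[of a] by linarith
  have "\<bar>B a $ k / \<tau> - (?w \<bullet> B a) * ?w $ k / \<tau>\<^sup>2\<bar> <= \<bar>B a $ k\<bar> / \<tau> + \<bar>?w \<bullet> B a\<bar> * \<bar>?w $ k\<bar> / \<tau>\<^sup>2"
   using \<tau> by (intro order_trans[OF abs_triangle_ineq4]) (simp add: abs_mult)
  also have "... <= L / \<tau> + (norm ?w * L) * norm ?w / \<tau>\<^sup>2"
   using \<tau> by (intro add_mono divide_right_mono mult_mono ip Bk component_le_norm_cart)
    (auto intro: order_trans[OF abs_ge_zero ip])
  finally have c: "\<bar>B a $ k / \<tau> - (?w \<bullet> B a) * ?w $ k / \<tau>\<^sup>2\<bar> <= L / \<tau> + (norm ?w * L) * norm ?w / \<tau>\<^sup>2" .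
  have "norm ?w * \<bar>chi \<tau> a z\<bar> = norm ?w * (\<bar>B a $ k / \<tau> - (?w \<bullet> B a) * ?w $ k / \<tau>\<^sup>2\<bar> * gd \<tau> ?w)"
   using \<tau> by (simp add: chi_def abs_mult)
  also have "... <= norm ?w * ((L / \<tau> + (norm ?w * L) * norm ?w / \<tau>\<^sup>2) * gd \<tau> ?w)"
   using \<tau> by (intro mult_left_mono mult_right_mono c) auto
  also have "... = L / \<tau> * (norm ?w ^ 1 * gd \<tau> ?w) + L / \<tau>\<^sup>2 * (norm ?w ^ 3 * gd \<tau> ?w)"
   by (simp add: field_simps power3_eq_cube)
  also have "... <= L / \<tau> * (C1 * sqrt \<tau> ^ 1 * ?g) + L / \<tau>\<^sup>2 * (C3 * sqrt \<tau> ^ 3 * ?g)"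
   using \<tau> L_nonneg by (intro add_mono mult_left_mono C1 C3) auto
  also have "... = L * (C1 + C3) / sqrt \<tau> * ?g"
  proof -
   have "sqrt \<tau> ^ 3 = \<tau> * sqrt \<tau>" using \<tau> by (simp add: power3_eq_cube)
   moreover have "sqrt \<tau> / \<tau> = 1 / sqrt \<tau>" using \<tau> by (simp add: real_div_sqrt field_simps)
   moreover have ss: "sqrt \<tau> * (sqrt \<tau> * y) = \<tau> * y" for y using \<tau> by (simp add: mult.assoc[symmetric])
   ultimately show ?thesis using \<tau> by (simp add: power2_eq_square field_simps ss)
  qed
  finally show "norm ?w * \<bar>chi \<tau> a z\<bar> <= L * (C1 + C3) / sqrt \<tau> * ?g" .
 qed
qed

definition CK :: real where
 "CK = (SOME C. 0 <= C \<and> (\<forall>\<tau>>0. \<forall>a z. \<bar>psi \<tau> a z\<bar> <= C / sqrt \<tau> * gd (2 * \<tau>) (z - a) \<and>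
   norm (z - a) * \<bar>chi \<tau> a z\<bar> <= C / sqrt \<tau> * gd (2 * \<tau>) (z - a)))"

lemma CK_nonneg: "0 <= CK"
 and psi_bound: "0 < \<tau> ==> \<bar>psi \<tau> a z\<bar> <= CK / sqrt \<tau> * gd (2 * \<tau>) (z - a)"
 and chi_bound: "0 < \<tau> ==> norm (z - a) * \<bar>chi \<tau> a z\<bar> <= CK / sqrt \<tau> * gd (2 * \<tau>) (z - a)"
 using someI_ex[OF kernel_bound_ex] unfolding CK_def[symmetric] by blast+

lemma kap_bound:
 assumes "0 < \<tau>" "a $ k <= m" "x $ k <= m"
 shows "\<bar>kap m \<tau> a x\<bar> <= 2 * CK / sqrt \<tau> * gd (2 * \<tau>) (x - a)"
proof -
 have "gd (2 * \<tau>) (mirror k m x - a) <= gd (2 * \<tau>) (x - a)"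
  using assms by (intro gd_mono norm_diff_le_mirror) auto
 hence "CK / sqrt \<tau> * gd (2 * \<tau>) (mirror k m x - a) <= CK / sqrt \<tau> * gd (2 * \<tau>) (x - a)"
  using assms CK_nonneg by (intro mult_left_mono) auto
 thus ?thesis
  using psi_bound[OF assms(1), of a x] psi_bound[OF assms(1), of a "mirror k m x"]
  unfolding kap_def by (simp add: field_simps)
qed

text \<open>The mirror image of \<open>x\<close> lies at or above the level, so
  \<open>m - a $ k\<close> is at most its distance to \<open>a\<close>, the factor that
  \<open>chi_bound\<close> asks for.\<close>

lemma dkap_bound:
 assumes "0 < \<tau>" "a $ k <= m" "x $ k <= m"
 shows "(m - a $ k) * \<bar>dkap m \<tau> a x\<bar> <= 2 * CK / sqrt \<tau> * gd (2 * \<tau>) (mirror k m x - a)"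
proof -
 have "m - a $ k <= \<bar>(mirror k m x - a) $ k\<bar>" using assms by (simp add: mirror_nth)
 also have "... <= norm (mirror k m x - a)" by (rule component_le_norm_cart)
 finally have "(m - a $ k) * \<bar>chi \<tau> a (mirror k m x)\<bar> <= norm (mirror k m x - a) * \<bar>chi \<tau> a (mirror k m x)\<bar>"
  by (intro mult_right_mono) auto
 also have "... <= CK / sqrt \<tau> * gd (2 * \<tau>) (mirror k m x - a)"
  by (rule chi_bound) fact
 finally show ?thesis by (simp add: dkap_def abs_mult)
qed

text \<open>The rate is tuned to \<open>4 * CK\<close>: \<open>kap\<close> and \<open>dkap\<close>
  are each bounded with the constant \<open>2 * CK\<close>, and both contributions reproduce the
  same Gaussian average.\<close>

definition ll :: real where
 "ll = (SOME l. 0 < l \<and> (\<forall>t>0. (NN s. ennreal (ind t s * (4 * CK / sqrt (t - s) * exp (l * s)))) <= ennreal (exp (l * t) / 2)) \<and>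
   (\<forall>t>0. (NN s. ennreal (ind t s * (4 * CK / sqrt (t - s) * (exp (l * s) / sqrt s)))) <= ennreal (exp (l * t) / sqrt t / 2)))"

lemma ll_pos: "0 < ll"
 and ll_contraction: "0 < t ==> (NN s. ennreal (ind t s * (4 * CK / sqrt (t - s) * exp (ll * s)))) <= ennreal (exp (ll * t) / 2)"
 and ll_contraction': "0 < t ==> (NN s. ennreal (ind t s * (4 * CK / sqrt (t - s) * (exp (ll * s) / sqrt s)))) <= ennreal (exp (ll * t) / sqrt t / 2)"
proof -
 have "0 <= 4 * CK" using CK_nonneg by simp
 hence "\<exists>l. 0 < l \<and> (\<forall>t>0. (NN s. ennreal (ind t s * (4 * CK / sqrt (t - s) * exp (l * s)))) <= ennreal (exp (l * t) / 2)) \<and>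
   (\<forall>t>0. (NN s. ennreal (ind t s * (4 * CK / sqrt (t - s) * (exp (l * s) / sqrt s)))) <= ennreal (exp (l * t) / sqrt t / 2))"
  by (rule singular_kernel_contraction) blast
 from someI_ex[OF this] show "0 < ll"
  "0 < t ==> (NN s. ennreal (ind t s * (4 * CK / sqrt (t - s) * exp (ll * s)))) <= ennreal (exp (ll * t) / 2)"
  "0 < t ==> (NN s. ennreal (ind t s * (4 * CK / sqrt (t - s) * (exp (ll * s) / sqrt s)))) <= ennreal (exp (ll * t) / sqrt t / 2)"
  unfolding ll_def[symmetric] by blast+
qed

section \<open>Gaussian averages of the initial law\<close>

definition Hm :: "real => real ^ 'd => real" where
 "Hm t x = (\<integral>z. gd (2 * t) (x - z) \<partial>\<mu>0)"

definition Hc :: "real => real => real ^ 'd => real" where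
 "Hc t m x = (\<integral>z. indicator {..m} (z $ k) * gd (2 * t) (x - z) \<partial>\<mu>0)"

text \<open>The natural size of a joint density of maximum \<open>m\<close> and position
  \<open>x\<close>: only starts at or below \<open>m\<close> count, and going up to the level and
  back to \<open>x\<close> costs as much as going to the mirror image of \<open>x\<close>.\<close>

definition Hp :: "real => real => real ^ 'd => real" where
 "Hp t m x = Hc t m (mirror k m x)"

lemma Hc_measurable [measurable (raw)]:
 assumes [measurable]: "f \<in> borel_measurable M" "g \<in> borel_measurable M" "h \<in> borel_measurable M"
 shows "(%x. Hc (f x) (g x) (h x)) \<in> borel_measurable M"
 unfolding Hc_def indicator_def atMost_iff by measurable

lemma Hp_measurable [measurable (raw)]:
 assumes [measurable]: "f \<in> borel_measurable M" "g \<in> borel_measurable M" "h \<in> borel_measurable M"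
 shows "(%x. Hp (f x) (g x) (h x)) \<in> borel_measurable M"
 unfolding Hp_def by measurable

lemma Hm_measurable [measurable (raw)]:
 assumes [measurable]: "f \<in> borel_measurable M" "h \<in> borel_measurable M"
 shows "(%x. Hm (f x) (h x)) \<in> borel_measurable M"
 unfolding Hm_def by measurable

lemma Hm_integrable: "0 < t ==> integrable \<mu>0 (%z. gd (2 * t) (x - z))"
 by (rule init.integrable_const_bound[where B="(1 / sqrt (2 * pi * (2 * t))) ^ CARD('d)"])
  (use gd_le_peak_vec[where 'd='d, of "2 * t"] in auto)

lemma Hc_integrable: "0 < t ==> integrable \<mu>0 (%z. indicator {..m} (z $ k) * gd (2 * t) (x - z))"
 by (rule lint_bound[OF Hm_integrable[of t x]]) (auto simp: indicator_def)

lemma Hm_nn: "0 < t ==> ennreal (Hm t x) = (\<integral>\<^sup>+z. ennreal (gd (2 * t) (x - z)) \<partial>\<mu>0)"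
 unfolding Hm_def by (rule nn_integral_eq_integral[symmetric]) (auto intro: Hm_integrable)

lemma Hc_nn: "0 < t ==> ennreal (Hc t m x) = (\<integral>\<^sup>+z. ennreal (indicator {..m} (z $ k) * gd (2 * t) (x - z)) \<partial>\<mu>0)"
 unfolding Hc_def by (rule nn_integral_eq_integral[symmetric]) (auto intro: Hc_integrable)

lemma Hc_nonneg: "0 < t ==> 0 <= Hc t m x"
 unfolding Hc_def by (rule integral_nonneg_AE) auto

lemma Hp_nonneg: "0 < t ==> 0 <= Hp t m x"
 unfolding Hp_def by (rule Hc_nonneg)

lemma Hm_nonneg: "0 < t ==> 0 <= Hm t x"
 unfolding Hm_def by (rule integral_nonneg_AE) auto

lemma Hc_le_Hm: "0 < t ==> Hc t m x <= Hm t x"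
 unfolding Hc_def Hm_def by (intro integral_mono Hc_integrable Hm_integrable) (auto simp: indicator_def)

lemma Hm_le_peak: "0 < t ==> Hm t x <= (1 / sqrt (2 * pi * (2 * t))) ^ CARD('d)"
 unfolding Hm_def using gd_le_peak_vec[where 'd='d, of "2 * t"]
 by (intro init.integral_le_const Hm_integrable) auto

text \<open>A lower level has fewer admissible starts and a more distant mirror image. The
  right-hand side is free of \<open>b\<close>, so the bound can be integrated over levels.\<close>

lemma Hp_le_Hc:
 assumes "0 < t" "x $ k <= b" "b <= m"
 shows "Hp t b x <= Hc t m x"
 unfolding Hp_def Hc_def
proof (intro integral_mono Hc_integrable)
 fix z
 show "indicator {..b} (z $ k) * gd (2 * t) (mirror k b x - z) <= indicator {..m} (z $ k) * gd (2 * t) (x - z)"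
  using assms by (auto simp: indicator_def intro!: gd_mono norm_diff_le_mirror)
qed (use assms in auto)

text \<open>Compared with the boundary point \<open>y\<close>, the reflected point gains
  \<open>u\<^sup>2\<close> in squared distance to every start below the level. Uniformity in
  \<open>u\<close> controls the supremum, the Gaussian factor in \<open>u\<close> controls the
  mass.\<close>

lemma Hp_below_diag:
 assumes "0 < t" "0 <= u"
 shows "Hp t (y $ k) (y - u *\<^sub>R axis k 1) <= exp (- u\<^sup>2 / (4 * t)) * Hm t y"
proof -
 have "Hp t (y $ k) (y - u *\<^sub>R axis k 1) <= (\<integral>z. exp (- u\<^sup>2 / (4 * t)) * gd (2 * t) (y - z) \<partial>\<mu>0)"
  unfolding Hp_def Hc_def
 proof (intro integral_mono Hc_integrable integrable_mult_right Hm_integrable)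
  fix z
  let ?x = "y - u *\<^sub>R axis k 1"
  show "indicator {..y $ k} (z $ k) * gd (2 * t) (mirror k (y $ k) ?x - z) <= exp (- u\<^sup>2 / (4 * t)) * gd (2 * t) (y - z)"
  proof (cases "z $ k <= y $ k")
   case True
   have xk: "?x $ k = y $ k - u" by (simp add: axis_def)
   have "(norm (y - z))\<^sup>2 + u\<^sup>2 <= (norm (mirror k (y $ k) ?x - z))\<^sup>2"
    using norm_mirror_lower[of ?x k "y $ k" z] True assms by (simp add: xk)
   hence "exp (- (norm (mirror k (y $ k) ?x - z))\<^sup>2 / (4 * t)) <= exp (- u\<^sup>2 / (4 * t) + - (norm (y - z))\<^sup>2 / (4 * t))"
    using assms by (simp add: field_simps)
   hence "gd (2 * t) (mirror k (y $ k) ?x - z) <= exp (- u\<^sup>2 / (4 * t)) * gd (2 * t) (y - z)"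
    unfolding gd_def exp_add by (simp add: mult.left_commute mult_left_mono assms less_imp_le)
   thus ?thesis using True by simp
  qed (use assms in auto)
 qed (use assms in auto)
 thus ?thesis unfolding Hm_def by simp
qed

lemma nn_integral_Hm: assumes "0 < t" shows "(NN y. ennreal (Hm t y)) = 1"
proof -
 interpret P: pair_sigma_finite lborel \<mu>0 ..
 have "(NN y. ennreal (Hm t y)) = (NN y. \<integral>\<^sup>+z. ennreal (gd (2 * t) (y - z)) \<partial>\<mu>0)"
  using assms by (simp add: Hm_nn)
 also have "... = (\<integral>\<^sup>+z. \<integral>\<^sup>+y. ennreal (gd (2 * t) (y - z)) \<partial>lborel \<partial>\<mu>0)"
  by (rule P.Fubini'[symmetric]) measurable
 also have "... = 1" using assms by (simp add: nn_integral_gd init.emeasure_space_1[simplified])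
 finally show ?thesis .
qed

lemma nn_integral_gd_Hc:
 assumes "0 < s" "0 < \<tau>"
 shows "(NN a. ennreal (gd (2 * \<tau>) (x - a) * Hc s m a)) = ennreal (Hc (\<tau> + s) m x)"
proof -
 interpret P: pair_sigma_finite lborel \<mu>0 ..
 have "(NN a. ennreal (gd (2 * \<tau>) (x - a) * Hc s m a))
   = (NN a. \<integral>\<^sup>+z. ennreal (indicator {..m} (z $ k) * (gd (2 * \<tau>) (x - a) * gd (2 * s) (a - z))) \<partial>\<mu>0)"
  using assms by (intro nn_integral_cong)
   (auto simp: ennreal_mult' ennreal_mult'' Hc_nn nn_integral_cmult[symmetric] mult_ac intro!: nn_integral_cong)
 also have "... = (\<integral>\<^sup>+z. \<integral>\<^sup>+a. ennreal (indicator {..m} (z $ k) * (gd (2 * \<tau>) (x - a) * gd (2 * s) (a - z))) \<partial>lborel \<partial>\<mu>0)"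
  unfolding indicator_def atMost_iff by (rule P.Fubini'[symmetric]) measurable
 also have "... = (\<integral>\<^sup>+z. ennreal (indicator {..m} (z $ k)) * (NN a. ennreal (gd (2 * \<tau>) (x - a) * gd (2 * s) (a - z))) \<partial>\<mu>0)"
  using assms by (intro nn_integral_cong) (subst nn_integral_cmult[symmetric], auto simp: ennreal_mult')
 also have "... = (\<integral>\<^sup>+z. ennreal (indicator {..m} (z $ k) * gd (2 * (\<tau> + s)) (x - z)) \<partial>\<mu>0)"
  using assms by (intro nn_integral_cong) (subst nn_integral_gd_conv, auto simp: ennreal_mult' distrib_left)
 also have "... = ennreal (Hc (\<tau> + s) m x)"
  using assms by (simp add: Hc_nn)
 finally show ?thesis .
qed

text \<open>Reflecting the integration variable moves the mirror from \<open>a\<close> to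
  \<open>x\<close>, and the convolution for \<open>Hc\<close> applies. A majorant of the form
  \<open>Hp\<close> thus reproduces itself.\<close>

lemma nn_integral_gd_Hp:
 assumes "0 < s" "0 < \<tau>"
 shows "(NN a. ennreal (gd (2 * \<tau>) (x - a) * Hp s m a)) = ennreal (Hp (\<tau> + s) m x)"
proof -
 have "(NN a. ennreal (gd (2 * \<tau>) (x - a) * Hp s m a))
   = (NN a. ennreal (gd (2 * \<tau>) (x - mirror k m a) * Hp s m (mirror k m a)))"
  by (rule nn_integral_mirror[symmetric]) measurable
 also have "... = (NN a. ennreal (gd (2 * \<tau>) (mirror k m x - a) * Hc s m a))"
  unfolding Hp_def mirror_mirror by (simp add: gd_cong_norm[OF norm_mirror_swap])
 also have "... = ennreal (Hp (\<tau> + s) m x)"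
  unfolding Hp_def by (rule nn_integral_gd_Hc) fact+
 finally show ?thesis .
qed

lemma nn_integral_gd_Hm:
 assumes "0 < s" "0 < \<tau>"
 shows "(NN a. ennreal (gd (2 * \<tau>) (x - a) * Hm s a)) = ennreal (Hm (\<tau> + s) x)"
proof -
 interpret P: pair_sigma_finite lborel \<mu>0 ..
 have "(NN a. ennreal (gd (2 * \<tau>) (x - a) * Hm s a))
   = (NN a. \<integral>\<^sup>+z. ennreal (gd (2 * \<tau>) (x - a) * gd (2 * s) (a - z)) \<partial>\<mu>0)"
  using assms by (intro nn_integral_cong) (auto simp: ennreal_mult' Hm_nn nn_integral_cmult[symmetric])
 also have "... = (\<integral>\<^sup>+z. \<integral>\<^sup>+a. ennreal (gd (2 * \<tau>) (x - a) * gd (2 * s) (a - z)) \<partial>lborel \<partial>\<mu>0)"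
  by (rule P.Fubini'[symmetric]) measurable
 also have "... = ennreal (Hm (\<tau> + s) x)"
  using assms by (simp add: nn_integral_gd_conv Hm_nn distrib_left)
 finally show ?thesis .
qed

lemma tendsto_Hm:
 assumes "x ----> y" "0 < t"
 shows "(%j. Hm t (x j)) ----> Hm t y"
 unfolding Hm_def
proof (rule integral_dominated_convergence[where w="%_. (1 / sqrt (2 * pi * (2 * t))) ^ CARD('d)"])
 show "AE z in \<mu>0. (%j. gd (2 * t) (x j - z)) ----> gd (2 * t) (y - z)"
  using assms by (intro AE_I2 continuous_gd tendsto_intros) auto
qed (use assms gd_le_peak_vec[where 'd='d, of "2 * t"] in auto)

end

section \<open>One step of the parametrix\<close>

context parametrix begin

text \<open>For a joint density \<open>f\<close> of maximum and position, this is the density of the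
  position on the event that the maximum is below \<open>m\<close>.\<close>

definition qq :: "(real \<times> real \<times> (real ^ 'd) => real) => real => real => real ^ 'd => real" where
 "qq f s m a = (LBINT b. indicator {a $ k<..<m} b * f (s, b, a))"

definition stepI :: "(real \<times> real \<times> (real ^ 'd) => real) => real => real => real ^ 'd => real \<times> (real ^ 'd) => real" where
 "stepI f t m x z = (if 0 < fst z \<and> fst z < t \<and> snd z $ k < m
   then f (fst z, m, snd z) * kap m (t - fst z) (snd z) x + qq f (fst z) m (snd z) * dkap m (t - fst z) (snd z) x
   else 0)"

definition stepP :: "(real \<times> real \<times> (real ^ 'd) => real) => real \<times> real \<times> (real ^ 'd) => real" where
 "stepP f v = (LBINT z. stepI f (fst v) (fst (snd v)) (snd (snd v)) z)"

text \<open>A growth bound together with continuity up to the diagonal. Levels approach only from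
  above: the initial law may charge a hyperplane, and then the terms may jump when the level
  approaches it from below.\<close>

definition good :: "real => (real \<times> real \<times> (real ^ 'd) => real) => bool" where
 "good A f \<longleftrightarrow> f \<in> borel_measurable borel \<and>
   (\<forall>t m x. 0 < t \<longrightarrow> x $ k <= m \<longrightarrow> \<bar>f (t, m, x)\<bar> <= A * (exp (ll * t) / sqrt t) * Hp t m x) \<and>
   (\<forall>t mj xj m x. 0 < t \<longrightarrow> (\<forall>j. m <= mj j) \<longrightarrow> mj ----> m \<longrightarrow> xj ----> x \<longrightarrow> (\<forall>j. xj j $ k <= mj j)
    \<longrightarrow> (%j. f (t, mj j, xj j)) ----> f (t, m, x))"

lemma good_measurable: "good A f ==> f \<in> borel_measurable borel"
 and good_bound: "good A f ==> 0 < t ==> x $ k <= m ==> \<bar>f (t, m, x)\<bar> <= A * (exp (ll * t) / sqrt t) * Hp t m x"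
 unfolding good_def by blast+

lemma good_tendsto:
 "good A f ==> 0 < t ==> (!!j. m <= mj j) ==> mj ----> m ==> xj ----> x ==> (!!j. xj j $ k <= mj j)
   ==> (%j. f (t, mj j, xj j)) ----> f (t, m, x)"
 unfolding good_def by blast

lemma qq_measurable [measurable (raw)]:
 assumes [measurable]: "f \<in> borel_measurable borel" "g \<in> borel_measurable M" "h \<in> borel_measurable M" "u \<in> borel_measurable M"
 shows "(%x. qq f (g x) (h x) (u x)) \<in> borel_measurable M"
 unfolding qq_def indicator_def greaterThanLessThan_iff by measurable

lemma stepI_measurable [measurable (raw)]:
 assumes [measurable]: "f \<in> borel_measurable borel" "g \<in> borel_measurable M" "h \<in> borel_measurable M" "u \<in> borel_measurable M" "w \<in> borel_measurable M"
 shows "(%x. stepI f (g x) (h x) (u x) (w x)) \<in> borel_measurable M"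
 unfolding stepI_def by measurable

lemma stepP_measurable [measurable]:
 assumes [measurable]: "f \<in> borel_measurable borel"
 shows "stepP f \<in> borel_measurable borel"
 unfolding stepP_def by measurable

lemmas nonneg_intros = mult_nonneg_nonneg divide_nonneg_nonneg add_nonneg_nonneg Hp_nonneg Hc_nonneg Hm_nonneg CK_nonneg

context
 fixes A and f :: "real \<times> real \<times> (real ^ 'd) => real"
 assumes A: "0 <= A" and f: "good A f"
begin

lemma f_measurable [measurable]: "f \<in> borel_measurable borel"
 using f by (rule good_measurable)

lemma f_bound_Hc:
 assumes "0 < s" "a $ k <= b" "b <= m"
 shows "\<bar>f (s, b, a)\<bar> <= A * (exp (ll * s) / sqrt s) * Hc s m a"
proof -
 have "\<bar>f (s, b, a)\<bar> <= A * (exp (ll * s) / sqrt s) * Hp s b a"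
  using assms by (intro good_bound[OF f]) auto
 also have "... <= A * (exp (ll * s) / sqrt s) * Hc s m a"
  using assms A by (intro mult_left_mono Hp_le_Hc) auto
 finally show ?thesis .
qed

lemma qq_integrable: "0 < s ==> integrable lborel (%b. indicator {a $ k<..<m} b * f (s, b, a))"
proof (cases "a $ k <= m")
 case True
 assume "0 < s"
 show ?thesis
 proof (rule abs_integral_interval_le(1)[where K="A * (exp (ll * s) / sqrt s) * Hc s m a"])
  show "0 <= A * (exp (ll * s) / sqrt s) * Hc s m a"
   using A \<open>0 < s\<close> by (intro nonneg_intros) auto
  show "\<bar>f (s, b, a)\<bar> <= A * (exp (ll * s) / sqrt s) * Hc s m a" if "a $ k < b" "b < m" for b
   using that \<open>0 < s\<close> by (intro f_bound_Hc) auto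
 qed (use True in auto)
qed simp

lemma qq_bound:
 assumes "0 < s" "a $ k <= m"
 shows "\<bar>qq f s m a\<bar> <= A * (exp (ll * s) / sqrt s) * Hc s m a * (m - a $ k)"
 unfolding qq_def
proof (rule abs_integral_interval_le(2))
 show "0 <= A * (exp (ll * s) / sqrt s) * Hc s m a"
  using A \<open>0 < s\<close> by (intro nonneg_intros) auto
 show "\<bar>f (s, b, a)\<bar> <= A * (exp (ll * s) / sqrt s) * Hc s m a" if "a $ k < b" "b < m" for b
  using that \<open>0 < s\<close> by (intro f_bound_Hc) auto
qed (use assms in auto)

definition stepE :: "real => real => real ^ 'd => real \<times> (real ^ 'd) => real" where
 "stepE t m x z = indicator {0<..<t} (fst z) * (2 * CK / sqrt (t - fst z) * (exp (ll * fst z) / sqrt (fst z))) *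
   (gd (2 * (t - fst z)) (x - snd z) * Hp (fst z) m (snd z) + gd (2 * (t - fst z)) (mirror k m x - snd z) * Hc (fst z) m (snd z))"

lemma stepE_measurable [measurable]: "stepE t m x \<in> borel_measurable borel"
 unfolding stepE_def indicator_def greaterThanLessThan_iff by measurable

lemma stepE_nonneg: "0 <= stepE t m x z"
 unfolding stepE_def using CK_nonneg by (auto simp: indicator_def intro!: nonneg_intros)

text \<open>\<open>qq_bound\<close> supplies the factor \<open>m - a $ k\<close> that
  \<open>dkap_bound\<close> consumes, so both halves keep only the integrable singularity
  \<open>1 / sqrt (t - s)\<close>.\<close>

lemma stepI_bound:
 assumes "x $ k <= m"
 shows "\<bar>stepI f t m x z\<bar> <= A * stepE t m x z"
proof (cases "0 < fst z \<and> fst z < t \<and> snd z $ k < m")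
 case True
 obtain s a where z: "z = (s, a)" by (cases z)
 from True z have s: "0 < s" "s < t" and a: "a $ k < m" by auto
 let ?e = "A * (exp (ll * s) / sqrt s)" and ?c = "2 * CK / sqrt (t - s)"
 have e: "0 <= ?e" using A s by auto
 have 1: "\<bar>f (s, m, a) * kap m (t - s) a x\<bar> <= (?e * Hp s m a) * (?c * gd (2 * (t - s)) (x - a))"
  unfolding abs_mult using s a assms e
  by (intro mult_mono good_bound[OF f] kap_bound) (use A in \<open>auto intro!: nonneg_intros\<close>)
 have "\<bar>qq f s m a * dkap m (t - s) a x\<bar> <= (?e * Hc s m a * (m - a $ k)) * \<bar>dkap m (t - s) a x\<bar>"
  unfolding abs_mult using s a by (intro mult_right_mono qq_bound) auto
 also have "... = (?e * Hc s m a) * ((m - a $ k) * \<bar>dkap m (t - s) a x\<bar>)" by simp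
 also have "... <= (?e * Hc s m a) * (?c * gd (2 * (t - s)) (mirror k m x - a))"
  using s a assms e A by (intro mult_left_mono dkap_bound) (auto intro!: nonneg_intros)
 finally have 2: "\<bar>qq f s m a * dkap m (t - s) a x\<bar> <= (?e * Hc s m a) * (?c * gd (2 * (t - s)) (mirror k m x - a))" .
 have "\<bar>stepI f t m x z\<bar> <= \<bar>f (s, m, a) * kap m (t - s) a x\<bar> + \<bar>qq f s m a * dkap m (t - s) a x\<bar>"
  using True z by (simp add: stepI_def)
 also have "... <= (?e * Hp s m a) * (?c * gd (2 * (t - s)) (x - a)) + (?e * Hc s m a) * (?c * gd (2 * (t - s)) (mirror k m x - a))"
  by (intro add_mono 1 2)
 also have "... = A * stepE t m x z"
  using s z by (simp add: stepE_def algebra_simps)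
 finally show ?thesis .
next
 case False
 hence "stepI f t m x z = 0" unfolding stepI_def by auto
 thus ?thesis using A stepE_nonneg by simp
qed

text \<open>In space both halves convolve to \<open>Hp t m x\<close>, the second because its kernel
  is already centred at the mirror image. In time the choice of \<open>ll\<close> leaves the factor
  1/2.\<close>

lemma nn_integral_stepE:
 assumes t: "0 < t" and x: "x $ k <= m"
 shows "(NN z. ennreal (stepE t m x z)) <= ennreal (exp (ll * t) / sqrt t / 2 * Hp t m x)"
proof -
 have "(NN z. ennreal (stepE t m x z)) = (NN s. \<integral>\<^sup>+a. ennreal (stepE t m x (s, a)) \<partial>lborel)"
  unfolding lborel_prod[symmetric] by (subst lborel.nn_integral_fst) (auto simp: lborel_prod)
 also have "... = (NN s. ennreal (ind t s * (4 * CK / sqrt (t - s) * (exp (ll * s) / sqrt s))) * ennreal (Hp t m x))"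
 proof (rule nn_integral_cong)
  fix s :: real
  show "(NN a. ennreal (stepE t m x (s, a))) = ennreal (ind t s * (4 * CK / sqrt (t - s) * (exp (ll * s) / sqrt s))) * ennreal (Hp t m x)"
  proof (cases "0 < s \<and> s < t")
   case True
   let ?c = "2 * CK / sqrt (t - s) * (exp (ll * s) / sqrt s)"
   have c: "0 <= ?c" using CK_nonneg True by simp
   have "(NN a. ennreal (stepE t m x (s, a)))
     = (NN a. ennreal ?c * (ennreal (gd (2 * (t - s)) (x - a) * Hp s m a) + ennreal (gd (2 * (t - s)) (mirror k m x - a) * Hc s m a)))"
    using True c by (intro nn_integral_cong)
     (simp add: stepE_def ennreal_mult'[symmetric] ennreal_plus[symmetric] Hp_nonneg Hc_nonneg del: ennreal_plus)
   also have "... = ennreal ?c * (ennreal (Hp t m x) + ennreal (Hc t m (mirror k m x)))"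
    using True nn_integral_gd_Hp[of s "t - s" x m] nn_integral_gd_Hc[of s "t - s" "mirror k m x" m]
    by (simp add: nn_integral_cmult nn_integral_add)
   also have "... = ennreal ?c * (2 * ennreal (Hp t m x))"
    by (simp only: Hp_def mult_2)
   also have "... = ennreal (4 * CK / sqrt (t - s) * (exp (ll * s) / sqrt s)) * ennreal (Hp t m x)"
   proof -
    have "ennreal ?c * 2 = ennreal (?c * 2)" using c by (subst ennreal_mult) auto
    also have "?c * 2 = 4 * CK / sqrt (t - s) * (exp (ll * s) / sqrt s)" by simp
    finally show ?thesis by (simp only: mult.assoc[symmetric])
   qed
   finally show ?thesis using True by simp
  qed (auto simp: stepE_def indicator_def)
 qed
 also have "... = (NN s. ennreal (ind t s * (4 * CK / sqrt (t - s) * (exp (ll * s) / sqrt s)))) * ennreal (Hp t m x)"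
  by (rule nn_integral_multc) measurable
 also have "... <= ennreal (exp (ll * t) / sqrt t / 2) * ennreal (Hp t m x)"
  by (intro mult_right_mono ll_contraction' t) auto
 also have "... = ennreal (exp (ll * t) / sqrt t / 2 * Hp t m x)"
  using t by (intro ennreal_mult[symmetric]) (auto intro: Hp_nonneg)
 finally show ?thesis .
qed

lemma stepE_integrable: "0 < t ==> x $ k <= m ==> integrable lborel (stepE t m x)"
 using nn_integral_stepE[of t x m] stepE_nonneg
 by (intro integrableI_nonneg) (auto simp: less_top[symmetric] top_unique)

lemma stepI_integrable: "0 < t ==> x $ k <= m ==> integrable lborel (stepI f t m x)"
proof (rule lint_bound)
 assume "0 < t" and x: "x $ k <= m"
 thus "integrable lborel (%z. A * stepE t m x z)"
  by (intro integrable_mult_right stepE_integrable)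
 show "AE z in lborel. norm (stepI f t m x z) <= norm (A * stepE t m x z)"
  using stepI_bound[OF x] A stepE_nonneg by (intro AE_I2) (simp only: real_norm_def abs_mult abs_of_nonneg)
qed measurable

lemma stepP_bound:
 assumes t: "0 < t" and x: "x $ k <= m"
 shows "\<bar>stepP f (t, m, x)\<bar> <= A / 2 * (exp (ll * t) / sqrt t) * Hp t m x"
proof -
 have "\<bar>stepP f (t, m, x)\<bar> <= (LBINT z. \<bar>stepI f t m x z\<bar>)"
  unfolding stepP_def using integral_norm_bound[of lborel "stepI f t m x"] by simp
 also have "... <= (LBINT z. A * stepE t m x z)"
  using assms by (intro integral_mono stepI_bound integrable_mult_right stepE_integrable integrable_abs stepI_integrable) auto
 also have "... = A * (LBINT z. stepE t m x z)" by simp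
 also have "... <= A * (exp (ll * t) / sqrt t / 2 * Hp t m x)"
 proof (intro mult_left_mono A)
  have "ennreal (LBINT z. stepE t m x z) <= ennreal (exp (ll * t) / sqrt t / 2 * Hp t m x)"
   using nn_integral_stepE[OF assms] nn_integral_eq_integral[OF stepE_integrable[OF assms]] stepE_nonneg by simp
  thus "(LBINT z. stepE t m x z) <= exp (ll * t) / sqrt t / 2 * Hp t m x"
   using t by (subst (asm) ennreal_le_iff) (auto intro!: nonneg_intros)
 qed
 finally show ?thesis by simp
qed

definition beta :: "real => real" where
 "beta t = (LBINT s. ind t s * (1 / sqrt (t - s) * (exp (ll * s) / sqrt s)))"

lemma beta_finite: "0 < t ==> integrable lborel (%s. ind t s * (1 / sqrt (t - s) * (exp (ll * s) / sqrt s)))"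
proof -
 assume t: "0 < t"
 \<comment> \<open>The estimate behind \<open>ll\<close> carries the factor \<open>4 * CK\<close>,
   which may be 0; finiteness is therefore taken from a rate for the constant 1.\<close>
 obtain l where l: "0 < l" "!!t. 0 < t ==> (NN s. ennreal (ind t s * (1 / sqrt (t - s) * (exp (l * s) / sqrt s)))) <= ennreal (exp (l * t) / sqrt t / 2)"
  by (rule singular_kernel_contraction[OF zero_le_one]) blast
 have "(NN s. ennreal (ind t s * (1 / sqrt (t - s) * (exp (ll * s) / sqrt s))))
   <= (NN s. ennreal (exp (ll * t)) * ennreal (ind t s * (1 / sqrt (t - s) * (exp (l * s) / sqrt s))))"
 proof (rule nn_integral_mono)
  fix s
  show "ennreal (ind t s * (1 / sqrt (t - s) * (exp (ll * s) / sqrt s)))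
    <= ennreal (exp (ll * t)) * ennreal (ind t s * (1 / sqrt (t - s) * (exp (l * s) / sqrt s)))"
  proof (cases "0 < s \<and> s < t")
   case True
   have "exp (ll * s) <= exp (ll * t) * 1" using True ll_pos by simp
   also have "... <= exp (ll * t) * exp (l * s)" using True l by (intro mult_left_mono) auto
   finally have "1 / sqrt (t - s) * (exp (ll * s) / sqrt s) <= exp (ll * t) * (1 / sqrt (t - s) * (exp (l * s) / sqrt s))"
    using True by (simp add: divide_right_mono)
   thus ?thesis using True by (simp add: ennreal_mult'[symmetric])
  qed (auto simp: indicator_def)
 qed
 also have "... <= ennreal (exp (ll * t)) * ennreal (exp (l * t) / sqrt t / 2)"
  by (subst nn_integral_cmult, simp, intro mult_left_mono l t) auto
 also have "... < \<infinity>" by (simp add: ennreal_mult_less_top)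
 finally show ?thesis
  by (intro integrableI_nonneg) (auto simp: indicator_def)
qed

text \<open>A majorant that no longer sees the level. Its integral \<open>beta t * Hm t x\<close> is
  continuous in \<open>x\<close>, as required of a dominating sequence with convergent
  integrals.\<close>

definition stepD :: "real => real ^ 'd => real \<times> (real ^ 'd) => real" where
 "stepD t x z = indicator {0<..<t} (fst z) * (1 / sqrt (t - fst z) * (exp (ll * fst z) / sqrt (fst z))) *
   (gd (2 * (t - fst z)) (x - snd z) * Hm (fst z) (snd z))"

lemma stepD_measurable [measurable]: "stepD t x \<in> borel_measurable borel"
 unfolding stepD_def indicator_def greaterThanLessThan_iff by measurable

lemma stepE_le_stepD:
 assumes "x $ k <= m" "snd z $ k < m"
 shows "stepE t m x z <= 4 * CK * stepD t x z"
proof (cases "0 < fst z \<and> fst z < t")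
 case True
 let ?g = "gd (2 * (t - fst z)) (x - snd z)"
 have "gd (2 * (t - fst z)) (mirror k m x - snd z) <= ?g"
  using assms True by (intro gd_mono norm_diff_le_mirror) auto
 moreover have "Hp (fst z) m (snd z) <= Hm (fst z) (snd z)"
  using Hp_le_Hc[of "fst z" "snd z" m m] Hc_le_Hm[of "fst z" m "snd z"] assms True by auto
 ultimately have "?g * Hp (fst z) m (snd z) + gd (2 * (t - fst z)) (mirror k m x - snd z) * Hc (fst z) m (snd z)
   <= ?g * Hm (fst z) (snd z) + ?g * Hm (fst z) (snd z)"
  using True Hc_le_Hm[of "fst z" m "snd z"] by (intro add_mono mult_mono) (auto intro!: nonneg_intros)
 hence "2 * CK / sqrt (t - fst z) * (exp (ll * fst z) / sqrt (fst z)) * (?g * Hp (fst z) m (snd z) + gd (2 * (t - fst z)) (mirror k m x - snd z) * Hc (fst z) m (snd z))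
   <= 2 * CK / sqrt (t - fst z) * (exp (ll * fst z) / sqrt (fst z)) * (2 * (?g * Hm (fst z) (snd z)))"
  using True CK_nonneg by (intro mult_left_mono) (auto simp: mult.commute)
 thus ?thesis using True by (simp add: stepE_def stepD_def)
qed (auto simp: stepE_def stepD_def)

lemma stepD_integral:
 assumes t: "0 < t"
 shows "integrable lborel (stepD t x)" "(LBINT z. stepD t x z) = beta t * Hm t x"
proof -
 have "(NN z. ennreal (stepD t x z)) = (NN s. \<integral>\<^sup>+a. ennreal (stepD t x (s, a)) \<partial>lborel)"
  unfolding lborel_prod[symmetric] by (subst lborel.nn_integral_fst) (auto simp: lborel_prod)
 also have "... = (NN s. ennreal (ind t s * (1 / sqrt (t - s) * (exp (ll * s) / sqrt s))) * ennreal (Hm t x))"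
 proof (rule nn_integral_cong)
  fix s :: real
  show "(NN a. ennreal (stepD t x (s, a))) = ennreal (ind t s * (1 / sqrt (t - s) * (exp (ll * s) / sqrt s))) * ennreal (Hm t x)"
  proof (cases "0 < s \<and> s < t")
   case True
   hence "(NN a. ennreal (stepD t x (s, a)))
     = (NN a. ennreal (1 / sqrt (t - s) * (exp (ll * s) / sqrt s)) * ennreal (gd (2 * (t - s)) (x - a) * Hm s a))"
    by (intro nn_integral_cong) (simp add: stepD_def ennreal_mult'[symmetric])
   also have "... = ennreal (1 / sqrt (t - s) * (exp (ll * s) / sqrt s)) * ennreal (Hm t x)"
    using True nn_integral_gd_Hm[of s "t - s" x] by (simp add: nn_integral_cmult)
   finally show ?thesis using True by simp
  qed (auto simp: stepD_def indicator_def)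
 qed
 also have "... = (NN s. ennreal (ind t s * (1 / sqrt (t - s) * (exp (ll * s) / sqrt s)))) * ennreal (Hm t x)"
  by (rule nn_integral_multc) measurable
 also have "... = ennreal (beta t) * ennreal (Hm t x)"
  unfolding beta_def by (subst nn_integral_eq_integral[OF beta_finite[OF t]]) (auto simp: indicator_def)
 also have "... = ennreal (beta t * Hm t x)"
  using t by (intro ennreal_mult[symmetric] Hm_nonneg) (auto simp: beta_def indicator_def intro!: integral_nonneg_AE)
 finally have nn: "(NN z. ennreal (stepD t x z)) = ennreal (beta t * Hm t x)" .
 have nonneg: "0 <= stepD t x z" for z
  unfolding stepD_def by (auto simp: indicator_def intro!: nonneg_intros)
 show i: "integrable lborel (stepD t x)"
  by (intro integrableI_nonneg) (auto simp: nn nonneg)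
 have "0 <= beta t * Hm t x"
  using t by (intro mult_nonneg_nonneg Hm_nonneg) (auto simp: beta_def indicator_def intro!: integral_nonneg_AE)
 thus "(LBINT z. stepD t x z) = beta t * Hm t x"
  using nn nn_integral_eq_integral[OF i] nonneg by (simp add: integral_nonneg_AE)
qed

lemma qq_tendsto:
 assumes s: "0 < s" and m: "!!j. m <= mj j" "mj ----> m"
 shows "(%j. qq f s (mj j) a) ----> qq f s m a"
proof -
 obtain M where M: "!!j. mj j <= M"
  using convergent_imp_Bseq[OF convergentI[OF m(2)]] by (auto simp: Bseq_def abs_le_iff)
 show ?thesis unfolding qq_def
 proof (rule integral_dominated_convergence[where w="%b. \<bar>indicator {a $ k<..<M} b * f (s, b, a)\<bar>"])
  show "integrable lborel (%b. \<bar>indicator {a $ k<..<M} b * f (s, b, a)\<bar>)"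
   by (intro integrable_abs qq_integrable s)
  show "AE b in lborel. (%j. indicator {a $ k<..<mj j} b * f (s, b, a)) ----> indicator {a $ k<..<m} b * f (s, b, a)"
   using AE_lborel_singleton[of m]
  proof eventually_elim
   case (elim b)
   have "eventually (%j. indicator {a $ k<..<mj j} b = (indicator {a $ k<..<m} b :: real)) sequentially"
   proof (cases "b < m")
    case True
    thus ?thesis using m(1) by (intro always_eventually) (auto simp: indicator_def intro: less_le_trans)
   next
    case False
    hence "eventually (%j. mj j < b) sequentially"
     using elim m(2) by (intro order_tendstoD) auto
    thus ?thesis by eventually_elim (use False in \<open>auto simp: indicator_def\<close>)
   qed
   hence "(%j. indicator {a $ k<..<mj j} b :: real) ----> indicator {a $ k<..<m} b"
    by (rule tendsto_eventually)
   thus ?case by (intro tendsto_intros)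
  qed
  show "AE b in lborel. norm (indicator {a $ k<..<mj j} b * f (s, b, a)) <= \<bar>indicator {a $ k<..<M} b * f (s, b, a)\<bar>" for j
   using M[of j] by (auto simp: indicator_def)
 qed (simp_all add: indicator_def)
qed

lemma psi_tendsto: "0 < \<tau> ==> zj ----> z ==> (%j. psi \<tau> a (zj j)) ----> psi \<tau> a z"
 unfolding psi_def by (intro tendsto_intros continuous_gd) auto

lemma chi_tendsto: "0 < \<tau> ==> zj ----> z ==> (%j. chi \<tau> a (zj j)) ----> chi \<tau> a z"
 unfolding chi_def by (intro tendsto_intros continuous_gd) auto

text \<open>The Gaussian peaks move with \<open>xj\<close> and sharpen without bound as
  \<open>s\<close> tends to \<open>t\<close>, so the dominating functions
  \<open>stepD t (xj j)\<close> are allowed to move along; their integrals converge.\<close>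

lemma stepP_tendsto:
 assumes t: "0 < t" and m: "!!j. m <= mj j" "mj ----> m" and x: "xj ----> x" "!!j. xj j $ k <= mj j"
 shows "(%j. stepP f (t, mj j, xj j)) ----> stepP f (t, m, x)"
proof -
 have "(%j. \<integral>z. stepI f t (mj j) (xj j) z \<partial>lborel) ----> (LBINT z. stepI f t m x z)"
 proof (rule integral_dominated_convergence_varying[where D="%j z. A * (4 * CK * stepD t (xj j) z)" and E="%z. A * (4 * CK * stepD t x z)"])
  show "integrable lborel (%z. A * (4 * CK * stepD t (xj j) z))" for j
   by (intro integrable_mult_right stepD_integral t)
  show "integrable lborel (%z. A * (4 * CK * stepD t x z))"
   by (intro integrable_mult_right stepD_integral t)
  \<comment> \<open>At \<open>a $ k = m\<close> the cut-off in \<open>stepI\<close> jumps; this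
    hyperplane is null.\<close>
  have "AE z in (lborel \<Otimes>\<^sub>M lborel :: (real \<times> (real ^ 'd)) measure). snd z $ k \<noteq> m"
  proof (rule lborel_pair.AE_pair_measure)
   show "AE s in lborel. AE a in lborel. snd (s :: real, a :: real ^ 'd) $ k \<noteq> m"
    by (rule AE_I2) (simp only: snd_conv AE_hyperplane)
  qed measurable
  hence ne: "AE z in (lborel :: (real \<times> (real ^ 'd)) measure). snd z $ k \<noteq> m"
   by (simp only: lborel_prod)
  show "AE z in lborel. (%j. stepI f t (mj j) (xj j) z) ----> stepI f t m x z"
   using ne
  proof eventually_elim
   case (elim z)
   obtain s a where z: "z = (s, a)" by (cases z)
   show ?case
   proof (cases "0 < s \<and> s < t")
    case True
    show ?thesis
    proof (cases "a $ k < m")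
     case am: True
     have "stepI f t (mj j) (xj j) z = f (s, mj j, a) * kap (mj j) (t - s) a (xj j) + qq f s (mj j) a * dkap (mj j) (t - s) a (xj j)" for j
      using True am m(1)[of j] z by (simp add: stepI_def)
     moreover have "(%j. f (s, mj j, a) * kap (mj j) (t - s) a (xj j) + qq f s (mj j) a * dkap (mj j) (t - s) a (xj j))
      ----> f (s, m, a) * kap m (t - s) a x + qq f s m a * dkap m (t - s) a x"
     proof -
      have "(%j. f (s, mj j, a)) ----> f (s, m, a)"
      proof (rule good_tendsto[OF f, of s m mj "%_. a" a])
       show "a $ k <= mj j" for j using am m(1)[of j] by linarith
      qed (use True m in simp_all)
      moreover have "(%j. qq f s (mj j) a) ----> qq f s m a"
       using True by (intro qq_tendsto m) auto
      moreover have mir: "(%j. mirror k (mj j) (xj j)) ----> mirror k m x"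
       by (intro tendsto_mirror m x)
      moreover have "(%j. kap (mj j) (t - s) a (xj j)) ----> kap m (t - s) a x"
       unfolding kap_def using True by (intro tendsto_diff psi_tendsto mir x) auto
      moreover have "(%j. dkap (mj j) (t - s) a (xj j)) ----> dkap m (t - s) a x"
       unfolding dkap_def using True by (intro tendsto_mult tendsto_const chi_tendsto mir) auto
      ultimately show ?thesis by (intro tendsto_add tendsto_mult)
     qed
     ultimately show ?thesis using True am z by (simp add: stepI_def)
    next
     case False
     hence "m < a $ k" using elim z by auto
     hence "eventually (%j. mj j < a $ k) sequentially" using m(2) by (intro order_tendstoD)
     hence "eventually (%j. stepI f t (mj j) (xj j) z = 0) sequentially"
      by eventually_elim (auto simp: stepI_def z)
     moreover have "stepI f t m x z = 0" using False by (auto simp: stepI_def z)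
     ultimately show ?thesis by (simp add: tendsto_eventually)
    qed
   qed (auto simp: stepI_def z)
  qed
  show "AE z in lborel. (%j. A * (4 * CK * stepD t (xj j) z)) ----> A * (4 * CK * stepD t x z)"
  proof (rule AE_I2)
   fix z
   show "(%j. A * (4 * CK * stepD t (xj j) z)) ----> A * (4 * CK * stepD t x z)"
   proof (cases "0 < fst z \<and> fst z < t")
    case True
    thus ?thesis unfolding stepD_def by (intro tendsto_intros continuous_gd x) auto
   qed (auto simp: stepD_def)
  qed
  show "AE z in lborel. \<bar>stepI f t (mj j) (xj j) z\<bar> <= A * (4 * CK * stepD t (xj j) z)" for j
  proof (rule AE_I2)
   fix z
   have nn: "0 <= A * (4 * CK * stepD t (xj j) z)"
    unfolding stepD_def using A CK_nonneg by (auto simp: indicator_def intro!: nonneg_intros)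
   show "\<bar>stepI f t (mj j) (xj j) z\<bar> <= A * (4 * CK * stepD t (xj j) z)"
   proof (cases "snd z $ k < mj j")
    case True
    have "\<bar>stepI f t (mj j) (xj j) z\<bar> <= A * stepE t (mj j) (xj j) z" by (rule stepI_bound) fact
    also have "... <= A * (4 * CK * stepD t (xj j) z)"
     using True x(2)[of j] by (intro mult_left_mono A stepE_le_stepD) auto
    finally show ?thesis .
   next
    case False
    hence "stepI f t (mj j) (xj j) z = 0" by (auto simp: stepI_def)
    thus ?thesis using nn by simp
   qed
  qed
  show "(%j. \<integral>z. A * (4 * CK * stepD t (xj j) z) \<partial>lborel) ----> (LBINT z. A * (4 * CK * stepD t x z))"
   using t by (simp add: stepD_integral) (intro tendsto_intros tendsto_Hm x)
 qed measurable
 thus ?thesis by (simp add: stepP_def)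
qed

lemma good_stepP: "good (A / 2) (stepP f)"
 unfolding good_def
 by (intro conjI allI impI stepP_bound stepP_tendsto) (auto intro: stepP_measurable)

end

end

lemma gd_along_line_derivative:
 fixes u v :: "'a::euclidean_space"
 assumes "0 < t"
 shows "((%m. gd t (u + m *\<^sub>R v)) has_real_derivative - (((u + m *\<^sub>R v) \<bullet> v) / t) * gd t (u + m *\<^sub>R v)) (at m)"
proof -
 have n: "(norm (u + m *\<^sub>R v))\<^sup>2 = u \<bullet> u + 2 * m * (u \<bullet> v) + m\<^sup>2 * (v \<bullet> v)" for m
  unfolding power2_norm_eq_inner by (simp add: inner_add_left inner_add_right inner_commute power2_eq_square algebra_simps)
 have e: "(u + m *\<^sub>R v) \<bullet> v = u \<bullet> v + m * (v \<bullet> v)"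
  by (simp add: inner_add_left)
 have "((%m. - (u \<bullet> u + 2 * m * (u \<bullet> v) + m\<^sup>2 * (v \<bullet> v)) / (2 * t)) has_real_derivative - ((u \<bullet> v + m * (v \<bullet> v)) / t)) (at m)"
  using assms by (auto intro!: derivative_eq_intros simp: field_simps)
 from DERIV_cmult[OF DERIV_fun_exp[OF this], of "(1 / sqrt (2 * pi * t)) ^ DIM('a)"]
 show ?thesis
  unfolding gd_def n e by (simp add: mult_ac)
qed

lemma mirror_line: "mirror k m x - a = (x - (2 * x $ k) *\<^sub>R axis k 1 - a) + m *\<^sub>R (2 *\<^sub>R axis k 1)"
 by (simp add: mirror_def algebra_simps)

lemma nn_integral_exp_square:
 assumes "0 < t" shows "(NN u. ennreal (exp (- u\<^sup>2 / (4 * t)))) = ennreal (sqrt (4 * pi * t))"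
proof -
 have "exp (- u\<^sup>2 / (4 * t)) = sqrt (4 * pi * t) * normal_density 0 (sqrt (2 * t)) u" for u
  using assms by (simp add: normal_density_def mult.assoc)
 hence "(NN u. ennreal (exp (- u\<^sup>2 / (4 * t)))) = (NN u. ennreal (sqrt (4 * pi * t)) * ennreal (normal_density 0 (sqrt (2 * t)) u))"
  using assms by (simp add: ennreal_mult')
 also have "... = ennreal (sqrt (4 * pi * t))"
  using assms by (simp add: nn_integral_cmult nn_integral_eq_integral)
 finally show ?thesis .
qed

context parametrix begin

lemma kap_derivative:
 assumes "0 < \<tau>"
 shows "((%m. kap m \<tau> a x) has_real_derivative dkap m \<tau> a x) (at m)"
proof -
 let ?u = "x - (2 * x $ k) *\<^sub>R axis k 1 - a" and ?v = "2 *\<^sub>R axis k 1 :: real ^ 'd"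
 have e: "psi \<tau> a (mirror k m x) = ((?u \<bullet> B a + m * (?v \<bullet> B a)) / \<tau>) * gd \<tau> (?u + m *\<^sub>R ?v)" for m
  unfolding psi_def mirror_line by (simp only: inner_add_left inner_scaleR_left)
 have "((%m. psi \<tau> a (mirror k m x)) has_real_derivative
   (?v \<bullet> B a) / \<tau> * gd \<tau> (?u + m *\<^sub>R ?v) + (- (((?u + m *\<^sub>R ?v) \<bullet> ?v) / \<tau>) * gd \<tau> (?u + m *\<^sub>R ?v)) * ((?u \<bullet> B a + m * (?v \<bullet> B a)) / \<tau>)) (at m)"
  unfolding e using assms
  by (intro DERIV_mult gd_along_line_derivative) (auto intro!: derivative_eq_intros)
 moreover have "(?v \<bullet> B a) / \<tau> * gd \<tau> (?u + m *\<^sub>R ?v) + (- (((?u + m *\<^sub>R ?v) \<bullet> ?v) / \<tau>) * gd \<tau> (?u + m *\<^sub>R ?v)) * ((?u \<bullet> B a + m * (?v \<bullet> B a)) / \<tau>)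
   = 2 * chi \<tau> a (mirror k m x)"
 proof -
  have 1: "?u \<bullet> B a + m * (?v \<bullet> B a) = (?u + m *\<^sub>R ?v) \<bullet> B a" by (simp only: inner_add_left inner_scaleR_left)
  have 2: "?v \<bullet> B a = 2 * B a $ k" by (simp add: inner_axis')
  have 3: "w \<bullet> ?v = 2 * w $ k" for w by (simp add: inner_axis)
  have gen: "(2 * b) / \<tau> * G + (- ((2 * wk) / \<tau>) * G) * (wB / \<tau>) = 2 * ((b / \<tau> - wB * wk / \<tau>\<^sup>2) * G)" for b G wk wB :: real
   using assms by (simp add: power2_eq_square field_simps)
  show ?thesis unfolding 1 unfolding 3 unfolding 2 unfolding gen chi_def mirror_line ..
 qed
 ultimately have "((%m. psi \<tau> a (mirror k m x)) has_real_derivative 2 * chi \<tau> a (mirror k m x)) (at m)"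
  by simp
 hence "((%m. psi \<tau> a x - psi \<tau> a (mirror k m x)) has_real_derivative 0 - 2 * chi \<tau> a (mirror k m x)) (at m)"
  by (intro DERIV_diff DERIV_const)
 thus ?thesis unfolding kap_def dkap_def by simp
qed

lemma dkap_continuous:
 assumes "0 < \<tau>" shows "continuous_on UNIV (%m. dkap m \<tau> a x)"
 unfolding dkap_def chi_def gd_def mirror_def using assms by (intro continuous_intros) auto

text \<open>Differentiating \<open>qq f s m a * kap m \<tau> a x\<close> in the level \<open>m\<close> produces the integrand of \<open>stepP\<close>.\<close>
lemma qq_stepP:
 assumes A: "0 <= A" and f: "good A f" and t: "0 < t" and x: "x $ k < c"
 shows "qq (stepP f) t c x = (LBINT z. (if 0 < fst z \<and> fst z < t \<and> snd z $ k < c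
      then qq f (fst z) c (snd z) * kap c (t - fst z) (snd z) x else 0))"
proof -
 note [measurable] = good_measurable[OF f]
 let ?F = "%(b, z). indicator {x $ k<..<c} b * stepI f t b x z"
 have meas: "?F \<in> borel_measurable (lborel \<Otimes>\<^sub>M lborel)"
  unfolding indicator_def greaterThanLessThan_iff by measurable
 have "(\<integral>\<^sup>+w. ennreal (norm (?F w)) \<partial>(lborel \<Otimes>\<^sub>M lborel)) = (NN b. \<integral>\<^sup>+z. ennreal (norm (?F (b, z))) \<partial>lborel)"
  by (rule lborel.nn_integral_fst[symmetric]) (use meas in measurable)
 also have "... <= (NN b. ennreal (A * (exp (ll * t) / sqrt t / 2 * Hc t c x)) * indicator {x $ k<..<c} b)"
 proof (rule nn_integral_mono)
  fix b
  show "(NN z. ennreal (norm (?F (b, z)))) <= ennreal (A * (exp (ll * t) / sqrt t / 2 * Hc t c x)) * indicator {x $ k<..<c} b"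
  proof (cases "x $ k < b \<and> b < c")
   case True
   have "(NN z. ennreal (norm (?F (b, z)))) <= (NN z. ennreal A * ennreal (stepE t b x z))"
    using True stepI_bound[OF A f, of x b t] A stepE_nonneg[OF A f]
    by (intro nn_integral_mono) (simp add: ennreal_mult'[symmetric])
   also have "... <= ennreal A * ennreal (exp (ll * t) / sqrt t / 2 * Hp t b x)"
    using True by (subst nn_integral_cmult) (use stepE_measurable[OF A f] in simp, intro mult_left_mono nn_integral_stepE[OF A f] t, auto)
   also have "... = ennreal (A * (exp (ll * t) / sqrt t / 2 * Hp t b x))"
    using A t by (intro ennreal_mult[symmetric] nonneg_intros) auto
   also have "... <= ennreal (A * (exp (ll * t) / sqrt t / 2 * Hc t c x))"
    using A t True by (intro ennreal_leI mult_left_mono Hp_le_Hc) auto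
   finally show ?thesis using True by simp
  qed (auto simp: indicator_def)
 qed
 also have "... < \<infinity>"
  using x by (simp add: nn_integral_cmult ennreal_mult_less_top less_top)
 finally have int: "integrable (lborel \<Otimes>\<^sub>M lborel) ?F"
  using meas by (intro integrableI_bounded)
 have "qq (stepP f) t c x = (LBINT b. (LBINT z. ?F (b, z)))"
  unfolding qq_def stepP_def by simp
 also have "... = (LBINT z. (LBINT b. ?F (b, z)))"
  using lborel_pair.Fubini_integral[of "%b z. ?F (b, z)"] int by (simp add: case_prod_unfold)
 also have "... = (LBINT z. (if 0 < fst z \<and> fst z < t \<and> snd z $ k < c
      then qq f (fst z) c (snd z) * kap c (t - fst z) (snd z) x else 0))"
 proof (rule lint_cong)
  fix z :: "real \<times> (real ^ 'd)"
  obtain s a where z: "z = (s, a)" by (cases z)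
  show "(LBINT b. ?F (b, z)) = (if 0 < fst z \<and> fst z < t \<and> snd z $ k < c
      then qq f (fst z) c (snd z) * kap c (t - fst z) (snd z) x else 0)"
  proof (cases "0 < s \<and> s < t \<and> a $ k < c")
   case True
   \<comment> \<open>The integrand lives on levels above both \<open>a $ k\<close> and
     \<open>x $ k\<close>.\<close>
   let ?m0 = "max (a $ k) (x $ k)"
   have [measurable]: "(%b. f (s, b, a)) \<in> borel_measurable borel" by measurable
   have "(LBINT b. ?F (b, z)) = (LBINT b. indicator {?m0<..<c} b * (f (s, b, a) * kap b (t - s) a x
     + (LBINT b'. indicator {a $ k<..<b} b' * f (s, b', a)) * dkap b (t - s) a x))"
    using True by (intro lint_cong) (auto simp: stepI_def z indicator_def qq_def)
   also have "... = qq f s c a * kap c (t - s) a x - qq f s ?m0 a * kap ?m0 (t - s) a x"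
    unfolding qq_def
   proof (rule integral_by_parts_indefinite)
    show "0 <= A * (exp (ll * s) / sqrt s) * Hc s c a"
     using A True by (intro nonneg_intros) auto
    show "\<bar>f (s, b, a)\<bar> <= A * (exp (ll * s) / sqrt s) * Hc s c a" if "a $ k < b" "b < c" for b
     using that True by (intro f_bound_Hc[OF A f]) auto
    show "((%b. kap b (t - s) a x) has_real_derivative dkap b (t - s) a x) (at b)" for b
     using True by (intro kap_derivative) auto
    show "continuous_on UNIV (%b. dkap b (t - s) a x)"
     using True by (intro dkap_continuous) auto
   qed (use True x in auto)
   \<comment> \<open>The lower boundary term vanishes: either \<open>x\<close> lies on the
     hyperplane, where \<open>kap\<close> cancels against its image, or the interval in
     \<open>qq\<close> is empty.\<close>
   also have "qq f s ?m0 a * kap ?m0 (t - s) a x = 0"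
   proof (cases "a $ k <= x $ k")
    case True
    hence "?m0 = x $ k" by simp
    thus ?thesis by (simp add: kap_def mirror_hyperplane)
   next
    case False
    thus ?thesis by (simp add: qq_def max_def)
   qed
   finally show ?thesis using True z by simp
  next
   case False
   have F0: "?F (b, z) = 0" for b using False by (auto simp: stepI_def z indicator_def)
   show ?thesis unfolding F0 using False z by auto
  qed
 qed simp
 finally show ?thesis .
qed

section \<open>Total mass and pairing with test functions\<close>

definition mass :: "real => real" where "mass t = exp (ll * t) * sqrt (4 * pi)"

text \<open>In the coordinates of \<open>below_diag\<close> the majorant factors into a Gaussian in
  \<open>u\<close>, with integral \<open>sqrt (4 * pi * t)\<close>, and the probability density
  \<open>Hm t\<close>. This compensates the \<open>1 / sqrt t\<close> in the bound of
  \<open>good\<close>.\<close>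

lemma nn_integral_Hp_wedge:
 assumes "0 < t"
 shows "(NN z. ennreal (if snd z $ k <= fst z then Hp t (fst z) (snd z) else 0)) <= ennreal (sqrt (4 * pi * t))"
proof -
 let ?h = "%z. ennreal (if snd z $ k <= fst z then Hp t (fst z) (snd z) else 0)"
 have m0: "(%(u, y :: real ^ 'd). below_diag k y u) \<in> borel_measurable borel"
  unfolding case_prod_unfold by measurable
 have "(NN z. ?h z) = (\<integral>\<^sup>+z. ?h z \<partial>distr lborel borel (%(u, y). below_diag k y u))"
  by (simp only: distr_lborel_below_diag)
 also have "... = (NN w. ?h (below_diag k (snd w) (fst w)))"
  using m0 by (subst nn_integral_distr) (auto simp: case_prod_unfold cong: if_cong)
 also have "... <= (NN w. ennreal (exp (- (fst w)\<^sup>2 / (4 * t))) * ennreal (Hm t (snd w)))"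
 proof (rule nn_integral_mono)
  fix w :: "real \<times> (real ^ 'd)"
  show "?h (below_diag k (snd w) (fst w)) <= ennreal (exp (- (fst w)\<^sup>2 / (4 * t))) * ennreal (Hm t (snd w))"
   using Hp_below_diag[OF assms, of "fst w" "snd w"] assms
   by (auto simp: below_diag_def axis_def ennreal_mult''[symmetric] Hm_nonneg intro!: ennreal_leI)
 qed
 also have "... = (NN u. \<integral>\<^sup>+y. ennreal (exp (- u\<^sup>2 / (4 * t))) * ennreal (Hm t y) \<partial>lborel)"
  unfolding lborel_prod[symmetric] by (subst lborel.nn_integral_fst[symmetric]) auto
 also have "... = ennreal (sqrt (4 * pi * t))"
  using assms nn_integral_exp_square[OF assms] by (simp add: nn_integral_cmult nn_integral_Hm)
 finally show ?thesis .
qed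

lemma wedge_integrable:
 assumes t: "0 < t"
 shows "integrable lborel (%z. if snd z $ k <= fst z then Hp t (fst z) (snd z) else 0)"
proof (rule integrableI_nonneg)
 show "(NN z. ennreal (if snd z $ k <= fst z then Hp t (fst z) (snd z) else 0)) < \<infinity>"
  using nn_integral_Hp_wedge[OF t] by (simp add: order_le_less_trans)
qed (use t in \<open>auto intro: Hp_nonneg\<close>)

lemma nn_integral_good:
 assumes A: "0 <= A" and f: "good A f" and t: "0 < t"
 shows "(NN z. ennreal (if snd z $ k <= fst z then \<bar>f (t, z)\<bar> else 0)) <= ennreal (A * mass t)"
proof -
 have "(NN z. ennreal (if snd z $ k <= fst z then \<bar>f (t, z)\<bar> else 0))
   <= (NN z. ennreal (A * (exp (ll * t) / sqrt t)) * ennreal (if snd z $ k <= fst z then Hp t (fst z) (snd z) else 0))"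
  using A t good_bound[OF f t]
  by (intro nn_integral_mono) (auto simp: ennreal_mult'[symmetric] intro!: ennreal_leI)
 also have "... <= ennreal (A * (exp (ll * t) / sqrt t)) * ennreal (sqrt (4 * pi * t))"
  by (subst nn_integral_cmult) (auto intro!: mult_left_mono nn_integral_Hp_wedge t)
 also have "... = ennreal (A * mass t)"
  using A t by (subst ennreal_mult[symmetric]) (auto simp: mass_def real_sqrt_mult)
 finally show ?thesis .
qed

text \<open>For a joint density \<open>f\<close> at time \<open>t\<close>, the expectation of
  \<open>g\<close> at the position on the event that the maximum is below \<open>c\<close>.\<close>

definition Wt :: "(real \<times> real \<times> (real ^ 'd) => real) => real => real => (real ^ 'd => real) => real" where
 "Wt f t c g = (LBINT z. (if snd z $ k < fst z \<and> fst z < c then f (t, z) * g (snd z) else 0))"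

text \<open>The drift kernel acting on a test function. By \<open>hh_eq_dheat\<close> it is the
  derivative along \<open>B a\<close> of the heat flow of \<open>g\<close> absorbed at
  \<open>c\<close>.\<close>

definition hh :: "real => real => (real ^ 'd => real) => real ^ 'd => real" where
 "hh c \<tau> g a = (LBINT x. (if x $ k < c then kap c \<tau> a x * g x else 0))"

context
 fixes A and f :: "real \<times> real \<times> (real ^ 'd) => real" and t c G :: real and g :: "real ^ 'd => real"
 assumes A: "0 <= A" and f: "good A f" and t: "0 < t" and [measurable]: "g \<in> borel_measurable borel"
  and g: "!!x. \<bar>g x\<bar> <= G"
begin

lemma G_nonneg: "0 <= G" using g[of 0] by linarith

lemma Wt_integrable: "integrable lborel (%z. if snd z $ k < fst z \<and> fst z < c then f (t, z) * g (snd z) else 0)"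
proof -
 note [measurable] = good_measurable[OF f]
 have "integrable lborel (%z. (A * (exp (ll * t) / sqrt t) * G) * (if snd z $ k <= fst z then Hp t (fst z) (snd z) else 0))"
  by (intro integrable_mult_right wedge_integrable t)
 thus ?thesis
 proof (rule lint_bound)
  show "AE z in lborel. norm (if snd z $ k < fst z \<and> fst z < c then f (t, z) * g (snd z) else 0)
    <= norm ((A * (exp (ll * t) / sqrt t) * G) * (if snd z $ k <= fst z then Hp t (fst z) (snd z) else 0))"
  proof (rule AE_I2)
   fix z :: "real \<times> (real ^ 'd)"
   show "norm (if snd z $ k < fst z \<and> fst z < c then f (t, z) * g (snd z) else 0)
    <= norm ((A * (exp (ll * t) / sqrt t) * G) * (if snd z $ k <= fst z then Hp t (fst z) (snd z) else 0))"
   proof (cases "snd z $ k < fst z \<and> fst z < c")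
    case True
    have "\<bar>f (t, z)\<bar> * \<bar>g (snd z)\<bar> <= (A * (exp (ll * t) / sqrt t) * Hp t (fst z) (snd z)) * G"
     using good_bound[OF f t, of "snd z" "fst z"] True g A t
     by (intro mult_mono) (auto intro!: nonneg_intros)
    also have "... = norm ((A * (exp (ll * t) / sqrt t) * G) * Hp t (fst z) (snd z))"
     using A t G_nonneg by (simp add: abs_mult Hp_nonneg)
    finally show ?thesis using True by (simp add: abs_mult)
   qed (auto simp del: norm_mult)
  qed
 qed measurable
qed

lemma Wt_eq: "Wt f t c g = (LBINT x. qq f t c x * g x)"
proof -
 note [measurable] = good_measurable[OF f]
 let ?F = "%b x. if x $ k < b \<and> b < c then f (t, b, x) * g x else 0"
 have i: "integrable (lborel \<Otimes>\<^sub>M lborel) (case_prod ?F)"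
  using Wt_integrable by (simp only: lborel_prod case_prod_unfold prod.collapse)
 have "Wt f t c g = (\<integral>z. case_prod ?F z \<partial>(lborel \<Otimes>\<^sub>M lborel))"
  unfolding Wt_def by (simp only: lborel_prod case_prod_unfold prod.collapse)
 also have "... = (LBINT x. (LBINT b. ?F b x))"
  by (rule lborel_pair.integral_snd[symmetric, OF i])
 also have "... = (LBINT x. qq f t c x * g x)"
 proof (rule lint_cong)
  fix x
  have "(LBINT b. ?F b x) = (LBINT b. (indicator {x $ k<..<c} b * f (t, b, x)) * g x)"
   by (intro lint_cong) (auto simp: indicator_def)
  thus "(LBINT b. ?F b x) = qq f t c x * g x" by (simp add: qq_def)
 qed simp
 finally show ?thesis .
qed

end

lemma hh_measurable [measurable (raw)]:
 assumes [measurable]: "g \<in> borel_measurable borel" "u \<in> borel_measurable M" "v \<in> borel_measurable M"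
 shows "(%x. hh c (u x) g (v x)) \<in> borel_measurable M"
 unfolding hh_def by measurable

lemma hh_bound:
 assumes \<tau>: "0 < \<tau>" and a: "a $ k <= c" and [measurable]: "g \<in> borel_measurable borel" and g: "!!x. \<bar>g x\<bar> <= G"
 shows "integrable lborel (%x. if x $ k < c then kap c \<tau> a x * g x else 0)"
  and "\<bar>hh c \<tau> g a\<bar> <= 2 * CK / sqrt \<tau> * G"
proof -
 have G: "0 <= G" using g[of 0] by linarith
 have i: "integrable lborel (%x. (2 * CK / sqrt \<tau> * G) * gd (2 * \<tau>) (x - a))"
  using \<tau> by (intro integrable_mult_right integrable_gd) auto
 have b: "\<bar>if x $ k < c then kap c \<tau> a x * g x else 0\<bar> <= (2 * CK / sqrt \<tau> * G) * gd (2 * \<tau>) (x - a)" for x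
 proof (cases "x $ k < c")
  case True
  have "\<bar>kap c \<tau> a x\<bar> * \<bar>g x\<bar> <= (2 * CK / sqrt \<tau> * gd (2 * \<tau>) (x - a)) * G"
   using True \<tau> a CK_nonneg by (intro mult_mono kap_bound g) auto
  thus ?thesis using True by (simp add: abs_mult mult_ac)
 qed (use G \<tau> CK_nonneg in auto)
 hence b': "\<bar>if x $ k < c then kap c \<tau> a x * g x else 0\<bar> <= norm ((2 * CK / sqrt \<tau> * G) * gd (2 * \<tau>) (x - a))" for x
  by (rule order_trans) (simp only: real_norm_def abs_ge_self)
 show i': "integrable lborel (%x. if x $ k < c then kap c \<tau> a x * g x else 0)"
  by (rule lint_bound[OF i]) (measurable, use b' in \<open>simp only: real_norm_def AE_I2\<close>)
 have "\<bar>hh c \<tau> g a\<bar> <= (LBINT x. \<bar>if x $ k < c then kap c \<tau> a x * g x else 0\<bar>)"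
  unfolding hh_def using integral_norm_bound[of lborel "%x. if x $ k < c then kap c \<tau> a x * g x else 0"] by simp
 also have "... <= (LBINT x. (2 * CK / sqrt \<tau> * G) * gd (2 * \<tau>) (x - a))"
  by (intro integral_mono i b integrable_abs i')
 also have "... = 2 * CK / sqrt \<tau> * G"
  using \<tau> by (simp add: integral_gd)
 finally show "\<bar>hh c \<tau> g a\<bar> <= 2 * CK / sqrt \<tau> * G" .
qed

lemma nn_integral_qq:
 assumes A: "0 <= A" and f: "good A f" and s: "0 < s"
 shows "(NN a. ennreal \<bar>qq f s c a\<bar>) <= ennreal (A * mass s)"
proof -
 note [measurable] = good_measurable[OF f]
 have "(NN a. ennreal \<bar>qq f s c a\<bar>) <= (NN a. \<integral>\<^sup>+b. ennreal \<bar>indicator {a $ k<..<c} b * f (s, b, a)\<bar> \<partial>lborel)"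
  unfolding qq_def using integral_norm_bound_ennreal[OF qq_integrable[OF A f s]]
  by (intro nn_integral_mono) simp
 also have "... <= (NN a. \<integral>\<^sup>+b. ennreal (if a $ k <= b then \<bar>f (s, b, a)\<bar> else 0) \<partial>lborel)"
  by (intro nn_integral_mono) (auto simp: indicator_def)
 also have "... = (\<integral>\<^sup>+z. ennreal (if snd z $ k <= fst z then \<bar>f (s, fst z, snd z)\<bar> else 0) \<partial>(lborel \<Otimes>\<^sub>M lborel))"
 proof -
  have "(%z. ennreal (if snd z $ k <= fst z then \<bar>f (s, fst z, snd z)\<bar> else 0)) \<in> borel_measurable (lborel \<Otimes>\<^sub>M lborel)"
   by measurable
  from lborel_pair.nn_integral_snd[OF this] show ?thesis by (simp only: fst_conv snd_conv)
 qed
 also have "... <= ennreal (A * mass s)"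
  using nn_integral_good[OF A f s] by (simp only: lborel_prod prod.collapse)
 finally show ?thesis .
qed

text \<open>The adjoint form of one step: the kernel passes from the density to the test function.
  The law of the process obeys the same recursion, in a form that makes sense before a density is
  known.\<close>

lemma Wt_stepP:
 assumes A: "0 <= A" and f: "good A f" and t: "0 < t" and [measurable]: "g \<in> borel_measurable borel"
  and g: "!!x. \<bar>g x\<bar> <= G"
 shows "Wt (stepP f) t c g = (LBINT s. ind t s * Wt f s c (hh c (t - s) g))"
proof -
 note [measurable] = good_measurable[OF f]
 have G: "0 <= G" using g[of 0] by linarith
 let ?P = "%z. 0 < fst z \<and> fst z < t \<and> snd z $ k < c"
 let ?F = "%x z. if x $ k < c \<and> ?P z then qq f (fst z) c (snd z) * kap c (t - fst z) (snd z) x * g x else 0"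
 have meas: "case_prod ?F \<in> borel_measurable (lborel \<Otimes>\<^sub>M lborel)" by measurable
 have meas2: "(%(z, x). ?F x z) \<in> borel_measurable (lborel \<Otimes>\<^sub>M lborel)" by measurable
 have inner: "(NN x. ennreal (norm (?F x (s, a)))) <= ennreal (ind t s * (2 * CK / sqrt (t - s)) * G) * ennreal \<bar>qq f s c a\<bar>" for s a
 proof (cases "?P (s, a)")
  case True
  have "(NN x. ennreal (norm (?F x (s, a))))
    <= (NN x. ennreal (2 * CK / sqrt (t - s) * G * \<bar>qq f s c a\<bar>) * ennreal (gd (2 * (t - s)) (x - a)))"
  proof (rule nn_integral_mono)
   fix x
   have "\<bar>qq f s c a\<bar> * (\<bar>kap c (t - s) a x\<bar> * \<bar>g x\<bar>) <= \<bar>qq f s c a\<bar> * ((2 * CK / sqrt (t - s) * gd (2 * (t - s)) (x - a)) * G)" if "x $ k < c"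
    using True that CK_nonneg by (intro mult_left_mono mult_mono kap_bound g) auto
   hence "norm (?F x (s, a)) <= 2 * CK / sqrt (t - s) * G * \<bar>qq f s c a\<bar> * gd (2 * (t - s)) (x - a)"
    using True CK_nonneg G by (auto simp: abs_mult mult_ac)
   thus "ennreal (norm (?F x (s, a))) <= ennreal (2 * CK / sqrt (t - s) * G * \<bar>qq f s c a\<bar>) * ennreal (gd (2 * (t - s)) (x - a))"
    using True by (subst ennreal_mult''[symmetric]) (auto intro!: ennreal_leI)
  qed
  also have "... = ennreal (2 * CK / sqrt (t - s) * G * \<bar>qq f s c a\<bar>)"
   using True by (simp add: nn_integral_cmult nn_integral_gd)
  also have "... = ennreal (ind t s * (2 * CK / sqrt (t - s)) * G) * ennreal \<bar>qq f s c a\<bar>"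
   using True by (subst ennreal_mult''[symmetric]) auto
  finally show ?thesis .
 qed (auto simp del: norm_mult)
 have "(\<integral>\<^sup>+w. ennreal (norm ((%(z, x). ?F x z) w)) \<partial>(lborel \<Otimes>\<^sub>M lborel)) = (NN z. \<integral>\<^sup>+x. ennreal (norm (?F x z)) \<partial>lborel)"
  by (subst lborel.nn_integral_fst[symmetric]) (use meas2 in \<open>auto simp del: norm_mult real_norm_def\<close>)
 also have "... <= (NN z. ennreal (indicator {0<..<t} (fst z) * (2 * CK / sqrt (t - fst z)) * G) * ennreal \<bar>qq f (fst z) c (snd z)\<bar>)"
  unfolding lborel_prod by (rule nn_integral_mono) (use inner[of "fst z" "snd z" for z] in \<open>simp only: prod.collapse\<close>)
 also have "... = (NN s. \<integral>\<^sup>+a. ennreal (ind t s * (2 * CK / sqrt (t - s)) * G) * ennreal \<bar>qq f s c a\<bar> \<partial>lborel)"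
  unfolding lborel_prod[symmetric] by (subst lborel.nn_integral_fst[symmetric]) (auto simp: indicator_def greaterThanLessThan_iff)
 also have "... <= (NN s. ennreal (A * sqrt (4 * pi) * G) * ennreal (ind t s * (4 * CK / sqrt (t - s) * exp (ll * s))))"
 proof (rule nn_integral_mono)
  fix s :: real
  show "(NN a. ennreal (ind t s * (2 * CK / sqrt (t - s)) * G) * ennreal \<bar>qq f s c a\<bar>)
    <= ennreal (A * sqrt (4 * pi) * G) * ennreal (ind t s * (4 * CK / sqrt (t - s) * exp (ll * s)))"
  proof (cases "0 < s \<and> s < t")
   case True
   have "(NN a. ennreal (ind t s * (2 * CK / sqrt (t - s)) * G) * ennreal \<bar>qq f s c a\<bar>)
     <= ennreal (2 * CK / sqrt (t - s) * G) * ennreal (A * mass s)"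
    using True by (subst nn_integral_cmult) (auto intro!: mult_left_mono nn_integral_qq[OF A f])
   also have "... = ennreal (2 * CK / sqrt (t - s) * G * (A * mass s))"
    using True A by (subst ennreal_mult''[symmetric]) (auto simp: mass_def)
   also have "... <= ennreal (A * sqrt (4 * pi) * G * (4 * CK / sqrt (t - s) * exp (ll * s)))"
   proof (rule ennreal_leI)
    have "2 * CK / sqrt (t - s) * (A * G * mass s) <= 4 * CK / sqrt (t - s) * (A * G * mass s)"
     using True A G CK_nonneg by (intro mult_right_mono divide_right_mono) (auto simp: mass_def)
    thus "2 * CK / sqrt (t - s) * G * (A * mass s) <= A * sqrt (4 * pi) * G * (4 * CK / sqrt (t - s) * exp (ll * s))"
     by (simp add: mass_def mult_ac)
   qed
   also have "... = ennreal (A * sqrt (4 * pi) * G) * ennreal (ind t s * (4 * CK / sqrt (t - s) * exp (ll * s)))"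
    using True A G CK_nonneg by (subst ennreal_mult''[symmetric]) auto
   finally show ?thesis .
  qed auto
 qed
 also have "... <= ennreal (A * sqrt (4 * pi) * G) * ennreal (exp (ll * t) / 2)"
  by (subst nn_integral_cmult) (auto simp del: times_divide_eq_left times_divide_eq_right intro!: mult_left_mono ll_contraction t)
 also have "... < \<infinity>" by (simp add: ennreal_mult_less_top)
 finally have int2: "integrable (lborel \<Otimes>\<^sub>M lborel) (%(z, x). ?F x z)"
  by (intro integrableI_bounded meas2)
 have int: "integrable (lborel \<Otimes>\<^sub>M lborel) (case_prod ?F)"
  using lborel_pair.integrable_product_swap_iff[of "%(z, x). ?F x z"] int2 by (simp add: case_prod_unfold cong: if_cong)
 have "Wt (stepP f) t c g = (LBINT x. qq (stepP f) t c x * g x)"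
  by (rule Wt_eq[OF _ good_stepP[OF A f] t _ g]) (use A in auto)
 also have "... = (LBINT x. (LBINT z. ?F x z))"
 proof (rule lint_cong)
  fix x
  show "qq (stepP f) t c x * g x = (LBINT z. ?F x z)"
  proof (cases "x $ k < c")
   case True
   have "qq (stepP f) t c x * g x = (LBINT z. (if ?P z then qq f (fst z) c (snd z) * kap c (t - fst z) (snd z) x else 0) * g x)"
    by (simp add: qq_stepP[OF A f t True])
   also have "... = (LBINT z. ?F x z)"
    using True by (intro lint_cong) auto
   finally show ?thesis .
  qed (simp add: qq_def)
 qed simp
 also have "... = (LBINT z. (LBINT x. ?F x z))"
  by (rule lborel_pair.Fubini_integral[OF int, symmetric])
 also have "... = (\<integral>z. (%(s, a). ind t s * (qq f s c a * hh c (t - s) g a)) z \<partial>(lborel \<Otimes>\<^sub>M lborel))"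
  unfolding lborel_prod
 proof (rule lint_cong)
  fix z :: "real \<times> (real ^ 'd)"
  show "(LBINT x. ?F x z) = (case z of (s, a) => ind t s * (qq f s c a * hh c (t - s) g a))"
  proof (cases "?P z")
   case True
   have "(LBINT x. ?F x z) = (LBINT x. qq f (fst z) c (snd z) * (if x $ k < c then kap c (t - fst z) (snd z) x * g x else 0))"
    using True by (intro lint_cong) auto
   also have "... = qq f (fst z) c (snd z) * hh c (t - fst z) g (snd z)" by (simp add: hh_def)
   finally show ?thesis using True by (simp add: case_prod_unfold)
  next
   case False
   hence "qq f (fst z) c (snd z) = 0 \<or> \<not> (0 < fst z \<and> fst z < t)" by (auto simp: qq_def)
   thus ?thesis using False by (auto simp: case_prod_unfold)
  qed
 qed simp
 also have "... = (LBINT s. (LBINT a. ind t s * (qq f s c a * hh c (t - s) g a)))"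
 proof (subst lborel_pair.integral_fst'[symmetric])
  have "integrable lborel (%z. (LBINT x. ?F x z))"
   using lborel_pair.integrable_fst'[OF int2] by simp
  also have "(%z. (LBINT x. ?F x z)) = (%(s, a). ind t s * (qq f s c a * hh c (t - s) g a))"
  proof
   fix z :: "real \<times> (real ^ 'd)"
   show "(LBINT x. ?F x z) = (case z of (s, a) => ind t s * (qq f s c a * hh c (t - s) g a))"
   proof (cases "?P z")
    case True
    have "(LBINT x. ?F x z) = (LBINT x. qq f (fst z) c (snd z) * (if x $ k < c then kap c (t - fst z) (snd z) x * g x else 0))"
     using True by (intro lint_cong) auto
    also have "... = qq f (fst z) c (snd z) * hh c (t - fst z) g (snd z)" by (simp add: hh_def)
    finally show ?thesis using True by (simp add: case_prod_unfold)
   next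
    case False
    hence "qq f (fst z) c (snd z) = 0 \<or> \<not> (0 < fst z \<and> fst z < t)" by (auto simp: qq_def)
    thus ?thesis using False by (auto simp: case_prod_unfold)
   qed
  qed
  finally show "integrable (lborel \<Otimes>\<^sub>M lborel) (%(s, a). ind t s * (qq f s c a * hh c (t - s) g a))"
   by (simp only: lborel_prod)
 qed simp
 also have "... = (LBINT s. ind t s * Wt f s c (hh c (t - s) g))"
 proof (rule lint_cong)
  fix s :: real
  show "(LBINT a. ind t s * (qq f s c a * hh c (t - s) g a)) = ind t s * Wt f s c (hh c (t - s) g)"
  proof (cases "0 < s \<and> s < t")
   case True
   \<comment> \<open>\<open>hh_bound\<close> speaks only of points up to the level, and these are
     all that \<open>Wt\<close> sees.\<close>
   let ?h = "%a. if a $ k <= c then hh c (t - s) g a else 0"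
   have "Wt f s c (hh c (t - s) g) = Wt f s c ?h"
    unfolding Wt_def by (intro lint_cong) auto
   also have "... = (LBINT a. qq f s c a * ?h a)"
   proof (rule Wt_eq[OF A f])
    show "\<bar>?h a\<bar> <= 2 * CK / sqrt (t - s) * G" for a
     using True hh_bound(2)[of "t - s" a c g G] g CK_nonneg G by auto
   qed (use True in auto)
   also have "... = (LBINT a. qq f s c a * hh c (t - s) g a)"
    by (intro lint_cong) (auto simp: qq_def)
   finally show ?thesis using True by simp
  qed auto
 qed simp
 finally show ?thesis .
qed

end

section \<open>The parametrix series\<close>

context parametrix begin

text \<open>For Brownian motion started at \<open>z\<close>, \<open>p0I\<close> is the joint density of the running maximum and the position.\<close>
definition p0I :: "real => real => real ^ 'd => real ^ 'd => real" where
 "p0I t m x z = 2 * (mirror k m x - z) $ k / t * gd t (mirror k m x - z)"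

definition p0 :: "real \<times> real \<times> (real ^ 'd) => real" where
 "p0 v = (\<integral>z. indicator {..fst (snd v)} (z $ k) * p0I (fst v) (fst (snd v)) (snd (snd v)) z \<partial>\<mu>0)"

lemma p0I_measurable [measurable (raw)]:
 assumes [measurable]: "c \<in> borel_measurable M" "f \<in> borel_measurable M" "g \<in> borel_measurable M" "h \<in> borel_measurable M"
 shows "(%x. p0I (c x) (f x) (g x) (h x)) \<in> borel_measurable M"
 unfolding p0I_def by measurable

lemma p0_measurable [measurable]: "p0 \<in> borel_measurable borel"
 unfolding p0_def indicator_def atMost_iff by measurable

lemma p0I_bound_ex: "\<exists>C\<ge>0. \<forall>t>0. \<forall>m x z. \<bar>p0I t m x z\<bar> <= C / sqrt t * gd (2 * t) (mirror k m x - z)"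
proof -
 obtain C1 where C1: "0 <= C1" "!!t (x :: real ^ 'd). 0 < t ==> norm x ^ 1 * gd t x <= C1 * sqrt t ^ 1 * gd (2 * t) x"
  using gd_poly by blast
 show ?thesis
 proof (intro exI[of _ "2 * C1"] conjI allI impI)
  fix t m :: real and x z :: "real ^ 'd" assume t: "0 < t"
  let ?w = "mirror k m x - z"
  have "\<bar>p0I t m x z\<bar> = 2 / t * (\<bar>?w $ k\<bar> * gd t ?w)"
   unfolding p0I_def abs_mult abs_divide using t by simp
  also have "... <= 2 / t * (norm ?w ^ 1 * gd t ?w)"
   using t component_le_norm_cart[of ?w k] by (intro mult_left_mono mult_right_mono) auto
  also have "... <= 2 / t * (C1 * sqrt t ^ 1 * gd (2 * t) ?w)"
   using t by (intro mult_left_mono C1) auto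
  also have "... = 2 * C1 / sqrt t * gd (2 * t) ?w"
   using t by (simp add: field_simps)
  finally show "\<bar>p0I t m x z\<bar> <= 2 * C1 / sqrt t * gd (2 * t) ?w" .
 qed (use C1 in auto)
qed

definition A0 :: real where
 "A0 = (SOME C. 0 <= C \<and> (\<forall>t>0. \<forall>m x z. \<bar>p0I t m x z\<bar> <= C / sqrt t * gd (2 * t) (mirror k m x - z)))"

lemma A0_nonneg: "0 <= A0"
 and p0I_bound: "0 < t ==> \<bar>p0I t m x z\<bar> <= A0 / sqrt t * gd (2 * t) (mirror k m x - z)"
 using someI_ex[OF p0I_bound_ex] unfolding A0_def[symmetric] by blast+

lemma p0I_bound': "0 < t ==> \<bar>p0I t m x z\<bar> <= A0 / sqrt t * (1 / sqrt (2 * pi * (2 * t))) ^ CARD('d)"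
proof -
 assume t: "0 < t"
 note p0I_bound[OF t, of m x z]
 also have "A0 / sqrt t * gd (2 * t) (mirror k m x - z) <= A0 / sqrt t * (1 / sqrt (2 * pi * (2 * t))) ^ CARD('d)"
  using A0_nonneg t by (intro mult_left_mono gd_le_peak_vec) auto
 finally show ?thesis .
qed

lemma good_p0: "good A0 p0"
 unfolding good_def
proof (intro conjI allI impI)
 fix t m :: real and x :: "real ^ 'd"
 assume t: "0 < t" and x: "x $ k <= m"
 let ?f = "%z. indicator {..m} (z $ k) * p0I t m x z"
 have b: "\<bar>?f z\<bar> <= A0 / sqrt t * (indicator {..m} (z $ k) * gd (2 * t) (mirror k m x - z))" for z
  using p0I_bound[OF t, of m x z] by (auto simp: indicator_def)
 have i: "integrable \<mu>0 (%z. A0 / sqrt t * (indicator {..m} (z $ k) * gd (2 * t) (mirror k m x - z)))"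
  by (intro integrable_mult_right Hc_integrable t)
 have fi: "integrable \<mu>0 ?f"
 proof (rule lint_bound[OF i])
  show "?f \<in> borel_measurable \<mu>0" unfolding indicator_def atMost_iff by measurable
  show "AE z in \<mu>0. norm (?f z) <= norm (A0 / sqrt t * (indicator {..m} (z $ k) * gd (2 * t) (mirror k m x - z)))"
   by (rule AE_I2) (simp only: real_norm_def, rule order_trans[OF b abs_ge_self])
 qed
 have "\<bar>p0 (t, m, x)\<bar> <= (\<integral>z. \<bar>?f z\<bar> \<partial>\<mu>0)"
  unfolding p0_def using integral_norm_bound[of \<mu>0 ?f] by simp
 also have "... <= (\<integral>z. A0 / sqrt t * (indicator {..m} (z $ k) * gd (2 * t) (mirror k m x - z)) \<partial>\<mu>0)"
  by (intro integral_mono integrable_abs fi i b)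
 also have "... = A0 / sqrt t * Hp t m x" by (simp add: Hp_def Hc_def)
 also have "... <= A0 * (exp (ll * t) / sqrt t) * Hp t m x"
 proof (intro mult_right_mono Hp_nonneg t)
  have "1 <= exp (ll * t)" using ll_pos t by simp
  hence "A0 * (1 / sqrt t) <= A0 * (exp (ll * t) / sqrt t)"
   using A0_nonneg t by (intro mult_left_mono divide_right_mono) auto
  thus "A0 / sqrt t <= A0 * (exp (ll * t) / sqrt t)" by simp
 qed
 finally show "\<bar>p0 (t, m, x)\<bar> <= A0 * (exp (ll * t) / sqrt t) * Hp t m x" .
next
 fix t :: real and mj xj and m :: real and x :: "real ^ 'd"
 assume t: "0 < t" and m: "\<forall>j. m <= mj j" "mj ----> m" and x: "xj ----> x"
 have "(%j. \<integral>z. indicator {..mj j} (z $ k) * p0I t (mj j) (xj j) z \<partial>\<mu>0) ----> (\<integral>z. indicator {..m} (z $ k) * p0I t m x z \<partial>\<mu>0)"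
 proof (rule integral_dominated_convergence[where w="%_. A0 / sqrt t * (1 / sqrt (2 * pi * (2 * t))) ^ CARD('d)"])
  show "(%z. indicator {..m} (z $ k) * p0I t m x z) \<in> borel_measurable \<mu>0"
   unfolding indicator_def atMost_iff by measurable
  show "(%z. indicator {..mj j} (z $ k) * p0I t (mj j) (xj j) z) \<in> borel_measurable \<mu>0" for j
   unfolding indicator_def atMost_iff by measurable
  show "AE z in \<mu>0. (%j. indicator {..mj j} (z $ k) * p0I t (mj j) (xj j) z) ----> indicator {..m} (z $ k) * p0I t m x z"
  proof (intro AE_I2 tendsto_mult)
   fix z :: "real ^ 'd"
   have "eventually (%j. indicator {..mj j} (z $ k) = (indicator {..m} (z $ k) :: real)) sequentially"
   proof (cases "z $ k <= m")
    case True
    thus ?thesis using m(1) by (intro always_eventually) (auto simp: indicator_def intro: order_trans)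
   next
    case False
    hence "eventually (%j. mj j < z $ k) sequentially" using m(2) by (intro order_tendstoD) auto
    thus ?thesis by eventually_elim (use False in \<open>auto simp: indicator_def\<close>)
   qed
   thus "(%j. indicator {..mj j} (z $ k) :: real) ----> indicator {..m} (z $ k)"
    by (rule tendsto_eventually)
   have mir: "(%j. mirror k (mj j) (xj j)) ----> mirror k m x"
    by (intro tendsto_mirror m x)
   show "(%j. p0I t (mj j) (xj j) z) ----> p0I t m x z"
    unfolding p0I_def using t by (intro tendsto_intros continuous_gd mir) auto
  qed
  show "AE z in \<mu>0. norm (indicator {..mj j} (z $ k) * p0I t (mj j) (xj j) z) <= A0 / sqrt t * (1 / sqrt (2 * pi * (2 * t))) ^ CARD('d)" for j
  proof (intro AE_I2)
   fix z
   have "norm (indicator {..mj j} (z $ k) * p0I t (mj j) (xj j) z) <= \<bar>p0I t (mj j) (xj j) z\<bar>"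
    by (simp add: indicator_def)
   also note p0I_bound'[OF t]
   finally show "norm (indicator {..mj j} (z $ k) * p0I t (mj j) (xj j) z) <= A0 / sqrt t * (1 / sqrt (2 * pi * (2 * t))) ^ CARD('d)" .
  qed
 qed simp
 thus "(%j. p0 (t, mj j, xj j)) ----> p0 (t, m, x)" by (simp add: p0_def)
qed (rule p0_measurable)

text \<open>By reflection, driftless paths from \<open>z\<close> whose maximum is below
  \<open>m\<close> have position density \<open>gd t (x - z) - gd t (mirror k m x - z)\<close>, and
  only the second term depends on the level.\<close>

lemma gd_mirror_derivative:
 assumes "0 < t"
 shows "((%m. - gd t (mirror k m x - z)) has_real_derivative p0I t m x z) (at m)"
proof -
 have 3: "w \<bullet> (2 *\<^sub>R axis k 1) = 2 * w $ k" for w :: "real ^ 'd" by (simp add: inner_axis)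
 show ?thesis
  using DERIV_minus[OF gd_along_line_derivative[OF assms, of "x - (2 * x $ k) *\<^sub>R axis k 1 - z" "2 *\<^sub>R axis k 1" m]]
  unfolding 3 mirror_line[symmetric] p0I_def by simp
qed

lemma p0I_continuous:
 assumes "0 < t" shows "continuous_on UNIV (%m. p0I t m x z)"
 unfolding p0I_def gd_def mirror_def using assms by (intro continuous_intros) auto

lemma qq_p0:
 assumes t: "0 < t" and x: "x $ k < c"
 shows "qq p0 t c x = (\<integral>z. indicator {..<c} (z $ k) * (gd t (x - z) - gd t (mirror k c x - z)) \<partial>\<mu>0)"
proof -
 interpret P: pair_sigma_finite lborel \<mu>0 ..
 let ?F = "%b z. indicator {x $ k<..<c} b * (indicator {..b} (z $ k) * p0I t b x z)"
 define K where "K = A0 / sqrt t * (1 / sqrt (2 * pi * (2 * t))) ^ CARD('d)"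
 have K: "0 <= K" using A0_nonneg t by (simp add: K_def)
 have meas: "case_prod ?F \<in> borel_measurable (lborel \<Otimes>\<^sub>M \<mu>0)"
  unfolding indicator_def greaterThanLessThan_iff atMost_iff by measurable
 have "integrable (lborel \<Otimes>\<^sub>M \<mu>0) (%w. K * indicator ({x $ k<..<c} \<times> UNIV) w :: real)"
  using x init.emeasure_space_1 by (intro integrable_mult_right integrable_real_indicator)
   (auto simp: init.emeasure_pair_measure_Times)
 hence int: "integrable (lborel \<Otimes>\<^sub>M \<mu>0) (case_prod ?F)"
 proof (rule lint_bound[OF _ meas])
  show "AE w in lborel \<Otimes>\<^sub>M \<mu>0. norm (case_prod ?F w) <= norm (K * indicator ({x $ k<..<c} \<times> UNIV) w :: real)"
   using p0I_bound'[OF t, folded K_def] K by (intro AE_I2) (auto simp: indicator_def)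
 qed
 have "qq p0 t c x = (LBINT b. (\<integral>z. ?F b z \<partial>\<mu>0))"
  unfolding qq_def p0_def by simp
 also have "... = (\<integral>z. (LBINT b. ?F b z) \<partial>\<mu>0)"
  by (rule P.Fubini_integral[OF int, symmetric])
 also have "... = (\<integral>z. indicator {..<c} (z $ k) * (gd t (x - z) - gd t (mirror k c x - z)) \<partial>\<mu>0)"
 proof (rule lint_cong)
  fix z :: "real ^ 'd"
  let ?m = "max (x $ k) (z $ k)"
  show "(LBINT b. ?F b z) = indicator {..<c} (z $ k) * (gd t (x - z) - gd t (mirror k c x - z))"
  proof (cases "z $ k < c")
   case True
   have "(LBINT b. ?F b z) = (LBINT b. indicator {?m<..<c} b * p0I t b x z)"
    using AE_lborel_singleton[of "z $ k"]
    by (intro integral_cong_AE) (auto elim!: eventually_mono simp: indicator_def)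
   also have "... = - gd t (mirror k c x - z) - (- gd t (mirror k ?m x - z))"
    using True x t by (intro integral_indicator_FTC gd_mirror_derivative p0I_continuous) auto
   \<comment> \<open>At the lower end of the interval one of the two points lies on the hyperplane,
     so the reflected and the direct kernel agree.\<close>
   also have "gd t (mirror k ?m x - z) = gd t (x - z)"
   proof (cases "z $ k <= x $ k")
    case True
    hence "?m = x $ k" by simp
    thus ?thesis by (simp add: mirror_hyperplane)
   next
    case False
    hence m: "?m = z $ k" by simp
    show ?thesis unfolding m
     by (rule gd_cong_norm) (simp add: norm_mirror_swap mirror_hyperplane)
   qed
   finally show ?thesis using True by simp
  next
   case False
   have F0: "?F b z = 0" for b using False by (auto simp: indicator_def)
   show ?thesis unfolding F0 using False by simp
  qed
 qed simp
 finally show ?thesis .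
qed

text \<open>The heat flow of \<open>g\<close> on the half space below \<open>c\<close>, absorbed at
  the boundary.\<close>

definition uu :: "real => real => (real ^ 'd => real) => real ^ 'd => real" where
 "uu c t g z = (LBINT x. (if x $ k < c then (gd t (x - z) - gd t (mirror k c x - z)) * g x else 0))"

text \<open>The zeroth term pairs to the initial law integrated against the absorbed heat flow,
  which is the driftless part of the Duhamel formula.\<close>

lemma Wt_p0:
 assumes t: "0 < t" and [measurable]: "g \<in> borel_measurable borel" and g: "!!x. \<bar>g x\<bar> <= G"
 shows "Wt p0 t c g = (\<integral>z. indicator {..<c} (z $ k) * uu c t g z \<partial>\<mu>0)"
proof -
 interpret P: pair_sigma_finite lborel \<mu>0 ..
 have G: "0 <= G" using g[of 0] by linarith
 let ?F = "%x z. if x $ k < c \<and> z $ k < c then (gd t (x - z) - gd t (mirror k c x - z)) * g x else 0"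
 have meas: "case_prod ?F \<in> borel_measurable (lborel \<Otimes>\<^sub>M \<mu>0)" by measurable
 have b: "norm (?F x z) <= G * gd t (x - z) + G * gd t (mirror k c x - z)" for x z
 proof -
  have "\<bar>gd t (x - z) - gd t (mirror k c x - z)\<bar> * \<bar>g x\<bar> <= (gd t (x - z) + gd t (mirror k c x - z)) * G"
   using t g by (intro mult_mono) (auto intro: order_trans[OF abs_triangle_ineq4])
  also have "... = G * gd t (x - z) + G * gd t (mirror k c x - z)" by (simp add: distrib_left mult.commute)
  finally have "norm ((gd t (x - z) - gd t (mirror k c x - z)) * g x) <= G * gd t (x - z) + G * gd t (mirror k c x - z)"
   by (simp only: real_norm_def abs_mult)
  thus ?thesis using t G by (auto simp del: norm_mult real_norm_def)
 qed
 have mi: "(NN x. ennreal (gd t (mirror k c x - z))) = 1" for z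
  using nn_integral_mirror[of "%x. ennreal (gd t (x - z))" k c] t by (simp add: nn_integral_gd)
 have "(\<integral>\<^sup>+w. ennreal (norm (case_prod ?F w)) \<partial>(lborel \<Otimes>\<^sub>M \<mu>0)) = (\<integral>\<^sup>+z. \<integral>\<^sup>+x. ennreal (norm (?F x z)) \<partial>lborel \<partial>\<mu>0)"
  by (subst P.nn_integral_snd[symmetric]) (use meas in \<open>auto simp del: norm_mult real_norm_def cong: if_cong\<close>)
 also have "... <= (\<integral>\<^sup>+z. \<integral>\<^sup>+x. ennreal G * ennreal (gd t (x - z)) + ennreal G * ennreal (gd t (mirror k c x - z)) \<partial>lborel \<partial>\<mu>0)"
  using b G t by (intro nn_integral_mono)
   (simp add: ennreal_mult'[symmetric] ennreal_plus[symmetric] ennreal_leI del: ennreal_plus norm_mult real_norm_def)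
 also have "... = (\<integral>\<^sup>+z. ennreal G + ennreal G \<partial>\<mu>0)"
  using t by (intro nn_integral_cong) (simp add: nn_integral_add nn_integral_cmult nn_integral_gd mi)
 also have "... < \<infinity>" using init.emeasure_space_1 by (simp add: ennreal_mult_less_top)
 finally have int: "integrable (lborel \<Otimes>\<^sub>M \<mu>0) (case_prod ?F)"
  by (intro integrableI_bounded meas)
 have "Wt p0 t c g = (LBINT x. qq p0 t c x * g x)"
  by (rule Wt_eq[OF A0_nonneg good_p0 t _ g]) simp
 also have "... = (LBINT x. (\<integral>z. ?F x z \<partial>\<mu>0))"
 proof (rule lint_cong)
  fix x
  show "qq p0 t c x * g x = (\<integral>z. ?F x z \<partial>\<mu>0)"
  proof (cases "x $ k < c")
   case True
   have "qq p0 t c x * g x = (\<integral>z. indicator {..<c} (z $ k) * (gd t (x - z) - gd t (mirror k c x - z)) * g x \<partial>\<mu>0)"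
    by (simp add: qq_p0[OF t True])
   also have "... = (\<integral>z. ?F x z \<partial>\<mu>0)"
    using True by (intro lint_cong) auto
   finally show ?thesis .
  qed (simp add: qq_def)
 qed simp
 also have "... = (\<integral>z. (LBINT x. ?F x z) \<partial>\<mu>0)"
  by (rule P.Fubini_integral[OF int, symmetric])
 also have "... = (\<integral>z. indicator {..<c} (z $ k) * uu c t g z \<partial>\<mu>0)"
 proof (rule lint_cong)
  fix z :: "real ^ 'd"
  show "(LBINT x. ?F x z) = indicator {..<c} (z $ k) * uu c t g z"
   by (cases "z $ k < c") (simp_all add: uu_def)
 qed simp
 finally show ?thesis .
qed

section \<open>Summation of the series\<close>

definition pn :: "nat => real \<times> real \<times> (real ^ 'd) => real" where
 "pn n = (stepP ^^ n) p0"

lemma good_pn: "good (A0 / 2 ^ n) (pn n)"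
proof (induction n)
 case (Suc n)
 have "good (A0 / 2 ^ n / 2) (stepP (pn n))"
  using A0_nonneg by (intro good_stepP Suc.IH) auto
 thus ?case by (simp add: pn_def mult.commute)
qed (simp add: pn_def good_p0)

definition ps :: "real \<times> real \<times> (real ^ 'd) => real" where
 "ps v = (\<Sum>n. pn n v)"

lemma pn_bound: "0 < t ==> x $ k <= m ==> \<bar>pn n (t, m, x)\<bar> <= (A0 * (exp (ll * t) / sqrt t) * Hp t m x) * (1 / 2) ^ n"
 using good_bound[OF good_pn, of t x m n] by (simp add: power_divide mult_ac)

lemma pn_sums: assumes "0 < t" "x $ k <= m"
 shows "summable (%n. \<bar>pn n (t, m, x)\<bar>)" "(\<Sum>n. \<bar>pn n (t, m, x)\<bar>) <= 2 * A0 * (exp (ll * t) / sqrt t) * Hp t m x"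
proof -
 let ?K = "A0 * (exp (ll * t) / sqrt t) * Hp t m x"
 have s: "(%n. ?K * (1 / 2) ^ n) sums (?K * 2)"
  using geometric_sums[of "1/2 :: real"] by (intro sums_mult) simp
 show "summable (%n. \<bar>pn n (t, m, x)\<bar>)"
  by (rule summable_comparison_test'[OF sums_summable[OF s], where N=0]) (use pn_bound[OF assms] in auto)
 hence "(\<Sum>n. \<bar>pn n (t, m, x)\<bar>) <= ?K * 2"
  unfolding sums_unique[OF s] using pn_bound[OF assms] by (intro suminf_le sums_summable[OF s])
 thus "(\<Sum>n. \<bar>pn n (t, m, x)\<bar>) <= 2 * A0 * (exp (ll * t) / sqrt t) * Hp t m x"
  by (simp add: mult_ac)
qed

lemma Hp_le_peak: "0 < t ==> x $ k <= m ==> Hp t m x <= (1 / sqrt (2 * pi * (2 * t))) ^ CARD('d)"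
 using Hp_le_Hc[of t x m m] Hc_le_Hm[of t m x] Hm_le_peak[of t x] by linarith

text \<open>At a fixed time \<open>Hp\<close> never exceeds the peak of the kernel, so the geometric
  bounds are uniform along a convergent sequence and the limit passes through the sum.\<close>

lemma good_ps: "good (2 * A0) ps"
 unfolding good_def
proof (intro conjI allI impI)
 have [measurable]: "pn n \<in> borel_measurable borel" for n by (rule good_measurable[OF good_pn])
 show "ps \<in> borel_measurable borel" unfolding ps_def by measurable
 fix t m :: real and x :: "real ^ 'd"
 assume t: "0 < t"
 { assume x: "x $ k <= m"
  have "\<bar>ps (t, m, x)\<bar> <= (\<Sum>n. \<bar>pn n (t, m, x)\<bar>)"
   unfolding ps_def by (intro summable_rabs pn_sums t x)
  also note pn_sums(2)[OF t x]
  finally show "\<bar>ps (t, m, x)\<bar> <= 2 * A0 * (exp (ll * t) / sqrt t) * Hp t m x" . }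
 fix mj xj
 assume m: "\<forall>j. m <= mj j" "mj ----> m" and x: "xj ----> x" "\<forall>j. xj j $ k <= mj j"
 define K where "K = A0 * (exp (ll * t) / sqrt t) * (1 / sqrt (2 * pi * (2 * t))) ^ CARD('d)"
 have "eventually (%j. summable (%n. norm (pn n (t, mj j, xj j)))) sequentially \<and>
   summable (%n. norm (pn n (t, m, x))) \<and> (%j. \<Sum>n. pn n (t, mj j, xj j)) ----> (\<Sum>n. pn n (t, m, x))"
 proof (rule tannerys_theorem)
  show "(%j. pn n (t, mj j, xj j)) ----> pn n (t, m, x)" for n
   using m x by (intro good_tendsto[OF good_pn t]) auto
  have "norm (pn n (t, mj j, xj j)) <= K * (1/2) ^ n" for n j
  proof -
   have "norm (pn n (t, mj j, xj j)) <= (A0 * (exp (ll * t) / sqrt t) * Hp t (mj j) (xj j)) * (1/2) ^ n"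
    using pn_bound[OF t] x(2) by simp
   also have "... <= K * (1/2) ^ n"
    unfolding K_def using t x(2) A0_nonneg by (intro mult_right_mono mult_left_mono Hp_le_peak) auto
   finally show ?thesis .
  qed
  thus "eventually (%(n, j). norm (pn n (t, mj j, xj j)) <= K * (1/2) ^ n) (at_top \<times>\<^sub>F sequentially)"
   by (intro always_eventually) auto
  show "summable (%n. K * (1/2) ^ n)" by (intro summable_mult summable_geometric) auto
 qed simp
 thus "(%j. ps (t, mj j, xj j)) ----> ps (t, m, x)" by (simp add: ps_def)
qed

lemma Wt_ps:
 assumes t: "0 < t" and [measurable]: "g \<in> borel_measurable borel" and g: "!!x. \<bar>g x\<bar> <= G"
 shows "(%N. \<Sum>n<N. Wt (pn n) t c g) ----> Wt ps t c g"
proof -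
 have G: "0 <= G" using g[of 0] by linarith
 have [measurable]: "pn n \<in> borel_measurable borel" for n by (rule good_measurable[OF good_pn])
 have [measurable]: "ps \<in> borel_measurable borel" by (rule good_measurable[OF good_ps])
 let ?i = "%f z. if snd z $ k < fst z \<and> fst z < c then f (t, z) * g (snd z) else 0"
 let ?w = "%z. (2 * A0 * (exp (ll * t) / sqrt t) * G) * (if snd z $ k <= fst z then Hp t (fst z) (snd z) else 0)"
 have "(%N. \<integral>z. ?i (%v. \<Sum>n<N. pn n v) z \<partial>lborel) ----> (LBINT z. ?i ps z)"
 proof (rule integral_dominated_convergence[where w="?w"])
  show "integrable lborel ?w" by (intro integrable_mult_right wedge_integrable t)
  show "AE z in lborel. (%N. ?i (%v. \<Sum>n<N. pn n v) z) ----> ?i ps z"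
  proof (rule AE_I2)
   fix z :: "real \<times> (real ^ 'd)"
   show "(%N. ?i (%v. \<Sum>n<N. pn n v) z) ----> ?i ps z"
   proof (cases "snd z $ k < fst z \<and> fst z < c")
    case True
    have "summable (%n. \<bar>pn n (t, fst z, snd z)\<bar>)"
     using True by (intro pn_sums t) auto
    hence "summable (%n. pn n (t, fst z, snd z))"
     by (rule summable_rabs_cancel)
    hence "summable (%n. pn n (t, z))" by simp
    hence "(%N. \<Sum>n<N. pn n (t, z)) ----> ps (t, z)"
     unfolding ps_def by (rule summable_LIMSEQ)
    thus ?thesis using True by (auto intro: tendsto_intros)
   qed auto
  qed
  show "AE z in lborel. norm (?i (%v. \<Sum>n<N. pn n v) z) <= ?w z" for N
  proof (rule AE_I2)
   fix z :: "real \<times> (real ^ 'd)"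
   show "norm (?i (%v. \<Sum>n<N. pn n v) z) <= ?w z"
   proof (cases "snd z $ k < fst z \<and> fst z < c")
    case True
    have z: "snd z $ k <= fst z" using True by simp
    have "\<bar>\<Sum>n<N. pn n (t, z)\<bar> <= (\<Sum>n<N. \<bar>pn n (t, fst z, snd z)\<bar>)" by simp
    also have "... <= (\<Sum>n. \<bar>pn n (t, fst z, snd z)\<bar>)"
     by (rule sum_le_suminf) (use pn_sums(1)[OF t z] in auto)
    also note pn_sums(2)[OF t z]
    finally have "\<bar>\<Sum>n<N. pn n (t, z)\<bar> * \<bar>g (snd z)\<bar> <= (2 * A0 * (exp (ll * t) / sqrt t) * Hp t (fst z) (snd z)) * G"
     using t A0_nonneg by (intro mult_mono g) (auto intro!: nonneg_intros)
    thus ?thesis using True by (simp add: abs_mult mult_ac)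
   qed (use t G A0_nonneg in \<open>auto intro!: nonneg_intros\<close>)
  qed
 qed measurable
 moreover have "(LBINT z. ?i (%v. \<Sum>n<N. pn n v) z) = (\<Sum>n<N. Wt (pn n) t c g)" for N
 proof -
  have "(LBINT z. ?i (%v. \<Sum>n<N. pn n v) z) = (LBINT z. (\<Sum>n<N. ?i (pn n) z))"
   by (intro lint_cong) (auto simp: sum_distrib_right)
  also have "... = (\<Sum>n<N. \<integral>z. ?i (pn n) z \<partial>lborel)"
   using A0_nonneg by (intro Bochner_Integration.integral_sum Wt_integrable[OF _ good_pn t _ g]) auto
  finally show ?thesis by (simp add: Wt_def)
 qed
 ultimately show ?thesis by (simp add: Wt_def)
qed

lemma ps_below_diag:
 assumes "0 < t" "0 <= u"
 shows "\<bar>ps (t, below_diag k y u)\<bar> <= 2 * A0 * (exp (ll * t) / sqrt t) * (exp (- u\<^sup>2 / (4 * t)) * Hm t y)"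
proof -
 have "\<bar>ps (t, below_diag k y u)\<bar> <= 2 * A0 * (exp (ll * t) / sqrt t) * Hp t (y $ k) (y - u *\<^sub>R axis k 1)"
  unfolding below_diag_def using assms by (intro good_bound[OF good_ps]) (auto simp: axis_def)
 also have "... <= 2 * A0 * (exp (ll * t) / sqrt t) * (exp (- u\<^sup>2 / (4 * t)) * Hm t y)"
  using assms A0_nonneg by (intro mult_left_mono Hp_below_diag) auto
 finally show ?thesis .
qed

end

section \<open>The heat semigroup\<close>

definition heat :: "('a::euclidean_space => real) => real => 'a => real" where
 "heat G t a = (LBINT z. gd t (z - a) * G z)"

text \<open>The derivative of \<open>heat G t\<close> at \<open>a\<close> in direction
  \<open>v\<close>, put on the kernel so that \<open>G\<close> may be discontinuous; the odd
  extensions below jump at a hyperplane.\<close>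

definition dheat :: "('a::euclidean_space => real) => real => 'a => 'a => real" where
 "dheat G t a v = (LBINT z. ((z - a) \<bullet> v / t) * gd t (z - a) * G z)"

lemma heat_measurable [measurable (raw)]:
 assumes [measurable]: "G \<in> borel_measurable borel" "f \<in> borel_measurable M" "g \<in> borel_measurable M"
 shows "(%x. heat G (f x) (g x)) \<in> borel_measurable M"
 unfolding heat_def by measurable

lemma dheat_measurable [measurable (raw)]:
 assumes [measurable]: "G \<in> borel_measurable borel" "f \<in> borel_measurable M" "g \<in> borel_measurable M" "h \<in> borel_measurable M"
 shows "(%x. dheat G (f x) (g x) (h x)) \<in> borel_measurable M"
 unfolding dheat_def by measurable

locale bounded_borel_fun =
 fixes G :: "'a::euclidean_space => real" and C :: real
 assumes G_measurable [measurable]: "G \<in> borel_measurable borel" and G_bound: "!!z. \<bar>G z\<bar> <= C"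
begin

lemma C_nonneg: "0 <= C" using G_bound[of 0] by linarith

lemma heat_integrable: "0 < t ==> integrable lborel (%z. gd t (z - a) * G z)"
proof (rule lint_bound)
 assume "0 < t"
 thus "integrable lborel (%z. C * gd t (z - a))" by (intro integrable_mult_right integrable_gd)
 show "AE z in lborel. norm (gd t (z - a) * G z) <= norm (C * gd t (z - a))"
  using \<open>0 < t\<close> G_bound C_nonneg by (auto simp: abs_mult mult.commute intro!: mult_right_mono)
qed measurable

lemma heat_bound: assumes "0 < t" shows "\<bar>heat G t a\<bar> <= C"
proof -
 have "\<bar>heat G t a\<bar> <= (LBINT z. \<bar>gd t (z - a) * G z\<bar>)"
  unfolding heat_def using integral_norm_bound[of lborel "%z. gd t (z - a) * G z"] by simp
 also have "... <= (LBINT z. C * gd t (z - a))"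
  using assms G_bound by (intro integral_mono integrable_abs heat_integrable integrable_mult_right integrable_gd)
   (auto simp: abs_mult mult.commute intro!: mult_right_mono)
 also have "... = C" using assms by (simp add: integral_gd)
 finally show ?thesis .
qed

lemma heat_tendsto:
 assumes "t ----> t0" "a ----> a0" "!!n. 0 < t n" "0 < t0"
 shows "(%n. heat G (t n) (a n)) ----> heat G t0 a0"
 unfolding heat_def
proof (rule integral_dominated_convergence_varying[where D="%n z. C * gd (t n) (z - a n)" and E="%z. C * gd t0 (z - a0)"])
 show "AE z in lborel. (%n. gd (t n) (z - a n) * G z) ----> gd t0 (z - a0) * G z"
  using assms by (intro AE_I2 tendsto_intros continuous_gd) auto
 show "AE z in lborel. (%n. C * gd (t n) (z - a n)) ----> C * gd t0 (z - a0)"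
  using assms by (intro AE_I2 tendsto_intros continuous_gd) auto
 show "AE z in lborel. \<bar>gd (t n) (z - a n) * G z\<bar> <= C * gd (t n) (z - a n)" for n
  using assms(3)[of n] G_bound by (auto simp: abs_mult mult.commute intro!: mult_right_mono)
qed (use assms in \<open>auto simp: integral_gd intro!: integrable_mult_right integrable_gd\<close>)

lemma heat_semigroup:
 assumes "0 < h" "0 < t"
 shows "(LBINT w. gd h w * heat G t (a + w)) = heat G (t + h) a"
proof -
 let ?F = "%w z. gd h w * (gd t (z - (a + w)) * G z)"
 have conv: "(NN w. ennreal (gd t (z - (a + w)) * gd h w)) = ennreal (gd (t + h) (z - a))" for z
  using nn_integral_gd_conv[OF assms(2,1), of "z - a" 0] by (simp add: diff_diff_eq)
 have meas: "case_prod ?F \<in> borel_measurable (lborel \<Otimes>\<^sub>M lborel)" by measurable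
 have "(\<integral>\<^sup>+x. ennreal (norm (case_prod ?F x)) \<partial>(lborel \<Otimes>\<^sub>M lborel)) = (NN z. \<integral>\<^sup>+w. ennreal (norm (?F w z)) \<partial>lborel)"
  by (subst lborel_pair.nn_integral_snd[symmetric]) auto
 also have "... <= (NN z. \<integral>\<^sup>+w. ennreal C * ennreal (gd t (z - (a + w)) * gd h w) \<partial>lborel)"
 proof (intro nn_integral_mono)
  fix z w :: 'a
  have "\<bar>G z\<bar> * (gd t (z - (a + w)) * gd h w) <= C * (gd t (z - (a + w)) * gd h w)"
   using assms by (intro mult_right_mono G_bound) auto
  hence "norm (?F w z) <= C * (gd t (z - (a + w)) * gd h w)"
   using assms by (simp add: abs_mult mult_ac)
  thus "ennreal (norm (?F w z)) <= ennreal C * ennreal (gd t (z - (a + w)) * gd h w)"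
   using C_nonneg assms by (subst ennreal_mult[symmetric]) (auto intro!: ennreal_leI)
 qed
 also have "... < \<infinity>"
  using assms nn_integral_gd(1)[of "t + h" a] by (simp add: nn_integral_cmult conv ennreal_mult_less_top)
 finally have int: "integrable (lborel \<Otimes>\<^sub>M lborel) (case_prod ?F)"
  by (intro integrableI_bounded meas)
 have "(LBINT w. gd h w * heat G t (a + w)) = (LBINT w. (LBINT z. ?F w z))"
  unfolding heat_def by simp
 also have "... = (LBINT z. (LBINT w. ?F w z))"
  by (rule lborel_pair.Fubini_integral[OF int, symmetric])
 also have "... = heat G (t + h) a"
  unfolding heat_def
 proof (rule lint_cong)
  fix z
  have "ennreal (LBINT w. gd t (z - (a + w)) * gd h w) = ennreal (gd (t + h) (z - a))"
   using assms conv[of z]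
   by (subst nn_integral_eq_integral[symmetric]) (auto intro!: integrableI_nonneg)
  hence "(LBINT w. gd t (z - (a + w)) * gd h w) = gd (t + h) (z - a)"
   using assms by (subst (asm) ennreal_inj) (auto intro!: integral_nonneg_AE)
  moreover have "(LBINT w. ?F w z) = (LBINT w. (gd t (z - (a + w)) * gd h w) * G z)"
   by (intro lint_cong) auto
  ultimately show "(LBINT w. ?F w z) = gd (t + h) (z - a) * G z" by simp
 qed simp
 finally show ?thesis .
qed

lemma dheat_estimates_ex:
 "\<exists>K\<ge>0. \<forall>t>0. \<forall>a v z. \<bar>((z - a) \<bullet> v / t) * gd t (z - a) * G z\<bar> <= K * norm v / sqrt t * gd (2 * t) (z - a)"
proof -
 obtain C1 where C1: "0 <= C1" "!!t (x :: 'a). 0 < t ==> norm x ^ 1 * gd t x <= C1 * sqrt t ^ 1 * gd (2 * t) x"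
  using gd_poly by blast
 show ?thesis
 proof (intro exI[of _ "C1 * C"] conjI allI impI)
  show "0 <= C1 * C" using C1 C_nonneg by simp
  fix t :: real and a v z :: 'a assume t: "0 < t"
  have "\<bar>((z - a) \<bullet> v / t) * gd t (z - a) * G z\<bar> = \<bar>(z - a) \<bullet> v\<bar> / t * gd t (z - a) * \<bar>G z\<bar>"
   using t by (simp add: abs_mult)
  also have "... <= (norm (z - a) * norm v) / t * gd t (z - a) * C"
   using t by (intro mult_mono divide_right_mono Cauchy_Schwarz_ineq2 G_bound) (auto intro!: mult_nonneg_nonneg divide_nonneg_nonneg)
  also have "... = norm v / t * C * (norm (z - a) ^ 1 * gd t (z - a))" by simp
  also have "... <= norm v / t * C * (C1 * sqrt t ^ 1 * gd (2 * t) (z - a))"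
   using t C_nonneg by (intro mult_left_mono C1) auto
  also have "... = C1 * C * norm v / sqrt t * gd (2 * t) (z - a)"
  proof -
   have "sqrt t / t = 1 / sqrt t" using t by (simp add: real_div_sqrt field_simps)
   hence "norm v / t * C * (C1 * sqrt t ^ 1 * gd (2 * t) (z - a)) = norm v * C * C1 * (1 / sqrt t) * gd (2 * t) (z - a)"
    unfolding \<open>sqrt t / t = 1 / sqrt t\<close>[symmetric] by simp
   thus ?thesis by (simp add: mult_ac)
  qed
  finally show "\<bar>((z - a) \<bullet> v / t) * gd t (z - a) * G z\<bar> <= C1 * C * norm v / sqrt t * gd (2 * t) (z - a)" .
 qed
qed

definition KH :: real where
 "KH = (SOME K. 0 <= K \<and> (\<forall>t>0. \<forall>a v z. \<bar>((z - a) \<bullet> v / t) * gd t (z - a) * G z\<bar> <= K * norm v / sqrt t * gd (2 * t) (z - a)))"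

lemma KH_nonneg: "0 <= KH"
 and dheat_integrand_bound: "0 < t ==> \<bar>((z - a) \<bullet> v / t) * gd t (z - a) * G z\<bar> <= KH * norm v / sqrt t * gd (2 * t) (z - a)"
 using someI_ex[OF dheat_estimates_ex] unfolding KH_def[symmetric] by blast+

lemma dheat_integrable: "0 < t ==> integrable lborel (%z. ((z - a) \<bullet> v / t) * gd t (z - a) * G z)"
proof (rule lint_bound)
 assume t: "0 < t"
 thus "integrable lborel (%z. KH * norm v / sqrt t * gd (2 * t) (z - a))" by (intro integrable_mult_right integrable_gd) auto
 show "AE z in lborel. norm (((z - a) \<bullet> v / t) * gd t (z - a) * G z) <= norm (KH * norm v / sqrt t * gd (2 * t) (z - a))"
  by (rule AE_I2) (simp only: real_norm_def, rule order_trans[OF dheat_integrand_bound[OF t] abs_ge_self])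
qed measurable

lemma dheat_bound: assumes "0 < t" shows "\<bar>dheat G t a v\<bar> <= KH * norm v / sqrt t"
proof -
 have "\<bar>dheat G t a v\<bar> <= (LBINT z. \<bar>((z - a) \<bullet> v / t) * gd t (z - a) * G z\<bar>)"
  unfolding dheat_def using integral_norm_bound[of lborel "%z. ((z - a) \<bullet> v / t) * gd t (z - a) * G z"] by simp
 also have "... <= (LBINT z. KH * norm v / sqrt t * gd (2 * t) (z - a))"
  using assms by (intro integral_mono integrable_abs dheat_integrable integrable_mult_right integrable_gd dheat_integrand_bound) auto
 also have "... = KH * norm v / sqrt t" using assms by (simp add: integral_gd)
 finally show ?thesis .
qed

lemma dheat_tendsto:
 assumes "t ----> t0" "a ----> a0" "v ----> v0" "!!n. 0 < t n" "0 < t0"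
 shows "(%n. dheat G (t n) (a n) (v n)) ----> dheat G t0 a0 v0"
 unfolding dheat_def
proof (rule integral_dominated_convergence_varying[where D="%n z. KH * norm (v n) / sqrt (t n) * gd (2 * t n) (z - a n)"
  and E="%z. KH * norm v0 / sqrt t0 * gd (2 * t0) (z - a0)"])
 have t0: "t0 \<noteq> 0" "sqrt t0 \<noteq> 0" using assms by auto
 show "AE z in lborel. (%n. ((z - a n) \<bullet> v n / t n) * gd (t n) (z - a n) * G z) ----> ((z - a0) \<bullet> v0 / t0) * gd t0 (z - a0) * G z"
  by (intro AE_I2 tendsto_intros continuous_gd assms t0)
 show "AE z in lborel. (%n. KH * norm (v n) / sqrt (t n) * gd (2 * t n) (z - a n)) ----> KH * norm v0 / sqrt t0 * gd (2 * t0) (z - a0)"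
  by (intro AE_I2 tendsto_intros continuous_gd assms t0) (use assms in auto)
 show "AE z in lborel. \<bar>((z - a n) \<bullet> v n / t n) * gd (t n) (z - a n) * G z\<bar> <= KH * norm (v n) / sqrt (t n) * gd (2 * t n) (z - a n)" for n
  using assms by (intro AE_I2 dheat_integrand_bound)
 have "(%n. KH * norm (v n) / sqrt (t n)) ----> KH * norm v0 / sqrt t0"
  by (intro tendsto_intros assms t0)
 thus "(%n. \<integral>z. KH * norm (v n) / sqrt (t n) * gd (2 * t n) (z - a n) \<partial>lborel) ----> (LBINT z. KH * norm v0 / sqrt t0 * gd (2 * t0) (z - a0))"
  using assms by (simp add: integral_gd)
qed (use assms in \<open>auto intro!: integrable_mult_right integrable_gd\<close>)

text \<open>Integrate the derivative of the kernel along the segment and exchange the integrals. The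
  Lipschitz bound and the limits of difference quotients both follow from this formula.\<close>

lemma heat_increment:
 assumes t: "0 < t"
 shows "heat G t (a + v) - heat G t a = (LBINT \<theta>. indicator {0<..<1} \<theta> * dheat G t (a + \<theta> *\<^sub>R v) v)"
proof -
 let ?F = "%\<theta> z. indicator {0<..<1} \<theta> * (((z - (a + \<theta> *\<^sub>R v)) \<bullet> v / t) * gd t (z - (a + \<theta> *\<^sub>R v)) * G z)"
 have meas: "case_prod ?F \<in> borel_measurable (lborel \<Otimes>\<^sub>M lborel)"
  unfolding indicator_def greaterThanLessThan_iff by measurable
 have "(\<integral>\<^sup>+x. ennreal (norm (case_prod ?F x)) \<partial>(lborel \<Otimes>\<^sub>M lborel)) = (NN \<theta>. \<integral>\<^sup>+z. ennreal (norm (?F \<theta> z)) \<partial>lborel)"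
  by (subst lborel.nn_integral_fst[symmetric]) (use meas in auto)
 also have "... <= (NN \<theta>. ennreal (KH * norm v / sqrt t) * indicator {0<..<1::real} \<theta>)"
 proof (rule nn_integral_mono)
  fix \<theta> :: real
  have "(NN z. ennreal (norm (?F \<theta> z))) <= (NN z. ennreal (indicator {0<..<1} \<theta> * (KH * norm v / sqrt t)) * ennreal (gd (2 * t) (z - (a + \<theta> *\<^sub>R v))))"
  proof (intro nn_integral_mono)
   fix z
   have "norm (?F \<theta> z) <= indicator {0<..<1} \<theta> * (KH * norm v / sqrt t) * gd (2 * t) (z - (a + \<theta> *\<^sub>R v))"
    using dheat_integrand_bound[OF t, of z "a + \<theta> *\<^sub>R v" v] by (simp add: indicator_def)
   thus "ennreal (norm (?F \<theta> z)) <= ennreal (indicator {0<..<1} \<theta> * (KH * norm v / sqrt t)) * ennreal (gd (2 * t) (z - (a + \<theta> *\<^sub>R v)))"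
    using t KH_nonneg by (subst ennreal_mult[symmetric]) (auto intro!: ennreal_leI)
  qed
  also have "... = ennreal (KH * norm v / sqrt t) * indicator {0<..<1} \<theta>"
   using t nn_integral_gd(1)[of "2 * t" "a + \<theta> *\<^sub>R v"] by (subst nn_integral_cmult) (auto simp: indicator_def)
  finally show "(NN z. ennreal (norm (?F \<theta> z))) <= ennreal (KH * norm v / sqrt t) * indicator {0<..<1} \<theta>" .
 qed
 also have "... < \<infinity>" by (simp add: nn_integral_cmult ennreal_mult_less_top)
 finally have int: "integrable (lborel \<Otimes>\<^sub>M lborel) (case_prod ?F)"
  by (intro integrableI_bounded meas)
 have "(LBINT \<theta>. indicator {0<..<1} \<theta> * dheat G t (a + \<theta> *\<^sub>R v) v) = (LBINT \<theta>. (LBINT z. ?F \<theta> z))"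
  unfolding dheat_def by simp
 also have "... = (LBINT z. (LBINT \<theta>. ?F \<theta> z))"
  by (rule lborel_pair.Fubini_integral[OF int, symmetric])
 also have "... = (LBINT z. gd t (z - (a + v)) * G z - gd t (z - a) * G z)"
 proof (rule lint_cong)
  fix z
  have "(LBINT \<theta>. indicator {0<..<1} \<theta> * (((z - (a + \<theta> *\<^sub>R v)) \<bullet> v / t) * gd t (z - (a + \<theta> *\<^sub>R v))))
    = gd t (z - (a + 1 *\<^sub>R v)) - gd t (z - (a + 0 *\<^sub>R v))"
  proof (rule integral_indicator_FTC)
   fix \<theta> :: real
   have e: "z - (a + \<theta> *\<^sub>R v) = (z - a) + \<theta> *\<^sub>R (- v)" for \<theta> by (simp add: algebra_simps)
   show "((%\<theta>. gd t (z - (a + \<theta> *\<^sub>R v))) has_real_derivative ((z - (a + \<theta> *\<^sub>R v)) \<bullet> v / t) * gd t (z - (a + \<theta> *\<^sub>R v))) (at \<theta>)"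
    using gd_along_line_derivative[OF t, of "z - a" "- v" \<theta>] unfolding e by simp
  next
   show "continuous_on UNIV (%\<theta>. ((z - (a + \<theta> *\<^sub>R v)) \<bullet> v / t) * gd t (z - (a + \<theta> *\<^sub>R v)))"
    unfolding gd_def using t by (intro continuous_intros) auto
  qed simp
  hence "(LBINT \<theta>. indicator {0<..<1} \<theta> * (((z - (a + \<theta> *\<^sub>R v)) \<bullet> v / t) * gd t (z - (a + \<theta> *\<^sub>R v)))) * G z
    = gd t (z - (a + v)) * G z - gd t (z - a) * G z"
   by (simp add: left_diff_distrib)
  thus "(LBINT \<theta>. ?F \<theta> z) = gd t (z - (a + v)) * G z - gd t (z - a) * G z"
   by (simp only: mult.assoc[symmetric] integral_mult_left_zero)
 qed simp
 also have "... = heat G t (a + v) - heat G t a"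
  unfolding heat_def using t by (intro Bochner_Integration.integral_diff heat_integrable)
 finally show ?thesis ..
qed

lemma heat_lipschitz:
 assumes t: "0 < t"
 shows "\<bar>heat G t (a + v) - heat G t a\<bar> <= KH * norm v / sqrt t"
proof -
 have "\<bar>LBINT \<theta>. indicator {0<..<1} \<theta> * dheat G t (a + \<theta> *\<^sub>R v) v\<bar> <= KH * norm v / sqrt t * (1 - 0)"
  by (rule abs_integral_interval_le) (use dheat_bound[OF t] KH_nonneg t in auto)
 thus ?thesis unfolding heat_increment[OF t] by simp
qed

text \<open>Base point, direction and time vary together: along a path, the drift step starts from a
  position already displaced by the noise and follows an averaged drift.\<close>

lemma heat_difference_quotient:
 assumes h: "h ----> 0" "!!n. h n \<noteq> 0" and b: "b ----> b0" and x: "x ----> x0" and t: "t ----> t0" "!!n. 0 < t n" "0 < t0"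
 shows "(%n. (heat G (t n) (x n + h n *\<^sub>R b n) - heat G (t n) (x n)) / h n) ----> dheat G t0 x0 b0"
proof -
 have lin: "dheat G s a (c *\<^sub>R v) = c * dheat G s a v" for s a c v
  unfolding dheat_def by (subst integral_mult_right_zero[symmetric], rule lint_cong) simp_all
 obtain N where N: "!!n. norm (b n) <= N" using convergent_imp_Bseq[OF convergentI[OF b]] by (auto simp: Bseq_def)
 \<comment> \<open>Keeps the time away from 0, where the bound on \<open>dheat\<close>
   explodes.\<close>
 have "eventually (%n. t0 / 2 < t n) sequentially" using t by (intro order_tendstoD) auto
 then obtain n0 where n0: "!!n. n \<ge> n0 ==> t0 / 2 < t n" unfolding eventually_sequentially by blast
 have "(%n. \<integral>\<theta>. indicator {0<..<1} \<theta> * dheat G (t (n + n0)) (x (n + n0) + \<theta> *\<^sub>R (h (n + n0) *\<^sub>R b (n + n0))) (b (n + n0)) \<partial>lborel) ----> (LBINT \<theta>. indicator {0<..<1::real} \<theta> * dheat G t0 x0 b0)"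
 proof (rule integral_dominated_convergence[where w="%\<theta>. KH * N / sqrt (t0 / 2) * indicator {0<..<1} \<theta>"])
  show "AE \<theta> in lborel. (%n. indicator {0<..<1} \<theta> * dheat G (t (n + n0)) (x (n + n0) + \<theta> *\<^sub>R (h (n + n0) *\<^sub>R b (n + n0))) (b (n + n0))) ----> indicator {0<..<1} \<theta> * dheat G t0 x0 b0"
  proof (rule AE_I2)
   fix \<theta> :: real
   have "(%n. dheat G (t n) (x n + \<theta> *\<^sub>R (h n *\<^sub>R b n)) (b n)) ----> dheat G t0 x0 b0"
    using assms by (intro dheat_tendsto) (auto intro!: tendsto_eq_intros)
   thus "(%n. indicator {0<..<1} \<theta> * dheat G (t (n + n0)) (x (n + n0) + \<theta> *\<^sub>R (h (n + n0) *\<^sub>R b (n + n0))) (b (n + n0))) ----> indicator {0<..<1} \<theta> * dheat G t0 x0 b0"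
    by (intro tendsto_mult tendsto_const) (rule LIMSEQ_ignore_initial_segment)
  qed
  show "AE \<theta> in lborel. norm (indicator {0<..<1} \<theta> * dheat G (t (n + n0)) (x (n + n0) + \<theta> *\<^sub>R (h (n + n0) *\<^sub>R b (n + n0))) (b (n + n0))) <= KH * N / sqrt (t0 / 2) * indicator {0<..<1} \<theta>" for n
  proof (rule AE_I2)
   fix \<theta> :: real
   have "\<bar>dheat G (t (n + n0)) (x (n + n0) + \<theta> *\<^sub>R (h (n + n0) *\<^sub>R b (n + n0))) (b (n + n0))\<bar> <= KH * norm (b (n + n0)) / sqrt (t (n + n0))"
    by (rule dheat_bound) (rule t)
   also have "... <= KH * N / sqrt (t0 / 2)"
    using n0[of "n + n0"] t KH_nonneg N[of "n + n0"] by (intro frac_le mult_left_mono mult_nonneg_nonneg) (auto intro: order_trans[OF norm_ge_zero])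
   finally show "norm (indicator {0<..<1} \<theta> * dheat G (t (n + n0)) (x (n + n0) + \<theta> *\<^sub>R (h (n + n0) *\<^sub>R b (n + n0))) (b (n + n0))) <= KH * N / sqrt (t0 / 2) * indicator {0<..<1} \<theta>"
    by (cases "\<theta> \<in> {0<..<1}") (simp_all only: indicator_simps real_norm_def mult_1 mult_1_right mult_zero_left mult_zero_right abs_zero order_refl not_False_eq_True)
  qed
  show "integrable lborel (%\<theta>::real. KH * N / sqrt (t0 / 2) * indicator {0<..<1} \<theta>)"
   by (intro integrable_mult_right integrable_real_indicator) auto
 qed (simp_all add: indicator_def greaterThanLessThan_iff)
 moreover have "(heat G (t n) (x n + h n *\<^sub>R b n) - heat G (t n) (x n)) / h n
   = (LBINT \<theta>. indicator {0<..<1} \<theta> * dheat G (t n) (x n + \<theta> *\<^sub>R (h n *\<^sub>R b n)) (b n))" for n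
 proof -
  have "(heat G (t n) (x n + h n *\<^sub>R b n) - heat G (t n) (x n)) / h n
   = (LBINT \<theta>. indicator {0<..<1} \<theta> * dheat G (t n) (x n + \<theta> *\<^sub>R (h n *\<^sub>R b n)) (h n *\<^sub>R b n)) / h n"
   unfolding heat_increment[OF t(2)] ..
  also have "... = (LBINT \<theta>. h n * (indicator {0<..<1} \<theta> * dheat G (t n) (x n + \<theta> *\<^sub>R (h n *\<^sub>R b n)) (b n))) / h n"
   unfolding lin by (intro arg_cong2[where f="(/)"] lint_cong) auto
  also have "... = (LBINT \<theta>. indicator {0<..<1} \<theta> * dheat G (t n) (x n + \<theta> *\<^sub>R (h n *\<^sub>R b n)) (b n))"
   using h(2) by simp
  finally show ?thesis .
 qed
 ultimately have "(%n. (heat G (t (n + n0)) (x (n + n0) + h (n + n0) *\<^sub>R b (n + n0)) - heat G (t (n + n0)) (x (n + n0))) / h (n + n0)) ----> dheat G t0 x0 b0"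
  by simp
 thus ?thesis by (rule LIMSEQ_offset)
qed

lemma gd_scale: "0 < t ==> sqrt t ^ DIM('a) * gd t (sqrt t *\<^sub>R w) = gd 1 (w :: 'a)"
 unfolding gd_def by (simp add: power_mult_distrib[symmetric] real_sqrt_mult power_mult_distrib)

lemma heat_scaled:
 assumes "0 < t"
 shows "heat G t a = (LBINT w. gd 1 w * G (a + sqrt t *\<^sub>R w))"
proof -
 have s: "sqrt t \<noteq> 0" using assms by simp
 have "heat G t a = (\<integral>z. gd t (z - a) * G z \<partial>density (distr lborel borel (%x. a + sqrt t *\<^sub>R x)) (%_. ennreal (\<bar>sqrt t\<bar> ^ DIM('a))))"
  unfolding heat_def lborel_affine[OF s, of a, symmetric] ..
 also have "... = (LBINT w. \<bar>sqrt t\<bar> ^ DIM('a) * (gd t (a + sqrt t *\<^sub>R w - a) * G (a + sqrt t *\<^sub>R w)))"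
  by (subst integral_density, measurable, subst integral_distr) auto
 also have "... = (LBINT w. gd 1 w * G (a + sqrt t *\<^sub>R w))"
  using assms by (intro lint_cong) (auto simp: gd_scale[symmetric] mult_ac)
 finally show ?thesis .
qed

lemma heat_initial:
 assumes "isCont G a" "t ----> 0" "!!n. 0 < t n"
 shows "(%n. heat G (t n) a) ----> G a"
proof -
 have "(%n. \<integral>w. gd 1 w * G (a + sqrt (t n) *\<^sub>R w) \<partial>lborel) ----> (LBINT w. gd 1 (w :: 'a) * G a)"
 proof (rule integral_dominated_convergence[where w="%w. C * gd 1 (w - 0)"])
  show "AE w in lborel. (%n. gd 1 w * G (a + sqrt (t n) *\<^sub>R w)) ----> gd 1 w * G a"
  proof (intro AE_I2 tendsto_mult tendsto_const)
   fix w
   have "(%n. a + sqrt (t n) *\<^sub>R w) ----> a + sqrt 0 *\<^sub>R w" by (intro tendsto_intros assms)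
   hence "(%n. a + sqrt (t n) *\<^sub>R w) ----> a" by simp
   thus "(%n. G (a + sqrt (t n) *\<^sub>R w)) ----> G a"
    by (rule isCont_tendsto_compose[OF assms(1)])
  qed
  show "AE w in lborel. norm (gd 1 w * G (a + sqrt (t n) *\<^sub>R w)) <= C * gd 1 (w - 0)" for n
   by (rule AE_I2) (simp add: abs_mult, subst mult.commute, intro mult_right_mono G_bound, simp)
  show "integrable lborel (%w :: 'a. C * gd 1 (w - 0))" by (intro integrable_mult_right integrable_gd) simp
 qed simp_all
 moreover have "(LBINT w. gd 1 (w :: 'a)) = 1"
  using integral_gd[of 1 "0 :: 'a"] by simp
 ultimately show ?thesis using assms(3) by (simp add: heat_scaled)
qed

end

text \<open>The method of images: an initial datum that is odd with respect to the hyperplane \<open>x $ k = c\<close>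
 stays odd under the heat flow, so it solves the Dirichlet problem on either side.\<close>
definition odd_ext :: "'d::finite => real => (real ^ 'd => real) => real ^ 'd => real" where
 "odd_ext k c g z = (if z $ k < c then g z else if c < z $ k then - g (mirror k c z) else 0)"

lemma odd_ext_measurable [measurable]:
 assumes [measurable]: "g \<in> borel_measurable borel"
 shows "odd_ext k c g \<in> borel_measurable borel"
 unfolding odd_ext_def by measurable

lemma odd_ext_bound: "(!!z. \<bar>g z\<bar> <= C) ==> \<bar>odd_ext k c g z\<bar> <= C"
proof -
 assume g: "!!z. \<bar>g z\<bar> <= C"
 have "0 <= C" using g[of 0] by linarith
 thus ?thesis using g by (auto simp: odd_ext_def)
qed

lemma odd_ext_mirror: "odd_ext k c g (mirror k c z) = - odd_ext k c g z"
 by (auto simp: odd_ext_def mirror_nth)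

text \<open>The half space above \<open>c\<close> is folded onto the one below by the
  reflection.\<close>

lemma odd_ext_split:
 assumes "integrable lborel (%z. f z * odd_ext k c g z)" and [measurable]: "f \<in> borel_measurable borel" "g \<in> borel_measurable borel"
 shows "(LBINT z. f z * odd_ext k c g z) = (LBINT z. (if z $ k < c then (f z - f (mirror k c z)) * g z else 0))"
proof -
 let ?l = "%z. if z $ k < c then f z * g z else 0" and ?r = "%z. if c < z $ k then f z * - g (mirror k c z) else 0"
 have l: "integrable lborel ?l"
  by (rule lint_bound[OF assms(1)]) (auto simp: odd_ext_def)
 have r: "integrable lborel ?r"
  by (rule lint_bound[OF assms(1)]) (auto simp: odd_ext_def)
 let ?r' = "%z. if z $ k < c then f (mirror k c z) * - g z else 0"
 have rr: "?r (mirror k c z) = ?r' z" for z by (auto simp: mirror_nth)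
 have r': "integrable lborel ?r'"
 proof -
  have "integrable (distr lborel borel (mirror k c)) ?r" using r by (simp add: distr_lborel_mirror)
  hence "integrable lborel (%z. ?r (mirror k c z))" by (subst (asm) integrable_distr_eq) auto
  thus ?thesis by (simp only: rr)
 qed
 have "(LBINT z. f z * odd_ext k c g z) = (LBINT z. ?l z + ?r z)"
  by (intro lint_cong) (auto simp: odd_ext_def)
 also have "... = (LBINT z. ?l z) + (LBINT z. ?r z)" using l r by (rule Bochner_Integration.integral_add)
 also have "(LBINT z. ?r z) = (LBINT z. ?r' z)"
  using integral_mirror[of ?r k c] by (simp only: rr) simp
 also have "(LBINT z. ?l z) + (LBINT z. ?r' z) = (LBINT z. ?l z + ?r' z)"
  using l r' by (rule Bochner_Integration.integral_add[symmetric])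
 also have "... = (LBINT z. (if z $ k < c then (f z - f (mirror k c z)) * g z else 0))"
  by (intro lint_cong) (auto simp: left_diff_distrib)
 finally show ?thesis .
qed

text \<open>By antisymmetry the value at a boundary point equals its own negative. This is why paths
  reaching \<open>c\<close> leave no boundary term.\<close>

lemma heat_odd_ext_boundary:
 assumes [measurable]: "g \<in> borel_measurable borel" and "a $ k = c"
 shows "heat (odd_ext k c g) t a = 0"
proof -
 have "heat (odd_ext k c g) t a = (LBINT z. gd t (mirror k c z - a) * odd_ext k c g (mirror k c z))"
  unfolding heat_def by (rule integral_mirror[symmetric]) measurable
 also have "... = - heat (odd_ext k c g) t a"
  unfolding heat_def odd_ext_mirror
  by (subst integral_minus[symmetric], rule lint_cong)
   (use assms in \<open>simp_all add: gd_cong_norm[OF norm_mirror_swap] mirror_hyperplane\<close>)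
 finally show ?thesis by simp
qed

context parametrix begin

text \<open>The series is built from absorbed kernels, the argument along paths from the heat flow
  of the odd extension; this lemma and the next identify the two.\<close>

lemma uu_eq_heat:
 assumes t: "0 < t" and [measurable]: "g \<in> borel_measurable borel" and g: "!!x. \<bar>g x\<bar> <= C"
 shows "uu c t g a = heat (odd_ext k c g) t a"
proof -
 interpret G: bounded_borel_fun "odd_ext k c g" C
  by unfold_locales (measurable, rule odd_ext_bound, rule g)
 show ?thesis unfolding uu_def heat_def
  by (subst odd_ext_split) (use G.heat_integrable[OF t] in auto)
qed

lemma hh_eq_dheat:
 assumes t: "0 < t" and [measurable]: "g \<in> borel_measurable borel" and g: "!!x. \<bar>g x\<bar> <= C"
 shows "hh c t g a = dheat (odd_ext k c g) t a (B a)"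
proof -
 interpret G: bounded_borel_fun "odd_ext k c g" C
  by unfold_locales (measurable, rule odd_ext_bound, rule g)
 show ?thesis unfolding hh_def dheat_def
  by (subst odd_ext_split) (use G.dheat_integrable[OF t] in \<open>auto simp: kap_def psi_def intro!: lint_cong\<close>)
qed

end

section \<open>Running maxima, Euler scheme and independence\<close>

definition rmax :: "(real => real) => real => real" where
 "rmax x t = (SUP s\<in>{0..t}. x s)"

lemma running_max_eq: "running_max k X t x = rmax (%s. X s x $ k) t"
 by (simp add: running_max_def rmax_def)

context
 fixes x :: "real => real" assumes x: "continuous_on {0..} x"
begin

lemma rmax_compact: "compact (x ` {0..t})"
 by (intro compact_continuous_image continuous_on_subset[OF x]) auto

lemma rmax_bdd: "bdd_above (x ` {0..t})"
 by (intro bounded_imp_bdd_above compact_imp_bounded rmax_compact)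

lemma rmax_ge: "0 <= s ==> s <= t ==> x s <= rmax x t"
 unfolding rmax_def by (intro cSUP_upper rmax_bdd) auto

lemma rmax_le: "0 <= t ==> (!!s. 0 <= s ==> s <= t ==> x s <= c) ==> rmax x t <= c"
 unfolding rmax_def by (intro cSUP_least) auto

lemma rmax_attained:
 assumes "0 <= t" obtains s where "0 <= s" "s <= t" "rmax x t = x s"
proof -
 have "\<exists>s\<in>{0..t}. \<forall>r\<in>{0..t}. x r <= x s"
  by (rule continuous_attains_sup) (use assms in \<open>auto intro: continuous_on_subset[OF x]\<close>)
 then obtain s where s: "s \<in> {0..t}" "!!r. r \<in> {0..t} ==> x r <= x s" by blast
 hence "rmax x t = x s" using assms by (intro antisym rmax_le rmax_ge) auto
 thus ?thesis using s that by auto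
qed

lemma rmax_mono: "0 <= s ==> s <= t ==> rmax x s <= rmax x t"
 by (intro rmax_le) (auto intro: rmax_ge)

lemma rmax_le_plus:
 assumes "0 <= s" "s <= t" and d: "!!r. s <= r ==> r <= t ==> x r <= rmax x s + e" and e: "0 <= e"
 shows "rmax x t <= rmax x s + e"
proof (rule rmax_le)
 fix r assume r: "0 <= r" "r <= t"
 show "x r <= rmax x s + e"
  using rmax_ge[of r s] d[of r] r e by (cases "r <= s") auto
qed (use assms in auto)

lemma rmax_continuous: "continuous_on {0..} (rmax x)"
 unfolding continuous_on_iff
proof (intro ballI allI impI)
 fix t e :: real assume t: "t \<in> {0..}" and e: "0 < e"
 from x t e obtain d where d: "0 < d" "!!r. 0 <= r ==> \<bar>r - t\<bar> < d ==> \<bar>x r - x t\<bar> < e / 4"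
  unfolding continuous_on_iff dist_real_def by (metis atLeast_iff zero_less_divide_iff zero_less_numeral)
 have main: "\<bar>rmax x b - rmax x a\<bar> <= e / 2" if "0 <= a" "a <= b" "\<bar>a - t\<bar> < d" "\<bar>b - t\<bar> < d" for a b
 proof -
  have "rmax x b <= rmax x a + e / 2"
  proof (rule rmax_le_plus)
   fix r assume r: "a <= r" "r <= b"
   have "\<bar>x r - x t\<bar> < e / 4" "\<bar>x a - x t\<bar> < e / 4" using that r by (auto intro!: d(2) simp del: less_divide_eq_numeral1)
   moreover have "x a <= rmax x a" using that by (intro rmax_ge) auto
   ultimately show "x r <= rmax x a + e / 2" by linarith
  qed (use that e in auto)
  thus ?thesis using rmax_mono[of a b] that by auto
 qed
 show "\<exists>d>0. \<forall>x'\<in>{0..}. dist x' t < d \<longrightarrow> dist (rmax x x') (rmax x t) < e"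
 proof (intro exI[of _ d] conjI ballI impI)
  fix t' assume "t' \<in> {0..}" "dist t' t < d"
  thus "dist (rmax x t') (rmax x t) < e"
   using main[of t t'] main[of t' t] t e d(1) by (cases "t <= t'") (auto simp: dist_real_def abs_minus_commute)
 qed (use d in auto)
qed

end

lemma uniform_modulus:
 fixes x :: "real => 'a::real_normed_vector"
 assumes x: "continuous_on {0..} x" and "0 < e"
 obtains d where "0 < d" "!!r s. 0 <= r ==> r <= t ==> 0 <= s ==> s <= t ==> \<bar>r - s\<bar> < d ==> norm (x r - x s) < e"
proof -
 have "uniformly_continuous_on {0..t} x"
  by (intro compact_uniformly_continuous continuous_on_subset[OF x]) auto
 thus ?thesis using that assms unfolding uniformly_continuous_on_def dist_norm real_norm_def by (metis atLeastAtMost_iff)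
qed

lemma grid_approx:
 fixes t r :: real and N :: nat
 assumes "0 < N" "0 <= r" "r <= t"
 obtains i where "i <= N" "real i * t / real N <= r" "r - real i * t / real N < t / real N \<or> t = 0"
proof (cases "t = 0")
 case True thus ?thesis using assms that[of 0] by auto
next
 case False
 hence t: "0 < t" using assms by auto
 let ?i = "nat \<lfloor>r * real N / t\<rfloor>"
 have p: "0 <= r * real N / t" using assms t by auto
 have l: "real ?i <= r * real N / t" using p by (simp add: of_nat_floor)
 have u: "r * real N / t < real ?i + 1" using p by linarith
 have "r * real N / t <= real N" using assms t by (simp add: field_simps mult_right_mono)
 hence "?i <= N" using l by linarith
 moreover have "real ?i * t <= r * real N" using l t by (simp only: pos_le_divide_eq)
 hence "real ?i * t / real N <= r" using assms by (simp add: pos_divide_le_eq)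
 moreover have "r * real N < (real ?i + 1) * t" using u t by (simp only: pos_divide_less_eq)
 hence "r * real N - real ?i * t < t" by (simp only: distrib_right mult_1)
 hence "(r * real N - real ?i * t) / real N < t / real N" using assms by (intro divide_strict_right_mono) auto
 hence "r - real ?i * t / real N < t / real N"
  using assms by (simp add: diff_divide_distrib del: of_nat_nat)
 ultimately show ?thesis by (intro that) auto
qed

text \<open>The uniformly small error at grid points covers both exact samples of a path and its
  Euler approximation.\<close>

lemma grid_max_tendsto:
 fixes x :: "real => real" and y :: "nat => nat => real"
 assumes x: "continuous_on {0..} x" and t: "0 <= t"
  and y: "!!e. 0 < e ==> eventually (%N. \<forall>i\<le>N. \<bar>y N i - x (real i * t / real N)\<bar> <= e) sequentially"
 shows "(%N. Max (y N ` {..N})) ----> rmax x t"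
proof (rule LIMSEQ_I)
 fix e :: real assume "0 < e"
 hence e: "0 < e / 3" by simp
 obtain d where d: "0 < d" "!!r s. 0 <= r ==> r <= t ==> 0 <= s ==> s <= t ==> \<bar>r - s\<bar> < d ==> \<bar>x r - x s\<bar> < e / 3"
  using uniform_modulus[OF x e, of t] unfolding real_norm_def by metis
 have "(%N. t / real N) ----> 0" by (rule lim_const_over_n)
 hence "eventually (%N. t / real N < d) sequentially" using d(1) by (intro order_tendstoD)
 moreover note y[OF e] eventually_gt_at_top[of 0]
 ultimately have "eventually (%N. norm (Max (y N ` {..N}) - rmax x t) < e) sequentially"
 proof eventually_elim
  case (elim N)
  have g: "0 <= real i * t / real N" "real i * t / real N <= t" if "i <= N" for i
   using that t elim mult_right_mono[of "real i" "real N" t] by (auto simp: pos_divide_le_eq mult.commute)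
  have "Max (y N ` {..N}) <= rmax x t + e / 3"
  proof (rule Max.boundedI)
   fix z assume "z \<in> y N ` {..N}"
   then obtain i where i: "i <= N" "z = y N i" by auto
   hence "\<bar>z - x (real i * t / real N)\<bar> <= e / 3" using elim by auto
   thus "z <= rmax x t + e / 3"
    using rmax_ge[OF x g[OF i(1)]] by linarith
  qed auto
  moreover have "rmax x t < Max (y N ` {..N}) + e"
  proof -
   obtain r where r: "0 <= r" "r <= t" "rmax x t = x r" using rmax_attained[OF x t] by metis
   obtain i where i: "i <= N" "real i * t / real N <= r" "r - real i * t / real N < t / real N \<or> t = 0"
    using grid_approx[OF elim(3) r(1,2)] by metis
   have "\<bar>r - real i * t / real N\<bar> < d" using i r elim d(1) by auto
   hence "\<bar>x r - x (real i * t / real N)\<bar> < e / 3" using r g[OF i(1)] by (intro d) auto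
   moreover have "\<bar>y N i - x (real i * t / real N)\<bar> <= e / 3" using elim i by auto
   moreover have "y N i <= Max (y N ` {..N})" using i by (intro Max_ge) auto
   ultimately show ?thesis using r by linarith
  qed
  ultimately show ?case using \<open>0 < e\<close> by (simp only: real_norm_def abs_less_iff) linarith
 qed
 thus "\<exists>no. \<forall>N\<ge>no. norm (Max (y N ` {..N}) - rmax x t) < e"
  unfolding eventually_sequentially .
qed

text \<open>The Euler scheme for additive noise, as a function of the initial value \<open>f 0\<close> and of the noise
 increments \<open>f (Suc i)\<close>.\<close>
fun euler :: "('a::real_normed_vector => 'a) => real => nat => (nat => 'a) => 'a" where
 "euler B \<delta> 0 f = f 0"
| "euler B \<delta> (Suc i) f = euler B \<delta> i f + \<delta> *\<^sub>R B (euler B \<delta> i f) + f (Suc i)"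

text \<open>The additive noise cancels and only the drift is approximated. The error satisfies
  \<open>e (Suc i) <= (1 + K * \<delta>) * e i + K * om * \<delta>\<close>, and the stated bound is
  the solution started at 0.\<close>

lemma euler_error:
 fixes x :: "real => 'a::euclidean_space"
 assumes x: "continuous_on {0..} x" and B: "!!y z. norm (B y - B z) <= K * norm (y - z)" and K: "0 <= K" and \<delta>: "0 < \<delta>"
  and eq: "!!t. 0 <= t ==> x t = x 0 + integral {0..t} (%s. B (x s)) + w t"
  and osc: "!!r s. 0 <= r ==> r <= real N * \<delta> ==> 0 <= s ==> s <= real N * \<delta> ==> \<bar>r - s\<bar> <= \<delta> ==> norm (x r - x s) <= om"
  and f0: "f 0 = x 0" and fS: "!!i. i < N ==> f (Suc i) = w (real (Suc i) * \<delta>) - w (real i * \<delta>)"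
  and om: "0 <= om"
 shows "i <= N ==> norm (x (real i * \<delta>) - euler B \<delta> i f) <= om * ((1 + K * \<delta>) ^ i - 1)"
proof (induction i)
 case 0
 thus ?case by (simp add: f0)
next
 case (Suc i)
 let ?a = "real i * \<delta>" and ?b = "real (Suc i) * \<delta>"
 have ab: "0 <= ?a" "?a <= ?b" "?b <= real N * \<delta>" "?b - ?a = \<delta>"
  using \<delta> Suc.prems mult_right_mono[of "real (Suc i)" "real N" \<delta>] by (auto simp: algebra_simps)
 have cB: "continuous_on UNIV B"
 proof (rule continuous_onI)
  fix y e assume e: "(0::real) < e"
  show "\<exists>d>0. \<forall>x'\<in>UNIV. dist x' y < d \<longrightarrow> dist (B x') (B y) <= e"
  proof (intro exI[of _ "e / (K + 1)"] conjI ballI impI)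
   fix z assume "dist z y < e / (K + 1)"
   hence "(K + 1) * norm (z - y) <= e" using K by (simp add: dist_norm field_simps)
   moreover have "K * norm (z - y) <= (K + 1) * norm (z - y)" by (intro mult_right_mono) auto
   ultimately show "dist (B z) (B y) <= e" using B[of z y] by (simp add: dist_norm)
  qed (use e K in auto)
 qed
 have cBx: "continuous_on {0..} (%s. B (x s))"
  by (rule continuous_on_compose2[OF cB x]) auto
 have int: "(%s. B (x s)) integrable_on {u..v}" if "0 <= u" for u v
  by (intro integrable_continuous_interval continuous_on_subset[OF cBx]) (use that in auto)
 have "integral {0..?a} (%s. B (x s)) + integral {?a..?b} (%s. B (x s)) = integral {0..?b} (%s. B (x s))"
  using ab int by (intro Henstock_Kurzweil_Integration.integral_combine) auto
 hence xb: "x ?b = x ?a + integral {?a..?b} (%s. B (x s)) + f (Suc i)"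
  using eq[of ?a] eq[of ?b] ab fS[of i] Suc.prems by (simp add: algebra_simps)
 let ?e = "euler B \<delta> i f"
 have IH: "norm (x ?a - ?e) <= om * ((1 + K * \<delta>) ^ i - 1)" using Suc by simp
 have "integral {?a..?b} (%s. B (x s)) - \<delta> *\<^sub>R B ?e = integral {?a..?b} (%s. B (x s) - B ?e)"
  using ab int[of ?a ?b] by (subst Henstock_Kurzweil_Integration.integral_diff) auto
 also have "norm ... <= (K * (om + om * ((1 + K * \<delta>) ^ i - 1))) * (?b - ?a)"
 proof (rule integral_bound)
  show "continuous_on {?a..?b} (%s. B (x s) - B ?e)"
   by (intro continuous_intros continuous_on_subset[OF cBx]) (use ab in auto)
  fix s assume s: "s \<in> {?a..?b}"
  have s0: "0 <= s" "s <= real N * \<delta>" using s ab(1,3) by (meson atLeastAtMost_iff order_trans)+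
  have "norm (B (x s) - B ?e) <= K * norm (x s - ?e)" by (rule B)
  also have "... <= K * (norm (x s - x ?a) + norm (x ?a - ?e))"
   using dist_triangle[of "x s" ?e "x ?a"] by (intro mult_left_mono K) (simp add: dist_norm)
  also have "... <= K * (om + om * ((1 + K * \<delta>) ^ i - 1))"
  proof (intro mult_left_mono K add_mono IH osc s0)
   show "0 <= ?a" "?a <= real N * \<delta>" using ab by linarith+
   show "\<bar>s - ?a\<bar> <= \<delta>" using s ab by auto
  qed
  finally show "norm (B (x s) - B ?e) <= K * (om + om * ((1 + K * \<delta>) ^ i - 1))" .
 qed (use ab in auto)
 finally have I: "norm (integral {?a..?b} (%s. B (x s)) - \<delta> *\<^sub>R B ?e) <= K * om * (1 + K * \<delta>) ^ i * \<delta>"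
  using ab by (simp add: algebra_simps)
 have "x ?b - euler B \<delta> (Suc i) f = (x ?a - ?e) + (integral {?a..?b} (%s. B (x s)) - \<delta> *\<^sub>R B ?e)"
  unfolding xb euler.simps by (simp add: algebra_simps)
 also have "norm ... <= om * ((1 + K * \<delta>) ^ i - 1) + K * om * (1 + K * \<delta>) ^ i * \<delta>"
  by (intro norm_triangle_le add_mono IH I)
 also have "... = om * ((1 + K * \<delta>) ^ Suc i - 1)" by (simp add: algebra_simps)
 finally show ?case .
qed


lemma euler_cong: "(!!j. j <= i ==> f j = g j) ==> euler B \<delta> i f = euler B \<delta> i g"
 by (induction i) auto

lemma euler_measurable:
 fixes B :: "'a::euclidean_space => 'a"
 assumes [measurable]: "B \<in> borel_measurable borel" and "i <= N"
 shows "(%f. euler B \<delta> i f) \<in> measurable (PiM {..N} (%_. borel)) borel"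
 using \<open>i <= N\<close>
proof (induction i)
 case 0 thus ?case by simp
next
 case (Suc i)
 hence [measurable]: "(%f. euler B \<delta> i f) \<in> measurable (PiM {..N} (%_. borel)) borel" by simp
 have "(%f. f (Suc i)) \<in> measurable (PiM {..N} (%_. borel)) (borel :: 'a measure)"
  using Suc.prems by (intro measurable_component_singleton) auto
 thus ?case by simp
qed

lemma euler_tendsto_uniform:
 fixes x :: "real => 'a::euclidean_space" and f :: "nat => nat => 'a"
 assumes x: "continuous_on {0..} x" and B: "!!y z. norm (B y - B z) <= K * norm (y - z)" and K: "0 <= K" and s: "0 < s"
  and eq: "!!t. 0 <= t ==> x t = x 0 + integral {0..t} (%s. B (x s)) + w t"
  and f0: "!!N. f N 0 = x 0" and fS: "!!N i. i < N ==> f N (Suc i) = w (real (Suc i) * (s / real N)) - w (real i * (s / real N))"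
  and e: "0 < e"
 shows "eventually (%N. \<forall>i\<le>N. norm (x (real i * (s / real N)) - euler B (s / real N) i (f N)) <= e) sequentially"
proof -
 \<comment> \<open>Since \<open>(1 + K * (s / N)) ^ N <= exp (K * s)\<close>, this oscillation keeps
   the error below \<open>e\<close>.\<close>
 define om where "om = e / exp (K * s)"
 have om: "0 < om" using e by (simp add: om_def)
 obtain d where d: "0 < d" "!!r r'. 0 <= r ==> r <= s ==> 0 <= r' ==> r' <= s ==> \<bar>r - r'\<bar> < d ==> norm (x r - x r') < om"
  using uniform_modulus[OF x om, of s] by metis
 have "(%N. s / real N) ----> 0" by (rule lim_const_over_n)
 hence "eventually (%N. s / real N < d) sequentially" using d(1) by (intro order_tendstoD)
 moreover note eventually_gt_at_top[of "0::nat"]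
 ultimately show ?thesis
 proof eventually_elim
  case (elim N)
  let ?d = "s / real N"
  have Nd: "real N * ?d = s" using elim by simp
  have dp: "0 < ?d" using elim s by simp
  show ?case
  proof (intro allI impI)
   fix i assume i: "i <= N"
   have "norm (x (real i * ?d) - euler B ?d i (f N)) <= om * ((1 + K * ?d) ^ i - 1)"
   proof (rule euler_error[OF x B K dp eq, where N=N])
    show "norm (x r - x s') <= om" if "0 <= r" "r <= real N * ?d" "0 <= s'" "s' <= real N * ?d" "\<bar>r - s'\<bar> <= ?d" for r s'
     using that elim unfolding Nd by (intro less_imp_le[OF d(2)]) auto
   qed (use f0 fS om i in auto)
   also have "... <= om * exp (K * s)"
   proof (intro mult_left_mono)
    have Kd: "0 <= K * ?d" using K dp by (intro mult_nonneg_nonneg) auto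
    have "(1 + K * ?d) ^ i <= (1 + K * ?d) ^ N"
     using Kd by (intro power_increasing i) linarith
    also have "... <= exp (K * ?d) ^ N"
     using Kd by (intro power_mono exp_ge_add_one_self) linarith
    also have "... = exp (K * s)" using elim by (simp add: exp_of_nat_mult[symmetric])
    finally show "(1 + K * ?d) ^ i - 1 <= exp (K * s)" by simp
   qed (use om in auto)
   also have "... = e" by (simp add: om_def)
   finally show "norm (x (real i * ?d) - euler B ?d i (f N)) <= e" .
  qed
 qed
qed

text \<open>Factorisation of expectations of bounded continuous functions survives almost sure
  limits. Approximating indicators by such functions carries it to open sets, which form an
  intersection-stable generator.\<close>

lemma (in prob_space) indep_var_limit:
 fixes V :: "nat => 'a => 'b::euclidean_space" and Z :: "nat => 'a => 'b"
 assumes ind: "!!n. indep_var borel (V n) borel (Z n)"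
  and rv [measurable]: "random_variable borel V0" "random_variable borel Z0"
  and lim: "AE q in M. (%n. V n q) ----> V0 q" "AE q in M. (%n. Z n q) ----> Z0 q"
 shows "indep_var borel V0 borel Z0"
proof -
 have [measurable]: "random_variable borel (V n)" "random_variable borel (Z n)" for n
  using ind[of n] by (auto dest: indep_var_rv1 indep_var_rv2)
 have fac: "(LINT q|M. f (V0 q) * g (Z0 q)) = (LINT q|M. f (V0 q)) * (LINT q|M. g (Z0 q))"
  if f: "continuous_on UNIV f" "!!x. \<bar>f x\<bar> <= 1" and g: "continuous_on UNIV g" "!!x. \<bar>g x\<bar> <= 1"
  for f :: "'b => real" and g :: "'b => real"
 proof (rule LIMSEQ_unique)
  have [measurable]: "f \<in> borel_measurable borel" "g \<in> borel_measurable borel"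
   using f g by (auto intro: borel_measurable_continuous_onI)
  have fl: "AE q in M. (%n. f (V n q)) ----> f (V0 q)"
   using lim(1) by eventually_elim (rule continuous_on_tendsto_compose[OF f(1)], auto)
  have gl: "AE q in M. (%n. g (Z n q)) ----> g (Z0 q)"
   using lim(2) by eventually_elim (rule continuous_on_tendsto_compose[OF g(1)], auto)
  have bd: "\<bar>f x * g y\<bar> <= 1" for x y using f(2)[of x] g(2)[of y] by (simp add: abs_mult mult_le_one)
  show "(%n. \<integral>q. f (V n q) * g (Z n q) \<partial>M) ----> (LINT q|M. f (V0 q) * g (Z0 q))"
   by (rule integral_dominated_convergence[where w="%_. 1"])
    (use bd fl gl in \<open>auto elim!: eventually_elim2 intro!: tendsto_mult\<close>)
  have "(LINT q|M. f (V n q) * g (Z n q)) = (LINT q|M. f (V n q)) * (LINT q|M. g (Z n q))" for n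
  proof (rule indep_var_lebesgue_integral)
   show "indep_var borel (%q. f (V n q)) borel (%q. g (Z n q))"
    using indep_var_compose[OF ind[of n], of f borel g borel] by (simp add: comp_def)
   show "integrable M (%q. f (V n q))" "integrable M (%q. g (Z n q))"
    using f(2) g(2) by (auto intro!: integrable_const_bound[where B=1])
  qed
  moreover have "(%n. \<integral>q. f (V n q) \<partial>M) ----> (LINT q|M. f (V0 q))"
   by (rule integral_dominated_convergence[where w="%_. 1"]) (use f(2) fl in auto)
  moreover have "(%n. \<integral>q. g (Z n q) \<partial>M) ----> (LINT q|M. g (Z0 q))"
   by (rule integral_dominated_convergence[where w="%_. 1"]) (use g(2) gl in auto)
  ultimately show "(%n. \<integral>q. f (V n q) * g (Z n q) \<partial>M) ----> (LINT q|M. f (V0 q)) * (LINT q|M. g (Z0 q))"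
   by (simp add: tendsto_mult)
 qed
 have approx: "\<exists>f :: nat => 'e => real. (\<forall>m. continuous_on UNIV (f m)) \<and> (\<forall>m x. \<bar>f m x\<bar> <= 1) \<and> (\<forall>x. (%m. f m x) ----> indicator U x)"
  if "open U" for U :: "'e::euclidean_space set"
 proof (cases "U = UNIV")
  case True
  thus ?thesis by (intro exI[of _ "%_ _. 1"]) auto
 next
  case False
  hence ne: "- U \<noteq> {}" by auto
  let ?f = "%m x. min 1 (real m * infdist x (- U))"
  show ?thesis
  proof (intro exI[of _ ?f] conjI allI)
   show "continuous_on UNIV (?f m)" for m by (intro continuous_intros)
   show "\<bar>?f m x\<bar> <= 1" for m x
   proof -
    have "0 <= ?f m x" using infdist_nonneg[of x "- U"] by simp
    thus ?thesis by (simp only: abs_of_nonneg min.cobounded1)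
   qed
   show "(%m. ?f m x) ----> indicator U x" for x
   proof (cases "x \<in> U")
    case True
    have c: "closed (- U)" using that by (simp add: closed_Compl)
    have "infdist x (- U) \<noteq> 0" using in_closed_iff_infdist_zero[OF c ne, of x] True by simp
    hence p: "0 < infdist x (- U)" using infdist_nonneg[of x "- U"] by linarith
    obtain m0 where "1 < real m0 * infdist x (- U)" using reals_Archimedean3[OF p] by blast
    hence "?f m x = 1" if "m \<ge> m0" for m
    proof -
     have "real m0 * infdist x (- U) <= real m * infdist x (- U)" using that p by (intro mult_right_mono) auto
     with \<open>1 < real m0 * infdist x (- U)\<close> show ?thesis by linarith
    qed
    hence "eventually (%m. ?f m x = 1) sequentially" unfolding eventually_sequentially by blast
    thus ?thesis using True by (simp add: tendsto_eventually)
   qed (simp add: infdist_zero)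
  qed
 qed
 have pr: "prob ({q\<in>space M. V0 q \<in> U} \<inter> {q\<in>space M. Z0 q \<in> U'}) = prob {q\<in>space M. V0 q \<in> U} * prob {q\<in>space M. Z0 q \<in> U'}"
  if U: "open U" "open U'" for U :: "'b set" and U' :: "'b set"
 proof -
  obtain f where f: "!!m. continuous_on UNIV (f m)" "!!m x. \<bar>f m x :: real\<bar> <= 1" "!!x. (%m. f m x) ----> indicator U x"
   using approx[OF U(1)] by blast
  obtain g where g: "!!m. continuous_on UNIV (g m)" "!!m x. \<bar>g m x :: real\<bar> <= 1" "!!x. (%m. g m x) ----> indicator U' x"
   using approx[OF U(2)] by blast
  have [measurable]: "f m \<in> borel_measurable borel" "g m \<in> borel_measurable borel" for m
   using f g by (auto intro: borel_measurable_continuous_onI)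
  have [measurable]: "U \<in> sets borel" "U' \<in> sets borel" using U by auto
  have bd: "\<bar>f m x * g m y\<bar> <= 1" for x y m using f(2)[of m x] g(2)[of m y] by (simp add: abs_mult mult_le_one)
  have "(LINT q|M. indicator U (V0 q) * indicator U' (Z0 q)) = (LINT q|M. indicator U (V0 q)) * (\<integral>q. indicator U' (Z0 q) \<partial>M :: real)"
  proof (rule LIMSEQ_unique)
   show "(%m. \<integral>q. f m (V0 q) * g m (Z0 q) \<partial>M) ----> (LINT q|M. indicator U (V0 q) * indicator U' (Z0 q))"
    by (rule integral_dominated_convergence[where w="%_. 1"]) (use bd in \<open>auto intro!: tendsto_mult f g\<close>)
   have "(%m. \<integral>q. f m (V0 q) \<partial>M) ----> (LINT q|M. indicator U (V0 q))"
    by (rule integral_dominated_convergence[where w="%_. 1"]) (use f in auto)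
   moreover have "(%m. \<integral>q. g m (Z0 q) \<partial>M) ----> (LINT q|M. indicator U' (Z0 q))"
    by (rule integral_dominated_convergence[where w="%_. 1"]) (use g in auto)
   ultimately show "(%m. \<integral>q. f m (V0 q) * g m (Z0 q) \<partial>M) ----> (LINT q|M. indicator U (V0 q)) * (LINT q|M. indicator U' (Z0 q))"
    using fac[OF f(1,2) g(1,2)] by (simp add: tendsto_mult)
  qed
  moreover have "(LINT q|M. indicator U (V0 q) * indicator U' (Z0 q)) = (\<integral>q. indicator ({q\<in>space M. V0 q \<in> U} \<inter> {q\<in>space M. Z0 q \<in> U'}) q \<partial>M :: real)"
   "(LINT q|M. indicator U (V0 q)) = (\<integral>q. indicator {q\<in>space M. V0 q \<in> U} q \<partial>M :: real)"
   "(LINT q|M. indicator U' (Z0 q)) = (\<integral>q. indicator {q\<in>space M. Z0 q \<in> U'} q \<partial>M :: real)"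
   by (auto intro!: lint_cong simp: indicator_def)
  ultimately show ?thesis by simp
 qed
 have sig: "sigma_sets (space M) {Y -` A \<inter> space M | A. A \<in> sets borel} = sigma_sets (space M) {Y -` A \<inter> space M | A. open A}"
  for Y :: "'a => 'e::topological_space"
 proof -
  have "sigma_sets (space M) {Y -` A \<inter> space M | A. A \<in> {S. open S}} = {Y -` A \<inter> space M | A. A \<in> sigma_sets UNIV {S. open S}}"
   by (rule sigma_sets_vimage_commute[symmetric]) auto
  hence e: "{Y -` A \<inter> space M | A. A \<in> sets borel} = sigma_sets (space M) {Y -` A \<inter> space M | A. open A}"
   by (simp add: borel_def)
  show ?thesis unfolding e by (rule sigma_sets_sigma_sets_eq) auto
 qed
 have stable: "Int_stable {Y -` A \<inter> space M | A. open A}" for Y :: "'a => 'b"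
 proof (clarsimp simp: Int_stable_def)
  fix A A' :: "'b set" assume "open A" "open A'"
  thus "\<exists>C. Y -` A \<inter> space M \<inter> (Y -` A' \<inter> space M) = Y -` C \<inter> space M \<and> open C"
   by (intro exI[of _ "A \<inter> A'"]) auto
 qed
 have "indep_set {V0 -` A \<inter> space M | A. open A} {Z0 -` A \<inter> space M | A. open A}"
  unfolding indep_set_def
 proof (rule indep_setsI)
  fix i :: bool
  show "case_bool {V0 -` A \<inter> space M | A. open A} {Z0 -` A \<inter> space M | A. open A} i \<subseteq> events"
   by (cases i) (auto intro!: measurable_sets[OF rv(1)] measurable_sets[OF rv(2)])
 next
  fix A :: "bool => 'a set" and J :: "bool set"
  assume J: "J \<noteq> {}" "J \<subseteq> UNIV" and A: "\<forall>j\<in>J. A j \<in> case_bool {V0 -` A \<inter> space M | A. open A} {Z0 -` A \<inter> space M | A. open A} j"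
  from J have "J = {True} \<or> J = {False} \<or> J = {True, False}" by (auto simp: UNIV_bool)
  thus "prob (\<Inter>j\<in>J. A j) = (\<Prod>j\<in>J. prob (A j))"
  proof (elim disjE)
   assume [simp]: "J = {True, False}"
   from A obtain U U' where U: "open U" "open U'" "A True = V0 -` U \<inter> space M" "A False = Z0 -` U' \<inter> space M" by auto
   have "prob ((V0 -` U \<inter> space M) \<inter> (Z0 -` U' \<inter> space M)) = prob (V0 -` U \<inter> space M) * prob (Z0 -` U' \<inter> space M)"
    using pr[OF U(1,2)] by (simp add: vimage_def Int_def conj_commute)
   thus ?thesis by (simp add: U)
  qed auto
 qed
 hence "indep_set (sigma_sets (space M) {V0 -` A \<inter> space M | A. open A}) (sigma_sets (space M) {Z0 -` A \<inter> space M | A. open A})"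
  by (rule indep_set_sigma_sets) (rule stable)+
 thus ?thesis
  unfolding indep_var_eq sig using rv by auto
qed

section \<open>The diffusion and the independence of its increments\<close>

locale diffusion = prob_space M
 for M :: "'w measure" +
 fixes k :: "'d::finite" and B :: "real ^ 'd => real ^ 'd" and \<mu>0 :: "(real ^ 'd) measure"
  and W X :: "real => 'w => real ^ 'd" and L K :: real
 assumes bm: "brownian_motion M W" and sde: "sde_solution M B \<mu>0 W X"
  and B_bound: "!!x. norm (B x) <= L" and B_lip: "!!x y. norm (B x - B y) <= K * norm (x - y)" and K_nonneg: "0 <= K"
  and sets_\<mu>0 [measurable_cong]: "sets \<mu>0 = sets borel"
begin

lemma L_nonneg: "0 <= L" using B_bound[of 0] norm_ge_zero order_trans by blast

lemma B_continuous: "continuous_on UNIV B"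
proof (rule continuous_onI)
 fix y e assume e: "(0::real) < e"
 show "\<exists>d>0. \<forall>x'\<in>UNIV. dist x' y < d \<longrightarrow> dist (B x') (B y) <= e"
 proof (intro exI[of _ "e / (K + 1)"] conjI ballI impI)
  fix z assume "dist z y < e / (K + 1)"
  hence "(K + 1) * norm (z - y) <= e" using K_nonneg by (simp add: dist_norm field_simps)
  moreover have "K * norm (z - y) <= (K + 1) * norm (z - y)" by (intro mult_right_mono) auto
  ultimately show "dist (B z) (B y) <= e" using B_lip[of z y] by (simp add: dist_norm)
 qed (use e K_nonneg in auto)
qed

lemma B_measurable [measurable]: "B \<in> borel_measurable borel"
 by (rule borel_measurable_continuous_onI[OF B_continuous])

lemma X_measurable: "0 <= t ==> X t \<in> borel_measurable M"
 and X_continuous: "x \<in> space M ==> continuous_on {0..} (%t. X t x)"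
 and X_initial: "distr M borel (X 0) = \<mu>0"
 and X_equation: "AE x in M. \<forall>t\<ge>0. X t x = X 0 x + integral {0..t} (%s. B (X s x)) + W t x"
 using sde unfolding sde_solution_def by blast+

lemma W_measurable: "0 <= t ==> W t \<in> borel_measurable M"
 and W_paths: "AE x in M. W 0 x = 0 \<and> continuous_on {0..} (%t. W t x)"
 using bm unfolding brownian_motion_def by blast+

lemma Xk_continuous: "x \<in> space M ==> continuous_on {0..} (%t. X t x $ i)"
 using X_continuous by (intro continuous_intros)

lemma W_increment_density:
 assumes "0 <= s" "s < t"
 shows "distributed M lborel (%p. W t p - W s p) (%x. ennreal (gd (t - s) x))"
proof -
 have B: "Basis = range (%i. axis i (1::real) :: real ^ 'd)"
  unfolding Basis_vec_def by auto
 have inj: "inj (%i. axis i (1::real) :: real ^ 'd)"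
  by (auto simp: inj_on_def axis_eq_axis)
 have e: "(\<Prod>i\<in>UNIV. normal_density 0 (sqrt (t - s)) (x $ i)) = gd (t - s) x" for x :: "real ^ 'd"
  using assms by (simp add: gd_prod B prod.reindex[OF inj] inner_axis)
 have "distributed M lborel (%p. W t p - W s p) (%x. ennreal (\<Prod>i\<in>UNIV. normal_density 0 (sqrt (t - s)) (x $ i)))"
  using bm assms unfolding brownian_motion_def by blast
 thus ?thesis by (simp only: e)
qed

lemma indep_increments:
 assumes "0 <= \<tau> (0::nat)" "!!i. i < n ==> \<tau> i < \<tau> (Suc i)"
 shows "indep_vars (%_. borel) (%i x. W (\<tau> (Suc i)) x - W (\<tau> i) x) {..<n}"
 using bm assms unfolding brownian_motion_def by blast

text \<open>Index 0 carries the initial value. An event built from the other indices lies in the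
  sigma-algebra of the noise, which is independent of \<open>X 0\<close>; among themselves the
  increments are independent.\<close>

lemma indep_initial_increments:
 assumes \<tau>: "0 <= \<tau> (0::nat)" "!!i. i < n ==> \<tau> i < \<tau> (Suc i)"
 shows "indep_vars (%_. borel) (%i p. if i = 0 then X 0 p else W (\<tau> i) p - W (\<tau> (i - 1)) p) {..n}"
  (is "indep_vars _ ?\<zeta> _")
 unfolding indep_vars_def2
proof (intro conjI ballI indep_setsI)
 have \<tau>0: "0 <= \<tau> i" if "i <= n" for i
  using that
 proof (induction i)
  case (Suc i)
  thus ?case using \<tau>(2)[of i] by auto
 qed (use \<tau> in auto)
 let ?G = "vimage_algebra (space M) (%p. \<lambda>t\<in>{0..}. W t p) (PiM {0..} (%_. borel))"
 have Wm: "W t \<in> borel_measurable ?G" if "0 <= t" for t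
 proof -
  have "(%p. \<lambda>t\<in>{0..}. W t p) \<in> measurable ?G (PiM {0..} (%_. borel))"
   by (rule measurable_vimage_algebra1) (auto simp: space_PiM)
  moreover have "(%f. f t) \<in> measurable (PiM {0..} (%_. borel)) (borel :: (real ^ 'd) measure)"
   using that by (intro measurable_component_singleton) simp
  ultimately have "(%p. (\<lambda>t\<in>{0..}. W t p) t) \<in> borel_measurable ?G"
   by (rule measurable_compose)
  thus ?thesis using that by simp
 qed
 have rv: "?\<zeta> i \<in> borel_measurable M" if "i \<in> {..n}" for i
  using that \<tau>0[of i] \<tau>0[of "i - 1"] X_measurable[of 0] W_measurable[of "\<tau> i"] W_measurable[of "\<tau> (i - 1)"] by (cases "i = 0") auto
 thus "random_variable borel (?\<zeta> i)" if "i \<in> {..n}" for i using that .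
 show "{?\<zeta> i -` A \<inter> space M |A. A \<in> sets borel} \<subseteq> events" if "i \<in> {..n}" for i
  using measurable_sets[OF rv[OF that]] by blast
 fix A :: "nat => 'w set" and J :: "nat set"
 assume J: "J \<noteq> {}" "J \<subseteq> {..n}" "finite J" and A: "\<forall>j\<in>J. A j \<in> {?\<zeta> j -` A \<inter> space M |A. A \<in> sets borel}"
 let ?J' = "J - {0}" and ?J'' = "{i. Suc i \<in> J}"
 have J': "?J' = Suc ` ?J''"
 proof (intro set_eqI iffI)
  fix x assume "x \<in> ?J'"
  thus "x \<in> Suc ` ?J''" by (cases x) auto
 qed auto
 have fJ'': "finite ?J''" using finite_vimageI[OF J(3) inj_Suc] by (simp add: vimage_def)
 have AG: "A j \<in> sets ?G" if "j \<in> ?J'" for j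
 proof -
  have jn: "j <= n" "j - 1 <= n" using that J(2) by force+
  have "(%p. W (\<tau> j) p - W (\<tau> (j - 1)) p) \<in> borel_measurable ?G"
   by (intro borel_measurable_diff Wm \<tau>0 jn)
  from measurable_sets[OF this] show ?thesis using A that by (auto simp: space_vimage_algebra)
 qed
 have prod': "prob (\<Inter>j\<in>?J'. A j) = (\<Prod>j\<in>?J'. prob (A j))" if "?J' \<noteq> {}"
 proof -
  have "prob (\<Inter>i\<in>?J''. A (Suc i)) = (\<Prod>i\<in>?J''. prob (A (Suc i)))"
  proof (rule indep_setsD)
   show "indep_sets (%i. {(%p. W (\<tau> (Suc i)) p - W (\<tau> i) p) -` A \<inter> space M |A. A \<in> sets borel}) {..<n}"
    using indep_increments[OF \<tau>] unfolding indep_vars_def2 by auto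
   show "\<forall>i\<in>?J''. A (Suc i) \<in> {(%p. W (\<tau> (Suc i)) p - W (\<tau> i) p) -` A \<inter> space M |A. A \<in> sets borel}"
   proof
    fix i assume "i \<in> ?J''"
    hence "A (Suc i) \<in> {?\<zeta> (Suc i) -` A \<inter> space M |A. A \<in> sets borel}" using A by blast
    thus "A (Suc i) \<in> {(%p. W (\<tau> (Suc i)) p - W (\<tau> i) p) -` A \<inter> space M |A. A \<in> sets borel}" by simp
   qed
  qed (use that J fJ'' J' in auto)
  thus ?thesis unfolding J' by (simp add: prod.reindex image_image)
 qed
 show "prob (\<Inter>j\<in>J. A j) = (\<Prod>j\<in>J. prob (A j))"
 proof (cases "0 \<in> J \<and> ?J' \<noteq> {}")
  case True
  have "A 0 \<in> sets (vimage_algebra (space M) (X 0) borel)"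
  proof -
   have "A 0 \<in> {?\<zeta> 0 -` A \<inter> space M |A. A \<in> sets borel}" using A True by blast
   then obtain U where "U \<in> sets borel" "A 0 = X 0 -` U \<inter> space M" by auto
   thus ?thesis by (auto intro: in_vimage_algebra)
  qed
  moreover have "(\<Inter>j\<in>?J'. A j) \<in> sets ?G"
   using True J AG by (intro sets.finite_INT) auto
  moreover have "indep_set (sets (vimage_algebra (space M) (X 0) borel)) (sets ?G)"
   using sde unfolding sde_solution_def by blast
  ultimately have "prob (A 0 \<inter> (\<Inter>j\<in>?J'. A j)) = prob (A 0) * prob (\<Inter>j\<in>?J'. A j)"
   by (intro indep_setD)
  moreover have "A 0 \<inter> (\<Inter>j\<in>?J'. A j) = (\<Inter>j\<in>J. A j)" using True by auto
  ultimately show ?thesis using True prod' J by (simp add: prod.remove[of J 0])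
 next
  case False
  hence "?J' = J \<or> J = {0}" by auto
  thus ?thesis
  proof
   assume "?J' = J" thus ?thesis using prod' J by auto
  qed auto
 qed
qed

lemma running_max_measurable:
 assumes Y: "!!x. x \<in> space M ==> continuous_on {0..} (%t. Y t x :: real ^ 'd)" "!!t. 0 <= t ==> Y t \<in> borel_measurable M" and t: "0 <= t"
 shows "running_max i Y t \<in> borel_measurable M"
proof (rule borel_measurable_LIMSEQ_real)
 show "(%N. Max ((%j. Y (real j * t / real N) x $ i) ` {..N})) ----> running_max i Y t x" if "x \<in> space M" for x
  unfolding running_max_eq
  by (rule grid_max_tendsto) (use Y(1)[OF that] t in \<open>auto intro!: continuous_intros\<close>)
 show "(%x. Max ((%j. Y (real j * t / real N) x $ i) ` {..N})) \<in> borel_measurable M" for N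
 proof (rule borel_measurable_Max)
  fix j show "(%x. Y (real j * t / real N) x $ i) \<in> borel_measurable M"
   using t by (intro vec_nth_measurable Y(2)) auto
 qed auto
qed

lemma M_measurable: "0 <= t ==> running_max k X t \<in> borel_measurable M"
 by (intro running_max_measurable X_continuous X_measurable)

text \<open>By the Euler scheme the past is a limit of functions of the initial value and of the
 increments before time \<open>s\<close>.\<close>
lemma indep_past_future:
 fixes Y :: "real => 'w => real ^ 'd"
 assumes s: "0 < s" and h: "0 < h"
  and Y: "!!x. x \<in> space M ==> continuous_on {0..} (%t. Y t x)" "!!t. 0 <= t ==> Y t \<in> borel_measurable M"
   "AE x in M. \<forall>r\<ge>0. Y r x = W (s + r) x - W s x"
 shows "indep_var borel (%x. (running_max k X s x, X s x)) borel (%x. (running_max k Y h x, W (s + h) x - W s x))"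
proof -
 \<comment> \<open>\<open>N\<close> grid steps on \<open>[0, s]\<close>, continued beyond
   \<open>s\<close> with steps of length \<open>h / N\<close>. Past and future then depend on
   disjoint blocks of the variables \<open>\<zeta>\<close>: the indices up to \<open>N\<close>, and
   those from \<open>Suc N\<close> on.\<close>
 define \<tau> where "\<tau> N i = (if i <= N then real i * (s / real N) else s + real (i - N) * (h / real N))" for N i :: nat
 define \<zeta> where "\<zeta> N i x = (if i = 0 then X 0 x else W (\<tau> N i) x - W (\<tau> N (i - 1)) x)" for N i x
 define FV where "FV N f = (Max ((%i. euler B (s / real N) i f $ k) ` {..N}), euler B (s / real N) N f)" for N and f :: "nat => real ^ 'd"
 define FZ where "FZ N f = (Max ((%j. (\<Sum>l<j. f (Suc (N + l))) $ k) ` {..N}), \<Sum>l<N. f (Suc (N + l)))" for N and f :: "nat => real ^ 'd"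
 have \<tau>N: "\<tau> N (N + j) = s + real j * (h / real N)" if "0 < N" for N j
  using that by (cases "j = 0") (auto simp: \<tau>_def)
 have ind: "indep_var borel (%x. FV (Suc n) (%i. \<zeta> (Suc n) i x)) borel (%x. FZ (Suc n) (%i. \<zeta> (Suc n) i x))" for n
 proof -
  let ?N = "Suc n"
  let ?I = "{..?N}" and ?J = "{Suc ?N..2 * ?N}"
  have mono: "\<tau> ?N i < \<tau> ?N (Suc i)" if "i < 2 * ?N" for i
  proof (cases "i < ?N")
   case True
   have "real i * (s / real ?N) < real (Suc i) * (s / real ?N)" using s by (intro mult_strict_right_mono) auto
   thus ?thesis using True by (simp add: \<tau>_def)
  next
   case False
   then obtain j where j: "i = ?N + j" using le_Suc_ex[of ?N i] by auto
   have "real j * (h / real ?N) < real (Suc j) * (h / real ?N)" using h by (intro mult_strict_right_mono) auto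
   thus ?thesis using \<tau>N[of ?N j] \<tau>N[of ?N "Suc j"] unfolding j by simp
  qed
  have "indep_vars (%_. borel) (\<zeta> ?N) {..2 * ?N}"
   unfolding \<zeta>_def by (rule indep_initial_increments) (use mono in \<open>auto simp: \<tau>_def\<close>)
  hence "indep_var (PiM ?I (%_. borel)) (%x. restrict (%i. \<zeta> ?N i x) ?I) (PiM ?J (%_. borel)) (%x. restrict (%i. \<zeta> ?N i x) ?J)"
   by (rule indep_var_restrict) auto
  moreover have "FV ?N \<in> measurable (PiM ?I (%_. borel)) borel"
  proof -
   have [measurable]: "(%f. euler B (s / real ?N) i f) \<in> measurable (PiM ?I (%_. borel)) borel" if "i \<in> {..?N}" for i
    using that by (intro euler_measurable) auto
   have "(%f. Max ((%i. euler B (s / real ?N) i f $ k) ` {..?N})) \<in> measurable (PiM ?I (%_. borel)) borel"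
    by (rule borel_measurable_Max) (auto intro!: vec_nth_measurable euler_measurable)
   thus ?thesis unfolding FV_def by (intro borel_measurable_Pair euler_measurable) auto
  qed
  moreover have "FZ ?N \<in> measurable (PiM ?J (%_. borel)) borel"
  proof -
   have 1: "(%f. \<Sum>l<j. f (Suc (?N + l)) :: real ^ 'd) \<in> measurable (PiM ?J (%_. borel)) borel" if "j <= ?N" for j
    using that by (intro borel_measurable_sum measurable_component_singleton) auto
   have "(%f. Max ((%j. (\<Sum>l<j. f (Suc (?N + l))) $ k) ` {..?N})) \<in> measurable (PiM ?J (%_. borel :: (real ^ 'd) measure)) borel"
    by (rule borel_measurable_Max) (auto intro!: vec_nth_measurable 1)
   thus ?thesis unfolding FZ_def by (intro borel_measurable_Pair 1) auto
  qed
  ultimately have "indep_var borel (FV ?N \<circ> (%x. restrict (%i. \<zeta> ?N i x) ?I)) borel (FZ ?N \<circ> (%x. restrict (%i. \<zeta> ?N i x) ?J))"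
   by (rule indep_var_compose)
  moreover have "FV ?N \<circ> (%x. restrict (%i. \<zeta> ?N i x) ?I) = (%x. FV ?N (%i. \<zeta> ?N i x))"
  proof
   fix x
   have "euler B (s / real ?N) i (restrict (%i. \<zeta> ?N i x) ?I) = euler B (s / real ?N) i (%i. \<zeta> ?N i x)" if "i <= ?N" for i
    using that by (intro euler_cong) auto
   thus "(FV ?N \<circ> (%x. restrict (%i. \<zeta> ?N i x) ?I)) x = FV ?N (%i. \<zeta> ?N i x)"
    unfolding FV_def comp_def by (auto intro!: arg_cong[where f=Max] image_cong)
  qed
  moreover have "FZ ?N \<circ> (%x. restrict (%i. \<zeta> ?N i x) ?J) = (%x. FZ ?N (%i. \<zeta> ?N i x))"
  proof
   fix x
   have "(\<Sum>l<j. restrict (%i. \<zeta> ?N i x) ?J (Suc (?N + l))) = (\<Sum>l<j. \<zeta> ?N (Suc (?N + l)) x)" if "j <= ?N" for j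
    using that by (intro sum.cong) auto
   thus "(FZ ?N \<circ> (%x. restrict (%i. \<zeta> ?N i x) ?J)) x = FZ ?N (%i. \<zeta> ?N i x)"
    unfolding FZ_def comp_def by (auto intro!: arg_cong[where f=Max] image_cong)
  qed
  ultimately show ?thesis by simp
 qed
 show ?thesis
 proof (rule indep_var_limit[OF ind])
  show "random_variable borel (%x. (running_max k X s x, X s x))"
   using s by (intro borel_measurable_Pair M_measurable X_measurable) auto
  show "random_variable borel (%x. (running_max k Y h x, W (s + h) x - W s x))"
   using s h by (intro borel_measurable_Pair running_max_measurable Y borel_measurable_diff W_measurable) auto
  show "AE x in M. (%n. FV (Suc n) (%i. \<zeta> (Suc n) i x)) ----> (running_max k X s x, X s x)"
   using X_equation AE_space
  proof eventually_elim
   case (elim x)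
   note c = X_continuous[OF elim(2)]
   have ev: "eventually (%N. \<forall>i\<le>N. norm (X (real i * (s / real N)) x - euler B (s / real N) i (%i. \<zeta> N i x)) <= e) sequentially" if "0 < e" for e
   proof (rule euler_tendsto_uniform[OF c B_lip K_nonneg s, where w="%t. W t x"])
    show "X t x = X 0 x + integral {0..t} (%s. B (X s x)) + W t x" if "0 <= t" for t
     using elim(1) that by blast
    show "\<zeta> N 0 x = X 0 x" for N by (simp add: \<zeta>_def)
    show "\<zeta> N (Suc i) x = W (real (Suc i) * (s / real N)) x - W (real i * (s / real N)) x" if "i < N" for N i
     using that by (simp add: \<zeta>_def \<tau>_def del: of_nat_Suc)
   qed fact
   have "(%N. Max ((%i. euler B (s / real N) i (%i. \<zeta> N i x) $ k) ` {..N})) ----> running_max k X s x"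
    unfolding running_max_eq
   proof (rule grid_max_tendsto[OF Xk_continuous[OF elim(2)]])
    fix e :: real assume "0 < e"
    from ev[OF this] show "eventually (%N. \<forall>i\<le>N. \<bar>euler B (s / real N) i (%i. \<zeta> N i x) $ k - X (real i * s / real N) x $ k\<bar> <= e) sequentially"
    proof eventually_elim
     case (elim N)
     show ?case
     proof (intro allI impI)
      fix i assume i: "i <= N"
      have "\<bar>(X (real i * (s / real N)) x - euler B (s / real N) i (%i. \<zeta> N i x)) $ k\<bar> <= e"
       using elim i component_le_norm_cart order_trans by blast
      thus "\<bar>euler B (s / real N) i (%i. \<zeta> N i x) $ k - X (real i * s / real N) x $ k\<bar> <= e"
       by (simp add: abs_minus_commute)
     qed
    qed
   qed (use s in auto)
   moreover have "(%N. euler B (s / real N) N (%i. \<zeta> N i x)) ----> X s x"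
    unfolding tendsto_iff
   proof (intro allI impI)
    fix e :: real assume "0 < e"
    hence "0 < e / 2" by simp
    from ev[OF this] eventually_gt_at_top[of "0::nat"]
    show "eventually (%N. dist (euler B (s / real N) N (%i. \<zeta> N i x)) (X s x) < e) sequentially"
    proof eventually_elim
     case (elim N)
     hence "norm (X (real N * (s / real N)) x - euler B (s / real N) N (%i. \<zeta> N i x)) <= e / 2" by auto
     thus ?case using elim \<open>0 < e\<close> by (simp add: dist_norm norm_minus_commute)
    qed
   qed
   ultimately have "(%N. FV N (%i. \<zeta> N i x)) ----> (running_max k X s x, X s x)"
    unfolding FV_def by (rule tendsto_Pair)
   thus ?case by (rule LIMSEQ_Suc)
  qed
  show "AE x in M. (%n. FZ (Suc n) (%i. \<zeta> (Suc n) i x)) ----> (running_max k Y h x, W (s + h) x - W s x)"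
   using Y(3) AE_space
  proof eventually_elim
   case (elim x)
   have tel: "(\<Sum>l<j. \<zeta> (Suc n) (Suc (Suc n + l)) x) = Y (real j * (h / real (Suc n))) x" for n j
   proof -
    have "(\<Sum>l<j. \<zeta> (Suc n) (Suc (Suc n + l)) x) = (\<Sum>l<j. W (\<tau> (Suc n) (Suc n + Suc l)) x - W (\<tau> (Suc n) (Suc n + l)) x)"
     by (intro sum.cong) (auto simp: \<zeta>_def)
    also have "... = W (\<tau> (Suc n) (Suc n + j)) x - W (\<tau> (Suc n) (Suc n + 0)) x"
     by (rule sum_lessThan_telescope)
    also have "... = Y (real j * (h / real (Suc n))) x"
     using elim(1) h by (subst (1 2) \<tau>N) auto
    finally show ?thesis .
   qed
   have "(%N. Max ((%j. Y (real j * h / real N) x $ k) ` {..N})) ----> running_max k Y h x"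
    unfolding running_max_eq
    by (rule grid_max_tendsto) (use Y(1)[OF elim(2)] h in \<open>auto intro!: continuous_intros\<close>)
   from LIMSEQ_Suc[OF this]
   have "(%n. Max ((%j. (\<Sum>l<j. \<zeta> (Suc n) (Suc (Suc n + l)) x) $ k) ` {..Suc n})) ----> running_max k Y h x"
    unfolding tel by simp
   moreover have "(\<Sum>l<Suc n. \<zeta> (Suc n) (Suc (Suc n + l)) x) = W (s + h) x - W s x" for n
    unfolding tel using elim(1) h by simp
   ultimately show ?case unfolding FZ_def by (simp add: tendsto_Pair)
  qed
 qed
qed

end

text \<open>Sampling at the next grid point gives measurable approximations, and continuity of the
  paths passes to the limit. Times before 0, where nothing is known, are frozen at 0.\<close>

lemma process_measurable:
 fixes Y :: "real => 'w => 'b::euclidean_space"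
 assumes c: "!!x. x \<in> space M ==> continuous_on {0..} (%t. Y t x)" and m: "!!t. 0 <= t ==> Y t \<in> borel_measurable M"
 shows "(%z. Y (max 0 (fst z)) (snd z)) \<in> borel_measurable (borel \<Otimes>\<^sub>M M)"
proof (rule borel_measurable_LIMSEQ_metric)
 let ?q = "%n s. nat \<lceil>max 0 s * real (Suc n)\<rceil>"
 show "(%z. Y (real (?q n (fst z)) / real (Suc n)) (snd z)) \<in> borel_measurable (borel \<Otimes>\<^sub>M M)" for n
 proof (rule measurable_compose_countable[where g="%z. ?q n (fst z)" and f="%i z. Y (real i / real (Suc n)) (snd z)"])
  show "(%z. Y (real i / real (Suc n)) (snd z)) \<in> borel_measurable (borel \<Otimes>\<^sub>M M)" for i
   by (rule measurable_compose[OF measurable_snd m]) auto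
 qed measurable
 fix z :: "real \<times> 'w" assume z: "z \<in> space (borel \<Otimes>\<^sub>M M)"
 let ?s = "max 0 (fst z)"
 have lim: "(%n. real (?q n (fst z)) / real (Suc n)) ----> ?s"
 proof (rule tendsto_sandwich[where f="%_. ?s" and h="%n. ?s + 1 / real (Suc n)"])
  have q: "?s * real (Suc n) <= real (?q n (fst z)) \<and> real (?q n (fst z)) <= ?s * real (Suc n) + 1" for n
  proof -
   have "0 <= ?s * real (Suc n)" by (intro mult_nonneg_nonneg) auto
   thus ?thesis by linarith
  qed
  show "eventually (%n. ?s <= real (?q n (fst z)) / real (Suc n)) sequentially"
   using q by (intro always_eventually allI mult_imp_le_div_pos) (simp_all only: of_nat_0_less_iff zero_less_Suc)
  show "eventually (%n. real (?q n (fst z)) / real (Suc n) <= ?s + 1 / real (Suc n)) sequentially"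
  proof (intro always_eventually allI mult_imp_div_pos_le)
   fix n
   have "(?s + 1 / real (Suc n)) * real (Suc n) = ?s * real (Suc n) + 1" by (simp add: distrib_right del: of_nat_Suc)
   thus "real (?q n (fst z)) <= (?s + 1 / real (Suc n)) * real (Suc n)" using q[of n] by linarith
  qed simp
  have "(%n. ?s + 1 / real (Suc n)) ----> ?s + 0"
   by (intro tendsto_intros LIMSEQ_Suc[OF lim_const_over_n])
  thus "(%n. ?s + 1 / real (Suc n)) ----> ?s" by simp
 qed simp
 show "(%n. Y (real (?q n (fst z)) / real (Suc n)) (snd z)) ----> Y ?s (snd z)"
 proof (rule continuous_on_tendsto_compose[OF c lim])
  show "snd z \<in> space M" using z by (auto simp: space_pair_measure)
  show "eventually (%n. real (?q n (fst z)) / real (Suc n) \<in> {0..}) sequentially"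
   by (intro always_eventually allI) (simp only: atLeast_iff divide_nonneg_nonneg of_nat_0_le_iff)
 qed auto
qed

text \<open>By monotonicity any two such times differ by at most \<open>h\<close>, so all of them
  fit into an interval of that length. This balances the \<open>1 / h\<close> of a difference
  quotient.\<close>

lemma crossing_time_measure:
 fixes m :: "real => real"
 assumes m: "!!s r. 0 <= s ==> s <= r ==> m s <= m r" and h: "0 < h" and [measurable]: "{s \<in> {0<..<t}. m s < c \<and> c <= m (s + h)} \<in> sets borel"
 shows "emeasure lborel {s \<in> {0<..<t}. m s < c \<and> c <= m (s + h)} <= ennreal h"
proof (cases "{s \<in> {0<..<t}. m s < c \<and> c <= m (s + h)} = {}")
 case False
 let ?S = "{s \<in> {0<..<t}. m s < c \<and> c <= m (s + h)}"
 have bdd: "bdd_below ?S" by (rule bdd_belowI[of _ 0]) auto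
 have "s <= r + h" if "s \<in> ?S" "r \<in> ?S" for s r
 proof (rule ccontr)
  assume "\<not> s <= r + h"
  hence "m (r + h) <= m s" using that h by (intro m) auto
  thus False using that by auto
 qed
 hence "s - h <= Inf ?S" if "s \<in> ?S" for s
  using that False by (intro cInf_greatest) (auto simp: algebra_simps)
 hence "?S \<subseteq> {Inf ?S..Inf ?S + h}"
  using cInf_lower[OF _ bdd] by (auto simp: algebra_simps)
 hence "emeasure lborel ?S <= emeasure lborel {Inf ?S..Inf ?S + h}"
  by (intro emeasure_mono) auto
 thus ?thesis using h by simp
next
 case True
 show ?thesis unfolding True by simp
qed

context diffusion begin

text \<open>Freezing at negative times makes both processes jointly measurable on the whole real
  line, over which the time integrals are taken.\<close>

definition MX :: "real => 'w => real" where "MX s x = running_max k X (max 0 s) x"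
definition XX :: "real => 'w => real ^ 'd" where "XX s x = X (max 0 s) x"

abbreviation (input) "X_incr x \<equiv> \<forall>s\<ge>0. \<forall>h\<ge>0. XX (s + h) x = XX s x + integral {s..s + h} (%r. B (X r x)) + (W (s + h) x - W s x)"

lemma MX_eq: "0 <= s ==> MX s = running_max k X s" and XX_eq: "0 <= s ==> XX s = X s"
 by (auto simp: MX_def XX_def fun_eq_iff)

lemma running_max_continuous: "x \<in> space M ==> continuous_on {0..} (%t. running_max k X t x)"
 unfolding running_max_eq by (intro rmax_continuous Xk_continuous)

lemma MX_measurable2: "(%z. MX (fst z) (snd z)) \<in> borel_measurable (borel \<Otimes>\<^sub>M M)"
 unfolding MX_def by (intro process_measurable running_max_continuous M_measurable)

lemma XX_measurable2: "(%z. XX (fst z) (snd z)) \<in> borel_measurable (borel \<Otimes>\<^sub>M M)"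
 unfolding XX_def by (intro process_measurable X_continuous X_measurable)

lemma MX_measurable [measurable (raw)]:
 assumes [measurable]: "f \<in> borel_measurable N" "g \<in> measurable N M"
 shows "(%x. MX (f x) (g x)) \<in> borel_measurable N"
proof -
 have "(%x. (f x, g x)) \<in> measurable N (borel \<Otimes>\<^sub>M M)" by measurable
 from measurable_compose[OF this MX_measurable2] show ?thesis by simp
qed

lemma XX_measurable [measurable (raw)]:
 assumes [measurable]: "f \<in> borel_measurable N" "g \<in> measurable N M"
 shows "(%x. XX (f x) (g x)) \<in> borel_measurable N"
proof -
 have "(%x. (f x, g x)) \<in> measurable N (borel \<Otimes>\<^sub>M M)" by measurable
 from measurable_compose[OF this XX_measurable2] show ?thesis by simp
qed

lemma MX_mono: "x \<in> space M ==> s <= t ==> MX s x <= MX t x"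
 unfolding MX_def running_max_eq by (intro rmax_mono Xk_continuous) auto

lemma XX_le_MX: "x \<in> space M ==> XX s x $ k <= MX s x"
 unfolding MX_def XX_def running_max_eq by (rule rmax_ge[OF Xk_continuous]) auto

lemma XX_tendsto: "x \<in> space M ==> s ----> s0 ==> (%n. XX (s n) x) ----> XX s0 x"
 unfolding XX_def
 by (rule continuous_on_tendsto_compose[OF X_continuous]) (auto intro!: tendsto_intros)

lemma MX_tendsto: "x \<in> space M ==> s ----> s0 ==> (%n. MX (s n) x) ----> MX s0 x"
 unfolding MX_def
 by (rule continuous_on_tendsto_compose[OF running_max_continuous]) (auto intro!: tendsto_intros)

text \<open>The increment process is redefined on a null set so that every path is continuous, which
  makes its running maximum measurable.\<close>

lemma shifted_noise_ex:
 assumes s: "0 <= s"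
 obtains Y where "!!x. x \<in> space M ==> continuous_on {0..} (%t. Y t x)" "!!t. 0 <= t ==> Y t \<in> borel_measurable M"
   "AE x in M. \<forall>r\<ge>0. Y r x = W (s + r) x - W s x" "!!x. x \<in> space M ==> Y 0 x = (0 :: real ^ 'd)"
proof -
 from AE_E[OF W_paths] obtain N where N: "{x \<in> space M. \<not> (W 0 x = 0 \<and> continuous_on {0..} (%t. W t x))} \<subseteq> N"
  "emeasure M N = 0" "N \<in> sets M" by blast
 let ?Y = "%r x. if x \<in> N then 0 else W (s + r) x - W s x"
 show ?thesis
 proof (rule that[of ?Y])
  show "continuous_on {0..} (%t. ?Y t x)" if "x \<in> space M" for x
  proof (cases "x \<in> N")
   case False
   hence "continuous_on {0..} (%t. W t x)" using N that by auto
   hence "continuous_on {0..} (%t. W (s + t) x)"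
    by (rule continuous_on_compose2) (use s in \<open>auto intro!: continuous_intros\<close>)
   thus ?thesis using False by (auto intro!: continuous_intros)
  qed auto
  show "?Y t \<in> borel_measurable M" if "0 <= t" for t
  proof -
   have [measurable]: "W (s + t) \<in> borel_measurable M" "W s \<in> borel_measurable M" "N \<in> sets M"
    using s that N by (auto intro!: W_measurable)
   show ?thesis by measurable
  qed
  have "AE x in M. x \<notin> N" using N by (intro AE_not_in) auto
  thus "AE x in M. \<forall>r\<ge>0. ?Y r x = W (s + r) x - W s x" by eventually_elim auto
 qed auto
qed

lemma indep_increment_expectation:
 assumes s: "0 < s" and h: "0 < h" and \<Psi> [measurable]: "\<Psi> \<in> borel_measurable borel" and bd: "!!v. \<bar>\<Psi> v\<bar> <= C"
 shows "(LINT p|M. \<Psi> ((MX s p, XX s p), W (s + h) p - W s p))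
  = (LINT p|M. (LBINT w. gd h w * \<Psi> ((MX s p, XX s p), w)))"
proof -
 obtain Y where Y: "!!p. p \<in> space M ==> continuous_on {0..} (%t. Y t p)" "!!t. 0 <= t ==> Y t \<in> borel_measurable M"
   "AE p in M. \<forall>r\<ge>0. Y r p = W (s + r) p - W s p"
  by (rule shifted_noise_ex[OF less_imp_le[OF s]]) blast
 let ?V = "%p. (MX s p, XX s p)" and ?Z = "%p. (running_max k Y h p, W (s + h) p - W s p)"
 have ind: "indep_var borel ?V borel ?Z"
  using indep_past_future[OF s h Y] s by (simp add: MX_eq XX_eq)
 have vm [measurable]: "?V \<in> borel_measurable M" "?Z \<in> borel_measurable M"
  using ind by (auto dest: indep_var_rv1 indep_var_rv2)
 have dW [measurable]: "(%p. W (s + h) p - W s p) \<in> borel_measurable M"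
  using s h by (intro borel_measurable_diff W_measurable) auto
 interpret PV: prob_space "distr M borel ?V" by (rule prob_space_distr) simp
 interpret PZ: prob_space "distr M borel ?Z" by (rule prob_space_distr) simp
 interpret P: pair_prob_space "distr M borel ?V" "distr M borel ?Z" ..
 have eq: "distr M borel ?V \<Otimes>\<^sub>M distr M borel ?Z = distr M (borel \<Otimes>\<^sub>M borel) (%p. (?V p, ?Z p))"
  using ind unfolding indep_var_distribution_eq by blast
 let ?\<Phi> = "%(v, z :: real \<times> (real ^ 'd)). \<Psi> (v, snd z)"
 have \<Phi>m: "?\<Phi> \<in> borel_measurable (borel \<Otimes>\<^sub>M borel)"
  unfolding case_prod_beta
  by (rule measurable_compose[OF _ \<Psi>])
   (rule borel_measurable_Pair[OF measurable_fst measurable_compose[OF measurable_snd borel_measurable_snd_borel]])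
 have \<Phi>i: "integrable (distr M borel ?V \<Otimes>\<^sub>M distr M borel ?Z) ?\<Phi>"
 proof (rule P.integrable_const_bound[where B=C])
  have "sets (distr M borel ?V \<Otimes>\<^sub>M distr M borel ?Z) = sets (borel \<Otimes>\<^sub>M borel)"
   by (intro sets_pair_measure_cong) auto
  thus "?\<Phi> \<in> borel_measurable (distr M borel ?V \<Otimes>\<^sub>M distr M borel ?Z)"
   using \<Phi>m by (subst measurable_cong_sets[OF _ HOL.refl])
 qed (use bd in auto)
 have "(LINT p|M. \<Psi> (?V p, snd (?Z p))) = (\<integral>x. ?\<Phi> x \<partial>distr M (borel \<Otimes>\<^sub>M borel) (%p. (?V p, ?Z p)))"
  by (subst integral_distr[OF measurable_Pair[OF vm] \<Phi>m]) simp
 also have "... = (\<integral>x. ?\<Phi> x \<partial>(distr M borel ?V \<Otimes>\<^sub>M distr M borel ?Z))" by (simp only: eq)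
 also have "... = (\<integral>v. (\<integral>z. ?\<Phi> (v, z) \<partial>distr M borel ?Z) \<partial>distr M borel ?V)"
  by (rule P.integral_fst'[symmetric, OF \<Phi>i])
 also have "... = (\<integral>v. (LBINT w. gd h w * \<Psi> (v, w)) \<partial>distr M borel ?V)"
 proof (rule lint_cong)
  fix v
  have D: "distributed M lborel (%p. W (s + h) p - W s p) (%x. ennreal (gd h x))"
   using W_increment_density[of s "s + h"] s h by simp
  have "(\<integral>z. ?\<Phi> (v, z) \<partial>distr M borel ?Z) = (LINT p|M. \<Psi> (v, W (s + h) p - W s p))"
   by (subst integral_distr) auto
  also have "... = (LBINT w. gd h w * \<Psi> (v, w))"
   using distributed_integral[OF D, of "%w. \<Psi> (v, w)"] h by simp
  finally show "(\<integral>z. ?\<Phi> (v, z) \<partial>distr M borel ?Z) = (LBINT w. gd h w * \<Psi> (v, w))" .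
 qed simp
 also have "... = (LINT p|M. (LBINT w. gd h w * \<Psi> (?V p, w)))"
  by (subst integral_distr) auto
 finally show ?thesis by simp
qed

lemma X_increment:
 "AE x in M. X_incr x"
 using X_equation AE_space
proof eventually_elim
 case (elim x)
 have cBx: "continuous_on {0..} (%s. B (X s x))"
  by (rule continuous_on_compose2[OF B_continuous X_continuous[OF elim(2)]]) auto
 show ?case
 proof (intro allI impI)
  fix s h :: real assume s: "0 <= s" and h: "0 <= h"
  have "integral {0..s} (%r. B (X r x)) + integral {s..s + h} (%r. B (X r x)) = integral {0..s + h} (%r. B (X r x))"
   using s h by (intro Henstock_Kurzweil_Integration.integral_combine integrable_continuous_interval continuous_on_subset[OF cBx]) auto
  moreover have "X (s + h) x = X 0 x + integral {0..s + h} (%s. B (X s x)) + W (s + h) x"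
   "X s x = X 0 x + integral {0..s} (%s. B (X s x)) + W s x"
   using elim(1) s h by (blast intro: add_nonneg_nonneg)+
  ultimately show "XX (s + h) x = XX s x + integral {s..s + h} (%r. B (X r x)) + (W (s + h) x - W s x)"
   using s h by (simp add: XX_eq algebra_simps)
 qed
qed

lemma drift_integral_bound:
 assumes "x \<in> space M" "0 <= s" "0 <= h"
 shows "norm (integral {s..s + h} (%r. B (X r x))) <= L * h"
proof -
 have cBx: "continuous_on {0..} (%s. B (X s x))"
  by (rule continuous_on_compose2[OF B_continuous X_continuous[OF assms(1)]]) auto
 have "norm (integral {s..s + h} (%r. B (X r x))) <= L * (s + h - s)"
  by (rule integral_bound) (use assms B_bound in \<open>auto intro!: continuous_on_subset[OF cBx]\<close>)
 thus ?thesis by simp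
qed

lemma drift_average_tendsto:
 assumes x: "x \<in> space M" and s: "0 <= s" and h: "h ----> 0" "!!n. 0 < h n"
 shows "(%n. (1 / h n) *\<^sub>R integral {s..s + h n} (%r. B (X r x))) ----> B (XX s x)"
proof (rule LIMSEQ_I)
 fix e :: real assume e: "0 < e"
 have cBx: "continuous_on {0..} (%s. B (X s x))"
  by (rule continuous_on_compose2[OF B_continuous X_continuous[OF x]]) auto
 from cBx s e obtain d where d: "0 < d" "!!r. 0 <= r ==> dist r s < d ==> dist (B (X r x)) (B (X s x)) < e / 2"
  unfolding continuous_on_iff by (metis atLeast_iff half_gt_zero)
 have "eventually (%n. h n < d) sequentially" using h(1) d(1) by (intro order_tendstoD)
 hence "eventually (%n. norm ((1 / h n) *\<^sub>R integral {s..s + h n} (%r. B (X r x)) - B (XX s x)) < e) sequentially"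
 proof eventually_elim
  case (elim n)
  note hn = h(2)[of n]
  have "integral {s..s + h n} (%r. B (X r x)) - h n *\<^sub>R B (X s x) = integral {s..s + h n} (%r. B (X r x) - B (X s x))"
   using s hn by (subst Henstock_Kurzweil_Integration.integral_diff) (auto intro!: integrable_continuous_interval continuous_on_subset[OF cBx])
  moreover have "norm (integral {s..s + h n} (%r. B (X r x) - B (X s x))) <= e / 2 * (s + h n - s)"
  proof (rule integral_bound)
   show "continuous_on {s..s + h n} (%r. B (X r x) - B (X s x))"
    using s by (intro continuous_intros continuous_on_subset[OF cBx]) auto
   show "norm (B (X r x) - B (X s x)) <= e / 2" if "r \<in> {s..s + h n}" for r
    using d(2)[of r] that s elim by (simp add: dist_norm)
  qed (use hn in auto)
  ultimately have "norm (integral {s..s + h n} (%r. B (X r x)) - h n *\<^sub>R B (X s x)) <= e / 2 * h n" by simp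
  moreover have eq: "(1 / h n) *\<^sub>R integral {s..s + h n} (%r. B (X r x)) - B (XX s x) = (1 / h n) *\<^sub>R (integral {s..s + h n} (%r. B (X r x)) - h n *\<^sub>R B (X s x))"
   using hn s by (simp add: scaleR_right_diff_distrib XX_eq)
  moreover have "norm ((1 / h n) *\<^sub>R (integral {s..s + h n} (%r. B (X r x)) - h n *\<^sub>R B (X s x))) = norm (integral {s..s + h n} (%r. B (X r x)) - h n *\<^sub>R B (X s x)) / h n"
   using hn by simp
  ultimately have "norm ((1 / h n) *\<^sub>R integral {s..s + h n} (%r. B (X r x)) - B (XX s x)) <= e / 2"
   using hn by (simp only: pos_divide_le_eq)
  thus ?case using e by linarith
 qed
 thus "\<exists>no. \<forall>n\<ge>no. norm ((1 / h n) *\<^sub>R integral {s..s + h n} (%r. B (X r x)) - B (XX s x)) < e"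
  unfolding eventually_sequentially .
qed

end

section \<open>The Duhamel formula up to the first passage\<close>

lemma integrable_inverse_sqrt:
 assumes "0 < t" shows "integrable lborel (%s. ind t s * (1 / sqrt (t - s)))"
proof (rule integrableI_nonneg)
 have "(NN s. ennreal (ind t s * (1 / sqrt (t - s)))) = (NN s. ennreal (ind t s * (1 / sqrt s)))"
  by (subst nn_integral_time_reversal[symmetric, of _ t]) (auto intro!: nn_integral_cong simp: indicator_def)
 also have "... <= ennreal (2 * sqrt t)" using assms by (intro nn_integral_inverse_sqrt) auto
 finally show "(NN s. ennreal (ind t s * (1 / sqrt (t - s)))) < \<infinity>"
  by (simp add: order_le_less_trans)
qed (auto simp: indicator_def)

context diffusion begin

context
 fixes c C t \<epsilon> :: real and g :: "real ^ 'd => real"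
 assumes g_meas [measurable]: "g \<in> borel_measurable borel" and g_bd: "!!x. \<bar>g x\<bar> <= C" and t: "0 < t" and \<epsilon>: "0 < \<epsilon>"
begin

interpretation G: bounded_borel_fun "odd_ext k c g" C
 by unfold_locales (measurable, rule odd_ext_bound, rule g_bd)

abbreviation "uh \<equiv> heat (odd_ext k c g)"

text \<open>The time left until \<open>t + \<epsilon>\<close>, which keeps the heat flow smooth up
  to \<open>s = t\<close>. Clipping at \<open>\<epsilon> / 2\<close> makes it positive for every
  \<open>s\<close>; for \<open>s < t\<close> and steps below \<open>\<epsilon> / 2\<close> it is
  inactive.\<close>

definition tau :: "real => real" where "tau s = max (\<epsilon> / 2) (t + \<epsilon> - s)"

lemma tau_pos: "0 < tau s" "\<epsilon> / 2 <= tau s" using \<epsilon> by (auto simp: tau_def)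

lemma tau_measurable [measurable]: "tau \<in> borel_measurable borel" unfolding tau_def by measurable

text \<open>The absorbed heat flow evaluated along the surviving path. Without drift this would be
  constant on \<open>[0, t]\<close>, so its increments isolate the effect of the drift.\<close>

definition gam :: "real => real" where
 "gam s = (LINT x|M. (if MX s x < c then uh (tau s) (XX s x) else 0))"

definition hs :: "nat => real" where "hs n = \<epsilon> / (2 * (real n + 2))"

lemma hs: "0 < hs n" "hs n < \<epsilon> / 2" "hs ----> 0"
proof -
 show "0 < hs n" using \<epsilon> by (simp add: hs_def)
 show "hs n < \<epsilon> / 2" unfolding hs_def using \<epsilon> by (intro divide_strict_left_mono) auto
 have "(%n. (\<epsilon> / 2) * (1 / real (n + 2))) ----> (\<epsilon> / 2) * 0"
  by (intro tendsto_intros LIMSEQ_ignore_initial_segment[OF lim_const_over_n])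
 thus "hs ----> 0" by (simp add: hs_def[abs_def] algebra_simps)
qed

lemma gam_measurable [measurable]: "gam \<in> borel_measurable borel"
 unfolding gam_def by measurable

lemma gam_bound: "\<bar>gam s\<bar> <= C"
proof -
 have "\<bar>gam s\<bar> <= (LINT x|M. \<bar>if MX s x < c then uh (tau s) (XX s x) else 0\<bar>)"
  unfolding gam_def using integral_norm_bound[of M "%x. if MX s x < c then uh (tau s) (XX s x) else 0"] by simp
 also have "... <= C"
  using G.heat_bound[OF tau_pos(1)] G.C_nonneg by (intro integral_le_const integrable_const_bound[where B=C]) auto
 finally show ?thesis .
qed

text \<open>Survival is right-continuous in time: a maximum below \<open>c\<close> stays below for a
  while, and one at or above \<open>c\<close> never comes back. From the left it jumps at the first
  passage.\<close>

lemma gam_right: assumes "0 <= s0" shows "(gam \<longlongrightarrow> gam s0) (at_right s0)"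
proof (rule tendsto_at_right_sequentially[where b="s0 + 1"])
 fix S :: "nat => real" assume S: "!!n. s0 < S n" "S ----> s0"
 show "(%n. gam (S n)) ----> gam s0"
  unfolding gam_def
 proof (rule integral_dominated_convergence[where w="%_. C"])
  show "AE x in M. (%n. if MX (S n) x < c then uh (tau (S n)) (XX (S n) x) else 0) ----> (if MX s0 x < c then uh (tau s0) (XX s0 x) else 0)"
  proof (rule AE_I2)
   fix x assume x: "x \<in> space M"
   show "(%n. if MX (S n) x < c then uh (tau (S n)) (XX (S n) x) else 0) ----> (if MX s0 x < c then uh (tau s0) (XX s0 x) else 0)"
   proof (cases "MX s0 x < c")
    case True
    have "eventually (%n. MX (S n) x < c) sequentially"
     using MX_tendsto[OF x S(2)] True by (rule order_tendstoD)
    hence "eventually (%n. uh (tau (S n)) (XX (S n) x) = (if MX (S n) x < c then uh (tau (S n)) (XX (S n) x) else 0)) sequentially"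
     by eventually_elim auto
    moreover have "(%n. uh (tau (S n)) (XX (S n) x)) ----> uh (tau s0) (XX s0 x)"
     using S(2) by (intro G.heat_tendsto XX_tendsto[OF x] tau_pos) (auto simp: tau_def intro!: tendsto_intros)
    ultimately show ?thesis using True by (auto elim: Lim_transform_eventually)
   next
    case False
    have "MX s0 x <= MX (S n) x" for n using MX_mono[OF x] S(1)[of n] by auto
    hence "\<not> MX (S n) x < c" for n using False by (meson leD leI order_trans)
    thus ?thesis using False by simp
   qed
  qed
  show "AE x in M. norm (if MX (S n) x < c then uh (tau (S n)) (XX (S n) x) else 0) <= C" for n
   using G.heat_bound[OF tau_pos(1)] G.C_nonneg by (intro AE_I2) auto
 qed auto
qed auto

text \<open>The loss over one step due to paths that reach \<open>c\<close>. It tends to 0 because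
  the heat flow vanishes at the boundary.\<close>

definition cross :: "nat => real => 'w => real" where
 "cross n s x = (if MX s x < c \<and> c <= MX (s + hs n) x then uh (tau (s + hs n)) (XX (s + hs n) x) / hs n else 0)"

definition diffq :: "nat => real => 'w => real" where
 "diffq n s x = (if MX s x < c then (uh (tau (s + hs n)) (XX (s + hs n) x) - uh (tau (s + hs n)) (XX s x + (W (s + hs n) x - W s x))) / hs n else 0)"

lemma cross_measurable [measurable]: "(%z. cross n (fst z) (snd z)) \<in> borel_measurable (lborel \<Otimes>\<^sub>M M)"
 unfolding cross_def by measurable

lemma cross_bound: "\<bar>cross n s x\<bar> <= C / hs n"
 using G.heat_bound[OF tau_pos(1)] G.C_nonneg hs(1)[of n] by (auto simp: cross_def intro!: divide_right_mono)

text \<open>By independence and the semigroup property, \<open>gam s\<close> is already the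
  expectation at \<open>X s\<close> displaced by the noise, with the later time left. The noise thus
  drops out of the increment, and only drift and crossings remain.\<close>

lemma gam_increment:
 assumes s: "0 < s" "s < t"
 shows "(gam (s + hs n) - gam s) / hs n = (LINT x|M. diffq n s x) - (LINT x|M. cross n s x)"
proof -
 note h = hs(1)[of n] hs(2)[of n]
 have dW [measurable]: "(%x. W (s + hs n) x - W s x) \<in> borel_measurable M"
  using s h by (intro borel_measurable_diff W_measurable) auto
 have \<tau>: "tau (s + hs n) + hs n = tau s" using s h \<epsilon> by (auto simp: tau_def)
 let ?\<Psi> = "%z :: (real \<times> (real ^ 'd)) \<times> (real ^ 'd). if fst (fst z) < c then uh (tau (s + hs n)) (snd (fst z) + snd z) else 0"
 let ?b = "%x. if MX s x < c then uh (tau (s + hs n)) (XX s x + (W (s + hs n) x - W s x)) else 0"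
 have "(LINT x|M. ?b x) = (LINT x|M. ?\<Psi> ((MX s x, XX s x), W (s + hs n) x - W s x))" by (simp only: fst_conv snd_conv)
 also have "... = (LINT x|M. (LBINT w. gd (hs n) w * ?\<Psi> ((MX s x, XX s x), w)))"
  using s h G.heat_bound[OF tau_pos(1)] G.C_nonneg by (intro indep_increment_expectation[where C=C]) auto
 also have "... = gam s"
  unfolding gam_def
 proof (rule lint_cong)
  fix x
  show "(LBINT w. gd (hs n) w * ?\<Psi> ((MX s x, XX s x), w)) = (if MX s x < c then uh (tau s) (XX s x) else 0)"
   using G.heat_semigroup[OF h(1) tau_pos(1), of "s + hs n" "XX s x"] unfolding \<tau> by simp
 qed simp
 finally have g0: "gam s = (LINT x|M. ?b x)" ..
 let ?a = "%x. if MX (s + hs n) x < c then uh (tau (s + hs n)) (XX (s + hs n) x) else 0"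
 have ia: "integrable M ?a" and ib: "integrable M ?b" and ic: "integrable M (cross n s)"
  using G.heat_bound[OF tau_pos(1)] G.C_nonneg cross_bound
  by (intro integrable_const_bound[where B=C] integrable_const_bound[where B="C / hs n"]; auto simp: cross_def[abs_def])+
 have "diffq n s x = (?a x - ?b x) / hs n + cross n s x" if "x \<in> space M" for x
  using MX_mono[OF that, of s "s + hs n"] h by (auto simp: diffq_def cross_def diff_divide_distrib)
 hence "(LINT x|M. diffq n s x) = (LINT x|M. (?a x - ?b x) / hs n + cross n s x)"
  by (intro lint_cong) auto
 also have "... = ((LINT x|M. ?a x) - (LINT x|M. ?b x)) / hs n + (LINT x|M. cross n s x)"
  using ia ib ic by simp
 finally show ?thesis using g0 by (simp add: gam_def)
qed

definition D0 :: "real => real" where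
 "D0 s = (LINT x|M. (if MX s x < c then dheat (odd_ext k c g) (t + \<epsilon> - s) (XX s x) (B (XX s x)) else 0))"

lemma diffq_bound:
 assumes s: "0 <= s" and p: "p \<in> space M"
  and X: "X_incr p"
 shows "\<bar>diffq n s p\<bar> <= G.KH * L / sqrt (\<epsilon> / 2)"
proof -
 note h = hs(1)[of n]
 let ?x = "XX s p + (W (s + hs n) p - W s p)" and ?v = "integral {s..s + hs n} (%r. B (X r p))"
 have "XX (s + hs n) p = XX s p + ?v + (W (s + hs n) p - W s p)"
  using X s less_imp_le[OF h] by blast
 hence XX: "XX (s + hs n) p = ?x + ?v" by (simp add: algebra_simps)
 have "\<bar>uh (tau (s + hs n)) (?x + ?v) - uh (tau (s + hs n)) ?x\<bar> <= G.KH * norm ?v / sqrt (tau (s + hs n))"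
  by (rule G.heat_lipschitz[OF tau_pos(1)])
 also have "... <= G.KH * (L * hs n) / sqrt (\<epsilon> / 2)"
  using drift_integral_bound[OF p s less_imp_le[OF h]] tau_pos(2)[of "s + hs n"] G.KH_nonneg \<epsilon> L_nonneg h
  by (intro frac_le mult_left_mono) auto
 finally have "\<bar>uh (tau (s + hs n)) (?x + ?v) - uh (tau (s + hs n)) ?x\<bar> / hs n <= G.KH * (L * hs n) / sqrt (\<epsilon> / 2) / hs n"
  using h by (intro divide_right_mono) auto
 also have "... = G.KH * L / sqrt (\<epsilon> / 2)" using h by simp
 finally have "\<bar>uh (tau (s + hs n)) (?x + ?v) - uh (tau (s + hs n)) ?x\<bar> / hs n <= G.KH * L / sqrt (\<epsilon> / 2)" .
 moreover have "0 <= G.KH * L / sqrt (\<epsilon> / 2)" using G.KH_nonneg L_nonneg \<epsilon> by simp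
 ultimately show ?thesis using h by (simp add: diffq_def XX)
qed

lemma diffq_tendsto:
 assumes s: "0 < s" "s < t"
 shows "(%n. \<integral>p. diffq n s p \<partial>M) ----> D0 s"
 unfolding D0_def
proof (rule integral_dominated_convergence[where w="%_. G.KH * L / sqrt (\<epsilon> / 2)"])
 show "AE p in M. norm (diffq n s p) <= G.KH * L / sqrt (\<epsilon> / 2)" for n
  using X_increment AE_space by eventually_elim (use s diffq_bound in auto)
 have "(%p. W (s + hs n) p - W s p) \<in> borel_measurable M" for n
  using s hs(1)[of n] by (intro borel_measurable_diff W_measurable) auto
 thus "diffq n s \<in> borel_measurable M" for n
  unfolding diffq_def[abs_def] by measurable
 show "AE p in M. (%n. diffq n s p) ----> (if MX s p < c then dheat (odd_ext k c g) (t + \<epsilon> - s) (XX s p) (B (XX s p)) else 0)"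
  using X_increment AE_space W_paths
 proof eventually_elim
  case (elim p)
  show ?case
  proof (cases "MX s p < c")
   case True
   let ?x = "%n. XX s p + (W (s + hs n) p - W s p)" and ?b = "%n. (1 / hs n) *\<^sub>R integral {s..s + hs n} (%r. B (X r p))"
   have XX: "XX (s + hs n) p = ?x n + hs n *\<^sub>R ?b n" for n
   proof -
    have "XX (s + hs n) p = XX s p + integral {s..s + hs n} (%r. B (X r p)) + (W (s + hs n) p - W s p)"
     using elim(1) s hs(1)[of n] by (meson less_imp_le)
    thus ?thesis using hs(1)[of n] by (simp add: algebra_simps)
   qed
   have "(%n. W (s + hs n) p) ----> W (s + 0) p"
   proof (rule continuous_on_tendsto_compose[of "{0..}" "%t. W t p"])
    show "(%n. s + hs n) ----> s + 0" by (intro tendsto_intros hs)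
    show "eventually (%n. s + hs n \<in> {0..}) sequentially"
     using s hs(1) by (intro always_eventually allI) (simp add: add_nonneg_nonneg less_imp_le)
   qed (use elim(3) s in auto)
   hence x: "?x ----> XX s p" by (auto intro!: tendsto_eq_intros)
   have "(%n. (uh (tau (s + hs n)) (?x n + hs n *\<^sub>R ?b n) - uh (tau (s + hs n)) (?x n)) / hs n) ----> dheat (odd_ext k c g) (tau (s + 0)) (XX s p) (B (XX s p))"
   proof (rule G.heat_difference_quotient[OF hs(3) _ drift_average_tendsto[OF elim(2) _ hs(3,1)] x])
    show "(%n. tau (s + hs n)) ----> tau (s + 0)" unfolding tau_def by (intro tendsto_intros hs(3))
    show "hs n \<noteq> 0" for n using hs(1)[of n] by simp
   qed (use s tau_pos in auto)
   moreover have "tau (s + 0) = t + \<epsilon> - s" using s \<epsilon> by (simp add: tau_def)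
   ultimately show ?thesis using True by (simp add: diffq_def XX)
  qed (simp add: diffq_def)
 qed
qed auto

lemma D0_measurable [measurable]: "D0 \<in> borel_measurable borel"
 unfolding D0_def by measurable

text \<open>The times at which one path contributes have measure at most \<open>hs n\<close>,
  against the factor \<open>1 / hs n\<close> in \<open>cross\<close>.\<close>

lemma cross_path_bound:
 assumes x: "x \<in> space M" and \<delta>: "0 <= \<delta>"
  and bd: "!!s. 0 < s ==> s < t ==> MX s x < c ==> c <= MX (s + hs n) x ==> \<bar>uh (tau (s + hs n)) (XX (s + hs n) x)\<bar> <= \<delta>"
 shows "\<bar>LBINT s. ind t s * cross n s x\<bar> <= \<delta>"
proof -
 note h = hs(1)[of n]
 let ?S = "{s \<in> {0<..<t}. MX s x < c \<and> c <= MX (s + hs n) x}"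
 have const: "(%_. x) \<in> measurable borel M" using x by simp
 have [measurable]: "(%s. MX s x) \<in> borel_measurable borel" "(%s. MX (s + hs n) x) \<in> borel_measurable borel" "(%s. XX (s + hs n) x) \<in> borel_measurable borel"
  by (intro MX_measurable XX_measurable const; measurable)+
 have S: "?S \<in> sets borel" by measurable
 have eS: "emeasure lborel ?S <= ennreal (hs n)"
  by (rule crossing_time_measure[OF _ h S]) (rule MX_mono[OF x])
 hence fS: "emeasure lborel ?S < \<infinity>" by (simp add: order_le_less_trans)
 have i: "integrable lborel (%s. \<delta> / hs n * indicator ?S s)"
  using S fS by (intro integrable_mult_right integrable_real_indicator) auto
 have pw: "\<bar>ind t s * cross n s x\<bar> <= \<delta> / hs n * indicator ?S s" for s
  using bd[of s] h \<delta> by (auto simp: cross_def indicator_def intro!: divide_right_mono)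
 have meas: "(%s. ind t s * cross n s x) \<in> borel_measurable lborel"
  unfolding cross_def indicator_def greaterThanLessThan_iff by measurable
 have i2: "integrable lborel (%s. ind t s * cross n s x)"
  by (rule lint_bound[OF i meas])
   (rule AE_I2, simp only: real_norm_def, rule order_trans[OF pw abs_ge_self])
 have "\<bar>LBINT s. ind t s * cross n s x\<bar> <= (LBINT s. \<bar>ind t s * cross n s x\<bar>)"
  using integral_norm_bound[of lborel "%s. ind t s * cross n s x"] by simp
 also have "... <= (LBINT s. \<delta> / hs n * indicator ?S s)"
  by (intro integral_mono integrable_abs i i2 pw)
 also have "... = \<delta> / hs n * measure lborel ?S" using S by simp
 also have "... <= \<delta> / hs n * hs n"
  using eS h \<delta> by (intro mult_left_mono) (auto simp: measure_def enn2real_leI)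
 also have "... = \<delta>" using h by simp
 finally show ?thesis .
qed

lemma crossing_position:
 assumes x: "x \<in> space M" and s: "0 <= s" and h: "0 <= h" and cr: "MX s x < c" "c <= MX (s + h) x"
 obtains q where "s <= q" "q <= s + h" "X q x $ k = c"
proof -
 obtain r where r: "0 <= r" "r <= s + h" "MX (s + h) x = X r x $ k"
  using rmax_attained[OF Xk_continuous[OF x], of "s + h" k] s h unfolding MX_def running_max_eq by auto
 have Xs: "X r x $ k <= MX s x" if "0 <= r" "r <= s" for r
  unfolding MX_def running_max_eq using rmax_ge[OF Xk_continuous[OF x], of r "max 0 s" k] that by simp
 have rs: "s < r"
 proof (rule ccontr)
  assume "\<not> s < r"
  hence "X r x $ k <= MX s x" using r by (intro Xs) auto
  thus False using r cr by linarith
 qed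
 have "X s x $ k < c" using Xs[of s] s cr by simp
 hence "\<exists>q\<ge>s. q <= r \<and> X q x $ k = c"
  using rs r cr s by (intro IVT') (auto intro!: continuous_on_subset[OF Xk_continuous[OF x]])
 then obtain q where "s <= q" "q <= r" "X q x $ k = c" by blast
 thus ?thesis using r(2) by (intro that[of q]) auto
qed

text \<open>A path that reaches \<open>c\<close> during the step is still near the hyperplane at the
  end of it, by its modulus of continuity; there the heat flow is small, being Lipschitz and 0 on
  the hyperplane. Bounded convergence over the sample points concludes.\<close>

lemma cross_tendsto: "(%n. \<integral>s. ind t s * (LINT x|M. cross n s x) \<partial>lborel) ----> 0"
proof -
 interpret P: pair_sigma_finite lborel M ..
 have int: "integrable (lborel \<Otimes>\<^sub>M M) (%(s, x). ind t s * cross n s x)" for n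
 proof -
  have "integrable (lborel \<Otimes>\<^sub>M M) (%z. C / hs n * indicator ({0<..<t} \<times> space M) z)"
   using t by (intro integrable_mult_right integrable_real_indicator) (auto simp: emeasure_pair_measure_Times emeasure_space_1)
  thus ?thesis
  proof (rule lint_bound)
   show "(%(s, x). ind t s * cross n s x) \<in> borel_measurable (lborel \<Otimes>\<^sub>M M)"
    unfolding case_prod_beta indicator_def greaterThanLessThan_iff by measurable
   show "AE z in lborel \<Otimes>\<^sub>M M. norm (case z of (s, x) => ind t s * cross n s x) <= norm (C / hs n * indicator ({0<..<t} \<times> space M) z)"
    using cross_bound G.C_nonneg hs(1)[of n] by (intro AE_I2) (auto simp: indicator_def space_pair_measure)
  qed
 qed
 have eq: "(LBINT s. ind t s * (LINT x|M. cross n s x)) = (LINT x|M. (LBINT s. ind t s * cross n s x))" for n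
  using P.Fubini_integral[OF int[of n]] by simp
 have "(%n. \<integral>x. (LBINT s. ind t s * cross n s x) \<partial>M) ----> (LINT x|M. 0)"
 proof (rule integral_dominated_convergence[where w="%_. C"])
  show "(%x. \<integral>s. ind t s * cross n s x \<partial>lborel) \<in> borel_measurable M" for n
   using P.integrable_snd[OF int[of n]] by (rule borel_measurable_integrable)
  show "AE x in M. norm (LBINT s. ind t s * cross n s x) <= C" for n
   unfolding real_norm_def by (intro AE_I2 cross_path_bound G.C_nonneg G.heat_bound tau_pos)
  show "AE x in M. (%n. \<integral>s. ind t s * cross n s x \<partial>lborel) ----> 0"
  proof (rule AE_I2, rule LIMSEQ_I)
   fix x and e :: real assume x: "x \<in> space M" and e: "0 < e"
   \<comment> \<open>Chosen so that \<open>(G.KH + 1) * e' / sqrt (\<epsilon> / 2) = e / 2\<close>;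
     the added 1 avoids a division by 0.\<close>
   define e' where "e' = e / 2 * sqrt (\<epsilon> / 2) / (G.KH + 1)"
   have KH1: "0 < G.KH + 1" using G.KH_nonneg by simp
   have e': "0 < e'" using e \<epsilon> KH1 by (simp add: e'_def)
   obtain d where d: "0 < d" "!!r s. 0 <= r ==> r <= t + \<epsilon> ==> 0 <= s ==> s <= t + \<epsilon> ==> \<bar>r - s\<bar> < d ==> norm (X r x $ k - X s x $ k) < e'"
    using uniform_modulus[OF Xk_continuous[OF x] e', of "t + \<epsilon>" k] by metis
   have "eventually (%n. hs n < d) sequentially" using hs(3) d(1) by (intro order_tendstoD)
   hence "eventually (%n. norm ((LBINT s. ind t s * cross n s x) - 0) < e) sequentially"
   proof eventually_elim
    case (elim n)
    note h = hs(1)[of n] hs(2)[of n]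
    have "\<bar>LBINT s. ind t s * cross n s x\<bar> <= e / 2"
    proof (rule cross_path_bound[OF x])
     fix s assume s: "0 < s" "s < t" and cr: "MX s x < c" "c <= MX (s + hs n) x"
     obtain q where q: "s <= q" "q <= s + hs n" "X q x $ k = c"
      using crossing_position[OF x _ _ cr] s h by (metis less_imp_le)
     have "norm (X (s + hs n) x $ k - X q x $ k) < e'"
      using q s h elim \<epsilon> by (intro d(2)) auto
     hence ck: "\<bar>XX (s + hs n) x $ k - c\<bar> < e'" using q s h by (simp add: XX_eq)
     let ?v = "(XX (s + hs n) x $ k - c) *\<^sub>R axis k 1 :: real ^ 'd" and ?\<tau> = "tau (s + hs n)"
     have "uh ?\<tau> (XX (s + hs n) x - ?v) = 0"
      by (rule heat_odd_ext_boundary) (auto simp: axis_def)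
     hence "\<bar>uh ?\<tau> (XX (s + hs n) x)\<bar> <= G.KH * norm ?v / sqrt ?\<tau>"
      using G.heat_lipschitz[OF tau_pos(1), of "s + hs n" "XX (s + hs n) x - ?v" ?v] by (simp only: diff_add_cancel diff_zero)
     also have "... <= G.KH * e' / sqrt (\<epsilon> / 2)"
      using ck tau_pos(2)[of "s + hs n"] G.KH_nonneg \<epsilon> e' by (intro frac_le mult_left_mono) (auto simp: norm_axis_1)
     also have "... <= (G.KH + 1) * e' / sqrt (\<epsilon> / 2)"
      using e' \<epsilon> by (intro divide_right_mono mult_right_mono) auto
     also have "... = e / 2" 
     proof -
      have *: "a * (e / 2 * q / a) / q = e / 2" if "a \<noteq> 0" "q \<noteq> 0" for a q using that by (simp add: field_simps)
      show ?thesis unfolding e'_def by (rule *) (use KH1 \<epsilon> in auto)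
     qed
     finally show "\<bar>uh ?\<tau> (XX (s + hs n) x)\<bar> <= e / 2" .
    qed (use e in auto)
    thus ?case using e by simp
   qed
   thus "\<exists>no. \<forall>n\<ge>no. norm ((LBINT s. ind t s * cross n s x) - 0) < e"
    unfolding eventually_sequentially .
  qed
 qed auto
 thus ?thesis by (simp add: eq)
qed

lemma weak_duhamel_smoothed:
 "(LINT x|M. (if MX t x < c then uh \<epsilon> (XX t x) else 0))
  = (LINT x|M. (if MX 0 x < c then uh (t + \<epsilon>) (XX 0 x) else 0)) + (LBINT s. ind t s * D0 s)"
proof -
 let ?D = "%n s. (gam (s + hs n) - gam s) / hs n + (LINT x|M. cross n s x)"
 have cm [measurable]: "(%s. \<integral>x. cross n s x \<partial>M) \<in> borel_measurable borel" for n
  unfolding cross_def by measurable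
 define K1 where "K1 = G.KH * L / sqrt (\<epsilon> / 2)"
 have Db: "\<bar>?D n s\<bar> <= K1" if "0 < s" "s < t" for n s
 proof -
  have "?D n s = (LINT x|M. diffq n s x)" using gam_increment[OF that] by simp
  moreover have "\<bar>LINT x|M. diffq n s x\<bar> <= K1"
  proof -
   have b: "AE x in M. \<bar>diffq n s x\<bar> <= K1"
    using X_increment AE_space by eventually_elim (use that diffq_bound K1_def in auto)
   have "(%x. W (s + hs n) x - W s x) \<in> borel_measurable M"
    using that hs(1)[of n] by (intro borel_measurable_diff W_measurable) auto
   hence m: "diffq n s \<in> borel_measurable M"
    unfolding diffq_def[abs_def] by measurable
   have i: "integrable M (diffq n s)" by (rule integrable_const_bound[where B=K1]) (use b m in auto)
   have "\<bar>LINT x|M. diffq n s x\<bar> <= (LINT x|M. \<bar>diffq n s x\<bar>)"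
    using integral_norm_bound[of M "diffq n s"] by simp
   also have "... <= K1" using i b by (intro integral_le_const integrable_abs)
   finally show ?thesis .
  qed
  ultimately show ?thesis by simp
 qed
 have "(%n. \<integral>s. ind t s * ?D n s \<partial>lborel) ----> (LBINT s. ind t s * D0 s)"
 proof (rule integral_dominated_convergence[where w="%s. K1 * ind t s"])
  show "integrable lborel (%s. K1 * ind t s)"
   using t by (intro integrable_mult_right integrable_real_indicator) auto
  show "AE s in lborel. (%n. ind t s * ?D n s) ----> ind t s * D0 s"
  proof (rule AE_I2)
   fix s
   show "(%n. ind t s * ?D n s) ----> ind t s * D0 s"
   proof (cases "0 < s \<and> s < t")
    case True
    thus ?thesis using diffq_tendsto[of s] gam_increment[of s] by simp
   qed auto
  qed
  show "AE s in lborel. norm (ind t s * ?D n s) <= K1 * ind t s" for n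
   using Db by (intro AE_I2) (auto simp: indicator_def)
 qed (simp_all add: indicator_def greaterThanLessThan_iff)
 moreover have "(LBINT s. ind t s * ?D n s) = (LBINT s. ind t s * ((gam (s + hs n) - gam s) / hs n)) + (LBINT s. ind t s * (LINT x|M. cross n s x))" for n
 proof -
  have i1: "integrable lborel (%s. ind t s * ((gam (s + hs n) - gam s) / hs n))"
  proof (rule abs_integral_interval_le(1)[where K="2 * C / hs n"])
   show "\<bar>(gam (s + hs n) - gam s) / hs n\<bar> <= 2 * C / hs n" for s
   proof -
    have "\<bar>gam (s + hs n) - gam s\<bar> <= 2 * C" using gam_bound[of s] gam_bound[of "s + hs n"] by linarith
    thus ?thesis using hs(1)[of n] by (simp add: divide_right_mono)
   qed
  qed (use t G.C_nonneg hs(1)[of n] in auto)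
  have i2: "integrable lborel (%s. ind t s * (LINT x|M. cross n s x))"
  proof (rule abs_integral_interval_le(1)[where K="C / hs n"])
   show "\<bar>LINT x|M. cross n s x\<bar> <= C / hs n" for s
   proof -
    have "integrable M (cross n s)" using cross_bound by (intro integrable_const_bound[where B="C / hs n"]) (auto simp: cross_def[abs_def])
    thus ?thesis using cross_bound integral_norm_bound[of M "cross n s"]
     by (intro order_trans[OF _ integral_le_const[of "%x. \<bar>cross n s x\<bar>" "C / hs n"]]) auto
   qed
  qed (use t G.C_nonneg hs(1)[of n] in auto)
  show ?thesis using i1 i2 by (simp add: distrib_left)
 qed
 moreover have "(%n. (LBINT s. ind t s * ((gam (s + hs n) - gam s) / hs n)) + (LBINT s. ind t s * (LINT x|M. cross n s x))) ----> (gam t - gam 0) + 0"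
  by (intro tendsto_add cross_tendsto average_increment_tendsto[where C=C] gam_bound gam_right hs gam_measurable) (use t in auto)
 ultimately have "(LBINT s. ind t s * D0 s) = gam t - gam 0"
  using LIMSEQ_unique by fastforce
 moreover have "tau t = \<epsilon>" "tau 0 = t + \<epsilon>" using t \<epsilon> by (auto simp: tau_def)
 ultimately show ?thesis unfolding gam_def by (simp cong: if_cong)
qed

end

text \<open>The limit of the smoothed formula as \<open>\<epsilon>\<close> tends to 0, where the
  drift term stays dominated by a multiple of \<open>1 / sqrt (t - s)\<close>.\<close>

lemma weak_duhamel:
 assumes g: "continuous_on UNIV g" "!!x. \<bar>g x\<bar> <= C" and t: "0 < t"
 shows "(LINT p|M. (if MX t p < c then g (XX t p) else 0))
  = (LINT p|M. (if XX 0 p $ k < c then heat (odd_ext k c g) t (XX 0 p) else 0))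
   + (LBINT s. ind t s * (LINT p|M. (if MX s p < c then dheat (odd_ext k c g) (t - s) (XX s p) (B (XX s p)) else 0)))"
proof -
 have [measurable]: "g \<in> borel_measurable borel" by (rule borel_measurable_continuous_onI) fact
 interpret G: bounded_borel_fun "odd_ext k c g" C
  by unfold_locales (measurable, rule odd_ext_bound, rule g)
 define e where "e n = 1 / real (Suc n)" for n
 have e: "0 < e n" for n by (simp add: e_def)
 have e0: "e ----> 0" unfolding e_def[abs_def] by (rule LIMSEQ_Suc[OF lim_const_over_n])
 let ?D = "%e s. \<integral>p. (if MX s p < c then dheat (odd_ext k c g) (t + e - s) (XX s p) (B (XX s p)) else 0) \<partial>M"
 have MX0: "MX 0 p = XX 0 p $ k" if "p \<in> space M" for p
  by (simp add: MX_def XX_def running_max_eq rmax_def)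
 have dm: "(%s. ?D e s) \<in> borel_measurable borel" for e by measurable
 have db: "\<bar>dheat (odd_ext k c g) r x (B x)\<bar> <= G.KH * L / sqrt r" if "0 < r" for r x
  by (rule order_trans[OF G.dheat_bound[OF that]]) (use G.KH_nonneg B_bound that in \<open>auto intro!: divide_right_mono mult_left_mono\<close>)
 have Db: "\<bar>?D e s\<bar> <= G.KH * L / sqrt (t - s)" if "0 <= e" "s < t" for e s
 proof -
  have b: "\<bar>if MX s p < c then dheat (odd_ext k c g) (t + e - s) (XX s p) (B (XX s p)) else 0\<bar> <= G.KH * L / sqrt (t - s)" for p
  proof -
   have "\<bar>dheat (odd_ext k c g) (t + e - s) (XX s p) (B (XX s p))\<bar> <= G.KH * L / sqrt (t + e - s)"
    using that by (intro db) auto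
   also have "... <= G.KH * L / sqrt (t - s)"
    using that G.KH_nonneg L_nonneg by (intro divide_left_mono) auto
   finally show ?thesis using that G.KH_nonneg L_nonneg by auto
  qed
  have "\<bar>?D e s\<bar> <= (LINT p|M. \<bar>if MX s p < c then dheat (odd_ext k c g) (t + e - s) (XX s p) (B (XX s p)) else 0\<bar>)"
   using integral_norm_bound[of M "%p. if MX s p < c then dheat (odd_ext k c g) (t + e - s) (XX s p) (B (XX s p)) else 0"] by simp
  also have "... <= G.KH * L / sqrt (t - s)"
   using b by (intro integral_le_const integrable_abs integrable_const_bound[where B="G.KH * L / sqrt (t - s)"]) auto
  finally show ?thesis .
 qed
 have inner: "(%n. ?D (e n) s) ----> ?D 0 s" if s: "s < t" for s
 proof (rule integral_dominated_convergence[where w="%_. G.KH * L / sqrt (t - s)"])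
  show "AE p in M. (%n. if MX s p < c then dheat (odd_ext k c g) (t + e n - s) (XX s p) (B (XX s p)) else 0) ----> (if MX s p < c then dheat (odd_ext k c g) (t + 0 - s) (XX s p) (B (XX s p)) else 0)"
  proof (rule AE_I2)
   fix p
   have "(%n. dheat (odd_ext k c g) (t + e n - s) (XX s p) (B (XX s p))) ----> dheat (odd_ext k c g) (t + 0 - s) (XX s p) (B (XX s p))"
   proof (intro G.dheat_tendsto tendsto_intros e0)
    show "0 < t + e n - s" for n using e[of n] s by linarith
   qed (use s in auto)
   thus "(%n. if MX s p < c then dheat (odd_ext k c g) (t + e n - s) (XX s p) (B (XX s p)) else 0) ----> (if MX s p < c then dheat (odd_ext k c g) (t + 0 - s) (XX s p) (B (XX s p)) else 0)"
    by simp
  qed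
  show "AE p in M. norm (if MX s p < c then dheat (odd_ext k c g) (t + e n - s) (XX s p) (B (XX s p)) else 0) <= G.KH * L / sqrt (t - s)" for n
  proof (rule AE_I2)
   fix p
   have "\<bar>dheat (odd_ext k c g) (t + e n - s) (XX s p) (B (XX s p))\<bar> <= G.KH * L / sqrt (t + e n - s)"
    using s e[of n] by (intro db) auto
   also have "... <= G.KH * L / sqrt (t - s)"
    using s e[of n] G.KH_nonneg L_nonneg by (intro divide_left_mono) auto
   finally show "norm (if MX s p < c then dheat (odd_ext k c g) (t + e n - s) (XX s p) (B (XX s p)) else 0) <= G.KH * L / sqrt (t - s)"
    using s G.KH_nonneg L_nonneg by auto
  qed
 qed auto
 have R: "(%n. \<integral>s. ind t s * ?D (e n) s \<partial>lborel) ----> (LBINT s. ind t s * ?D 0 s)"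
 proof (rule integral_dominated_convergence[where w="%s. G.KH * L * (ind t s * (1 / sqrt (t - s)))"])
  show "integrable lborel (%s. G.KH * L * (ind t s * (1 / sqrt (t - s))))"
   by (intro integrable_mult_right integrable_inverse_sqrt t)
  show "AE s in lborel. (%n. ind t s * ?D (e n) s) ----> ind t s * ?D 0 s"
  proof (rule AE_I2)
   fix s show "(%n. ind t s * ?D (e n) s) ----> ind t s * ?D 0 s"
    by (cases "0 < s \<and> s < t") (use inner[of s] in auto)
  qed
  show "AE s in lborel. norm (ind t s * ?D (e n) s) <= G.KH * L * (ind t s * (1 / sqrt (t - s)))" for n
  proof (rule AE_I2)
   fix s show "norm (ind t s * ?D (e n) s) <= G.KH * L * (ind t s * (1 / sqrt (t - s)))"
    using Db[OF less_imp_le[OF e[of n]], of s] by (cases "0 < s \<and> s < t") auto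
  qed
 qed (use dm in \<open>simp_all add: indicator_def greaterThanLessThan_iff\<close>)
 have L1: "(%n. \<integral>p. (if MX t p < c then heat (odd_ext k c g) (e n) (XX t p) else 0) \<partial>M) ----> (LINT p|M. (if MX t p < c then g (XX t p) else 0))"
 proof (rule integral_dominated_convergence[where w="%_. C"])
  show "AE p in M. (%n. if MX t p < c then heat (odd_ext k c g) (e n) (XX t p) else 0) ----> (if MX t p < c then g (XX t p) else 0)"
  proof (rule AE_I2)
   fix p assume p: "p \<in> space M"
   show "(%n. if MX t p < c then heat (odd_ext k c g) (e n) (XX t p) else 0) ----> (if MX t p < c then g (XX t p) else 0)"
   proof (cases "MX t p < c")
    case True
    \<comment> \<open>On survival the position is strictly below \<open>c\<close>. Near such a point
      the odd extension coincides with \<open>g\<close>, so it is continuous and the heat flow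
      returns \<open>g\<close>.\<close>
    hence Xc: "XX t p $ k < c" using XX_le_MX[OF p, of t] by linarith
    have op: "open {x :: real ^ 'd. x $ k < c}" by (intro open_Collect_less continuous_intros)
    have "isCont g (XX t p)" using g(1) by (simp add: continuous_on_eq_continuous_at)
    moreover have "eventually (%x. g x = odd_ext k c g x) (nhds (XX t p))"
     using eventually_nhds_in_open[OF op, of "XX t p"] Xc by (auto elim!: eventually_mono simp: odd_ext_def)
    ultimately have "isCont (odd_ext k c g) (XX t p)"
     by (subst isCont_cong[symmetric]) 
    from G.heat_initial[OF this e0 e] show ?thesis using True Xc by (simp add: odd_ext_def)
   qed simp
  qed
  show "AE p in M. norm (if MX t p < c then heat (odd_ext k c g) (e n) (XX t p) else 0) <= C" for n
   using G.heat_bound[OF e] G.C_nonneg by (intro AE_I2) auto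
 qed auto
 have L2: "(%n. \<integral>p. (if MX 0 p < c then heat (odd_ext k c g) (t + e n) (XX 0 p) else 0) \<partial>M) ----> (LINT p|M. (if MX 0 p < c then heat (odd_ext k c g) t (XX 0 p) else 0))"
 proof (rule integral_dominated_convergence[where w="%_. C"])
  show "AE p in M. (%n. if MX 0 p < c then heat (odd_ext k c g) (t + e n) (XX 0 p) else 0) ----> (if MX 0 p < c then heat (odd_ext k c g) t (XX 0 p) else 0)"
  proof (rule AE_I2)
   fix p
   have "(%n. t + e n) ----> t" using e0 by (auto intro!: tendsto_eq_intros)
   hence "(%n. heat (odd_ext k c g) (t + e n) (XX 0 p)) ----> heat (odd_ext k c g) t (XX 0 p)"
    using t e by (intro G.heat_tendsto tendsto_const) (auto intro: add_pos_pos)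
   thus "(%n. if MX 0 p < c then heat (odd_ext k c g) (t + e n) (XX 0 p) else 0) ----> (if MX 0 p < c then heat (odd_ext k c g) t (XX 0 p) else 0)"
    by simp
  qed
  show "AE p in M. norm (if MX 0 p < c then heat (odd_ext k c g) (t + e n) (XX 0 p) else 0) <= C" for n
   using G.heat_bound[of "t + e n"] t e[of n] G.C_nonneg by (intro AE_I2) auto
 qed auto
 have eqn: "(LINT p|M. (if MX t p < c then heat (odd_ext k c g) (e n) (XX t p) else 0))
   = (LINT p|M. (if MX 0 p < c then heat (odd_ext k c g) (t + e n) (XX 0 p) else 0)) + (LBINT s. ind t s * ?D (e n) s)" for n
  using weak_duhamel_smoothed[of g C t "e n" c] g t e[of n] D0_def[of g C t "e n" c] by simp
 have "(LINT p|M. (if MX t p < c then g (XX t p) else 0))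
   = (LINT p|M. (if MX 0 p < c then heat (odd_ext k c g) t (XX 0 p) else 0)) + (LBINT s. ind t s * ?D 0 s)"
  by (rule LIMSEQ_unique[OF L1[unfolded eqn]]) (intro tendsto_add L2 R)
 also have "(LINT p|M. (if MX 0 p < c then heat (odd_ext k c g) t (XX 0 p) else 0)) = (LINT p|M. (if XX 0 p $ k < c then heat (odd_ext k c g) t (XX 0 p) else 0))"
  using MX0 by (intro lint_cong) auto
 finally show ?thesis by (simp only: add_0_right)
qed

end

section \<open>The joint density\<close>

text \<open>A half space in the second factor is the countable union of its products with
  \<open>{..<real n}\<close>.\<close>

lemma sigma_sets_lessThan_times_open:
 "sigma_sets UNIV {{..<c} \<times> U | (c :: real) (U :: 'a::euclidean_space set). open U} = sets borel" (is "sigma_sets UNIV ?E = _")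
proof
 have "?E \<subseteq> sets borel" by (auto intro!: borel_open open_Times)
 thus "sigma_sets UNIV ?E \<subseteq> sets borel" using sets.sigma_sets_subset[of ?E borel] by simp
 interpret S: sigma_algebra UNIV "sigma_sets UNIV ?E" by (rule sigma_algebra_sigma_sets) auto
 have "{z :: real \<times> 'a. z \<bullet> i < a} \<in> sigma_sets UNIV ?E" if "i \<in> Basis" for a i
 proof -
  from that consider "i = (1, 0)" | b where "b \<in> Basis" "i = (0, b)" by (auto simp: Basis_prod_def)
  thus ?thesis
  proof cases
   case 1
   hence "{z :: real \<times> 'a. z \<bullet> i < a} = {..<a} \<times> UNIV" by (auto simp: inner_prod_def)
   thus ?thesis by (intro sigma_sets.Basic) blast
  next
   case 2
   have op: "open {x. x \<bullet> b < a}" by (intro open_Collect_less continuous_intros)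
   have "{z :: real \<times> 'a. z \<bullet> i < a} = (\<Union>n::nat. {..<real n} \<times> {x. x \<bullet> b < a})"
    using 2 by (auto simp: inner_prod_def reals_Archimedean2)
   moreover have "{..<real n} \<times> {x. x \<bullet> b < a} \<in> sigma_sets UNIV ?E" for n
    by (intro sigma_sets.Basic) (use op in blast)
   ultimately show ?thesis by (simp add: sigma_sets.Union)
  qed
 qed
 hence "sigma_sets UNIV ((%(a, i). {x::real \<times> 'a. x \<bullet> i < a}) ` (UNIV \<times> Basis)) \<subseteq> sigma_sets UNIV ?E"
  by (intro S.sigma_sets_subset) auto
 thus "sets borel \<subseteq> sigma_sets UNIV ?E"
  unfolding borel_eq_halfspace_less by (subst sets_measure_of) auto
qed

lemma open_indicator_limit:
 fixes U :: "'a::metric_space set"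
 assumes "open U"
 obtains g :: "nat => 'a => real" where "!!n. continuous_on UNIV (g n)" "!!n x. \<bar>g n x\<bar> <= 1" "!!x. (%n. g n x) ----> indicator U x"
proof (cases "U = UNIV")
 case True
 show ?thesis by (rule that[of "%_ _. 1"]) (auto simp: True)
next
 case False
 let ?g = "%n x. min 1 (real n * infdist x (- U))"
 show ?thesis
 proof (rule that[of ?g])
  fix x
  show "(%n. ?g n x) ----> indicator U x"
  proof (cases "x \<in> U")
   case True
   have "closure (- U) = - U" using assms by (simp add: closed_Compl)
   hence d: "0 < infdist x (- U)"
    using True False in_closure_iff_infdist_zero[of "- U" x] infdist_nonneg[of x "- U"] by (auto simp: less_le)
   obtain N where N: "1 < real N * infdist x (- U)" using reals_Archimedean3[OF d] by blast
   have "eventually (%n. ?g n x = indicator U x) sequentially"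
    using eventually_ge_at_top[of N]
   proof eventually_elim
    case (elim n)
    have "real N * infdist x (- U) <= real n * infdist x (- U)" using elim d by (intro mult_right_mono) auto
    thus ?case using N True by simp
   qed
   thus ?thesis by (rule tendsto_eventually)
  qed simp
 next
  show "continuous_on UNIV (?g n)" for n by (intro continuous_intros)
  show "\<bar>?g n x\<bar> <= 1" for n x using infdist_nonneg[of x "- U"] by (simp add: abs_if) (smt (verit) mult_nonneg_nonneg of_nat_0_le_iff)
 qed
qed

text \<open>The density \<open>q\<close> is not assumed to be nonnegative: this is part of the conclusion.\<close>
lemma eq_density_signedI:
 fixes q :: "real \<times> 'a::euclidean_space => real"
 assumes N: "prob_space N" "sets N = sets borel" and q: "integrable lborel q"
  and eq: "!!c U. open U ==> measure N ({..<c} \<times> U) = (LBINT z. indicator ({..<c} \<times> U) z * q z)"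
 shows "N = density lborel (%z. ennreal (q z))"
proof -
 interpret N: prob_space N by fact
 have sp: "space N = UNIV" using sets_eq_imp_space_eq[OF N(2)] by simp
 have qi: "integrable lborel (%z. indicator A z * q z)" if "A \<in> sets borel" for A
  using integrable_mult_indicator[OF _ q, of A] that by simp
 have total: "(LBINT z. q z) = 1"
 proof -
  have "(%n. \<integral>z. indicator ({..<real n} \<times> (UNIV :: 'a set)) z * q z \<partial>lborel) ----> (LBINT z. q z)"
  proof (rule integral_dominated_convergence[where w="%z. \<bar>q z\<bar>"])
   show "AE z in lborel. (%n. indicator ({..<real n} \<times> (UNIV :: 'a set)) z * q z) ----> q z"
   proof (rule AE_I2, rule tendsto_eventually)
    fix z :: "real \<times> 'a"
    obtain n0 where n0: "fst z < real n0" using reals_Archimedean2 by blast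
    show "eventually (%n. indicator ({..<real n} \<times> (UNIV :: 'a set)) z * q z = q z) sequentially"
     using eventually_ge_at_top[of n0] by eventually_elim (use n0 in \<open>auto simp: indicator_def mem_Times_iff\<close>)
   qed
   show "(%z. indicator ({..<real n} \<times> (UNIV :: 'a set)) z * q z) \<in> borel_measurable lborel" for n
    by (intro borel_measurable_integrable qi borel_open open_Times) auto
   show "AE z in lborel. norm (indicator ({..<real n} \<times> (UNIV :: 'a set)) z * q z) <= \<bar>q z\<bar>" for n
    by (intro AE_I2) (simp add: indicator_def)
  qed (use q in auto)
  hence l: "(%n. measure N ({..<real n} \<times> (UNIV :: 'a set))) ----> (LBINT z. q z)" by (simp add: eq)
  have "(%n. measure N ({..<real n} \<times> (UNIV :: 'a set))) ----> measure N (\<Union>n. {..<real n} \<times> (UNIV :: 'a set))"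
  proof (rule N.finite_Lim_measure_incseq)
   show "range (%n. {..<real n} \<times> (UNIV :: 'a set)) \<subseteq> sets N"
    by (auto simp: N(2) intro!: borel_open open_Times)
   show "incseq (%n. {..<real n} \<times> (UNIV :: 'a set))" by (rule incseq_SucI) auto
  qed
  moreover have "(\<Union>n. {..<real n} \<times> (UNIV :: 'a set)) = space N"
   by (auto simp: sp reals_Archimedean2)
  ultimately have "(%n. measure N ({..<real n} \<times> (UNIV :: 'a set))) ----> 1" by (simp only: N.prob_space)
  from LIMSEQ_unique[OF l this] show ?thesis .
 qed
 have all: "measure N A = (LBINT z. indicator A z * q z)" if "A \<in> sets borel" for A
 proof -
  let ?E = "{{..<c} \<times> U | (c :: real) (U :: 'a set). open U}"
  have "Int_stable ?E"
  proof (rule Int_stableI)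
   fix a b assume "a \<in> ?E" "b \<in> ?E"
   then obtain c U c' U' where ab: "a = {..<c} \<times> U" "b = {..<c'} \<times> U'" "open U" "open U'" by blast
   hence "a \<inter> b = {..<min c c'} \<times> (U \<inter> U')" by auto
   thus "a \<inter> b \<in> ?E" using open_Int[OF ab(3,4)] by blast
  qed
  moreover have "?E \<subseteq> Pow UNIV" by simp
  moreover have "A \<in> sigma_sets UNIV ?E" using that by (simp only: sigma_sets_lessThan_times_open)
  ultimately show ?thesis
  proof (induction rule: sigma_sets_induct_disjoint)
   case (basic A) thus ?case using eq by blast
  next
   case (compl A)
   hence A: "A \<in> sets borel" by (simp only: sigma_sets_lessThan_times_open)
   have "measure N (UNIV - A) = 1 - measure N A" using N.prob_compl[of A] A sp N(2) by simp
   moreover have "(LBINT z. indicator (UNIV - A) z * q z) = (LBINT z. q z - indicator A z * q z)"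
    by (intro lint_cong) (auto simp: indicator_def)
   ultimately show ?case using compl q qi[OF A] total by simp
  next
   case (union A)
   hence A: "A i \<in> sets borel" for i by (simp only: sigma_sets_lessThan_times_open) blast
   have "(%i. measure N (A i)) sums measure N (\<Union>i. A i)"
    using A union(1) N(2) by (intro N.finite_measure_UNION) auto
   moreover have "(LINT z:(\<Union>i. A i)|lborel. q z) = (\<Sum>i. (LINT z:(A i)|lborel. q z))"
    using A union(1) qi[of "\<Union>i. A i"] by (intro lebesgue_integral_countable_add) (auto simp: disjoint_family_on_def set_integrable_def)
   ultimately show ?case using union(3) by (simp add: set_lebesgue_integral_def sums_iff)
  qed auto
 qed
 have nonneg: "AE z in lborel. 0 <= q z"
 proof -
  \<comment> \<open>Over this set \<open>q\<close> integrates to a probability, which is not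
    negative, although the integrand is negative; so the set is null.\<close>
  let ?A = "{z. q z < 0}"
  have [measurable]: "q \<in> borel_measurable borel" using borel_measurable_integrable[OF q] by simp
  have A: "?A \<in> sets borel" by measurable
  have i: "integrable lborel (%z. - (indicator ?A z * q z))" using qi[OF A] by simp
  have "0 <= (LBINT z. indicator ?A z * q z)" using all[OF A] by (simp flip: all)
  moreover have "0 <= (LBINT z. - (indicator ?A z * q z))" by (intro integral_nonneg_AE) (auto simp: indicator_def)
  ultimately have "(LBINT z. - (indicator ?A z * q z)) = 0" by simp
  hence "AE z in lborel. - (indicator ?A z * q z) = 0"
   using integral_nonneg_eq_0_iff_AE[OF i] by (simp add: indicator_def)
  thus ?thesis by eventually_elim (auto simp: indicator_def split: if_splits)
 qed
 show ?thesis
 proof (rule measure_eqI)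
  fix A assume "A \<in> sets N"
  hence A [measurable]: "A \<in> sets borel" using N(2) by simp
  have [measurable]: "q \<in> borel_measurable borel" using borel_measurable_integrable[OF q] by simp
  have "emeasure N A = ennreal (LBINT z. indicator A z * q z)" using all[OF A] by (simp add: N.emeasure_eq_measure)
  also have "... = (NN z. ennreal (indicator A z * q z))"
   by (rule nn_integral_eq_integral[symmetric, OF qi[OF A]]) (use nonneg in \<open>auto simp: indicator_def\<close>)
  also have "... = (NN z. ennreal (q z) * indicator A z)"
   by (intro nn_integral_cong) (auto simp: indicator_def)
  also have "... = emeasure (density lborel (%z. ennreal (q z))) A" by (subst emeasure_density) auto
  finally show "emeasure N A = emeasure (density lborel (%z. ennreal (q z))) A" .
 qed (simp add: N(2))
qed


section \<open>Identifying the law with the series\<close>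

context parametrix begin

lemma Wt_cong: "(!!x. x $ k < c ==> g x = g' x) ==> Wt f t c g = Wt f t c g'"
 unfolding Wt_def by (intro lint_cong) auto

lemma Wt_bound:
 assumes A: "0 <= A" and f: "good A f" and t: "0 < t" and gm [measurable]: "g \<in> borel_measurable borel" and g: "!!x. \<bar>g x\<bar> <= G"
 shows "\<bar>Wt f t c g\<bar> <= A * mass t * G"
proof -
 have G: "0 <= G" using g[of 0] by linarith
 have m: "0 <= mass t" using t by (simp add: mass_def)
 note [measurable] = good_measurable[OF f]
 have "ennreal \<bar>Wt f t c g\<bar> <= (NN z. ennreal (norm (if snd z $ k < fst z \<and> fst z < c then f (t, z) * g (snd z) else 0)))"
  using integral_norm_bound_ennreal[OF Wt_integrable[OF A f t gm g, where c=c]] by (simp add: Wt_def)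
 also have "... <= (NN z. ennreal (if snd z $ k <= fst z then \<bar>f (t, z)\<bar> else 0) * ennreal G)"
  using g G by (intro nn_integral_mono) (auto simp: ennreal_mult[symmetric] abs_mult intro!: ennreal_leI mult_left_mono)
 also have "... = (NN z. ennreal (if snd z $ k <= fst z then \<bar>f (t, z)\<bar> else 0)) * ennreal G"
  by (rule nn_integral_multc) measurable
 also have "... <= ennreal (A * mass t) * ennreal G"
  by (intro mult_right_mono nn_integral_good A f t) simp
 finally show ?thesis using A m G by (simp add: ennreal_mult[symmetric])
qed

end

context diffusion begin

sublocale par: parametrix k B \<mu>0 L
proof (rule parametrix.intro)
 show "prob_space \<mu>0" using prob_space_distr[OF X_measurable[of 0]] X_initial by simp
qed (use sets_\<mu>0 B_bound in auto)

text \<open>The induction below needs test functions that are continuous and bounded on the whole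
  space, while \<open>hh_bound\<close> speaks only of points up to the level. Clipping at that bound
  changes nothing there.\<close>

lemma hh_clip_continuous:
 assumes \<tau>: "0 < \<tau>" and g: "continuous_on UNIV g" "!!x. \<bar>g x\<bar> <= C"
 shows "continuous_on UNIV (%x. max (- A) (min A (par.hh c \<tau> g x)))"
proof -
 have gm [measurable]: "g \<in> borel_measurable borel" by (rule borel_measurable_continuous_onI) fact
 interpret G: bounded_borel_fun "odd_ext k c g" C
  by unfold_locales (measurable, rule odd_ext_bound, rule g)
 have "continuous_on UNIV (par.hh c \<tau> g)"
 proof (rule continuous_on_sequentiallyI)
  fix y :: "nat => real ^ 'd" and x assume y: "y ----> x"
  have "(%n. B (y n)) ----> B x" by (rule continuous_on_tendsto_compose[OF B_continuous y]) auto
  hence "(%n. dheat (odd_ext k c g) \<tau> (y n) (B (y n))) ----> dheat (odd_ext k c g) \<tau> x (B x)"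
   using \<tau> y by (intro G.dheat_tendsto tendsto_const) auto
  thus "(%n. par.hh c \<tau> g (y n)) ----> par.hh c \<tau> g x"
   using par.hh_eq_dheat[OF \<tau> gm g(2)] by simp
 qed
 thus ?thesis by (intro continuous_intros)
qed

text \<open>Law and partial sums satisfy the same recursion, so the error for \<open>Suc N\<close>
  and \<open>g\<close> is a time integral of errors for \<open>N\<close> and test functions of size
  \<open>C / sqrt (t - s)\<close> up to a constant. The induction therefore runs over all times and
  test functions at once, and the choice of \<open>ll\<close> yields 1/2 per step.\<close>

lemma law_approximation:
 "0 < t ==> continuous_on UNIV g ==> (!!x. \<bar>g x\<bar> <= C) ==>
  \<bar>(LINT p|M. (if MX t p < c then g (XX t p) else 0)) - (\<Sum>n<N. par.Wt (par.pn n) t c g)\<bar> <= exp (par.ll * t) * C / 2 ^ N"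
proof (induction N arbitrary: t g C)
 case 0
 have gm [measurable]: "g \<in> borel_measurable borel" by (rule borel_measurable_continuous_onI) fact
 have C: "0 <= C" using 0(3)[of 0] by linarith
 have "\<bar>LINT p|M. (if MX t p < c then g (XX t p) else 0)\<bar> <= (LINT p|M. \<bar>if MX t p < c then g (XX t p) else 0\<bar>)"
  using integral_norm_bound[of M "%p. if MX t p < c then g (XX t p) else 0"] by simp
 also have "... <= C" using 0(3) C by (intro integral_le_const integrable_const_bound[where B=C]) auto
 also have "... <= exp (par.ll * t) * C" using par.ll_pos 0(1) C by (simp add: mult_le_cancel_right1 not_less)
 finally show ?case by simp
next
 case (Suc N)
 note t = Suc.prems(1) and g = Suc.prems(2,3)
 have gm [measurable]: "g \<in> borel_measurable borel" by (rule borel_measurable_continuous_onI) fact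
 have C: "0 <= C" using g(2)[of 0] by linarith
 have good: "par.good (par.A0 / 2 ^ n) (par.pn n)" and A: "0 <= par.A0 / 2 ^ n" for n
  using par.A0_nonneg by (auto intro: par.good_pn)
 note [measurable] = par.good_measurable[OF good]
 \<comment> \<open>The bound from \<open>hh_bound\<close>, used as clipping height for
   \<open>\<kappa> s\<close>. Below the level, the only region entering either side,
   \<open>\<kappa> s\<close> and \<open>hh\<close> agree.\<close>
 define b where "b s = 2 * par.CK / sqrt (t - s) * C" for s
 have b: "0 <= b s" if "s < t" for s using that C par.CK_nonneg by (simp add: b_def)
 define \<kappa> where "\<kappa> s x = max (- b s) (min (b s) (par.hh c (t - s) g x))" for s x
 have \<kappa>b: "\<bar>\<kappa> s x\<bar> <= b s" if "s < t" for s x using b[OF that] by (auto simp: \<kappa>_def)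
 have \<kappa>c: "continuous_on UNIV (\<kappa> s)" if "s < t" for s
  unfolding \<kappa>_def[abs_def] by (rule hh_clip_continuous[OF _ g]) (use that in auto)
 have \<kappa>m [measurable]: "(%z. \<kappa> (fst z) (snd z)) \<in> borel_measurable (borel \<Otimes>\<^sub>M borel)" "\<kappa> s \<in> borel_measurable borel" for s
  unfolding \<kappa>_def[abs_def] b_def by measurable
 have hk: "par.hh c (t - s) g x = \<kappa> s x" if "s < t" "x $ k < c" for s x
  using par.hh_bound(2)[of "t - s" x c g C] that g by (auto simp: \<kappa>_def b_def)
 let ?E = "%s. \<integral>p. (if MX s p < c then par.hh c (t - s) g (XX s p) else 0) \<partial>M"
 have E\<kappa>: "?E s = (LINT p|M. (if MX s p < c then \<kappa> s (XX s p) else 0))" if "s < t" for s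
  using hk[OF that] XX_le_MX[of _ s] by (intro lint_cong) (auto intro: le_less_trans)
 have W\<kappa>: "par.Wt f s c (par.hh c (t - s) g) = par.Wt f s c (\<kappa> s)" if "s < t" for f s
  using hk[OF that] by (intro par.Wt_cong) auto
 have Em [measurable]: "?E \<in> borel_measurable borel" by measurable
 have Wm [measurable]: "(%s. par.Wt (par.pn n) s c (par.hh c (t - s) g)) \<in> borel_measurable borel" for n
  unfolding par.Wt_def by measurable
 have ib: "integrable lborel (%s. (K * 2 * par.CK * C) * (ind t s * (1 / sqrt (t - s))))" for K
  by (intro integrable_mult_right integrable_inverse_sqrt t)
 have iE: "integrable lborel (%s. ind t s * ?E s)"
 proof (rule lint_bound[OF ib[of 1]])
  have "\<bar>?E s\<bar> <= b s" if "s < t" for s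
  proof -
   have "\<bar>?E s\<bar> <= (LINT p|M. \<bar>if MX s p < c then \<kappa> s (XX s p) else 0\<bar>)"
    unfolding E\<kappa>[OF that] using integral_norm_bound[of M "%p. if MX s p < c then \<kappa> s (XX s p) else 0"] by simp
   also have "... <= b s" using \<kappa>b[OF that] b[OF that] by (intro integral_le_const integrable_const_bound[where B="b s"]) auto
   finally show ?thesis .
  qed
  hence "norm (ind t s * ?E s) <= (1 * 2 * par.CK * C) * (ind t s * (1 / sqrt (t - s)))" for s
   by (auto simp: indicator_def b_def)
  thus "AE s in lborel. norm (ind t s * ?E s) <= norm ((1 * 2 * par.CK * C) * (ind t s * (1 / sqrt (t - s))))"
   by (intro AE_I2) (simp only: real_norm_def, rule order_trans[OF _ abs_ge_self])
 qed (simp add: indicator_def)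
 have iW: "integrable lborel (%s. ind t s * par.Wt (par.pn n) s c (par.hh c (t - s) g))" for n
 proof (rule lint_bound[OF ib[of "par.A0 / 2 ^ n * par.mass t"]])
  have "\<bar>par.Wt (par.pn n) s c (par.hh c (t - s) g)\<bar> <= par.A0 / 2 ^ n * par.mass t * b s" if "0 < s" "s < t" for s
  proof -
   have "\<bar>par.Wt (par.pn n) s c (par.hh c (t - s) g)\<bar> <= par.A0 / 2 ^ n * par.mass s * b s"
    unfolding W\<kappa>[OF that(2)] by (rule par.Wt_bound[OF A good that(1) \<kappa>m(2) \<kappa>b[OF that(2)]])
   also have "... <= par.A0 / 2 ^ n * par.mass t * b s"
    using that b[OF that(2)] par.ll_pos A[of n] by (intro mult_right_mono mult_left_mono) (auto simp: par.mass_def)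
   finally show ?thesis .
  qed
  hence "norm (ind t s * par.Wt (par.pn n) s c (par.hh c (t - s) g)) <= (par.A0 / 2 ^ n * par.mass t * 2 * par.CK * C) * (ind t s * (1 / sqrt (t - s)))" for s
   by (auto simp: indicator_def b_def mult.assoc)
  thus "AE s in lborel. norm (ind t s * par.Wt (par.pn n) s c (par.hh c (t - s) g)) <= norm ((par.A0 / 2 ^ n * par.mass t * 2 * par.CK * C) * (ind t s * (1 / sqrt (t - s))))"
   by (intro AE_I2) (simp only: real_norm_def, rule order_trans[OF _ abs_ge_self])
 qed (simp add: indicator_def)
 have iS: "integrable lborel (%s. ind t s * (\<Sum>n<N. par.Wt (par.pn n) s c (par.hh c (t - s) g)))"
  unfolding sum_distrib_left by (intro Bochner_Integration.integrable_sum iW)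
 have init: "(LINT p|M. (if XX 0 p $ k < c then heat (odd_ext k c g) t (XX 0 p) else 0)) = par.Wt (par.pn 0) t c g"
 proof -
  have [measurable]: "X 0 \<in> borel_measurable M" by (rule X_measurable) simp
  have "par.Wt (par.pn 0) t c g = (\<integral>z. indicator {..<c} (z $ k) * heat (odd_ext k c g) t z \<partial>distr M borel (X 0))"
   using par.Wt_p0[OF t gm g(2)] par.uu_eq_heat[OF t gm g(2)] X_initial by (simp add: par.pn_def)
  also have "... = (LINT p|M. indicator {..<c} (X 0 p $ k) * heat (odd_ext k c g) t (X 0 p))"
   by (subst integral_distr) (auto simp: indicator_def)
  also have "... = (LINT p|M. (if XX 0 p $ k < c then heat (odd_ext k c g) t (XX 0 p) else 0))"
   by (intro lint_cong) (auto simp: indicator_def XX_eq)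
  finally show ?thesis ..
 qed
 have "(LINT p|M. (if MX t p < c then g (XX t p) else 0)) = par.Wt (par.pn 0) t c g + (LBINT s. ind t s * ?E s)"
 proof -
  have "(LBINT s. ind t s * (LINT p|M. (if MX s p < c then dheat (odd_ext k c g) (t - s) (XX s p) (B (XX s p)) else 0))) = (LBINT s. ind t s * ?E s)"
  proof (rule lint_cong)
   fix s
   show "ind t s * (LINT p|M. (if MX s p < c then dheat (odd_ext k c g) (t - s) (XX s p) (B (XX s p)) else 0)) = ind t s * ?E s"
    using par.hh_eq_dheat[OF _ gm g(2), of "t - s" c] by (cases "s < t") (auto cong: if_cong)
  qed simp
  thus ?thesis using weak_duhamel[OF g t, of c] init by simp
 qed
 moreover have "(\<Sum>n<Suc N. par.Wt (par.pn n) t c g) = par.Wt (par.pn 0) t c g + (LBINT s. ind t s * (\<Sum>n<N. par.Wt (par.pn n) s c (par.hh c (t - s) g)))"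
 proof -
  have "par.Wt (par.pn (Suc n)) t c g = (LBINT s. ind t s * par.Wt (par.pn n) s c (par.hh c (t - s) g))" for n
   using par.Wt_stepP[OF A good t gm g(2), where c=c] by (simp add: par.pn_def)
  thus ?thesis
   by (subst sum.lessThan_Suc_shift) (simp only: sum_distrib_left Bochner_Integration.integral_sum[OF iW])
 qed
 ultimately have "(LINT p|M. (if MX t p < c then g (XX t p) else 0)) - (\<Sum>n<Suc N. par.Wt (par.pn n) t c g)
   = (LBINT s. ind t s * ?E s) - (LBINT s. ind t s * (\<Sum>n<N. par.Wt (par.pn n) s c (par.hh c (t - s) g)))"
  by simp
 also have "... = (LBINT s. ind t s * (?E s - (\<Sum>n<N. par.Wt (par.pn n) s c (par.hh c (t - s) g))))"
  by (simp only: Bochner_Integration.integral_diff[OF iE iS] right_diff_distrib)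
 finally have eq: "(LINT p|M. (if MX t p < c then g (XX t p) else 0)) - (\<Sum>n<Suc N. par.Wt (par.pn n) t c g)
   = (LBINT s. ind t s * (?E s - (\<Sum>n<N. par.Wt (par.pn n) s c (par.hh c (t - s) g))))" (is "_ = integral\<^sup>L lborel ?D") .
 have iD: "integrable lborel ?D"
  unfolding right_diff_distrib by (rule Bochner_Integration.integrable_diff[OF iE iS])
 have Db: "\<bar>?D s\<bar> <= C / 2 ^ N * (ind t s * (4 * par.CK / sqrt (t - s) * exp (par.ll * s)))" for s
 proof (cases "0 < s \<and> s < t")
  case True
  hence s: "0 < s" "s < t" by auto
  have "\<bar>?E s - (\<Sum>n<N. par.Wt (par.pn n) s c (par.hh c (t - s) g))\<bar> <= exp (par.ll * s) * b s / 2 ^ N"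
   unfolding E\<kappa>[OF s(2)] W\<kappa>[OF s(2)] by (rule Suc.IH[OF s(1) \<kappa>c[OF s(2)] \<kappa>b[OF s(2)]])
  also have "... <= C / 2 ^ N * (4 * par.CK / sqrt (t - s) * exp (par.ll * s))"
  proof -
   have "2 * (par.CK * C / sqrt (t - s)) <= 4 * (par.CK * C / sqrt (t - s))" using s C par.CK_nonneg by (intro mult_right_mono) auto
   hence "exp (par.ll * s) / 2 ^ N * (2 * (par.CK * C / sqrt (t - s))) <= exp (par.ll * s) / 2 ^ N * (4 * (par.CK * C / sqrt (t - s)))"
    by (intro mult_left_mono) auto
   thus ?thesis by (simp add: b_def mult_ac)
  qed
  finally show ?thesis using s by simp
 qed simp
 have "ennreal \<bar>integral\<^sup>L lborel ?D\<bar> <= (NN s. ennreal (norm (?D s)))"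
  using integral_norm_bound_ennreal[OF iD] by simp
 also have "... <= (NN s. ennreal (C / 2 ^ N) * ennreal (ind t s * (4 * par.CK / sqrt (t - s) * exp (par.ll * s))))"
 proof (rule nn_integral_mono)
  fix s
  have "ennreal (norm (?D s)) <= ennreal (C / 2 ^ N * (ind t s * (4 * par.CK / sqrt (t - s) * exp (par.ll * s))))"
   using Db[of s] by (intro ennreal_leI) simp
  also have "... = ennreal (C / 2 ^ N) * ennreal (ind t s * (4 * par.CK / sqrt (t - s) * exp (par.ll * s)))"
   using C par.CK_nonneg by (intro ennreal_mult) (auto simp: indicator_def)
  finally show "ennreal (norm (?D s)) <= ennreal (C / 2 ^ N) * ennreal (ind t s * (4 * par.CK / sqrt (t - s) * exp (par.ll * s)))" .
 qed
 also have "... = ennreal (C / 2 ^ N) * (NN s. ennreal (ind t s * (4 * par.CK / sqrt (t - s) * exp (par.ll * s))))"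
  by (rule nn_integral_cmult) (simp add: indicator_def)
 also have "... <= ennreal (C / 2 ^ N) * ennreal (exp (par.ll * t) / 2)"
  by (intro mult_left_mono par.ll_contraction t) auto
 also have "... = ennreal (exp (par.ll * t) * C / 2 ^ Suc N)"
  using C by (subst ennreal_mult[symmetric]) (auto simp: mult_ac)
 finally show ?case unfolding eq using C by (subst (asm) ennreal_le_iff) auto
qed

lemma law_test_function:
 assumes t: "0 < t" and g: "continuous_on UNIV g" "!!x. \<bar>g x\<bar> <= C"
 shows "(LINT p|M. (if MX t p < c then g (XX t p) else 0)) = par.Wt par.ps t c g"
proof -
 have gm: "g \<in> borel_measurable borel" by (rule borel_measurable_continuous_onI) fact
 have "(%N. exp (par.ll * t) * C * (1 / 2) ^ N) ----> exp (par.ll * t) * C * 0"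
  by (intro tendsto_intros LIMSEQ_power_zero) auto
 hence l: "(%N. exp (par.ll * t) * C / 2 ^ N) ----> 0" by (simp add: power_one_over)
 have "(%N. (\<Sum>n<N. par.Wt (par.pn n) t c g) - (LINT p|M. (if MX t p < c then g (XX t p) else 0))) ----> 0"
  by (rule Lim_null_comparison[OF _ l])
   (use law_approximation[OF t g] in \<open>simp only: real_norm_def abs_minus_commute eventually_sequentially, blast\<close>)
 hence "(%N. \<Sum>n<N. par.Wt (par.pn n) t c g) ----> (LINT p|M. (if MX t p < c then g (XX t p) else 0))"
  by (rule LIM_zero_cancel)
 thus ?thesis by (rule LIMSEQ_unique[OF _ par.Wt_ps[OF t gm g(2)]])
qed


text \<open>This version is nonnegative and supported in the open wedge everywhere; the series
  itself is known to be nonnegative only almost everywhere.\<close>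

definition pV :: "real => real \<times> (real ^ 'd) => real" where
 "pV t z = (if 0 < t \<and> snd z $ k < fst z then max 0 (par.ps (t, z)) else 0)"

lemma ps_measurable [measurable]: "par.ps \<in> borel_measurable borel"
 by (rule par.good_measurable[OF par.good_ps])

lemma pV_measurable [measurable (raw)]:
 assumes [measurable]: "f \<in> borel_measurable N" "g \<in> borel_measurable N"
 shows "(%x. pV (f x) (g x)) \<in> borel_measurable N"
 unfolding pV_def by measurable

lemma pV_nonneg: "0 <= pV t z" and pV_zero: "m <= x $ k ==> pV t (m, x) = 0"
 by (simp_all add: pV_def)

lemma pV_density:
 assumes t: "0 < t"
 shows "has_density M (%p. (running_max k X t p, X t p)) (pV t)"
proof -
 let ?V = "%p. (MX t p, XX t p)"
 let ?q = "%z. if snd z $ k < fst z then par.ps (t, z) else 0"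
 have Vm [measurable]: "?V \<in> borel_measurable M" by measurable
 have "distr M borel ?V = density lborel (%z. ennreal (?q z))"
 proof (rule eq_density_signedI)
  show "prob_space (distr M borel ?V)" by (rule prob_space_distr) simp
  show "integrable lborel ?q"
  proof (rule integrableI_bounded)
   have "(NN z. ennreal (norm (?q z))) <= (NN z. ennreal (if snd z $ k <= fst z then \<bar>par.ps (t, z)\<bar> else 0))"
    by (intro nn_integral_mono) auto
   also have "... <= ennreal (2 * par.A0 * par.mass t)"
    using par.A0_nonneg by (intro par.nn_integral_good par.good_ps t) auto
   finally show "(NN z. ennreal (norm (?q z))) < \<infinity>" by (simp add: order_le_less_trans)
  qed measurable
  hence qi: "integrable lborel (%z. \<bar>?q z\<bar>)" by (rule integrable_abs)
  fix c :: real and U :: "(real ^ 'd) set" assume U: "open U"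
  hence [measurable]: "U \<in> sets borel" "{..<c} \<times> U \<in> sets borel" by (intro borel_open open_Times open_lessThan; assumption)+
  from open_indicator_limit[OF U] obtain g :: "nat => real ^ 'd => real"
   where g: "!!n. continuous_on UNIV (g n)" "!!n x. \<bar>g n x\<bar> <= 1" "!!x. (%n. g n x) ----> indicator U x" by metis
  have gm [measurable]: "g n \<in> borel_measurable borel" for n by (rule borel_measurable_continuous_onI) (rule g)
  have "(%n. \<integral>p. (if MX t p < c then g n (XX t p) else 0) \<partial>M) ----> (LINT p|M. (if MX t p < c then indicator U (XX t p) else 0))"
  proof (rule integral_dominated_convergence[where w="%_. 1"])
   show "AE p in M. (%n. if MX t p < c then g n (XX t p) else 0) ----> (if MX t p < c then indicator U (XX t p) else 0)"
    using g(3) by (intro AE_I2) auto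
  qed (use g(2) in auto)
  moreover have "(%n. \<integral>p. (if MX t p < c then g n (XX t p) else 0) \<partial>M) ----> (LBINT z. indicator ({..<c} \<times> U) z * ?q z)"
   unfolding law_test_function[OF t g(1,2)] par.Wt_def
  proof (rule integral_dominated_convergence[where w="%z. \<bar>?q z\<bar>"])
   show "AE z in lborel. (%n. if snd z $ k < fst z \<and> fst z < c then par.ps (t, z) * g n (snd z) else 0) ----> indicator ({..<c} \<times> U) z * ?q z"
   proof (rule AE_I2)
    fix z :: "real \<times> (real ^ 'd)"
    have "(%n. par.ps (t, z) * g n (snd z)) ----> par.ps (t, z) * indicator U (snd z)" by (intro tendsto_intros g)
    thus "(%n. if snd z $ k < fst z \<and> fst z < c then par.ps (t, z) * g n (snd z) else 0) ----> indicator ({..<c} \<times> U) z * ?q z"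
     by (cases "fst z < c") (auto simp: indicator_def mem_Times_iff)
   qed
   show "AE z in lborel. norm (if snd z $ k < fst z \<and> fst z < c then par.ps (t, z) * g n (snd z) else 0) <= \<bar>?q z\<bar>" for n
    using g(2) by (intro AE_I2) (auto simp: abs_mult mult_left_le)
  qed (use qi in \<open>auto intro: borel_measurable_integrable\<close>)
  ultimately have "(LINT p|M. (if MX t p < c then indicator U (XX t p) else 0)) = (LBINT z. indicator ({..<c} \<times> U) z * ?q z)"
   by (rule LIMSEQ_unique)
  moreover have "measure (distr M borel ?V) ({..<c} \<times> U) = (LINT p|M. indicator ({..<c} \<times> U) (?V p))"
  proof -
   have "measure (distr M borel ?V) ({..<c} \<times> U) = (\<integral>z. indicator ({..<c} \<times> U) z \<partial>distr M borel ?V)" by simp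
   also have "... = (LINT p|M. indicator ({..<c} \<times> U) (?V p))" by (rule integral_distr) auto
   finally show ?thesis .
  qed
  moreover have "(LINT p|M. indicator ({..<c} \<times> U) (?V p)) = (LINT p|M. (if MX t p < c then indicator U (XX t p) else 0 :: real))"
   by (intro lint_cong) (auto simp: indicator_def)
  ultimately show "measure (distr M borel ?V) ({..<c} \<times> U) = (LBINT z. indicator ({..<c} \<times> U) z * ?q z)" by simp
 qed simp
 also have "... = density lborel (%z. ennreal (pV t z))"
  using t by (intro density_cong) (auto simp: pV_def max_def ennreal_neg)
 finally have "distr M borel ?V = density lborel (%z. ennreal (pV t z))" .
 moreover have "distr M lborel ?V = distr M borel ?V" by (rule distr_cong) auto
 ultimately have "distributed M lborel ?V (%z. ennreal (pV t z))"
  unfolding distributed_def by simp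
 thus ?thesis
  using t pV_nonneg by (simp add: has_density_def MX_eq XX_eq)
qed

definition Gam :: "real => real" where "Gam t = 2 * par.A0 * (exp (par.ll * t) / sqrt t)"

lemma Gam_nonneg: "0 <= t ==> 0 <= Gam t"
 using par.A0_nonneg by (simp add: Gam_def)

lemma pV_le: assumes "0 < t" "0 <= w" shows "pV t (below_diag k y w) <= Gam t * par.Hm t y"
proof -
 have "pV t (below_diag k y w) <= \<bar>par.ps (t, below_diag k y w)\<bar>" by (auto simp: pV_def)
 also have "... <= Gam t * (exp (- w\<^sup>2 / (4 * t)) * par.Hm t y)"
  unfolding Gam_def by (rule par.ps_below_diag[OF assms])
 also have "... <= Gam t * (1 * par.Hm t y)"
  using assms par.Hm_nonneg Gam_nonneg[of t] by (intro mult_left_mono mult_right_mono) auto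
 finally show ?thesis by simp
qed

text \<open>Read off the series on the diagonal, because \<open>pV\<close> itself is set to 0
  there.\<close>

definition tr :: "real => real ^ 'd => real" where "tr t y = max 0 (par.ps (t, y $ k, y))"

lemma tr_measurable [measurable (raw)]:
 assumes [measurable]: "f \<in> borel_measurable N" "g \<in> borel_measurable N"
 shows "(%x. tr (f x) (g x)) \<in> borel_measurable N"
 unfolding tr_def by measurable

lemma pV_below_diag: "0 < t ==> 0 < w ==> pV t (below_diag k y w) = max 0 (par.ps (t, below_diag k y w))"
 by (simp add: pV_def below_diag_def axis_def)

lemma ps_below_diag_tendsto:
 assumes t: "0 < t" and w: "!!n. 0 <= w n" "w ----> w0"
 shows "(%n. par.ps (t, below_diag k y (w n))) ----> par.ps (t, below_diag k y w0)"
 unfolding below_diag_def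
proof (rule par.good_tendsto[OF par.good_ps t])
 show "(%n. y - w n *\<^sub>R axis k 1) ----> y - w0 *\<^sub>R axis k 1" by (intro tendsto_intros w)
 show "(y - w n *\<^sub>R axis k 1) $ k <= y $ k" for n using w(1)[of n] by (simp add: axis_def)
qed auto

lemma pV_trace:
 assumes t: "0 < t" and w: "!!n. 0 < w n" "w ----> 0"
 shows "(%n. pV t (below_diag k y (w n))) ----> tr t y"
proof -
 have "(%n. max 0 (par.ps (t, below_diag k y (w n)))) ----> max 0 (par.ps (t, below_diag k y 0))"
  using w by (intro tendsto_intros ps_below_diag_tendsto t) (auto intro: less_imp_le)
 moreover have "below_diag k y 0 = (y $ k, y)" by (simp add: below_diag_def)
 ultimately show ?thesis by (simp only: pV_below_diag[OF t w(1)] tr_def)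
qed

lemma pV_trace_limit: "0 < t ==> ((%w. pV t (below_diag k y w)) \<longlongrightarrow> tr t y) (at_right 0)"
 by (rule tendsto_at_right_sequentially[where b=1]) (auto intro!: pV_trace)

lemma diag_trace_pV: "0 < t ==> diag_trace k (pV t) y = tr t y"
 unfolding diag_trace_def by (rule tendsto_Lim[OF _ pV_trace_limit]) auto

lemma tr_le: "0 < t ==> tr t y <= Gam t * par.Hm t y"
 by (rule tendsto_upperbound[OF pV_trace_limit]) (auto simp: eventually_at_filter intro!: always_eventually pV_le)

text \<open>The series is continuous in the distance \<open>w\<close>, so rational distances exhaust
  the supremum, and a countable supremum is measurable.\<close>

lemma sup_rational:
 assumes t: "0 < t"
 shows "(SUP w\<in>{0<..}. ennreal (pV t (below_diag k y w))) = (SUP w\<in>\<rat> \<inter> {0<..}. ennreal (pV t (below_diag k y w)))"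
proof (rule antisym)
 show "(SUP w\<in>{0<..}. ennreal (pV t (below_diag k y w))) <= (SUP w\<in>\<rat> \<inter> {0<..}. ennreal (pV t (below_diag k y w)))" (is "_ <= ?S")
 proof (rule SUP_least)
  fix w :: real assume w: "w \<in> {0<..}"
  have "\<exists>r. r \<in> \<rat> \<and> w < r \<and> r < w + 1 / real (Suc n)" for n using Rats_dense_in_real[of w "w + 1 / real (Suc n)"] by auto
  then obtain r where r: "!!n. r n \<in> \<rat>" "!!n. w < r n" "!!n. r n < w + 1 / real (Suc n)" by metis
  have "(%n. w + 1 / real (Suc n)) ----> w + 0" by (intro tendsto_intros LIMSEQ_Suc[OF lim_const_over_n])
  hence rl: "r ----> w"
   by (intro tendsto_sandwich[of "%_. w" r sequentially "%n. w + 1 / real (Suc n)"] always_eventually allI less_imp_le r) simp_all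
  have rp: "0 < r n" for n using r(2)[of n] w by simp
  have "(%n. max 0 (par.ps (t, below_diag k y (r n)))) ----> max 0 (par.ps (t, below_diag k y w))"
   using rp by (intro tendsto_intros ps_below_diag_tendsto t rl) (auto intro: less_imp_le)
  hence "(%n. ennreal (pV t (below_diag k y (r n)))) ----> ennreal (pV t (below_diag k y w))"
   using w by (simp only: pV_below_diag[OF t rp] pV_below_diag[OF t] greaterThan_iff tendsto_ennrealI)
  thus "ennreal (pV t (below_diag k y w)) <= ?S"
   by (rule LIMSEQ_le_const2) (use r rp in \<open>auto intro!: SUP_upper\<close>)
 qed
qed (rule SUP_subset_mono; auto)

text \<open>The supremum is at most \<open>Gam t * par.Hm t y\<close>, where \<open>par.Hm t\<close>
  has mass 1 and \<open>Gam t\<close> is of order \<open>1 / sqrt t\<close> near 0, hence integrable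
  in time.\<close>

lemma sup_density:
 shows "(%(t, y). SUP w\<in>{0<..}. ennreal (pV t (below_diag k y w))) \<in> borel_measurable (lebesgue_on ({0..T} \<times> UNIV))"
  and "0 < T ==> (\<integral>\<^sup>+(t, y). (SUP w\<in>{0<..}. ennreal (pV t (below_diag k y w))) \<partial>lebesgue_on ({0..T} \<times> UNIV)) < \<infinity>"
proof -
 let ?S = "%(t, y). SUP w\<in>{0<..}. ennreal (pV t (below_diag k y w))"
 have eq: "?S = (%z. SUP w\<in>\<rat> \<inter> {0<..}. ennreal (pV (fst z) (below_diag k (snd z) w)))"
 proof (rule ext, clarsimp)
  fix t y
  show "(SUP w\<in>{0<..}. ennreal (pV t (below_diag k y w))) = (SUP w\<in>\<rat> \<inter> {0<..}. ennreal (pV t (below_diag k y w)))"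
  proof (cases "0 < t")
   case False
   have "(1::real) \<in> \<rat> \<inter> {0<..}" by simp
   thus ?thesis using False by (subst (1 2) SUP_eq_const) (auto simp: pV_def)
  qed (rule sup_rational)
 qed
 have S: "?S \<in> borel_measurable borel"
  unfolding eq by (rule borel_measurable_SUP) (auto intro: countable_Int1 countable_rat)
 have D: "{0..T} \<times> UNIV \<in> sets (borel :: (real \<times> (real ^ 'd)) measure)" by (intro borel_closed closed_Times) auto
 show "?S \<in> borel_measurable (lebesgue_on ({0..T} \<times> UNIV))"
  by (intro measurable_restrict_space1 measurable_completion) (use S in simp)
 assume T: "0 < T"
 have "(\<integral>\<^sup>+z. ?S z \<partial>lebesgue_on ({0..T} \<times> UNIV)) = (NN z. ?S z * indicator ({0..T} \<times> UNIV) z)"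
  using D S by (subst nn_integral_restrict_space) (auto simp: nn_integral_completion)
 also have "... <= (NN z. ennreal (indicator {0<..T} (fst z) * (Gam (fst z) * par.Hm (fst z) (snd z))))"
 proof (rule nn_integral_mono)
  fix z :: "real \<times> (real ^ 'd)"
  obtain t y where z: "z = (t, y)" by (cases z)
  show "?S z * indicator ({0..T} \<times> UNIV) z <= ennreal (indicator {0<..T} (fst z) * (Gam (fst z) * par.Hm (fst z) (snd z)))"
  proof (cases "0 < t \<and> t <= T")
   case True
   hence "(SUP w\<in>{0<..}. ennreal (pV t (below_diag k y w))) <= ennreal (Gam t * par.Hm t y)"
    by (intro SUP_least ennreal_leI pV_le) auto
   thus ?thesis using True z by (simp add: indicator_def)
  next
   case False
   thus ?thesis using z by (auto simp: indicator_def pV_def)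
  qed
 qed
 also have "... = (NN t. (NN y. ennreal (indicator {0<..T} t * (Gam t * par.Hm t y))))"
  unfolding lborel_prod[symmetric] Gam_def by (subst lborel.nn_integral_fst[symmetric]) (auto simp: indicator_def)
 also have "... <= (NN t. ennreal (2 * par.A0 * exp (par.ll * T)) * ennreal (indicator {0<..<T + 1} t * (1 / sqrt t)))"
 proof (rule nn_integral_mono)
  fix t
  show "(NN y. ennreal (indicator {0<..T} t * (Gam t * par.Hm t y))) <= ennreal (2 * par.A0 * exp (par.ll * T)) * ennreal (indicator {0<..<T + 1} t * (1 / sqrt t))"
  proof (cases "0 < t \<and> t <= T")
   case True
   hence "(NN y. ennreal (indicator {0<..T} t * (Gam t * par.Hm t y))) = ennreal (Gam t) * (NN y. ennreal (par.Hm t y))"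
    using par.Hm_nonneg Gam_nonneg[of t] by (subst nn_integral_cmult[symmetric]) (auto simp: ennreal_mult)
   also have "... = ennreal (Gam t)" using True by (simp add: par.nn_integral_Hm)
   also have "... <= ennreal (2 * par.A0 * exp (par.ll * T) * (1 / sqrt t))"
    using True par.A0_nonneg par.ll_pos unfolding Gam_def
    by (intro ennreal_leI) (simp add: mult_left_mono divide_right_mono)
   finally show ?thesis using True par.A0_nonneg by (simp add: ennreal_mult[symmetric])
  qed (auto simp: indicator_def)
 qed
 also have "... = ennreal (2 * par.A0 * exp (par.ll * T)) * (NN t. ennreal (indicator {0<..<T + 1} t * (1 / sqrt t)))"
  by (rule nn_integral_cmult) (simp add: indicator_def)
 also have "... <= ennreal (2 * par.A0 * exp (par.ll * T)) * ennreal (2 * sqrt (T + 1))"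
  using T by (intro mult_left_mono nn_integral_inverse_sqrt) auto
 also have "... < \<infinity>" by (simp add: ennreal_mult_less_top)
 finally show "(\<integral>\<^sup>+z. ?S z \<partial>lebesgue_on ({0..T} \<times> UNIV)) < \<infinity>" .
qed

end

section \<open>The maximum of the noise\<close>

lemma integral_gd_scaled:
 fixes f :: "'a::euclidean_space => real"
 assumes t: "0 < t" and [measurable]: "f \<in> borel_measurable borel"
 shows "(LBINT z. gd t z * f z) = (LBINT w. gd 1 w * f (sqrt t *\<^sub>R w))"
proof -
 have s: "sqrt t \<noteq> 0" using t by simp
 have gd_scale: "sqrt t ^ DIM('a) * gd t (sqrt t *\<^sub>R w) = gd 1 (w :: 'a)" for w
  using t unfolding gd_def by (simp add: power_mult_distrib[symmetric] real_sqrt_mult power_mult_distrib)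
 have "(LBINT z. gd t z * f z) = (\<integral>z. gd t z * f z \<partial>density (distr lborel borel (%x. 0 + sqrt t *\<^sub>R x)) (%_. ennreal (\<bar>sqrt t\<bar> ^ DIM('a))))"
  unfolding lborel_affine[OF s, of 0, symmetric] ..
 also have "... = (LBINT w. \<bar>sqrt t\<bar> ^ DIM('a) * (gd t (0 + sqrt t *\<^sub>R w) * f (0 + sqrt t *\<^sub>R w)))"
  by (subst integral_density, measurable, subst integral_distr) auto
 also have "... = (LBINT w. gd 1 w * f (sqrt t *\<^sub>R w))"
  using t by (intro lint_cong) (auto simp: gd_scale[symmetric] mult_ac)
 finally show ?thesis .
qed

lemma gd_moments:
 obtains C where "0 <= C" "!!t. 0 < t ==> (NN w. ennreal (norm (w :: 'a::euclidean_space) ^ j * gd t w)) <= ennreal (C * sqrt t ^ j)"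
proof -
 obtain C where C: "0 <= C" "!!t (x :: 'a). 0 < t ==> norm x ^ j * gd t x <= C * sqrt t ^ j * gd (2 * t) x"
  by (rule gd_poly[of j]) blast
 show ?thesis
 proof (rule that[OF C(1)])
  fix t :: real assume t: "0 < t"
  have "(NN w. ennreal (norm (w :: 'a) ^ j * gd t w)) <= (NN w. ennreal (C * sqrt t ^ j) * ennreal (gd (2 * t) (w :: 'a)))"
  proof (rule nn_integral_mono)
   fix w :: 'a
   have "ennreal (norm w ^ j * gd t w) <= ennreal (C * sqrt t ^ j * gd (2 * t) w)" by (intro ennreal_leI C t)
   thus "ennreal (norm w ^ j * gd t w) <= ennreal (C * sqrt t ^ j) * ennreal (gd (2 * t) w)"
    using C(1) t by (simp add: ennreal_mult)
  qed
  also have "... = ennreal (C * sqrt t ^ j)"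
   using t by (simp add: nn_integral_cmult nn_integral_gd_0)
  finally show "(NN w. ennreal (norm (w :: 'a) ^ j * gd t w)) <= ennreal (C * sqrt t ^ j)" .
 qed
qed

lemma integrable_gd_moment:
 assumes "0 < t" shows "integrable lborel (%w :: 'a::euclidean_space. norm w ^ j * gd t w)"
proof -
 obtain C where "!!t. 0 < t ==> (NN w. ennreal (norm (w :: 'a) ^ j * gd t w)) <= ennreal (C * sqrt t ^ j)"
  by (rule gd_moments[of j]) blast
 from this[OF assms] show ?thesis
  using assms by (intro integrableI_nonneg) (auto simp: order_le_less_trans)
qed

lemma integral_gd_coord_square:
 "(NN x. ennreal (gd 1 x * (x $ i)\<^sup>2)) = 1" "(LBINT x. gd 1 x * (x $ i)\<^sup>2) = 1"
 for i :: "'d::finite"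
proof -
 let ?e = "axis i (1 :: real) :: real ^ 'd"
 let ?f = "%b y. ennreal (std_normal_density y * (if b = ?e then y\<^sup>2 else 1))"
 have e: "?e \<in> Basis" by (auto simp: Basis_vec_def)
 have "ennreal (gd 1 x * (x $ i)\<^sup>2) = (\<Prod>b\<in>Basis. ?f b (x \<bullet> b))" for x :: "real ^ 'd"
 proof -
  have "(\<Prod>b\<in>Basis. if b = ?e then (x \<bullet> b)\<^sup>2 else 1) = (x $ i)\<^sup>2"
   using e by (simp add: prod.delta inner_axis)
  hence "gd 1 x * (x $ i)\<^sup>2 = (\<Prod>b\<in>Basis. std_normal_density (x \<bullet> b) * (if b = ?e then (x \<bullet> b)\<^sup>2 else 1))"
   by (simp add: gd_prod prod.distrib)
  thus ?thesis by (subst prod_ennreal) auto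
 qed
 hence "(NN x. ennreal (gd 1 x * (x $ i)\<^sup>2)) = (\<integral>\<^sup>+x. (\<Prod>b\<in>Basis. ?f b (x \<bullet> b)) \<partial>(lborel :: (real ^ 'd) measure))" by simp
 also have "... = (\<Prod>b\<in>(Basis :: (real ^ 'd) set). (NN y. ?f b y))"
  by (rule nn_integral_lborel_prod) auto
 also have "... = 1"
 proof (rule prod.neutral, rule ballI)
  fix b :: "real ^ 'd"
  have "has_bochner_integral lborel (%x. std_normal_density x * x\<^sup>2) 1"
   using std_normal_moment_even[of 1] by simp
  hence "(NN y. ennreal (std_normal_density y * y\<^sup>2)) = 1"
   by (subst nn_integral_eq_integral) (auto simp: has_bochner_integral_iff)
  moreover have "(NN y. ennreal (std_normal_density y)) = 1"
   by (simp add: nn_integral_eq_integral)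
  ultimately show "(NN y. ?f b y) = 1" by (cases "b = ?e") simp_all
 qed
 finally show *: "(NN x. ennreal (gd 1 x * (x $ i)\<^sup>2)) = 1" .
 show "(LBINT x. gd 1 x * (x $ i)\<^sup>2) = 1"
  by (subst integral_eq_nn_integral) (auto simp: *)
qed

context prob_space begin

text \<open>Independence lets the two components be evaluated at separate sample points, so that
  expectations become iterated integrals over \<open>M\<close> and one component can be
  frozen.\<close>

lemma indep_var_distr_pair:
 assumes "indep_var borel V borel Z"
 shows "distr M (borel \<Otimes>\<^sub>M borel) (%x. (V x, Z x)) = distr (M \<Otimes>\<^sub>M M) (borel \<Otimes>\<^sub>M borel) (%z. (V (fst z), Z (snd z)))"
proof -
 have [measurable]: "V \<in> borel_measurable M" "Z \<in> borel_measurable M"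
  using assms by (auto dest: indep_var_rv1 indep_var_rv2)
 interpret Z: prob_space "distr M borel Z" by (rule prob_space_distr) simp
 have "distr M (borel \<Otimes>\<^sub>M borel) (%x. (V x, Z x)) = distr M borel V \<Otimes>\<^sub>M distr M borel Z"
  using assms unfolding indep_var_distribution_eq by simp
 also have "... = distr (M \<Otimes>\<^sub>M M) (borel \<Otimes>\<^sub>M borel) (%z. (V (fst z), Z (snd z)))"
  by (subst pair_measure_distr) (simp_all add: case_prod_beta', unfold_locales)
 finally show ?thesis .
qed

lemma
 fixes V :: "'a => 'b::second_countable_topology" and Z :: "'a => 'b"
 assumes ind: "indep_var borel V borel Z"
 shows indep_var_nn_integral: "!!\<Phi>. \<Phi> \<in> borel_measurable (borel \<Otimes>\<^sub>M borel) ==>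
   (\<integral>\<^sup>+x. \<Phi> (V x, Z x) \<partial>M) = (\<integral>\<^sup>+x'. (\<integral>\<^sup>+x. \<Phi> (V x, Z x') \<partial>M) \<partial>M)"
  and indep_var_integral: "!!\<Psi> :: 'b \<times> 'b => real. \<Psi> \<in> borel_measurable (borel \<Otimes>\<^sub>M borel) ==> integrable M (%x. \<Psi> (V x, Z x)) ==>
   (LINT x|M. \<Psi> (V x, Z x)) = (LINT x|M. (LINT x'|M. \<Psi> (V x, Z x')))"
proof -
 interpret P: pair_prob_space M M ..
 have [measurable]: "V \<in> borel_measurable M" "Z \<in> borel_measurable M"
  using ind by (auto dest: indep_var_rv1 indep_var_rv2)
 { fix \<Phi> :: "'b \<times> 'b => ennreal" assume [measurable]: "\<Phi> \<in> borel_measurable (borel \<Otimes>\<^sub>M borel)"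
  have "(\<integral>\<^sup>+x. \<Phi> (V x, Z x) \<partial>M) = (\<integral>\<^sup>+z. \<Phi> z \<partial>distr M (borel \<Otimes>\<^sub>M borel) (%x. (V x, Z x)))"
   by (subst nn_integral_distr) auto
  also have "... = (\<integral>\<^sup>+z. \<Phi> (V (fst z), Z (snd z)) \<partial>(M \<Otimes>\<^sub>M M))"
   unfolding indep_var_distr_pair[OF ind] by (subst nn_integral_distr) auto
  also have "... = (\<integral>\<^sup>+x'. (\<integral>\<^sup>+x. \<Phi> (V x, Z x') \<partial>M) \<partial>M)"
   by (subst P.nn_integral_snd[symmetric]) auto
  finally show "(\<integral>\<^sup>+x. \<Phi> (V x, Z x) \<partial>M) = (\<integral>\<^sup>+x'. (\<integral>\<^sup>+x. \<Phi> (V x, Z x') \<partial>M) \<partial>M)" . }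
 fix \<Psi> :: "'b \<times> 'b => real" assume [measurable]: "\<Psi> \<in> borel_measurable (borel \<Otimes>\<^sub>M borel)" and i: "integrable M (%x. \<Psi> (V x, Z x))"
 hence "integrable (distr M (borel \<Otimes>\<^sub>M borel) (%x. (V x, Z x))) \<Psi>"
  by (subst integrable_distr_eq) auto
 hence "integrable (M \<Otimes>\<^sub>M M) (%z. \<Psi> (V (fst z), Z (snd z)))"
  unfolding indep_var_distr_pair[OF ind] by (subst (asm) integrable_distr_eq) auto
 from P.integral_fst'[OF this] have "(LINT x|M. (LINT x'|M. \<Psi> (V x, Z x'))) = (\<integral>z. \<Psi> (V (fst z), Z (snd z)) \<partial>(M \<Otimes>\<^sub>M M))" by simp
 also have "... = (\<integral>z. \<Psi> z \<partial>distr M (borel \<Otimes>\<^sub>M borel) (%x. (V x, Z x)))"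
  unfolding indep_var_distr_pair[OF ind] by (subst integral_distr) auto
 also have "... = (LINT x|M. \<Psi> (V x, Z x))" by (subst integral_distr) auto
 finally show "(LINT x|M. \<Psi> (V x, Z x)) = (LINT x|M. (LINT x'|M. \<Psi> (V x, Z x')))" ..
qed

end

context diffusion begin

definition shifted_noise :: "real => (real => 'w => real ^ 'd) => bool" where
 "shifted_noise s Y \<longleftrightarrow> 0 <= s \<and> (\<forall>x\<in>space M. continuous_on {0..} (%t. Y t x) \<and> Y 0 x = 0) \<and>
   (\<forall>t\<ge>0. Y t \<in> borel_measurable M) \<and> (AE x in M. \<forall>r\<ge>0. Y r x = W (s + r) x - W s x)"

context
 fixes s :: real and Y :: "real => 'w => real ^ 'd"
 assumes sn: "shifted_noise s Y"
begin

lemma shifted_noise_start: "0 <= s"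
 and shifted_noise_continuous: "!!x. x \<in> space M ==> continuous_on {0..} (%t. Y t x)"
 and shifted_noise_measurable: "!!t. 0 <= t ==> Y t \<in> borel_measurable M"
 and shifted_noise_eq: "AE x in M. \<forall>r\<ge>0. Y r x = W (s + r) x - W s x"
 and shifted_noise_zero: "!!x. x \<in> space M ==> Y 0 x = 0"
 using sn unfolding shifted_noise_def by blast+

lemma shifted_max_measurable: "0 <= h ==> running_max k Y h \<in> borel_measurable M"
 by (rule running_max_measurable[OF shifted_noise_continuous shifted_noise_measurable])

lemma shifted_max_nonneg:
 assumes "x \<in> space M" "0 <= h" shows "0 <= running_max k Y h x"
proof -
 have "continuous_on {0..} (%t. Y t x $ k)" by (intro continuous_intros shifted_noise_continuous assms)
 from rmax_ge[OF this, of 0 h] show ?thesis using assms shifted_noise_zero[OF assms(1)] by (simp add: running_max_eq)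
qed

text \<open>The shifted noise is itself a driftless diffusion, so the Duhamel formula determines the law of
 its running maximum (the reflection principle).\<close>
lemma shifted_noise_diffusion:
 "diffusion M (%_. 0) (return borel 0) (%r p. W (s + r) p - W s p) Y 0 0"
proof
 show "brownian_motion M (%r p. W (s + r) p - W s p)"
  unfolding brownian_motion_def
 proof (intro conjI allI impI)
  show "(%p. W (s + t) p - W s p) \<in> borel_measurable M" if "0 <= t" for t
   using shifted_noise_start that by (intro borel_measurable_diff W_measurable) auto
  show "AE p in M. W (s + 0) p - W s p = 0 \<and> continuous_on {0..} (%t. W (s + t) p - W s p)"
   using W_paths
  proof eventually_elim
   case (elim p)
   have "continuous_on {0..} (%t. W (s + t) p)"
    by (rule continuous_on_compose2[OF conjunct2[OF elim]]) (use shifted_noise_start in \<open>auto intro!: continuous_intros\<close>)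
   thus ?case by (auto intro!: continuous_intros)
  qed
  fix r t :: real assume rt: "0 <= r \<and> r < t"
  have "\<forall>s t. 0 <= s \<and> s < t \<longrightarrow> distributed M lborel (%p. W t p - W s p)
     (%x. ennreal (\<Prod>i\<in>UNIV. normal_density 0 (sqrt (t - s)) (x $ i)))"
   using bm unfolding brownian_motion_def by blast
  from this[rule_format, of "s + r" "s + t"] shifted_noise_start rt show "distributed M lborel (%p. W (s + t) p - W s p - (W (s + r) p - W s p)) (%x. ennreal (\<Prod>i\<in>UNIV. normal_density 0 (sqrt (t - r)) (x $ i)))"
   by simp
 next
  fix n :: nat and \<tau> :: "nat => real" assume \<tau>: "0 <= \<tau> 0 \<and> (\<forall>i<n. \<tau> i < \<tau> (Suc i))"
  have "indep_vars (%_. borel) (%i p. W (s + \<tau> (Suc i)) p - W (s + \<tau> i) p) {..<n}"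
   using indep_increments[of "%i. s + \<tau> i" n] shifted_noise_start \<tau> by simp
  thus "indep_vars (%_. borel) (%i p. W (s + \<tau> (Suc i)) p - W s p - (W (s + \<tau> i) p - W s p)) {..<n}" by simp
 qed
 show "sde_solution M (%_. 0) (return borel 0) (%r p. W (s + r) p - W s p) Y"
  unfolding sde_solution_def
 proof (intro conjI allI impI ballI)
  show "distr M borel (Y 0) = return borel 0"
  proof -
   have "distr M borel (Y 0) = distr M borel (%_. 0)" using shifted_noise_zero by (intro distr_cong) auto
   thus ?thesis by (simp add: distr_const)
  qed
  show "AE p in M. \<forall>t\<ge>0. Y t p = Y 0 p + integral {0..t} (%s. 0) + (W (s + t) p - W s p)"
   using shifted_noise_eq AE_space by eventually_elim (simp add: shifted_noise_zero)
  let ?A = "sets (vimage_algebra (space M) (Y 0) borel)"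
  let ?B = "sets (vimage_algebra (space M) (%p. \<lambda>t\<in>{0..}. W (s + t) p - W s p) (PiM {0..} (%_. borel)))"
  have A: "A = {} \<or> A = space M" if A: "A \<in> ?A" for A
  proof -
   obtain S where "A = Y 0 -` S \<inter> space M" using A by (subst (asm) sets_vimage_algebra2) auto
   thus ?thesis by (cases "0 \<in> S") (auto simp: shifted_noise_zero)
  qed
  have Wm: "(%p. \<lambda>t\<in>{0..}. W (s + t) p - W s p) \<in> measurable M (PiM {0..} (%_. borel))"
   using shifted_noise_start by (intro measurable_restrict borel_measurable_diff W_measurable) auto
  have B: "?B \<subseteq> events"
   using measurable_space[OF Wm] measurable_sets[OF Wm] by (subst sets_vimage_algebra2) auto
  show "indep_set ?A ?B"
  proof (rule indep_setI)
   show "?A \<subseteq> events" using A by blast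
   fix a b assume ab: "a \<in> ?A" "b \<in> ?B"
   have b: "b \<subseteq> space M" using B ab sets.sets_into_space by blast
   from A[OF ab(1)] show "prob (a \<inter> b) = prob a * prob b"
    by (elim disjE) (use b in \<open>auto simp: prob_space Int_absorb1\<close>)
  qed (rule B)
 qed (use shifted_noise_continuous shifted_noise_measurable in auto)
qed simp_all

text \<open>The Duhamel formula with \<open>g = 1\<close> and no drift: the odd extension of 1 gives
  the Gaussian mass below \<open>c\<close> minus the mass above, which by symmetry is the mass of
  \<open>\<bar>z $ k\<bar> < c\<close>.\<close>

lemma maximum_cdf:
 assumes h: "0 < h"
 shows "measure M {v \<in> space M. running_max k Y h v < c} = (LBINT z. gd h z * (if \<bar>z $ k\<bar> < c then 1 else 0))"
proof -
 interpret S: diffusion M k "%_. 0" "return borel 0" "%r v. W (s + r) v - W s v" Y 0 0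
  by (rule shifted_noise_diffusion)
 note [measurable] = S.MX_measurable
 let ?o = "odd_ext k c (%_ :: real ^ 'd. 1 :: real)"
 have "measure M {v \<in> space M. running_max k Y h v < c} = (LINT v|M. (if S.MX h v < c then 1 else 0))"
 proof -
  have "{v \<in> space M. S.MX h v < c} \<in> sets M" by measurable
  hence "measure M {v \<in> space M. S.MX h v < c} = (LINT v|M. indicator {v \<in> space M. S.MX h v < c} v)" by simp
  also have "... = (LINT v|M. (if S.MX h v < c then 1 else 0))" by (intro lint_cong) (auto simp: indicator_def)
  finally show ?thesis using h by (simp add: S.MX_eq)
 qed
 also have "... = (LINT v|M. (if S.XX 0 v $ k < c then heat ?o h (S.XX 0 v) else 0))"
 proof -
  have "dheat ?o r x 0 = 0" for r x by (simp add: dheat_def)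
  thus ?thesis using S.weak_duhamel[of "%_. 1" 1 h c] h by (simp cong: if_cong)
 qed
 also have "... = (LINT v|M. (if 0 < c then heat ?o h 0 else 0))"
  by (intro lint_cong) (auto simp: S.XX_eq shifted_noise_zero)
 also have "... = (if 0 < c then heat ?o h 0 else 0)" by (simp add: prob_space)
 also have "... = (LBINT z. gd h z * (if \<bar>z $ k\<bar> < c then 1 else 0))"
 proof (cases "0 < c")
  case True
  have i: "integrable lborel (%z. gd h z * f z)" if "!!z. \<bar>f z\<bar> <= 1" and [measurable]: "f \<in> borel_measurable borel" for f :: "real ^ 'd => real"
  proof (rule lint_bound[OF integrable_gd[OF h, of 0]])
   show "AE z in lborel. norm (gd h z * f z) <= norm (gd h (z - 0))"
    using that(1) h by (intro AE_I2) (simp add: abs_mult mult_left_le)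
  qed measurable
  let ?p = "%z. (if z $ k < c then 1 else 0) :: real" and ?q = "%z. (if c < z $ k then 1 else 0) :: real"
  have "heat ?o h 0 = (LBINT z. gd h z * ?p z - gd h z * ?q z)"
   unfolding heat_def by (intro lint_cong) (auto simp: odd_ext_def)
  also have "... = (LBINT z. gd h z * ?p z) - (LBINT z. gd h z * ?q z)"
   by (intro Bochner_Integration.integral_diff i) auto
  also have "(LBINT z. gd h z * ?q z) = (LBINT z. gd h (mirror k 0 z) * ?q (mirror k 0 z))"
   by (rule integral_mirror[symmetric]) measurable
  also have "... = (LBINT z. gd h z * ?q (mirror k 0 z))"
  proof -
   have "norm (mirror k 0 z) = norm z" for z :: "real ^ 'd"
    using norm_mirror_diff[of k 0 z 0] by (simp add: mirror_hyperplane)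
   hence "gd h (mirror k 0 z) = gd h z" for z :: "real ^ 'd" by (intro gd_cong_norm)
   thus ?thesis by simp
  qed
  also have "(LBINT z. gd h z * ?p z) - ... = (LBINT z. gd h z * ?p z - gd h z * ?q (mirror k 0 z))"
   by (intro Bochner_Integration.integral_diff[symmetric] i) auto
  also have "... = (LBINT z. gd h z * (if \<bar>z $ k\<bar> < c then 1 else 0))"
  proof (rule integral_cong_AE)
   show "AE z in lborel. gd h z * ?p z - gd h z * ?q (mirror k 0 z) = gd h z * (if \<bar>z $ k\<bar> < c then 1 else 0)"
    using AE_hyperplane[of k "- c"] by eventually_elim (use True in \<open>auto simp: mirror_nth\<close>)
  qed measurable
  finally show ?thesis using True by simp
 next
  case False
  hence "\<not> \<bar>z $ k\<bar> < c" for z :: "real ^ 'd" by linarith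
  thus ?thesis using False by simp
 qed
 finally show ?thesis .
qed


lemma maximum_law:
 assumes h: "0 < h"
 shows "distr M borel (running_max k Y h) = distr (density lborel (%z. ennreal (gd h z))) borel (%z :: real ^ 'd. \<bar>z $ k\<bar>)"
proof -
 have Sm [measurable]: "running_max k Y h \<in> borel_measurable M" by (rule shifted_max_measurable) (use h in auto)
 let ?G = "density lborel (%z :: real ^ 'd. ennreal (gd h z))"
 have "prob_space ?G" by (rule prob_spaceI) (simp add: emeasure_density nn_integral_gd_0 h)
 then interpret G: prob_space ?G .
 \<comment> \<open>The sign is reversed because the known probabilities are those below a level,
   while the uniqueness criterion compares upper tails.\<close>
 have "distr M borel (%p. - running_max k Y h p) = distr ?G borel (%z. - \<bar>z $ k\<bar>)"
 proof (rule measure_eqI_lessThan)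
  fix x :: real
  have "emeasure (distr M borel (%p. - running_max k Y h p)) {x<..} = ennreal (measure M {p \<in> space M. running_max k Y h p < - x})"
   by (subst emeasure_distr) (auto simp: emeasure_eq_measure vimage_def Int_def conj_commute less_minus_iff intro!: arg_cong[where f=prob])
  also have "... = ennreal (LBINT z. gd h z * (if \<bar>z $ k\<bar> < - x then 1 else 0))" by (simp add: maximum_cdf[OF h])
  also have "... = (NN z. ennreal (gd h z * (if \<bar>z $ k\<bar> < - x then 1 else 0)))"
   by (rule nn_integral_eq_integral[symmetric], rule lint_bound[OF integrable_gd[OF h, of 0]]) (use h in auto)
  also have "... = (NN z. ennreal (gd h z) * indicator {z. \<bar>z $ k\<bar> < - x} z)"
   by (intro nn_integral_cong) (auto simp: indicator_def)
  also have "... = emeasure ?G {z. \<bar>z $ k\<bar> < - x}" by (subst emeasure_density) auto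
  also have "... = emeasure (distr ?G borel (%z. - \<bar>z $ k\<bar>)) {x<..}"
   by (subst emeasure_distr) (auto simp: vimage_def less_minus_iff intro!: arg_cong[where f="emeasure ?G"])
  finally show "emeasure (distr M borel (%p. - running_max k Y h p)) {x<..} = emeasure (distr ?G borel (%z. - \<bar>z $ k\<bar>)) {x<..}" .
  show "emeasure (distr M borel (%p. - running_max k Y h p)) {x<..} < \<infinity>"
   by (subst emeasure_distr) (auto simp: emeasure_eq_measure)
 qed auto
 hence "distr (distr M borel (%p. - running_max k Y h p)) borel uminus = distr (distr ?G borel (%z. - \<bar>z $ k\<bar>)) borel uminus" by simp
 thus ?thesis by (simp add: distr_distr comp_def)
qed

end

definition disp :: "real => (real => 'w => real ^ 'd) => real => 'w => real" where
 "disp s Y h x = running_max k Y h x + norm (W (s + h) x - W s x) + L * h"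

text \<open>\<open>disp\<close> dominates both the growth of the running maximum and the displacement of the
 diffusion over a time step of length \<open>h\<close>.\<close>
lemma displacement_moment_ex:
 "\<exists>C\<ge>0. \<forall>s Y h. shifted_noise s Y \<longrightarrow> 0 < h \<longrightarrow> h <= 1 \<longrightarrow>
   (\<integral>\<^sup>+p. ennreal (((disp s Y h p)\<^sup>2 + h) * disp s Y h p) \<partial>M) <= ennreal (C * (h * sqrt h))"
proof -
 obtain C1 where C1: "0 <= C1" "!!t. 0 < t ==> (NN w. ennreal (norm (w :: real ^ 'd) ^ 1 * gd t w)) <= ennreal (C1 * sqrt t ^ 1)"
  by (rule gd_moments[of 1]) blast
 obtain C3 where C3: "0 <= C3" "!!t. 0 < t ==> (NN w. ennreal (norm (w :: real ^ 'd) ^ 3 * gd t w)) <= ennreal (C3 * sqrt t ^ 3)"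
  by (rule gd_moments[of 3]) blast
 \<comment> \<open>27 is the loss in \<open>(a + b + c) ^ 3 <= 27 * (a ^ 3 + b ^ 3 + c ^ 3)\<close>.
   Third moments of the noise and of its maximum are of order \<open>h * sqrt h\<close>, as is
   \<open>h\<close> times a first moment; the drift terms are no larger because
   \<open>h <= 1\<close>.\<close>
 let ?C = "27 * (C3 + C3 + L ^ 3) + (C1 + C1 + L)"
 show ?thesis
 proof (intro exI[of _ ?C] conjI allI impI)
  show "0 <= ?C" using C1 C3 L_nonneg by simp
  fix s h :: real and Y :: "real => 'w => real ^ 'd" assume sn: "shifted_noise s Y" and h: "0 < h" "h <= 1"
  note s = shifted_noise_start[OF sn]
  let ?S = "running_max k Y h" and ?N = "%p. norm (W (s + h) p - W s p)"
  have Sm [measurable]: "?S \<in> borel_measurable M" by (rule shifted_max_measurable[OF sn]) (use h in auto)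
  have dW [measurable]: "(%p. W (s + h) p - W s p) \<in> borel_measurable M"
   using s h by (intro borel_measurable_diff W_measurable) auto
  have S0: "0 <= ?S p" if "p \<in> space M" for p using shifted_max_nonneg[OF sn that] h by simp
  have mN: "(\<integral>\<^sup>+p. ennreal (?N p ^ j) \<partial>M) = (NN w. ennreal (norm (w :: real ^ 'd) ^ j * gd h w))" for j
  proof -
   have D: "distributed M lborel (%p. W (s + h) p - W s p) (%x. ennreal (gd h x))"
    using W_increment_density[of s "s + h"] s h by simp
   show ?thesis
    using distributed_nn_integral[OF D, of "%w. ennreal (norm w ^ j)"] h by (simp add: ennreal_mult' mult.commute)
  qed
  have mS: "(\<integral>\<^sup>+p. ennreal (?S p ^ j) \<partial>M) <= (NN w. ennreal (norm (w :: real ^ 'd) ^ j * gd h w))" for j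
  proof -
   have "(\<integral>\<^sup>+p. ennreal (?S p ^ j) \<partial>M) = (\<integral>\<^sup>+x. ennreal (x ^ j) \<partial>distr M borel ?S)"
    by (subst nn_integral_distr) auto
   also have "... = (NN w. ennreal (gd h w) * ennreal (\<bar>w $ k\<bar> ^ j))"
    unfolding maximum_law[OF sn h(1)] by (subst nn_integral_distr, simp, simp, subst nn_integral_density) auto
   also have "... <= (NN w. ennreal (norm (w :: real ^ 'd) ^ j * gd h w))"
    using h component_le_norm_cart
    by (intro nn_integral_mono) (auto simp: ennreal_mult[symmetric] mult.commute intro!: ennreal_leI mult_left_mono power_mono)
   finally show ?thesis .
  qed
  have pw: "ennreal (((?S p + ?N p + L * h)\<^sup>2 + h) * (?S p + ?N p + L * h))
    <= ennreal 27 * (ennreal (?S p ^ 3) + ennreal (?N p ^ 3) + ennreal ((L * h) ^ 3)) + ennreal h * (ennreal (?S p ^ 1) + ennreal (?N p ^ 1) + ennreal (L * h))"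
   if "p \<in> space M" for p
  proof -
   have cube: "(a + b + c) ^ 3 <= 27 * (a ^ 3 + b ^ 3 + c ^ 3)" if "0 <= a" "0 <= b" "0 <= c" for a b c :: real
   proof -
    define m where "m = max a (max b c)"
    have "(a + b + c) ^ 3 <= (3 * m) ^ 3" using that by (intro power_mono) (auto simp: m_def)
    also have "... = 27 * m ^ 3" by (simp add: power_mult_distrib)
    also have "m ^ 3 <= a ^ 3 + b ^ 3 + c ^ 3" using that by (auto simp: m_def max_def)
    finally show ?thesis by simp
   qed
   let ?a = "?S p" and ?b = "?N p" and ?c = "L * h"
   have n: "0 <= ?a" "0 <= ?b" "0 <= ?c" using S0[OF that] L_nonneg h by auto
   have "((?a + ?b + ?c)\<^sup>2 + h) * (?a + ?b + ?c) = (?a + ?b + ?c) ^ 3 + h * (?a + ?b + ?c)"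
    by (simp add: power2_eq_square power3_eq_cube distrib_right)
   also have "... <= 27 * (?a ^ 3 + ?b ^ 3 + ?c ^ 3) + h * (?a + ?b + ?c)" using cube[OF n] by simp
   finally have "ennreal (((?a + ?b + ?c)\<^sup>2 + h) * (?a + ?b + ?c)) <= ennreal (27 * (?a ^ 3 + ?b ^ 3 + ?c ^ 3) + h * (?a + ?b + ?c))" by (rule ennreal_leI)
   also have "... = ennreal 27 * (ennreal (?a ^ 3) + ennreal (?b ^ 3) + ennreal (?c ^ 3)) + ennreal h * (ennreal (?a ^ 1) + ennreal (?b ^ 1) + ennreal ?c)"
    using n h by (simp only: ennreal_plus[symmetric] ennreal_mult[symmetric] add_nonneg_nonneg zero_le_power mult_nonneg_nonneg power_one_right less_imp_le[OF h(1)] zero_le_numeral)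
   finally show ?thesis .
  qed
  have "(\<integral>\<^sup>+p. ennreal (((?S p + ?N p + L * h)\<^sup>2 + h) * (?S p + ?N p + L * h)) \<partial>M)
    <= (\<integral>\<^sup>+p. ennreal 27 * (ennreal (?S p ^ 3) + ennreal (?N p ^ 3) + ennreal ((L * h) ^ 3)) + ennreal h * (ennreal (?S p ^ 1) + ennreal (?N p ^ 1) + ennreal (L * h)) \<partial>M)"
   by (rule nn_integral_mono) (rule pw)
  also have "... = ennreal 27 * ((\<integral>\<^sup>+p. ennreal (?S p ^ 3) \<partial>M) + (\<integral>\<^sup>+p. ennreal (?N p ^ 3) \<partial>M) + ennreal ((L * h) ^ 3))
    + ennreal h * ((\<integral>\<^sup>+p. ennreal (?S p ^ 1) \<partial>M) + (\<integral>\<^sup>+p. ennreal (?N p ^ 1) \<partial>M) + ennreal (L * h))"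
   by (simp add: nn_integral_add nn_integral_cmult emeasure_space_1)
  also have "... <= ennreal 27 * (ennreal (C3 * sqrt h ^ 3) + ennreal (C3 * sqrt h ^ 3) + ennreal ((L * h) ^ 3))
    + ennreal h * (ennreal (C1 * sqrt h ^ 1) + ennreal (C1 * sqrt h ^ 1) + ennreal (L * h))"
   using order_trans[OF mS C3(2)[OF h(1)]] order_trans[OF eq_refl[OF mN] C3(2)[OF h(1)]] order_trans[OF mS C1(2)[OF h(1)]] order_trans[OF eq_refl[OF mN] C1(2)[OF h(1)]]
   by (intro add_mono mult_left_mono order_refl) simp_all
  also have "... = ennreal (27 * (C3 * sqrt h ^ 3 + C3 * sqrt h ^ 3 + (L * h) ^ 3) + h * (C1 * sqrt h ^ 1 + C1 * sqrt h ^ 1 + L * h))"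
   using h C1(1) C3(1) L_nonneg
   by (simp only: ennreal_plus[symmetric] ennreal_mult[symmetric] add_nonneg_nonneg zero_le_power mult_nonneg_nonneg less_imp_le[OF h(1)] zero_le_numeral real_sqrt_ge_zero)
  also have "... <= ennreal (?C * (h * sqrt h))"
  proof (rule ennreal_leI)
   have c: "sqrt h ^ 3 = h * sqrt h" using h by (simp add: power3_eq_cube)
   have hs: "h <= sqrt h" using h by (intro real_le_rsqrt) (simp add: power2_eq_square mult_left_le)
   have "h ^ 3 <= h * sqrt h"
   proof -
    have "h * h <= 1 * sqrt h" using h hs by (intro mult_mono) auto
    hence "h * (h * h) <= h * sqrt h" using h by (intro mult_left_mono) auto
    thus ?thesis by (simp add: power3_eq_cube mult.assoc)
   qed
   hence "L ^ 3 * h ^ 3 <= L ^ 3 * (h * sqrt h)" using L_nonneg by (intro mult_left_mono) auto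
   moreover have "h * (L * h) <= L * (h * sqrt h)" using h hs L_nonneg by (simp add: mult.left_commute mult_left_mono)
   ultimately show "27 * (C3 * sqrt h ^ 3 + C3 * sqrt h ^ 3 + (L * h) ^ 3) + h * (C1 * sqrt h ^ 1 + C1 * sqrt h ^ 1 + L * h) <= ?C * (h * sqrt h)"
    unfolding c power_mult_distrib by (simp add: algebra_simps)
  qed
  finally show "(\<integral>\<^sup>+p. ennreal (((disp s Y h p)\<^sup>2 + h) * disp s Y h p) \<partial>M) <= ennreal (?C * (h * sqrt h))"
   unfolding disp_def .
 qed
qed

definition CD :: real where
 "CD = (SOME C. 0 <= C \<and> (\<forall>s Y h. shifted_noise s Y \<longrightarrow> 0 < h \<longrightarrow> h <= 1 \<longrightarrow>
   (\<integral>\<^sup>+x. ennreal (((disp s Y h x)\<^sup>2 + h) * disp s Y h x) \<partial>M) <= ennreal (C * (h * sqrt h))))"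

lemma CD_nonneg: "0 <= CD"
 and displacement_moment: "shifted_noise s Y ==> 0 < h ==> h <= 1 ==>
   (\<integral>\<^sup>+x. ennreal (((disp s Y h x)\<^sup>2 + h) * disp s Y h x) \<partial>M) <= ennreal (CD * (h * sqrt h))"
 using someI_ex[OF displacement_moment_ex] unfolding CD_def[symmetric] by blast+

end

section \<open>Test functions\<close>

lemma integral_gd_odd:
 fixes i j :: "'d::finite"
 shows "(LBINT v. gd 1 v * v $ i) = 0" and "i \<noteq> j ==> (LBINT v. gd 1 v * (v $ i * v $ j)) = 0"
proof -
 have odd: "(LBINT v. gd 1 v * f v) = 0"
  if [measurable]: "f \<in> borel_measurable borel" and f: "!!v. f (mirror i 0 v) = - f v" for f :: "real ^ 'd => real"
 proof -
  have "norm (mirror i 0 v) = norm v" for v :: "real ^ 'd"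
   using norm_mirror_diff[of i 0 v 0] by (simp add: mirror_hyperplane)
  hence "gd 1 (mirror i 0 v) = gd 1 v" for v :: "real ^ 'd" by (intro gd_cong_norm)
  moreover have "(LBINT v. gd 1 v * f v) = (LBINT v. gd 1 (mirror i 0 v) * f (mirror i 0 v))"
   by (rule integral_mirror[symmetric]) measurable
  ultimately show ?thesis by (simp add: f)
 qed
 show "(LBINT v. gd 1 v * v $ i) = 0" by (rule odd) (auto simp: mirror_nth)
 show "(LBINT v. gd 1 v * (v $ i * v $ j)) = 0" if "i \<noteq> j" using that by (intro odd) (auto simp: mirror_nth)
qed

lemma integrable_gd_growth:
 fixes f :: "'a::euclidean_space => real"
 assumes [measurable]: "f \<in> borel_measurable borel" and f: "!!v. \<bar>f v\<bar> <= K * norm v ^ j"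
 shows "integrable lborel (%v. gd 1 v * f v)"
proof (rule lint_bound[OF integrable_mult_right[OF integrable_gd_moment[of 1 j], of K]])
 show "AE v in lborel. norm (gd 1 v * f v) <= norm (K * (norm v ^ j * gd 1 v))"
 proof (rule AE_I2)
  fix v :: 'a
  have "gd 1 v * \<bar>f v\<bar> <= gd 1 v * (K * norm v ^ j)" by (intro mult_left_mono f) auto
  also have "gd 1 v * (K * norm v ^ j) <= \<bar>K * (norm v ^ j * gd 1 v)\<bar>" by (rule order_trans[OF _ abs_ge_self]) (simp add: mult_ac)
  finally show "norm (gd 1 v * f v) <= norm (K * (norm v ^ j * gd 1 v))" by (simp add: abs_mult)
 qed
qed auto

lemma vec_sum_axis: "(\<Sum>i\<in>UNIV. v $ i *\<^sub>R axis i 1) = (v :: real ^ 'd::finite)"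
 using basis_expansion[of v] by (simp add: scalar_mult_eq_scaleR)

text \<open>Mixed moments vanish by reflection and second moments are 1, so the Gaussian average of
  a bilinear form is its trace.\<close>

lemma integral_gd_bilinear:
 fixes A :: "real ^ 'd::finite => real ^ 'd => real"
 assumes A: "bounded_bilinear A"
 shows "(LBINT v. gd 1 v * A v v) = (\<Sum>i\<in>UNIV. A (axis i 1) (axis i 1))"
proof -
 interpret bounded_bilinear A by fact
 have "A v v = (\<Sum>i\<in>UNIV. \<Sum>j\<in>UNIV. v $ i * v $ j * A (axis i 1) (axis j 1))" for v
 proof -
  have "A v v = A (\<Sum>i\<in>UNIV. v $ i *\<^sub>R axis i 1) (\<Sum>j\<in>UNIV. v $ j *\<^sub>R axis j 1)" by (simp only: vec_sum_axis)
  also have "... = (\<Sum>i\<in>UNIV. \<Sum>j\<in>UNIV. v $ i * v $ j * A (axis i 1) (axis j 1))"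
   by (simp only: sum_left scaleR_left, simp only: sum_right scaleR_right real_scaleR_def sum_distrib_left mult.assoc)
  finally show ?thesis .
 qed
 hence "(LBINT v. gd 1 v * A v v) = (LBINT v. (\<Sum>i\<in>UNIV. \<Sum>j\<in>UNIV. gd 1 v * (v $ i * v $ j) * A (axis i 1) (axis j 1)))"
  by (simp add: sum_distrib_left mult.assoc)
 also have "... = (\<Sum>i\<in>UNIV. \<Sum>j\<in>UNIV. (LBINT v. gd 1 v * (v $ i * v $ j)) * A (axis i 1) (axis j 1))"
 proof -
  have i: "integrable lborel (%v :: real ^ 'd. gd 1 v * (v $ i * v $ j))" for i j
   by (rule integrable_gd_growth[where K=1 and j=2])
    (auto simp: abs_mult power2_eq_square intro!: mult_mono component_le_norm_cart)
  have i': "integrable lborel (%v :: real ^ 'd. gd 1 v * (v $ i * v $ j) * A (axis i 1) (axis j 1))" for i j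
   by (rule integrable_mult_left) (rule i)
  have "(LBINT v. (\<Sum>i\<in>UNIV. \<Sum>j\<in>UNIV. gd 1 v * (v $ i * v $ j) * A (axis i 1) (axis j 1)))
    = (\<Sum>i\<in>UNIV. \<integral>v. (\<Sum>j\<in>UNIV. gd 1 v * (v $ i * v $ j) * A (axis i 1) (axis j 1)) \<partial>lborel)"
   by (rule Bochner_Integration.integral_sum) (rule Bochner_Integration.integrable_sum, rule i')
  also have "... = (\<Sum>i\<in>UNIV. \<Sum>j\<in>UNIV. \<integral>v. gd 1 v * (v $ i * v $ j) * A (axis i 1) (axis j 1) \<partial>lborel)"
   by (intro sum.cong Bochner_Integration.integral_sum i' HOL.refl)
  finally show ?thesis by simp
 qed
 also have "... = (\<Sum>i\<in>UNIV. \<Sum>j\<in>UNIV. if i = j then A (axis i 1) (axis j 1) else 0)"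
  using integral_gd_coord_square(2)[where 'd='d] by (intro sum.cong) (auto simp: integral_gd_odd(2) power2_eq_square)
 finally show ?thesis by simp
qed

locale test_function =
 fixes F :: "'a::euclidean_space => real" and F' :: "'a => 'a \<Rightarrow>\<^sub>L real" and F'' :: "'a => 'a \<Rightarrow>\<^sub>L ('a \<Rightarrow>\<^sub>L real)" and C :: real
 assumes D1: "!!z. (F has_derivative blinfun_apply (F' z)) (at z)" and D2: "!!z. (F' has_derivative blinfun_apply (F'' z)) (at z)"
  and F''_continuous: "continuous_on UNIV F''"
  and F_bound: "!!z. \<bar>F z\<bar> <= C" and F'_norm: "!!z. norm (F' z) <= C" and F''_norm: "!!z. norm (F'' z) <= C"
begin

lemma C_nonneg: "0 <= C" using F_bound[of 0] by linarith

lemma F_continuous: "continuous_on UNIV F" and F'_continuous: "continuous_on UNIV F'"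
 by (rule has_derivative_continuous_on, rule has_derivative_at_withinI, rule D1)
  (rule has_derivative_continuous_on, rule has_derivative_at_withinI, rule D2)

lemma F_measurable [measurable]: "F \<in> borel_measurable borel"
 by (rule borel_measurable_continuous_onI[OF F_continuous])

lemma F'_tendsto: "z ----> z0 ==> v ----> v0 ==> (%n. F' (z n) (v n)) ----> F' z0 v0"
 by (rule blinfun.tendsto[OF continuous_on_tendsto_compose[OF F'_continuous]]) auto

lemma F''_tendsto: "z ----> z0 ==> (%n. F'' (z n) v w) ----> F'' z0 v w"
 by (intro blinfun.tendsto[OF blinfun.tendsto[OF continuous_on_tendsto_compose[OF F''_continuous]]] tendsto_const) auto

lemma F'_measurable [measurable (raw)]:
 assumes [measurable]: "f \<in> borel_measurable N" "g \<in> borel_measurable N"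
 shows "(%x. blinfun_apply (F' (f x)) (g x)) \<in> borel_measurable N"
proof -
 have "continuous_on UNIV (%p. blinfun_apply (F' (fst p)) (snd p))"
  by (intro blinfun.continuous_on continuous_on_compose2[OF F'_continuous] continuous_intros) auto
 hence "(%p. blinfun_apply (F' (fst p)) (snd p)) \<in> borel_measurable borel" by (rule borel_measurable_continuous_onI)
 from measurable_compose[OF borel_measurable_Pair[OF assms] this] show ?thesis by simp
qed

lemma F''_measurable [measurable]: "(%x. blinfun_apply (blinfun_apply (F'' x) v) w) \<in> borel_measurable borel"
 by (intro borel_measurable_continuous_onI blinfun.continuous_on F''_continuous continuous_on_const)

lemma F'_bound: "\<bar>F' z v\<bar> <= C * norm v"
 using norm_blinfun[of "F' z" v] mult_right_mono[OF F'_norm norm_ge_zero, of z v] by simp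

lemma F''_bound: "\<bar>F'' z v w\<bar> <= C * norm v * norm w"
proof -
 have "\<bar>F'' z v w\<bar> <= norm (F'' z v) * norm w" using norm_blinfun[of "F'' z v" w] by simp
 also have "... <= norm (F'' z) * norm v * norm w" by (intro mult_right_mono norm_blinfun) auto
 also have "... <= C * norm v * norm w" by (intro mult_right_mono F''_norm) auto
 finally show ?thesis .
qed

lemma line_derivative: "((%r. F (z + r *\<^sub>R v)) has_real_derivative F' (z + r *\<^sub>R v) v) (at r)"
proof -
 have "((%r. F (z + r *\<^sub>R v)) has_derivative (%h. F' (z + r *\<^sub>R v) (h *\<^sub>R v))) (at r)"
  by (rule has_derivative_compose[OF _ D1]) (auto intro!: derivative_eq_intros)
 thus ?thesis unfolding has_field_derivative_def by (simp add: blinfun.scaleR_right mult_commute_abs)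
qed

lemma line_derivative': "((%r. F' (z + r *\<^sub>R v) v) has_real_derivative F'' (z + r *\<^sub>R v) v v) (at r)"
proof -
 have "((%r. F' (z + r *\<^sub>R v)) has_derivative (%h. F'' (z + r *\<^sub>R v) (h *\<^sub>R v))) (at r)"
  by (rule has_derivative_compose[OF _ D2]) (auto intro!: derivative_eq_intros)
 hence "((%r. F' (z + r *\<^sub>R v) v) has_derivative (%h. F'' (z + r *\<^sub>R v) (h *\<^sub>R v) v)) (at r)"
  by (rule bounded_linear.has_derivative[OF blinfun.bounded_linear_left])
 thus ?thesis unfolding has_field_derivative_def by (simp add: blinfun.scaleR_right blinfun.scaleR_left mult_commute_abs)
qed

lemma taylor: obtains \<theta> where "\<bar>\<theta>\<bar> <= 1" "F (z + v) = F z + F' z v + F'' (z + \<theta> *\<^sub>R v) v v / 2"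
proof -
 let ?d = "%(m :: nat) r. if m = 0 then F (z + r *\<^sub>R v) else if m = 1 then F' (z + r *\<^sub>R v) v else F'' (z + r *\<^sub>R v) v v"
 have "\<exists>t. \<bar>t\<bar> <= \<bar>1\<bar> \<and> F (z + 1 *\<^sub>R v) = (\<Sum>m<2. ?d m 0 / (fact m) * 1 ^ m) + ?d 2 t / (fact 2) * 1 ^ 2"
 proof (rule Maclaurin_bi_le[where diff="?d"])
  show "\<forall>m t. m < 2 \<and> \<bar>t\<bar> <= \<bar>1\<bar> \<longrightarrow> DERIV (?d m) t :> ?d (Suc m) t"
   using line_derivative line_derivative' by (auto simp: less_2_cases_iff)
 qed simp
 thus ?thesis using that by (auto simp: numeral_2_eq_2)
qed

lemma taylor_bound: "\<bar>F (z + v) - F z - F' z v\<bar> <= C / 2 * (norm v)\<^sup>2"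
proof -
 obtain \<theta> where "F (z + v) = F z + F' z v + F'' (z + \<theta> *\<^sub>R v) v v / 2" by (rule taylor)
 thus ?thesis using F''_bound[of "z + \<theta> *\<^sub>R v" v v] by (simp add: power2_eq_square mult.assoc)
qed

lemma F_lipschitz: "\<bar>F (z + v) - F z\<bar> <= C * norm v"
proof -
 have "norm (F (z + v) - F z) <= C * norm (z + v - z)"
  by (rule differentiable_bound[OF convex_UNIV has_derivative_at_withinI[OF D1]]) (simp_all add: F'_norm norm_blinfun.rep_eq[symmetric])
 thus ?thesis by simp
qed

lemma F'_lipschitz: "\<bar>F' (z + w) v - F' z v\<bar> <= C * norm w * norm v"
proof -
 have "norm (F' (z + w) - F' z) <= C * norm w"
 proof -
  have "norm (F' (z + w) - F' z) <= C * norm (z + w - z)"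
   by (rule differentiable_bound[OF convex_UNIV has_derivative_at_withinI[OF D2]]) (simp_all add: F''_norm norm_blinfun.rep_eq[symmetric])
  thus ?thesis by simp
 qed
 hence "norm (F' (z + w) - F' z) * norm v <= C * norm w * norm v" by (intro mult_right_mono) auto
 thus ?thesis using norm_blinfun[of "F' (z + w) - F' z" v] by (simp add: blinfun.diff_left)
qed

lemma second_order_quotient:
 assumes e: "e ----> 0" "!!n. e n \<noteq> 0"
 shows "(%n. (F (z + e n *\<^sub>R v) - F z - e n * F' z v) / (e n)\<^sup>2) ----> F'' z v v / 2"
proof -
 have "\<exists>\<theta>. \<bar>\<theta>\<bar> <= 1 \<and> F (z + e n *\<^sub>R v) = F z + F' z (e n *\<^sub>R v) + F'' (z + \<theta> *\<^sub>R e n *\<^sub>R v) (e n *\<^sub>R v) (e n *\<^sub>R v) / 2" for n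
  by (rule taylor[of z "e n *\<^sub>R v"]) blast
 then obtain \<theta> where \<theta>: "!!n. \<bar>\<theta> n\<bar> <= 1" "!!n. F (z + e n *\<^sub>R v) = F z + F' z (e n *\<^sub>R v) + F'' (z + \<theta> n *\<^sub>R e n *\<^sub>R v) (e n *\<^sub>R v) (e n *\<^sub>R v) / 2" by metis
 have eq: "(F (z + e n *\<^sub>R v) - F z - e n * F' z v) / (e n)\<^sup>2 = F'' (z + (\<theta> n * e n) *\<^sub>R v) v v / 2" for n
  using e(2)[of n] unfolding \<theta>(2)[of n]
  by (simp add: blinfun.scaleR_right blinfun.scaleR_left power2_eq_square)
 have "(%n. \<theta> n * e n) ----> 0"
  by (rule Lim_null_comparison[OF _ tendsto_rabs_zero[OF e(1)]])
   (use \<theta>(1) in \<open>auto simp: abs_mult mult_left_le_one_le intro!: always_eventually\<close>)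
 hence "(%n. z + (\<theta> n * e n) *\<^sub>R v) ----> z + 0 *\<^sub>R v" by (intro tendsto_intros)
 hence "(%n. F'' (z + (\<theta> n * e n) *\<^sub>R v) v v / 2) ----> F'' z v v / 2" by (intro tendsto_intros F''_tendsto) simp_all
 thus ?thesis unfolding eq .
qed

lemma first_order_quotient:
 assumes h: "h ----> 0" "!!n. h n \<noteq> 0" and b: "b ----> b0" and z: "z ----> z0"
 shows "(%n. (F (z n + h n *\<^sub>R b n) - F (z n)) / h n) ----> F' z0 b0"
proof -
 have "(%n. \<bar>h n\<bar> * (C / 2 * (norm (b n))\<^sup>2)) ----> \<bar>0\<bar> * (C / 2 * (norm b0)\<^sup>2)" by (intro tendsto_intros h b)
 hence l: "(%n. \<bar>h n\<bar> * (C / 2 * (norm (b n))\<^sup>2)) ----> 0" by simp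
 have "(%n. (F (z n + h n *\<^sub>R b n) - F (z n)) / h n - F' (z n) (b n)) ----> 0"
 proof (rule Lim_null_comparison[OF always_eventually l], rule allI)
  fix n
  have "\<bar>F (z n + h n *\<^sub>R b n) - F (z n) - h n * F' (z n) (b n)\<bar> <= \<bar>h n\<bar> * (\<bar>h n\<bar> * (C / 2 * (norm (b n))\<^sup>2))"
   using taylor_bound[of "z n" "h n *\<^sub>R b n"] by (simp add: blinfun.scaleR_right power_mult_distrib power2_eq_square mult_ac)
  hence "\<bar>F (z n + h n *\<^sub>R b n) - F (z n) - h n * F' (z n) (b n)\<bar> / \<bar>h n\<bar> <= \<bar>h n\<bar> * (C / 2 * (norm (b n))\<^sup>2)"
   using h(2)[of n] by (simp add: divide_le_eq mult_ac)
  thus "norm ((F (z n + h n *\<^sub>R b n) - F (z n)) / h n - F' (z n) (b n)) <= \<bar>h n\<bar> * (C / 2 * (norm (b n))\<^sup>2)"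
   using h(2)[of n] by (simp add: diff_divide_distrib flip: abs_divide)
 qed
 from tendsto_add[OF this F'_tendsto[OF z b]] show ?thesis by simp
qed

lemma dir_deriv_eq: "dir_deriv v F z = F' z v"
 unfolding dir_deriv_def using line_derivative[of z v 0] by (intro DERIV_imp_deriv) simp

lemma dir_deriv_twice: "dir_deriv v (dir_deriv v F) z = F'' z v v"
 unfolding dir_deriv_eq[abs_def] unfolding dir_deriv_def using line_derivative'[of z v 0] by (intro DERIV_imp_deriv) simp

end

lemma C2_b_test_function:
 assumes "C2_b F" obtains F' F'' C where "test_function F F' F'' C"
proof -
 from assms obtain F' where F': "bounded (range F)" "\<forall>x. (F has_derivative blinfun_apply (F' x)) (at x)" "C1_b F'"
  unfolding C2_b_def by blast
 from F'(3) obtain F'' where F'': "bounded (range F')" "\<forall>x. (F' has_derivative blinfun_apply (F'' x)) (at x)"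
   "continuous_on UNIV F''" "bounded (range F'')"
  unfolding C1_b_def by blast
 obtain a b c where "!!x. norm (F x) <= a" "!!x. norm (F' x) <= b" "!!x. norm (F'' x) <= c"
  using F'(1) F''(1,4) unfolding bounded_iff by auto
 hence "test_function F F' F'' (max a (max b c))"
  using F' F'' by unfold_locales (auto simp: le_max_iff_disj)
 thus ?thesis by (rule that)
qed

locale vector_test_function = test_function F F' F'' C
 for F :: "real \<times> (real ^ 'd::finite) => real" and F' F'' C
begin

lemma generator_eq: "generator B F z = F' z (0, B (snd z)) + (\<Sum>i\<in>UNIV. F'' z (0, axis i 1) (0, axis i 1)) / 2"
proof -
 have "(0, B (snd z)) = (\<Sum>i\<in>UNIV. B (snd z) $ i *\<^sub>R (0 :: real, axis i 1 :: real ^ 'd))"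
  by (simp add: prod_eq_iff fst_sum snd_sum vec_sum_axis)
 hence "F' z (0, B (snd z)) = (\<Sum>i\<in>UNIV. B (snd z) $ i * F' z (0, axis i 1))"
  by (simp only: blinfun.sum_right blinfun.scaleR_right real_scaleR_def)
 thus ?thesis by (simp add: generator_def dir_deriv_eq dir_deriv_twice)
qed

lemma F_shift_measurable [measurable]: "(%w. F (z + c *\<^sub>R (0, w))) \<in> borel_measurable borel"
  "(%w. F (z + (0, w))) \<in> borel_measurable borel" "(%w. F' z (0, w)) \<in> borel_measurable borel"
  "(%w. F'' z (0, w) (0, w)) \<in> borel_measurable borel"
proof -
 show "(%w. F (z + c *\<^sub>R (0, w))) \<in> borel_measurable borel" "(%w. F (z + (0, w))) \<in> borel_measurable borel"
  by (rule borel_measurable_continuous_onI, rule continuous_on_compose2[OF F_continuous], auto intro!: continuous_intros)+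
 show "(%w. F' z (0, w)) \<in> borel_measurable borel" "(%w. F'' z (0, w) (0, w)) \<in> borel_measurable borel"
  by (rule borel_measurable_continuous_onI, intro blinfun.continuous_on continuous_intros)+
qed

abbreviation (input) "tq h z w \<equiv> (F (z + sqrt h *\<^sub>R (0, w)) - F z - sqrt h * F' z (0, w)) / (sqrt h)\<^sup>2"

text \<open>The difference quotient in time of the heat flow acting on the position alone, with the
  maximum frozen.\<close>

definition smear :: "real => real \<times> (real ^ 'd) => real" where
 "smear h z = (LBINT w. gd h w * (F (z + (0, w)) - F z)) / h"

text \<open>The linear term has Gaussian mean 0 and is subtracted for free; what remains is a
  second-order Taylor quotient, bounded by a multiple of \<open>norm w ^ 2\<close> independently of
  \<open>h\<close>.\<close>

lemma smear_eq:
 assumes h: "0 < h"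
 shows "smear h z = (LBINT w. gd 1 w * tq h z w)"
proof -
 have p: "norm (0 :: real, w :: real ^ 'd) = norm w" for w by (simp add: norm_prod_def)
 have i1: "integrable lborel (%w. gd 1 w * (F (z + sqrt h *\<^sub>R (0, w)) - F z))"
 proof (rule integrable_gd_growth[where K="C * sqrt h" and j=1])
  show "\<bar>F (z + sqrt h *\<^sub>R (0, w)) - F z\<bar> <= C * sqrt h * norm w ^ 1" for w
   using F_lipschitz[of z "sqrt h *\<^sub>R (0, w)"] h by (simp add: p[unfolded zero_prod_def] norm_prod_def mult.assoc)
 qed measurable
 have i2: "integrable lborel (%w. gd 1 w * F' z (0, w))"
  by (rule integrable_gd_growth[where K=C and j=1]) (use F'_bound[of z] in \<open>auto simp: p\<close>, metis p)
 have z0: "(LBINT w. gd 1 w * F' z (0, w)) = 0"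
 proof -
  define c where "c i = F' z (0, axis i 1)" for i
  have "F' z (0, w) = (\<Sum>i\<in>UNIV. w $ i * c i)" for w
  proof -
   have e: "(0, w) = (\<Sum>i\<in>UNIV. w $ i *\<^sub>R (0 :: real, axis i 1 :: real ^ 'd))"
    by (simp add: prod_eq_iff fst_sum snd_sum vec_sum_axis)
   show ?thesis unfolding c_def by (subst e) (simp only: blinfun.sum_right blinfun.scaleR_right real_scaleR_def)
  qed
  hence "(LBINT w. gd 1 w * F' z (0, w)) = (LBINT w. (\<Sum>i\<in>UNIV. gd 1 w * w $ i * c i))"
   by (simp add: sum_distrib_left mult.assoc)
  also have "... = (\<Sum>i\<in>UNIV. \<integral>w. gd 1 w * w $ i * c i \<partial>lborel)"
  proof (rule Bochner_Integration.integral_sum, rule integrable_mult_left)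
   show "integrable lborel (%w :: real ^ 'd. gd 1 w * w $ i)" for i
    by (rule integrable_gd_growth[where K=1 and j=1]) (auto simp: component_le_norm_cart)
  qed
  finally show ?thesis by (simp add: integral_gd_odd)
 qed
 have "smear h z = (LBINT w. gd 1 w * (F (z + (0, sqrt h *\<^sub>R w)) - F z)) / h"
  unfolding smear_def by (subst integral_gd_scaled[OF h]) auto
 also have "... = ((LBINT w. gd 1 w * (F (z + sqrt h *\<^sub>R (0, w)) - F z)) - sqrt h * (LBINT w. gd 1 w * F' z (0, w))) / h"
  by (simp add: z0)
 also have "... = (LBINT w. (gd 1 w * (F (z + sqrt h *\<^sub>R (0, w)) - F z) - sqrt h * (gd 1 w * F' z (0, w))) / h)"
  using i1 i2 by simp
 also have "... = (LBINT w. gd 1 w * tq h z w)"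
  using h by (intro lint_cong) (auto simp: field_simps)
 finally show ?thesis .
qed

lemma smear_integrand_bound:
 "0 < h ==> \<bar>tq h z w\<bar> <= C / 2 * norm w ^ 2"
proof -
 assume h: "0 < h"
 have "norm (sqrt h *\<^sub>R (0 :: real, w)) = sqrt h * norm w" using h by (simp add: norm_prod_def real_sqrt_mult)
 hence "\<bar>F (z + sqrt h *\<^sub>R (0, w)) - F z - sqrt h * F' z (0, w)\<bar> <= C / 2 * norm w ^ 2 * h"
  using taylor_bound[of z "sqrt h *\<^sub>R (0, w)"] h by (simp only: blinfun.scaleR_right real_scaleR_def) (simp add: power_mult_distrib mult_ac)
 thus ?thesis using h by (simp add: abs_divide pos_divide_le_eq)
qed

lemma smear_tendsto:
 assumes h: "h ----> 0" "!!n. 0 < h n"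
 shows "(%n. smear (h n) z) ----> (\<Sum>i\<in>UNIV. F'' z (0, axis i 1) (0, axis i 1)) / 2"
proof -
 have bil: "bounded_bilinear (%v w. blinfun_apply (blinfun_apply (F'' z) (0, v)) (0, w))"
 proof -
  have l: "bounded_linear (%v :: real ^ 'd. (0 :: real, v))" by (intro bounded_linear_Pair bounded_linear_zero bounded_linear_ident)
  have "bounded_bilinear (%v w. blinfun_apply (blinfun_apply (F'' z) v) w)"
   by (rule bounded_bilinear.comp1[OF bounded_bilinear_blinfun_apply]) (rule blinfun.bounded_linear_right)
  from bounded_bilinear.comp[OF this l l] show ?thesis .
 qed
 have "(%n. \<integral>w. gd 1 w * tq (h n) z w \<partial>lborel) ----> (LBINT w. gd 1 w * (F'' z (0, w) (0, w) / 2))"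
 proof (rule integral_dominated_convergence[where w="%w. C / 2 * (norm w ^ 2 * gd 1 w)"])
  show "AE w in lborel. (%n. gd 1 w * tq (h n) z w) ----> gd 1 w * (F'' z (0, w) (0, w) / 2)"
  proof (intro AE_I2 tendsto_mult tendsto_const second_order_quotient)
   show "(%n. sqrt (h n)) ----> 0" using tendsto_real_sqrt[OF h(1)] by simp
   show "sqrt (h n) \<noteq> 0" for n using h(2)[of n] by simp
  qed
  show "AE w in lborel. norm (gd 1 w * tq (h n) z w) <= C / 2 * (norm w ^ 2 * gd 1 w)" for n
  proof (rule AE_I2)
   fix w :: "real ^ 'd"
   show "norm (gd 1 w * tq (h n) z w) <= C / 2 * (norm w ^ 2 * gd 1 w)"
    using mult_left_mono[OF smear_integrand_bound[OF h(2), of z n w], of "gd 1 w"] by (simp only: real_norm_def abs_mult) (simp add: mult_ac)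
  qed
  show "integrable lborel (%w :: real ^ 'd. C / 2 * (norm w ^ 2 * gd 1 w))" by (intro integrable_mult_right integrable_gd_moment) simp
  show "(%w. gd 1 w * (F'' z (0, w) (0, w) / 2)) \<in> borel_measurable lborel" by measurable
  show "(%w. gd 1 w * tq (h n) z w) \<in> borel_measurable lborel" for n
   by measurable
 qed
 moreover have "(LBINT w. gd 1 w * (F'' z (0, w) (0, w) / 2)) = (\<Sum>i\<in>UNIV. F'' z (0, axis i 1) (0, axis i 1)) / 2"
  using integral_gd_bilinear[OF bil] by simp
 ultimately show ?thesis by (simp add: smear_eq h(2))
qed

definition CS :: real where "CS = (LBINT w. C / 2 * (norm (w :: real ^ 'd) ^ 2 * gd 1 w))"

lemma smear_bound: assumes h: "0 < h" shows "\<bar>smear h z\<bar> <= CS"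
proof -
 let ?f = "%w. tq h z w"
 have i: "integrable lborel (%w. gd 1 w * ?f w)"
  by (rule integrable_gd_growth[where K="C / 2" and j=2], measurable) (rule smear_integrand_bound[OF h])
 have "\<bar>smear h z\<bar> <= (LBINT w. \<bar>gd 1 w * ?f w\<bar>)"
  unfolding smear_eq[OF h] using integral_norm_bound[of lborel "%w. gd 1 w * ?f w"] by simp
 also have "... <= CS"
  unfolding CS_def
 proof (rule integral_mono)
  show "integrable lborel (%w. \<bar>gd 1 w * ?f w\<bar>)" using i by (rule integrable_abs)
  show "integrable lborel (%w :: real ^ 'd. C / 2 * (norm w ^ 2 * gd 1 w))" by (intro integrable_mult_right integrable_gd_moment) simp
  show "\<bar>gd 1 w * ?f w\<bar> <= C / 2 * (norm w ^ 2 * gd 1 w)" for w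
   using mult_left_mono[OF smear_integrand_bound[OF h, of z w], of "gd 1 w"] by (simp only: abs_mult) (simp add: mult_ac)
 qed
 finally show ?thesis .
qed

end

section \<open>Small time increments\<close>

locale diffusion_test = diffusion M k B \<mu>0 W X L K + T: vector_test_function F F' F'' C
 for M :: "'w measure" and k :: "'d::finite" and B :: "real ^ 'd => real ^ 'd" and \<mu>0 W X L K
  and F :: "real \<times> (real ^ 'd) => real" and F' F'' C
begin

lemma F_MX_measurable [measurable]: "(%x. F (MX r x, XX s x)) \<in> borel_measurable M"
 by measurable

lemma increment_tendsto:
 assumes s: "0 <= s" and h: "h ----> 0" "!!n. 0 < h n" and W: "continuous_on {0..} (%t. W t x)"
 shows "(%n. W (s + h n) x - W s x) ----> 0"
proof -
 have "(%n. W (s + h n) x) ----> W (s + 0) x"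
 proof (rule continuous_on_tendsto_compose[OF W])
  show "(%n. s + h n) ----> s + 0" by (intro tendsto_intros h)
  show "eventually (%n. s + h n \<in> {0..}) sequentially"
   using s h(2) by (intro always_eventually allI) (simp add: add_nonneg_nonneg less_imp_le)
 qed (use s in auto)
 from tendsto_diff[OF this tendsto_const[of "W s x"]] show ?thesis by simp
qed

section \<open>Moving the position with the maximum frozen\<close>

definition drift_quot :: "real => real => 'w => real" where
 "drift_quot s h x = (F (MX s x, XX (s + h) x) - F (MX s x, XX s x + (W (s + h) x - W s x))) / h"

lemma drift_quot_eq:
 assumes "0 <= s" "0 < h"
  and X: "X_incr x"
 shows "drift_quot s h x = (F ((MX s x, XX s x + (W (s + h) x - W s x)) + h *\<^sub>R (0, (1 / h) *\<^sub>R integral {s..s + h} (%r. B (X r x))))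
   - F (MX s x, XX s x + (W (s + h) x - W s x))) / h"
proof -
 have e: "XX (s + h) x = XX s x + integral {s..s + h} (%r. B (X r x)) + (W (s + h) x - W s x)"
  using X assms less_imp_le by blast
 have e': "XX (s + h) x = XX s x + (W (s + h) x - W s x) + integral {s..s + h} (%r. B (X r x))"
  by (subst e) (simp only: add_ac)
 show ?thesis unfolding drift_quot_def e' using assms(2) by simp
qed

lemma drift_quot_bound:
 assumes "0 <= s" "0 < h" "x \<in> space M"
  and X: "X_incr x"
 shows "\<bar>drift_quot s h x\<bar> <= C * L"
proof -
 let ?i = "integral {s..s + h} (%r. B (X r x))"
 have "norm (0 :: real, ?i) <= L * h" using drift_integral_bound[of x s h] assms by (simp add: norm_prod_def)
 hence "C * norm (0 :: real, ?i) <= C * (L * h)" using T.C_nonneg by (intro mult_left_mono) auto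
 hence "\<bar>F ((MX s x, XX s x + (W (s + h) x - W s x)) + (0, ?i)) - F (MX s x, XX s x + (W (s + h) x - W s x))\<bar> <= C * (L * h)"
  using T.F_lipschitz order_trans by blast
 thus ?thesis using assms(2) unfolding drift_quot_eq[OF assms(1,2) X] by (simp add: pos_divide_le_eq mult.assoc)
qed

lemma drift_quot_measurable [measurable]: "0 <= s ==> 0 < h ==> drift_quot s h \<in> borel_measurable M"
proof -
 assume "0 <= s" "0 < h"
 hence [measurable]: "(%x. W (s + h) x - W s x) \<in> borel_measurable M"
  by (intro borel_measurable_diff W_measurable) auto
 show ?thesis unfolding drift_quot_def by measurable
qed

lemma noise_part:
 assumes s: "0 < s" and h: "0 < h"
 shows "(LINT x|M. F (MX s x, XX s x + (W (s + h) x - W s x)) - F (MX s x, XX s x)) / h = (LINT x|M. T.smear h (MX s x, XX s x))"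
proof -
 let ?\<Psi> = "%v :: (real \<times> (real ^ 'd)) \<times> (real ^ 'd). F (fst v + (0, snd v)) - F (fst v)"
 have "(LINT x|M. ?\<Psi> ((MX s x, XX s x), W (s + h) x - W s x)) = (LINT x|M. (LBINT w. gd h w * ?\<Psi> ((MX s x, XX s x), w)))"
 proof (rule indep_increment_expectation[OF s h])
  show "?\<Psi> \<in> borel_measurable borel"
   by (intro borel_measurable_continuous_onI continuous_intros continuous_on_compose2[OF T.F_continuous]) auto
  show "\<bar>?\<Psi> v\<bar> <= 2 * C" for v
   using T.F_bound[of "fst v + (0, snd v)"] T.F_bound[of "fst v"] by linarith
 qed
 thus ?thesis by (simp add: T.smear_def)
qed

text \<open>Noise first, drift second: independence turns the noise displacement into
  \<open>smear\<close>, which tends to half the Laplacian, and the drift displacement is a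
  first-order quotient along the path.\<close>

lemma x_part:
 assumes s: "0 < s" and h: "h ----> 0" "!!n. 0 < h n"
 shows "(%n. (LINT x|M. F (MX s x, XX (s + h n) x) - F (MX s x, XX s x)) / h n) ----> (LINT x|M. generator B F (MX s x, XX s x))"
  and "\<bar>(LINT x|M. F (MX s x, XX (s + h n) x) - F (MX s x, XX s x)) / h n\<bar> <= C * L + T.CS"
proof -
 have s0: "0 <= s" using s by simp
 let ?G = "%x. (\<Sum>i\<in>UNIV. F'' (MX s x, XX s x) (0, axis i 1) (0, axis i 1)) / 2"
 let ?D = "%x. F' (MX s x, XX s x) (0, B (XX s x))"
 have sm: "(%x. T.smear r (MX s x, XX s x)) \<in> borel_measurable M" for r
 proof -
  have "(%z :: (real \<times> (real ^ 'd)) \<times> (real ^ 'd). F (fst z + (0, snd z)) - F (fst z)) \<in> borel_measurable borel"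
   by (intro borel_measurable_continuous_onI continuous_intros continuous_on_compose2[OF T.F_continuous]) auto
  hence [measurable]: "(%z :: (real \<times> (real ^ 'd)) \<times> (real ^ 'd). F (fst z + (0, snd z)) - F (fst z)) \<in> borel_measurable (borel \<Otimes>\<^sub>M borel)"
   by (simp add: borel_prod)
  have "(%z. T.smear r z) \<in> borel_measurable borel" unfolding T.smear_def
   by (intro borel_measurable_divide lborel.borel_measurable_lebesgue_integral borel_measurable_const) (simp add: case_prod_beta')
  thus ?thesis by measurable
 qed
 have db: "AE x in M. \<bar>drift_quot s (h n) x\<bar> <= C * L" for n
  using X_increment AE_space by eventually_elim (use drift_quot_bound[OF s0 h(2)] in auto)
 have di: "integrable M (drift_quot s (h n))" for n
  by (rule integrable_const_bound[where B="C * L"]) (use db drift_quot_measurable[OF s0 h(2)] in auto)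
 have si: "integrable M (%x. T.smear (h n) (MX s x, XX s x))" for n
  by (rule integrable_const_bound[where B="T.CS"]) (use T.smear_bound[OF h(2)] sm in auto)
 have eq: "(LINT x|M. F (MX s x, XX (s + h n) x) - F (MX s x, XX s x)) / h n
   = (LINT x|M. drift_quot s (h n) x) + (LINT x|M. T.smear (h n) (MX s x, XX s x))" for n
 proof -
  have [measurable]: "(%x. W (s + h n) x - W s x) \<in> borel_measurable M"
   using s h(2)[of n] by (intro borel_measurable_diff W_measurable) auto
  let ?a = "%x. F (MX s x, XX (s + h n) x)" and ?b = "%x. F (MX s x, XX s x + (W (s + h n) x - W s x))" and ?c = "%x. F (MX s x, XX s x)"
  have i: "integrable M ?a" "integrable M ?b" "integrable M ?c"
   by (rule integrable_const_bound[where B=C], use T.F_bound in \<open>auto simp del: F_MX_measurable\<close>)+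
  have "(LINT x|M. ?a x - ?c x) / h n = (LINT x|M. ?a x - ?b x) / h n + (LINT x|M. ?b x - ?c x) / h n"
   using i by (simp add: add_divide_distrib[symmetric])
  thus ?thesis using noise_part[OF s h(2), of n] by (simp add: drift_quot_def)
 qed
 have "(%n. \<integral>x. drift_quot s (h n) x \<partial>M) ----> (LINT x|M. ?D x)"
 proof (rule integral_dominated_convergence[where w="%_. C * L"])
  show "AE x in M. (%n. drift_quot s (h n) x) ----> ?D x"
   using X_increment AE_space W_paths
  proof eventually_elim
   case (elim x)
   have w: "(%n. (MX s x, XX s x + (W (s + h n) x - W s x))) ----> (MX s x, XX s x + 0)"
    using elim(3) by (intro tendsto_intros increment_tendsto[OF s0 h]) auto
   have "(%n. (0, (1 / h n) *\<^sub>R integral {s..s + h n} (%r. B (X r x)))) ----> (0, B (XX s x))"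
    by (intro tendsto_intros drift_average_tendsto[OF elim(2) s0 h])
   from T.first_order_quotient[OF h(1) _ this w] h(2) show ?case
    using drift_quot_eq[OF s0 h(2) elim(1)] by (simp add: less_imp_neq[symmetric])
  qed
  show "AE x in M. norm (drift_quot s (h n) x) <= C * L" for n using db by simp
  show "?D \<in> borel_measurable M" by measurable
  show "drift_quot s (h n) \<in> borel_measurable M" for n by (rule drift_quot_measurable[OF s0 h(2)])
 qed simp
 moreover have "(%n. \<integral>x. T.smear (h n) (MX s x, XX s x) \<partial>M) ----> (LINT x|M. ?G x)"
  by (rule integral_dominated_convergence[where w="%_. T.CS"]) (use T.smear_tendsto[OF h] T.smear_bound[OF h(2)] sm in \<open>auto intro!: borel_measurable_sum\<close>)
 moreover have "(LINT x|M. ?D x) + (LINT x|M. ?G x) = (LINT x|M. generator B F (MX s x, XX s x))"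
 proof -
  have "integrable M ?D"
  proof (rule integrable_const_bound[where B="C * L"])
   have "\<bar>?D x\<bar> <= C * L" for x
    using T.F'_bound[of "(MX s x, XX s x)" "(0, B (XX s x))"] mult_left_mono[OF B_bound T.C_nonneg, of "XX s x"] by (simp add: norm_prod_def)
   thus "AE x in M. norm (?D x) <= C * L" by simp
  qed measurable
  moreover have "integrable M ?G"
  proof (intro integrable_divide Bochner_Integration.integrable_sum integrable_const_bound[where B=C] AE_I2)
   show "norm (F'' (MX s x, XX s x) (0, axis i 1) (0, axis i 1)) <= C" for x i
    using T.F''_bound[of "(MX s x, XX s x)" "(0, axis i 1)" "(0, axis i 1)"] by (simp add: norm_prod_def norm_axis_1)
  qed measurable
  ultimately show ?thesis by (simp add: T.generator_eq)
 qed
 ultimately show "(%n. (LINT x|M. F (MX s x, XX (s + h n) x) - F (MX s x, XX s x)) / h n) ----> (LINT x|M. generator B F (MX s x, XX s x))"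
  unfolding eq using tendsto_add by fastforce
 have "\<bar>LINT x|M. drift_quot s (h n) x\<bar> <= C * L"
  using integral_norm_bound[of M "drift_quot s (h n)"] di db
  by (intro order_trans[OF _ integral_le_const[of "%x. \<bar>drift_quot s (h n) x\<bar>" "C * L"]]) auto
 moreover have "\<bar>LINT x|M. T.smear (h n) (MX s x, XX s x)\<bar> <= T.CS"
  using integral_norm_bound[of M "%x. T.smear (h n) (MX s x, XX s x)"] si T.smear_bound[OF h(2)]
  by (intro order_trans[OF _ integral_le_const[of "%x. \<bar>T.smear (h n) (MX s x, XX s x)\<bar>" "T.CS"]]) auto
 ultimately show "\<bar>(LINT x|M. F (MX s x, XX (s + h n) x) - F (MX s x, XX s x)) / h n\<bar> <= C * L + T.CS"
  unfolding eq by linarith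
qed


text \<open>The mean overshoot of the maximum of unit-time noise above the height \<open>v\<close>;
  see \<open>max_expectation\<close> with \<open>h = 1\<close>.\<close>

definition e1 :: "real => real" where "e1 v = (LBINT z. gd 1 (z :: real ^ 'd) * max 0 (\<bar>z $ k\<bar> - v))"

lemma e1_integrable:
 assumes "0 < t" "0 <= v" shows "integrable lborel (%z :: real ^ 'd. gd t z * max 0 (\<bar>z $ k\<bar> - v))"
proof (rule lint_bound[OF integrable_gd_moment[OF assms(1), of 1]])
 show "AE z :: real ^ 'd in lborel. norm (gd t z * max 0 (\<bar>z $ k\<bar> - v)) <= norm (norm z ^ 1 * gd t z)"
 proof (rule AE_I2)
  fix z :: "real ^ 'd"
  have "gd t z * max 0 (\<bar>z $ k\<bar> - v) <= gd t z * norm z"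
   using component_le_norm_cart[of z k] assms by (intro mult_left_mono) auto
  thus "norm (gd t z * max 0 (\<bar>z $ k\<bar> - v)) <= norm (norm z ^ 1 * gd t z)" using assms by (simp add: abs_mult mult.commute)
 qed
qed measurable

lemma e1_nonneg: "0 <= e1 v" unfolding e1_def by (intro integral_nonneg_AE) auto

lemma e1_measurable [measurable (raw)]:
 assumes [measurable]: "f \<in> borel_measurable N" shows "(%x. e1 (f x)) \<in> borel_measurable N"
 unfolding e1_def by measurable

text \<open>By Fubini: integrating \<open>max 0 (a - v)\<close> over \<open>v > 0\<close> gives
  \<open>a\<^sup>2 / 2\<close>, and the second moment is 1. This is the factor 1/2 of the boundary
  term.\<close>

lemma e1_half_line: "integrable lborel (%v. indicator {0<..} v * e1 v)" "(LBINT v. indicator {0<..} v * e1 v) = 1 / 2"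
proof -
 have inner: "(NN v. ennreal (indicator {0<..} v * max 0 (a - v))) = ennreal (a\<^sup>2 / 2)" if a: "0 <= a" for a :: real
 proof -
  have "(NN v. ennreal (indicator {0<..} v * max 0 (a - v))) = (NN v. ennreal (a - v) * indicator {0..a} v)"
   by (intro nn_integral_cong_AE, rule AE_mp[OF AE_lborel_singleton[of 0]]) (auto simp: indicator_def intro!: AE_I2)
  also have "... = ennreal ((a * a - a\<^sup>2 / 2) - (a * 0 - 0\<^sup>2 / 2))"
   by (rule nn_integral_FTC_Icc[where F="%v. a * v - v\<^sup>2 / 2"]) (use a in \<open>auto intro!: derivative_eq_intros\<close>)
  finally show ?thesis by (simp add: power2_eq_square)
 qed
 have "(NN v. ennreal (indicator {0<..} v * e1 v))
   = (NN v. (NN z. ennreal (gd 1 (z :: real ^ 'd)) * ennreal (indicator {0<..} v * max 0 (\<bar>z $ k\<bar> - v))))"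
 proof (rule nn_integral_cong)
  fix v :: real
  show "ennreal (indicator {0<..} v * e1 v) = (NN z. ennreal (gd 1 (z :: real ^ 'd)) * ennreal (indicator {0<..} v * max 0 (\<bar>z $ k\<bar> - v)))"
  proof (cases "0 < v")
   case True
   hence "ennreal (e1 v) = (NN z. ennreal (gd 1 (z :: real ^ 'd) * max 0 (\<bar>z $ k\<bar> - v)))"
    unfolding e1_def by (intro nn_integral_eq_integral[symmetric] e1_integrable) auto
   thus ?thesis using True by (simp add: ennreal_mult)
  qed simp
 qed
 also have "... = (NN z. (NN v. ennreal (gd 1 (z :: real ^ 'd)) * ennreal (indicator {0<..} v * max 0 (\<bar>z $ k\<bar> - v))))"
  by (rule lborel_pair.Fubini') (simp add: indicator_def)
 also have "... = (NN z. ennreal (1 / 2) * ennreal (gd 1 (z :: real ^ 'd) * (z $ k)\<^sup>2))"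
 proof (rule nn_integral_cong)
  fix z :: "real ^ 'd"
  have "(NN v. ennreal (gd 1 z) * ennreal (indicator {0<..} v * max 0 (\<bar>z $ k\<bar> - v))) = ennreal (gd 1 z) * (NN v. ennreal (indicator {0<..} v * max 0 (\<bar>z $ k\<bar> - v)))"
   by (rule nn_integral_cmult) (simp add: indicator_def)
  also have "... = ennreal (gd 1 z * (\<bar>z $ k\<bar>\<^sup>2 / 2))" by (simp only: inner abs_ge_zero) (rule ennreal_mult[symmetric], auto)
  also have "... = ennreal (1 / 2 * (gd 1 z * (z $ k)\<^sup>2))" by simp
  also have "... = ennreal (1 / 2) * ennreal (gd 1 z * (z $ k)\<^sup>2)" by (rule ennreal_mult) auto
  finally show "(NN v. ennreal (gd 1 z) * ennreal (indicator {0<..} v * max 0 (\<bar>z $ k\<bar> - v))) = ennreal (1 / 2) * ennreal (gd 1 z * (z $ k)\<^sup>2)" .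
 qed
 also have "... = ennreal (1 / 2)" by (subst nn_integral_cmult) (auto simp: integral_gd_coord_square(1))
 finally have nn: "(NN v. ennreal (indicator {0<..} v * e1 v)) = ennreal (1 / 2)" .
 thus i: "integrable lborel (%v. indicator {0<..} v * e1 v)"
  by (intro integrableI_nonneg) (simp_all only: nn infinity_ennreal_def ennreal_less_top, auto simp: e1_nonneg indicator_def)
 show "(LBINT v. indicator {0<..} v * e1 v) = 1 / 2"
 proof -
  have "(LBINT v. indicator {0<..} v * e1 v) = enn2real (NN v. ennreal (indicator {0<..} v * e1 v))"
   by (rule integral_eq_nn_integral) (auto simp: e1_nonneg indicator_def)
  also have "... = 1 / 2" unfolding nn by (rule enn2real_ennreal) simp
  finally show ?thesis .
 qed
qed

lemma e1_scaled:
 assumes "0 < h"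
 shows "(LBINT z. gd h (z :: real ^ 'd) * max 0 (\<bar>z $ k\<bar> - d)) = sqrt h * e1 (d / sqrt h)"
proof -
 have "(LBINT z. gd h (z :: real ^ 'd) * max 0 (\<bar>z $ k\<bar> - d)) = (LBINT z. gd 1 (z :: real ^ 'd) * max 0 (\<bar>(sqrt h *\<^sub>R z) $ k\<bar> - d))"
  by (rule integral_gd_scaled[OF assms]) measurable
 also have "... = (LBINT z. sqrt h * (gd 1 (z :: real ^ 'd) * max 0 (\<bar>z $ k\<bar> - d / sqrt h)))"
 proof (rule lint_cong)
  fix z :: "real ^ 'd"
  have "sqrt h * max 0 (\<bar>z $ k\<bar> - d / sqrt h) = max 0 (\<bar>(sqrt h *\<^sub>R z) $ k\<bar> - d)"
   using assms by (simp add: max_mult_distrib_left right_diff_distrib abs_mult)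
  thus "gd 1 z * max 0 (\<bar>(sqrt h *\<^sub>R z) $ k\<bar> - d) = sqrt h * (gd 1 z * max 0 (\<bar>z $ k\<bar> - d / sqrt h))" by (metis mult.left_commute)
 qed simp
 finally show ?thesis by (simp add: e1_def)
qed

text \<open>The density is at most \<open>Gam s * par.Hm s y\<close> at every distance from the
  diagonal, and \<open>par.Hm s\<close> has mass 1, so a strip of width \<open>q\<close> has
  probability of order \<open>q\<close>.\<close>

lemma near_diagonal:
 assumes s: "0 < s" and q: "0 <= q"
 shows "(\<integral>\<^sup>+p. indicator {x. x < q} (MX s p - XX s p $ k) \<partial>M) <= ennreal (Gam s * q)"
proof -
 have D: "distributed M lborel (%p. (MX s p, XX s p)) (%z. ennreal (pV s z))"
  using pV_density[OF s] s by (simp add: has_density_def MX_eq XX_eq)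
 have "(\<integral>\<^sup>+p. indicator {x. x < q} (MX s p - XX s p $ k) \<partial>M) = (NN z. ennreal (pV s z) * indicator {x. x < q} (fst z - snd z $ k))"
  by (subst distributed_nn_integral[OF D]) auto
 also have "... = (\<integral>\<^sup>+z. ennreal (pV s z) * indicator {x. x < q} (fst z - snd z $ k) \<partial>distr lborel borel (%(w, y). below_diag k y w))"
  by (simp only: distr_lborel_below_diag)
 also have "... = (NN z. ennreal (pV s (below_diag k (snd z) (fst z))) * indicator {x. x < q} (fst z))"
  by (subst nn_integral_distr) (auto simp: case_prod_beta below_diag_def axis_def indicator_def)
 also have "... <= (NN z. indicator {0..q} (fst z) * ennreal (Gam s * par.Hm s (snd z)))"
 proof (rule nn_integral_mono)
  fix z :: "real \<times> (real ^ 'd)"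
  show "ennreal (pV s (below_diag k (snd z) (fst z))) * indicator {x. x < q} (fst z) <= indicator {0..q} (fst z) * ennreal (Gam s * par.Hm s (snd z))"
  proof (cases "0 <= fst z")
   case True
   thus ?thesis using pV_le[OF s True, of "snd z"] by (auto simp: indicator_def intro: ennreal_leI)
  next
   case False
   thus ?thesis by (simp add: below_diag_def pV_zero axis_def)
  qed
 qed
 also have "... = (NN w. (NN y. indicator {0..q} w * ennreal (Gam s * par.Hm s y)))"
  unfolding lborel_prod[symmetric] by (subst lborel.nn_integral_fst[symmetric]) auto
 also have "... = (NN w. indicator {0..q} w * ennreal (Gam s))"
  using s Gam_nonneg[of s] par.Hm_nonneg par.nn_integral_Hm[OF s]
  by (intro nn_integral_cong) (simp add: nn_integral_cmult ennreal_mult)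
 also have "... = ennreal (Gam s) * emeasure lborel {0..q}"
  by (subst mult.commute) (rule nn_integral_cmult_indicator, simp)
 also have "... = ennreal (Gam s * q)" using q s Gam_nonneg[of s] by (simp add: ennreal_mult)
 finally show ?thesis .
qed

text \<open>The expectation in the boundary term, written as a Lebesgue integral of the trace;
  \<open>conditional_trace\<close> relates the two.\<close>

definition Tr :: "real => real" where "Tr s = (LBINT y. F' (y $ k, y) (1, 0) * tr s y)"

lemma Hm_integrable: "0 < s ==> integrable lborel (par.Hm s)" and Hm_integral: "0 < s ==> (LBINT y. par.Hm s y) = 1"
proof -
 assume s: "0 < s"
 show i: "integrable lborel (par.Hm s)" using par.nn_integral_Hm[OF s] par.Hm_nonneg[OF s] by (intro integrableI_nonneg) auto
 show "(LBINT y. par.Hm s y) = 1"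
  by (subst integral_eq_nn_integral) (auto simp: par.nn_integral_Hm[OF s] par.Hm_nonneg[OF s])
qed

text \<open>The limit arises after rescaling the distance to the diagonal by \<open>sqrt h\<close>.\<close>
lemma diagonal_limit:
 assumes s: "0 < s" and h: "h ----> 0" "!!n. 0 < h n"
 defines "\<Phi> n z \<equiv> F' z (1, 0) * (sqrt (h n) * e1 ((fst z - snd z $ k) / sqrt (h n)))"
 shows "(%n. (LINT x|M. \<Phi> n (MX s x, XX s x)) / h n) ----> 1 / 2 * Tr s"
  and "\<bar>(LINT x|M. \<Phi> n (MX s x, XX s x)) / h n\<bar> <= C * Gam s"
proof -
 have D: "distributed M lborel (%x. (MX s x, XX s x)) (%z. ennreal (pV s z))"
  using pV_density[OF s] s by (simp add: has_density_def MX_eq XX_eq)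
 have Fm: "\<bar>F' z (1, 0)\<bar> <= C" for z using T.F'_bound[of z "(1, 0)"] by (simp add: norm_prod_def)
 let ?a = "%n v y. pV s (below_diag k y (sqrt (h n) * v)) * F' (below_diag k y (sqrt (h n) * v)) (1, 0)"
 let ?g = "%n y. \<integral>v. ?a n v y * (indicator {0<..} v * e1 v) \<partial>lborel"
 have ab: "\<bar>?a n v y * (indicator {0<..} v * e1 v)\<bar> <= C * Gam s * par.Hm s y * (indicator {0<..} v * e1 v)" for n v y
 proof (cases "0 < v")
  case True
  have "\<bar>?a n v y\<bar> = pV s (below_diag k y (sqrt (h n) * v)) * \<bar>F' (below_diag k y (sqrt (h n) * v)) (1, 0)\<bar>"
   by (simp add: abs_mult pV_nonneg)
  also have "... <= (Gam s * par.Hm s y) * C"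
   using True h(2)[of n] s Gam_nonneg[of s] par.Hm_nonneg[OF s] by (intro mult_mono pV_le Fm) auto
  finally have "\<bar>?a n v y\<bar> * e1 v <= (Gam s * par.Hm s y) * C * e1 v" by (intro mult_right_mono e1_nonneg)
  thus ?thesis using True e1_nonneg[of v] by (simp add: abs_mult mult_ac)
 qed simp
 have eq: "(LINT x|M. \<Phi> n (MX s x, XX s x)) / h n = (LBINT y. ?g n y)" for n
 proof -
  define c where "c = sqrt (h n)"
  have c: "0 < c" "h n = c * c" using h(2)[of n] by (auto simp: c_def)
  let ?f = "%w y. pV s (below_diag k y w) * (F' (below_diag k y w) (1, 0) * (c * e1 (w / c)))"
  \<comment> \<open>One factor \<open>c\<close> is the Jacobian of \<open>w = c * v\<close>, the
    other is the scale of the overshoot; together they cancel the division by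
    \<open>h n\<close>.\<close>
  have sub: "(LBINT w. ?f w y) = c * c * ?g n y" for y
  proof -
   have "(LBINT w. ?f w y) = \<bar>c\<bar> *\<^sub>R (LBINT v. ?f (0 + c * v) y)"
    by (rule lborel_integral_real_affine) (use c in simp)
   also have "(LBINT v. ?f (0 + c * v) y) = (LBINT v. c * (?a n v y * (indicator {0<..} v * e1 v)))"
   proof (rule lint_cong)
    fix v
    show "?f (0 + c * v) y = c * (?a n v y * (indicator {0<..} v * e1 v))"
    proof (cases "0 < v")
     case False
     hence "c * v <= 0" using c by (simp add: mult_le_0_iff)
     thus ?thesis using False by (simp add: below_diag_def pV_zero axis_def c_def[symmetric])
    qed (use c in \<open>simp add: c_def[symmetric] mult_ac\<close>)
   qed simp
   finally show ?thesis using c by simp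
  qed
  have i0: "integrable M (%x. \<Phi> n (MX s x, XX s x))"
  proof (rule integrable_const_bound[where B="C * (c * e1 0)"])
   show "AE x in M. norm (\<Phi> n (MX s x, XX s x)) <= C * (c * e1 0)"
   proof (rule AE_I2)
    fix x assume x: "x \<in> space M"
    let ?d = "(MX s x - XX s x $ k) / c"
    have d: "0 <= ?d" using XX_le_MX[OF x, of s] c by simp
    have "e1 ?d <= e1 0"
     unfolding e1_def using d by (intro integral_mono e1_integrable mult_left_mono) auto
    hence "\<bar>F' (MX s x, XX s x) (1, 0)\<bar> * (c * e1 ?d) <= C * (c * e1 0)"
     using c T.C_nonneg e1_nonneg Fm by (intro mult_mono) auto
    thus "norm (\<Phi> n (MX s x, XX s x)) <= C * (c * e1 0)"
     using c e1_nonneg[of ?d] by (simp add: \<Phi>_def abs_mult c_def[symmetric])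
   qed
  qed (unfold \<Phi>_def, measurable)
  have \<Phi>m: "\<Phi> n \<in> borel_measurable borel" unfolding \<Phi>_def by measurable
  have "integrable lborel (%z. pV s z * \<Phi> n z)"
   using distributed_integrable[OF D, of "\<Phi> n"] \<Phi>m i0 pV_nonneg by simp
  hence "integrable (distr lborel borel (%(w, y). below_diag k y w)) (%z. pV s z * \<Phi> n z)"
   by (simp only: distr_lborel_below_diag)
  hence "integrable lborel (%z. ?f (fst z) (snd z))"
   using \<Phi>m by (subst (asm) integrable_distr_eq) (auto simp: case_prod_beta \<Phi>_def below_diag_def axis_def c_def)
  hence i: "integrable (lborel \<Otimes>\<^sub>M lborel) (%(w, y). ?f w y)" by (simp add: lborel_prod case_prod_beta')
  have "(LINT x|M. \<Phi> n (MX s x, XX s x)) = (LBINT z. pV s z * \<Phi> n z)"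
   using distributed_integral[OF D, of "\<Phi> n"] \<Phi>m pV_nonneg by simp
  also have "... = (\<integral>z. pV s z * \<Phi> n z \<partial>distr lborel borel (%(w, y). below_diag k y w))"
   by (simp only: distr_lborel_below_diag)
  also have "... = (\<integral>z. ?f (fst z) (snd z) \<partial>(lborel \<Otimes>\<^sub>M lborel))"
   using \<Phi>m by (subst integral_distr) (auto simp: case_prod_beta \<Phi>_def below_diag_def axis_def c_def lborel_prod)
  also have "... = (LBINT y. (LBINT w. ?f w y))"
   using lborel_pair.integral_snd[OF i] by (simp add: case_prod_beta')
  also have "... = c * c * (LBINT y. ?g n y)" unfolding sub by simp
  finally show ?thesis using c by simp
 qed
 have gb: "\<bar>?g n y\<bar> <= C * Gam s * par.Hm s y" for n y
 proof -
  have i: "integrable lborel (%v. C * Gam s * par.Hm s y * (indicator {0<..} v * e1 v))" by (intro integrable_mult_right e1_half_line)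
  have i2: "integrable lborel (%v. ?a n v y * (indicator {0<..} v * e1 v))"
   by (rule lint_bound[OF i])
    (simp add: indicator_def, rule AE_I2, simp only: real_norm_def, rule order_trans[OF ab abs_ge_self])
  have "\<bar>?g n y\<bar> <= (LBINT v. \<bar>?a n v y * (indicator {0<..} v * e1 v)\<bar>)"
   using integral_norm_bound[of lborel "%v. ?a n v y * (indicator {0<..} v * e1 v)"] by (simp only: real_norm_def)
  also have "... <= (LBINT v. C * Gam s * par.Hm s y * (indicator {0<..} v * e1 v))"
   by (intro integral_mono integrable_abs i i2 ab)
  also have "... = C * Gam s * par.Hm s y * (1 / 2)" by (simp only: integral_mult_right_zero e1_half_line)
  also have "... <= C * Gam s * par.Hm s y"
   using T.C_nonneg Gam_nonneg[of s] s par.Hm_nonneg[OF s, of y] by simp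
  finally show ?thesis .
 qed
 have gm: "?g n \<in> borel_measurable lborel" for n
  unfolding indicator_def by measurable
 have iH: "integrable lborel (%y. C * Gam s * par.Hm s y)" by (intro integrable_mult_right Hm_integrable s)
 have lim: "(%n. ?g n y) ----> F' (y $ k, y) (1, 0) * tr s y * (1 / 2)" for y
 proof -
  have "(%n. ?g n y) ----> (LBINT v. tr s y * F' (y $ k, y) (1, 0) * (indicator {0<..} v * e1 v))"
  proof (rule integral_dominated_convergence[where w="%v. C * Gam s * par.Hm s y * (indicator {0<..} v * e1 v)"])
   show "AE v in lborel. (%n. ?a n v y * (indicator {0<..} v * e1 v)) ----> tr s y * F' (y $ k, y) (1, 0) * (indicator {0<..} v * e1 v)"
   proof (rule AE_I2)
    fix v :: real
    show "(%n. ?a n v y * (indicator {0<..} v * e1 v)) ----> tr s y * F' (y $ k, y) (1, 0) * (indicator {0<..} v * e1 v)"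
    proof (cases "0 < v")
     case True
     have "(%n. sqrt (h n) * v) ----> sqrt 0 * v" by (intro tendsto_intros h)
     hence l: "(%n. sqrt (h n) * v) ----> 0" by simp
     have "(%n. below_diag k y (sqrt (h n) * v)) ----> (y $ k, y - 0 *\<^sub>R axis k 1)"
      unfolding below_diag_def by (intro tendsto_intros l)
     hence "(%n. below_diag k y (sqrt (h n) * v)) ----> (y $ k, y)" by simp
     thus ?thesis using True h(2)
      by (intro tendsto_mult pV_trace[OF s _ l] T.F'_tendsto tendsto_const) auto
    qed simp
   qed
   show "integrable lborel (%v. C * Gam s * par.Hm s y * (indicator {0<..} v * e1 v))" by (intro integrable_mult_right e1_half_line)
   show "AE v in lborel. norm (?a n v y * (indicator {0<..} v * e1 v)) <= C * Gam s * par.Hm s y * (indicator {0<..} v * e1 v)" for n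
    using ab by (simp only: real_norm_def) simp
  qed (simp_all add: indicator_def)
  thus ?thesis by (simp only: integral_mult_right_zero e1_half_line mult.commute[of "tr s y"])
 qed
 have "(%n. \<integral>y. ?g n y \<partial>lborel) ----> (LBINT y. F' (y $ k, y) (1, 0) * tr s y * (1 / 2))"
  by (rule integral_dominated_convergence[where w="%y. C * Gam s * par.Hm s y"])
   (use gb lim gm iH in \<open>simp_all only: real_norm_def AE_I2\<close>, measurable)
 thus "(%n. (LINT x|M. \<Phi> n (MX s x, XX s x)) / h n) ----> 1 / 2 * Tr s"
  unfolding eq by (simp add: Tr_def)
 have ig: "integrable lborel (?g n)"
  by (rule lint_bound[OF iH gm]) (rule AE_I2, simp only: real_norm_def, rule order_trans[OF gb abs_ge_self])
 have "\<bar>LBINT y. ?g n y\<bar> <= (LBINT y. \<bar>?g n y\<bar>)"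
  using integral_norm_bound[of lborel "?g n"] by (simp only: real_norm_def)
 also have "... <= (LBINT y. C * Gam s * par.Hm s y)" by (intro integral_mono integrable_abs ig iH gb)
 finally show "\<bar>(LINT x|M. \<Phi> n (MX s x, XX s x)) / h n\<bar> <= C * Gam s"
  unfolding eq by (simp add: Hm_integral[OF s])
qed


section \<open>Moving the maximum\<close>

context
 fixes s :: real and Y :: "real => 'w => real ^ 'd"
 assumes s: "0 < s" and sn: "shifted_noise s Y"
begin

text \<open>During the step the path stays within \<open>L * h\<close> of \<open>X s\<close> plus
  the noise, and the maximum grows only by the amount in which this exceeds the gap
  \<open>D\<close>.\<close>

lemma max_increment:
 assumes h: "0 < h" and x: "x \<in> space M" and Y: "\<forall>r\<ge>0. Y r x = W (s + r) x - W s x"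
  and X: "X_incr x"
 defines "S \<equiv> running_max k Y h x" and "D \<equiv> MX s x - XX s x $ k" and "R \<equiv> MX (s + h) x - MX s x"
 shows "max 0 (S - D - L * h) <= R" "R <= max 0 (S - D + L * h)"
proof -
 have s0: "0 <= s" using s by simp
 have Lh: "0 <= L * h" using L_nonneg h by simp
 have c: "continuous_on {0..} (%t. Y t x $ k)" by (intro continuous_intros shifted_noise_continuous[OF sn] x)
 have step: "\<bar>X (s + r) x $ k - (XX s x $ k + Y r x $ k)\<bar> <= L * h" if r: "0 <= r" "r <= h" for r
 proof -
  have "XX (s + r) x = XX s x + integral {s..s + r} (%r. B (X r x)) + Y r x" using X Y s0 r(1) by metis
  hence e: "X (s + r) x $ k - (XX s x $ k + Y r x $ k) = integral {s..s + r} (%r. B (X r x)) $ k"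
   using s0 r by (simp add: XX_eq)
  have "\<bar>integral {s..s + r} (%r. B (X r x)) $ k\<bar> <= L * r"
   by (rule order_trans[OF component_le_norm_cart drift_integral_bound[OF x s0 r(1)]])
  also have "... <= L * h" using r L_nonneg by (intro mult_left_mono)
  finally show ?thesis unfolding e .
 qed
 have mx: "X r x $ k <= MX r' x" if "0 <= r" "r <= r'" for r r'
  using rmax_ge[OF Xk_continuous[OF x] that, of k] that by (simp add: MX_eq running_max_eq)
 have R0: "0 <= R" using MX_mono[OF x, of s "s + h"] h by (simp add: R_def)
 obtain q where q: "0 <= q" "q <= h" "S = Y q x $ k"
  using rmax_attained[OF c, of h] h unfolding S_def running_max_eq by auto
 have "X (s + q) x $ k <= MX (s + h) x" using q s0 by (intro mx) auto
 hence "S - D - L * h <= R" using step[OF q(1,2)] q(3) unfolding R_def D_def by linarith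
 thus "max 0 (S - D - L * h) <= R" using R0 by simp
 obtain r where r: "0 <= r" "r <= s + h" "MX (s + h) x = X r x $ k"
  using rmax_attained[OF Xk_continuous[OF x], of "s + h" k] s0 h by (auto simp: MX_eq running_max_eq)
 show "R <= max 0 (S - D + L * h)"
 proof (cases "r <= s")
  case True
  thus ?thesis using mx[OF r(1) True] r(3) by (simp add: R_def)
 next
  case False
  have "Y (r - s) x $ k <= S" unfolding S_def running_max_eq using rmax_ge[OF c, of "r - s" h] False r by simp
  moreover have "\<bar>X r x $ k - (XX s x $ k + Y (r - s) x $ k)\<bar> <= L * h" using step[of "r - s"] False r by simp
  ultimately have "R <= S - D + L * h" unfolding R_def D_def r(3) by linarith
  thus ?thesis by simp
 qed
qed

text \<open>After division by \<open>h\<close>, an error of size \<open>Q\<^sup>2 + h\<close> alone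
  would stay of order 1. The gain is the indicator: unless the gap \<open>D\<close> is below
  \<open>Q\<close> the maximum does not move, and by \<open>near_diagonal\<close> this event has
  probability of order \<open>Q\<close>.\<close>

lemma taylor_error:
 assumes h: "0 < h" and p: "p \<in> space M" and Y: "\<forall>r\<ge>0. Y r p = W (s + r) p - W s p"
  and X: "X_incr p"
 defines "S \<equiv> running_max k Y h p" and "D \<equiv> MX s p - XX s p $ k"
  and "Q \<equiv> disp s Y h p"
 shows "\<bar>F (MX (s + h) p, XX (s + h) p) - F (MX s p, XX (s + h) p) - F' (MX s p, XX s p) (1, 0) * max 0 (S - D)\<bar>
   <= (2 * C + C * L) * (indicator {x. x < Q} D * (Q\<^sup>2 + h))"
proof -
 let ?x = "XX (s + h) p" and ?m = "MX s p" and ?y = "XX s p"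
 define R where "R = MX (s + h) p - MX s p"
 have Lh: "0 <= L * h" using L_nonneg h by simp
 have S0: "0 <= S" using shifted_max_nonneg[OF sn p] h by (simp add: S_def)
 have D0: "0 <= D" using XX_le_MX[OF p, of s] by (simp add: D_def)
 have R: "max 0 (S - D - L * h) <= R" "R <= max 0 (S - D + L * h)"
  using max_increment[OF h p Y X] by (simp_all only: R_def S_def D_def)
 have SQ: "S + L * h <= Q" by (simp add: Q_def S_def disp_def)
 show ?thesis
 proof (cases "D < Q")
  case False
  hence "max 0 (S - D + L * h) = 0" "max 0 (S - D) = 0" using SQ Lh by auto
  hence "MX (s + h) p = MX s p" using R by (simp add: R_def)
  thus ?thesis using False \<open>max 0 (S - D) = 0\<close> by simp
 next
  case True
  have RQ: "0 <= R" "R <= Q" "\<bar>R - max 0 (S - D)\<bar> <= L * h" using R SQ D0 S0 Lh by linarith+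
  have nx: "norm (?x - ?y) <= Q"
  proof -
   have "?x - ?y = integral {s..s + h} (%r. B (X r p)) + (W (s + h) p - W s p)"
   proof -
    have "?x = ?y + integral {s..s + h} (%r. B (X r p)) + (W (s + h) p - W s p)" using X s h less_imp_le by blast
    thus ?thesis by (simp add: algebra_simps)
   qed
   hence "norm (?x - ?y) <= norm (integral {s..s + h} (%r. B (X r p))) + norm (W (s + h) p - W s p)"
    by (simp only: norm_triangle_ineq)
   also have "... <= Q" using drift_integral_bound[OF p, of s h] s h S0 by (simp add: Q_def S_def disp_def)
   finally show ?thesis .
  qed
  have f: "F' z (R, 0) = R * F' z (1, 0)" for z
  proof -
   have "(R, 0) = R *\<^sub>R (1 :: real, 0 :: real ^ 'd)" by simp
   thus ?thesis by (simp only: blinfun.scaleR_right real_scaleR_def)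
  qed
  \<comment> \<open>\<open>?A\<close> is the Taylor remainder in the maximum, \<open>?B\<close> the
    change of base position from the end to the start of the step, \<open>?E\<close> the replacement
    of the true increment by \<open>max 0 (S - D)\<close>.\<close>
  let ?A = "F (?m + R, ?x) - F (?m, ?x) - R * F' (?m, ?x) (1, 0)"
   and ?B = "R * (F' (?m, ?x) (1, 0) - F' (?m, ?y) (1, 0))" and ?E = "F' (?m, ?y) (1, 0) * (R - max 0 (S - D))"
  have "\<bar>?A\<bar> <= C / 2 * R\<^sup>2" using T.taylor_bound[of "(?m, ?x)" "(R, 0)"] by (simp add: f norm_prod_def)
  also have "... <= C * Q\<^sup>2"
   using RQ T.C_nonneg by (intro mult_mono power_mono) auto
  finally have A: "\<bar>?A\<bar> <= C * Q\<^sup>2" .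
  have "\<bar>F' (?m, ?x) (1, 0) - F' (?m, ?y) (1, 0)\<bar> <= C * norm (?x - ?y)"
   using T.F'_lipschitz[of "(?m, ?y)" "(0, ?x - ?y)" "(1, 0)"] by (simp add: norm_prod_def)
  also have "... <= C * Q" using nx T.C_nonneg by (intro mult_left_mono)
  finally have "\<bar>?B\<bar> <= Q * (C * Q)" unfolding abs_mult using RQ by (intro mult_mono) auto
  hence B: "\<bar>?B\<bar> <= C * Q\<^sup>2" by (simp add: power2_eq_square mult_ac)
  have "\<bar>?E\<bar> <= C * (L * h)"
   unfolding abs_mult using RQ T.F'_bound[of "(?m, ?y)" "(1, 0)"] T.C_nonneg by (intro mult_mono) (auto simp: norm_prod_def)
  moreover have "F (MX (s + h) p, ?x) - F (?m, ?x) - F' (?m, ?y) (1, 0) * max 0 (S - D) = ?A + ?B + ?E"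
   by (simp add: R_def algebra_simps)
  ultimately have "\<bar>F (MX (s + h) p, ?x) - F (?m, ?x) - F' (?m, ?y) (1, 0) * max 0 (S - D)\<bar> <= C * Q\<^sup>2 + C * Q\<^sup>2 + C * (L * h)"
   using A B by linarith
  also have "... <= (2 * C + C * L) * (Q\<^sup>2 + h)"
   using T.C_nonneg L_nonneg h by (simp add: algebra_simps)
  finally show ?thesis using True by simp
 qed
qed

lemma max_expectation:
 assumes h: "0 < h"
 shows "(LINT p|M. max 0 (running_max k Y h p - d)) = sqrt h * e1 (d / sqrt h)"
proof -
 have [measurable]: "running_max k Y h \<in> borel_measurable M" by (rule shifted_max_measurable[OF sn]) (use h in simp)
 have "(LINT p|M. max 0 (running_max k Y h p - d)) = (\<integral>x. max 0 (x - d) \<partial>distr M borel (running_max k Y h))"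
  by (subst integral_distr) auto
 also have "... = (LBINT z. gd h (z :: real ^ 'd) * max 0 (\<bar>z $ k\<bar> - d))"
  unfolding maximum_law[OF sn h] using h by (subst integral_distr, simp, simp, subst integral_density) auto
 finally show ?thesis by (simp add: e1_scaled[OF h])
qed

text \<open>With the noise frozen, \<open>near_diagonal\<close> turns the indicator into the factor
  \<open>Gam s * disp\<close>, and the moment bound then leaves \<open>sqrt h\<close> after division
  by \<open>h\<close>. In the main term the noise is averaged with the past frozen, which produces
  \<open>e1\<close>.\<close>

lemma max_part_error:
 assumes h: "0 < h" "h <= 1"
 shows "\<bar>(LINT p|M. F (MX (s + h) p, XX (s + h) p) - F (MX s p, XX (s + h) p)) / h
   - (LINT p|M. F' (MX s p, XX s p) (1, 0) * (sqrt h * e1 ((MX s p - XX s p $ k) / sqrt h))) / h\<bar>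
  <= (2 * C + C * L) * Gam s * CD * sqrt h"
proof -
 let ?V = "%p. (MX s p, XX s p)" and ?Z = "%p. (running_max k Y h p, W (s + h) p - W s p)"
 have ind: "indep_var borel ?V borel ?Z"
  using indep_past_future[OF s h(1) shifted_noise_continuous[OF sn] shifted_noise_measurable[OF sn] shifted_noise_eq[OF sn]] s by (simp add: MX_eq XX_eq)
 have [measurable]: "running_max k Y h \<in> borel_measurable M" by (rule shifted_max_measurable[OF sn]) (use h in simp)
 have [measurable]: "(%p. W (s + h) p - W s p) \<in> borel_measurable M" using s h by (intro borel_measurable_diff W_measurable) auto
 have [measurable]: "disp s Y h \<in> borel_measurable M" unfolding disp_def by measurable
 define K1 where "K1 = 2 * C + C * L"
 have K1: "0 <= K1" using T.C_nonneg L_nonneg by (simp add: K1_def)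
 have disp0: "0 <= disp s Y h p" if "p \<in> space M" for p
  using shifted_max_nonneg[OF sn that, of h] h L_nonneg by (simp add: disp_def)
 let ?D = "%p. MX s p - XX s p $ k"
 let ?A = "%p. F (MX (s + h) p, XX (s + h) p) - F (MX s p, XX (s + h) p)"
 let ?\<Psi> = "%z :: (real \<times> (real ^ 'd)) \<times> (real \<times> (real ^ 'd)). F' (fst z) (1, 0) * max 0 (fst (snd z) - (fst (fst z) - snd (fst z) $ k))"
 let ?P = "%p. F' (?V p) (1, 0) * max 0 (running_max k Y h p - ?D p)"
 let ?q = "%z :: real \<times> (real ^ 'd). fst z + norm (snd z) + L * h"
 have err: "AE p in M. \<bar>?A p - ?P p\<bar> <= K1 * (indicator {x. x < disp s Y h p} (?D p) * ((disp s Y h p)\<^sup>2 + h))"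
  using X_increment shifted_noise_eq[OF sn] AE_space
  by eventually_elim (unfold K1_def, rule taylor_error[OF h(1)])
 have "(\<integral>\<^sup>+p. ennreal (norm (?A p - ?P p)) \<partial>M)
   <= (\<integral>\<^sup>+p. ennreal K1 * (indicator {x. x < disp s Y h p} (?D p) * ennreal ((disp s Y h p)\<^sup>2 + h)) \<partial>M)"
 proof (rule nn_integral_mono_AE, use err in eventually_elim)
  fix p assume "\<bar>?A p - ?P p\<bar> <= K1 * (indicator {x. x < disp s Y h p} (?D p) * ((disp s Y h p)\<^sup>2 + h))"
  hence "ennreal (norm (?A p - ?P p)) <= ennreal (K1 * (indicator {x. x < disp s Y h p} (?D p) * ((disp s Y h p)\<^sup>2 + h)))" by (simp add: ennreal_leI)
  also have "... = ennreal K1 * (indicator {x. x < disp s Y h p} (?D p) * ennreal ((disp s Y h p)\<^sup>2 + h))"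
   using K1 h by (auto simp: ennreal_mult indicator_def)
  finally show "ennreal (norm (?A p - ?P p)) <= ennreal K1 * (indicator {x. x < disp s Y h p} (?D p) * ennreal ((disp s Y h p)\<^sup>2 + h))" .
 qed
 also have "... = ennreal K1 * (\<integral>\<^sup>+p. indicator {x. x < disp s Y h p} (?D p) * ennreal ((disp s Y h p)\<^sup>2 + h) \<partial>M)"
  by (rule nn_integral_cmult) (simp add: indicator_def)
 also have "(\<integral>\<^sup>+p. indicator {x. x < disp s Y h p} (?D p) * ennreal ((disp s Y h p)\<^sup>2 + h) \<partial>M)
   = (\<integral>\<^sup>+p'. (\<integral>\<^sup>+p. indicator {x. x < disp s Y h p'} (?D p) * ennreal ((disp s Y h p')\<^sup>2 + h) \<partial>M) \<partial>M)"
  using indep_var_nn_integral[OF ind, of "%z. indicator {x. x < ?q (snd z)} (fst (fst z) - snd (fst z) $ k) * ennreal ((?q (snd z))\<^sup>2 + h)"]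
  by (simp add: disp_def indicator_def)
 also have "... <= (\<integral>\<^sup>+p'. ennreal (Gam s) * ennreal (((disp s Y h p')\<^sup>2 + h) * disp s Y h p') \<partial>M)"
 proof (rule nn_integral_mono)
  fix p' assume p': "p' \<in> space M"
  have "(\<integral>\<^sup>+p. indicator {x. x < disp s Y h p'} (?D p) * ennreal ((disp s Y h p')\<^sup>2 + h) \<partial>M)
    = (\<integral>\<^sup>+p. indicator {x. x < disp s Y h p'} (?D p) \<partial>M) * ennreal ((disp s Y h p')\<^sup>2 + h)"
   by (rule nn_integral_multc) simp
  also have "... <= ennreal (Gam s * disp s Y h p') * ennreal ((disp s Y h p')\<^sup>2 + h)"
   by (intro mult_right_mono near_diagonal s disp0 p') simp
  also have "... = ennreal (Gam s) * ennreal (((disp s Y h p')\<^sup>2 + h) * disp s Y h p')"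
   using Gam_nonneg[of s] s h disp0[OF p'] by (simp add: ennreal_mult mult_ac)
  finally show "(\<integral>\<^sup>+p. indicator {x. x < disp s Y h p'} (?D p) * ennreal ((disp s Y h p')\<^sup>2 + h) \<partial>M) <= ennreal (Gam s) * ennreal (((disp s Y h p')\<^sup>2 + h) * disp s Y h p')" .
 qed
 also have "... = ennreal (Gam s) * (\<integral>\<^sup>+p'. ennreal (((disp s Y h p')\<^sup>2 + h) * disp s Y h p') \<partial>M)"
  by (rule nn_integral_cmult) simp
 also have "... <= ennreal (Gam s) * ennreal (CD * (h * sqrt h))"
  by (intro mult_left_mono displacement_moment sn h) simp
 also have "ennreal K1 * ... = ennreal (K1 * Gam s * CD * sqrt h * h)"
  using K1 Gam_nonneg[of s] s h CD_nonneg by (simp add: ennreal_mult[symmetric] mult_ac)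
 finally have nn: "(\<integral>\<^sup>+p. ennreal (norm (?A p - ?P p)) \<partial>M) <= ennreal (K1 * Gam s * CD * sqrt h * h)"
  by (simp add: mult_left_mono)
 have ierr: "integrable M (%p. ?A p - ?P p)"
  by (rule integrableI_bounded) (use nn in \<open>auto simp: order_le_less_trans\<close>)
 have iA: "integrable M ?A"
 proof (rule integrable_const_bound[where B="2 * C"])
  have "\<bar>?A p\<bar> <= 2 * C" for p
   using T.F_bound[of "(MX (s + h) p, XX (s + h) p)"] T.F_bound[of "(MX s p, XX (s + h) p)"] by linarith
  thus "AE p in M. norm (?A p) <= 2 * C" by simp
 qed measurable
 have iP: "integrable M ?P" using Bochner_Integration.integrable_diff[OF iA ierr] by simp
 have "(LINT p|M. ?P p) = (LINT p|M. (LINT p'|M. ?\<Psi> (?V p, ?Z p')))"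
  using indep_var_integral[OF ind, of ?\<Psi>] iP by simp
 also have "... = (LINT p|M. F' (?V p) (1, 0) * (sqrt h * e1 (?D p / sqrt h)))"
  by (simp add: max_expectation[OF h(1)])
 finally have EP: "(LINT p|M. ?P p) = (LINT p|M. F' (?V p) (1, 0) * (sqrt h * e1 (?D p / sqrt h)))" .
 have "ennreal \<bar>LINT p|M. ?A p - ?P p\<bar> <= ennreal (K1 * Gam s * CD * sqrt h * h)"
  using integral_norm_bound_ennreal[OF ierr] nn by simp
 hence "\<bar>LINT p|M. ?A p - ?P p\<bar> <= K1 * Gam s * CD * sqrt h * h"
  using K1 Gam_nonneg[of s] s h CD_nonneg by (subst (asm) ennreal_le_iff) auto
 hence "\<bar>(LINT p|M. ?A p) - (LINT p|M. ?P p)\<bar> / h <= K1 * Gam s * CD * sqrt h"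
  using h iA iP by (simp add: pos_divide_le_eq)
 thus ?thesis unfolding EP[symmetric] K1_def[symmetric] using h by (simp add: abs_divide diff_divide_distrib[symmetric])
qed

end

lemma max_part:
 assumes s: "0 < s" and h: "h ----> 0" "!!n. 0 < h n" "!!n. h n <= 1"
 defines "m \<equiv> %n. (LINT x|M. F (MX (s + h n) x, XX (s + h n) x) - F (MX s x, XX (s + h n) x)) / h n"
 shows "m ----> 1 / 2 * Tr s" and "\<bar>m n\<bar> <= (C + (2 * C + C * L) * CD) * Gam s"
proof -
 have "\<exists>Y. shifted_noise s Y"
 proof (rule shifted_noise_ex[OF less_imp_le[OF s]])
  fix Y assume "!!x. x \<in> space M ==> continuous_on {0..} (%t. Y t x)" "!!t. 0 <= t ==> Y t \<in> borel_measurable M"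
   "AE x in M. \<forall>r\<ge>0. Y r x = W (s + r) x - W s x" "!!x. x \<in> space M ==> Y 0 x = 0"
  hence "shifted_noise s Y" using s by (simp add: shifted_noise_def)
  thus ?thesis by blast
 qed
 then obtain Y where sn: "shifted_noise s Y" by blast
 let ?d = "%n. (LINT x|M. F' (MX s x, XX s x) (1, 0) * (sqrt (h n) * e1 ((MX s x - XX s x $ k) / sqrt (h n)))) / h n"
 let ?K = "(2 * C + C * L) * Gam s * CD"
 have K: "0 <= ?K" using T.C_nonneg L_nonneg Gam_nonneg[of s] s CD_nonneg by simp
 have e: "\<bar>m n - ?d n\<bar> <= ?K * sqrt (h n)" for n
  unfolding m_def by (rule max_part_error[OF s sn h(2,3)])
 have d: "?d ----> 1 / 2 * Tr s" "\<bar>?d n\<bar> <= C * Gam s" for n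
  using diagonal_limit[OF s h(1,2)] by simp_all
 have "(%n. ?K * sqrt (h n)) ----> ?K * sqrt 0" by (intro tendsto_intros h)
 hence "(%n. m n - ?d n) ----> 0"
  by (intro Lim_null_comparison[of "%n. m n - ?d n" "%n. ?K * sqrt (h n)"]) (use e in auto)
 from tendsto_add[OF this d(1)] show "m ----> 1 / 2 * Tr s" by simp
 have "\<bar>m n\<bar> <= \<bar>m n - ?d n\<bar> + \<bar>?d n\<bar>" using abs_triangle_ineq[of "m n - ?d n" "?d n"] by simp
 also have "... <= ?K * sqrt (h n) + C * Gam s" by (intro add_mono e d)
 also have "... <= ?K * 1 + C * Gam s" by (rule add_right_mono, rule mult_left_mono[OF _ K]) (use h(3) in simp)
 also have "... = (C + (2 * C + C * L) * CD) * Gam s" by (simp add: algebra_simps)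
 finally show "\<bar>m n\<bar> <= (C + (2 * C + C * L) * CD) * Gam s" .
qed

end

section \<open>The formula\<close>

text \<open>\<open>f\<close> is controlled only in the open interval and the endpoints are null; at
  time 0 the position may have no density.\<close>

lemma lebesgue_on_interval:
 fixes f g :: "real => real"
 assumes g: "integrable lborel (%s. ind t s * g s)" and eq: "!!s. 0 < s ==> s < t ==> f s = g s"
 shows "integrable (lebesgue_on {0..t}) f" "(\<integral>s. f s \<partial>lebesgue_on {0..t}) = (LBINT s. ind t s * g s)"
proof -
 let ?f = "%s. indicator {0..t} s * f s" and ?g = "%s. ind t s * g s"
 have gm [measurable]: "?g \<in> borel_measurable borel" using borel_measurable_integrable[OF g] by simp
 have "?f = (%s. if s = 0 then ?f 0 else if s = t then ?f t else ?g s)" by (rule ext) (use eq in \<open>auto simp: indicator_def\<close>)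
 moreover have "(%s. if s = 0 then ?f 0 else if s = t then ?f t else ?g s) \<in> borel_measurable borel" by measurable
 ultimately have fm: "?f \<in> borel_measurable lborel" by simp
 have ae: "AE s in lborel. ?f s = ?g s"
  using AE_lborel_singleton[of 0] AE_lborel_singleton[of t] by eventually_elim (use eq in \<open>auto simp: indicator_def\<close>)
 have i: "integrable lborel ?f" and e: "(LBINT s. ?f s) = (LBINT s. ?g s)"
  using integrable_cong_AE[OF fm _ ae] integral_cong_AE[OF fm _ ae] g by auto
 have S: "{0..t} \<inter> space lebesgue \<in> sets lebesgue" by simp
 show "integrable (lebesgue_on {0..t}) f"
  using i fm by (subst integrable_restrict_space[OF S]) (simp add: integrable_completion)
 show "(\<integral>s. f s \<partial>lebesgue_on {0..t}) = (LBINT s. ?g s)"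
  using e fm by (subst integral_restrict_space[OF S]) (simp add: integral_completion)
qed

lemma AE_interval_ex:
 fixes a b :: real assumes "AE m in lborel. P m" "a < b" shows "\<exists>m. a < m \<and> m < b \<and> P m"
proof (rule ccontr)
 assume n: "\<not> ?thesis"
 have "AE m in lborel. m \<notin> {a<..<b}" using assms(1) by eventually_elim (use n in auto)
 hence "{a<..<b} \<in> null_sets lborel" by (subst AE_iff_null_sets) auto
 thus False using assms(2) by (auto simp: null_sets_def)
qed

context diffusion begin

lemma Gam_integrable: assumes "0 < t" shows "integrable lborel (%s. ind t s * Gam s)"
proof (rule lint_bound)
 have "(NN s. ennreal (ind t s * (1 / sqrt s))) <= ennreal (2 * sqrt t)"
  using assms by (intro nn_integral_inverse_sqrt) auto
 hence "integrable lborel (%s. ind t s * (1 / sqrt s))"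
  by (intro integrableI_nonneg) (auto simp: order_le_less_trans indicator_def)
 thus "integrable lborel (%s. 2 * par.A0 * exp (par.ll * t) * (ind t s * (1 / sqrt s)))"
  by (rule integrable_mult_right)
 show "AE s in lborel. norm (ind t s * Gam s) <= norm (2 * par.A0 * exp (par.ll * t) * (ind t s * (1 / sqrt s)))"
 proof (rule AE_I2)
  fix s
  show "norm (ind t s * Gam s) <= norm (2 * par.A0 * exp (par.ll * t) * (ind t s * (1 / sqrt s)))"
  proof (cases "0 < s \<and> s < t")
   case True
   hence "exp (par.ll * s) / sqrt s <= exp (par.ll * t) / sqrt s" using par.ll_pos by (intro divide_right_mono) auto
   hence "2 * par.A0 * (exp (par.ll * s) / sqrt s) <= 2 * par.A0 * (exp (par.ll * t) / sqrt s)"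
    using par.A0_nonneg by (intro mult_left_mono) auto
   thus ?thesis using True par.A0_nonneg by (simp add: Gam_def abs_mult)
  qed auto
 qed
 show "(%s. ind t s * Gam s) \<in> borel_measurable lborel" unfolding Gam_def indicator_def greaterThanLessThan_iff by measurable
qed

text \<open>Right-continuity in the level \<open>m\<close> is what makes the trace vanish where the law of \<open>X s\<close> has no mass.\<close>
lemma tr_zero:
 assumes s: "0 < s" and pX: "has_density M (X s) pX"
 shows "AE y in lborel. pX y = 0 \<longrightarrow> tr s y = 0"
proof -
 have D: "distributed M lborel (%x. (MX s x, XX s x)) (%z. ennreal (pV s z))"
  using pV_density[OF s] s by (simp add: has_density_def MX_eq XX_eq)
 have DX: "distributed M lborel (XX s) (%y. ennreal (pX y))" and pX0: "!!y. 0 <= pX y"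
  using pX s by (simp_all add: has_density_def XX_eq)
 have pXm [measurable]: "(%y. ennreal (pX y)) \<in> borel_measurable borel" using distributed_borel_measurable[OF DX] by simp
 let ?q = "%y. \<integral>\<^sup>+m. ennreal (pV s (m, y)) \<partial>lborel"
 have qm [measurable]: "?q \<in> borel_measurable borel" by measurable
 have "density lborel (%y. ennreal (pX y)) = density lborel ?q"
 proof (rule measure_eqI)
  fix A assume "A \<in> sets (density lborel (%y. ennreal (pX y)))"
  hence [measurable]: "A \<in> sets borel" by simp
  have m: "(%z. ennreal (pV s z) * indicator A (snd z)) \<in> borel_measurable (lborel \<Otimes>\<^sub>M lborel)"
   by (simp only: lborel_prod) measurable
  have "emeasure (density lborel (%y. ennreal (pX y))) A = (NN y. ennreal (pX y) * indicator A y)"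
   by (subst emeasure_density) auto
  also have "... = (\<integral>\<^sup>+x. indicator A (XX s x) \<partial>M)"
   using distributed_nn_integral[OF DX, of "indicator A"] by simp
  also have "... = (NN z. ennreal (pV s z) * indicator A (snd z))"
   by (subst distributed_nn_integral[OF D]) auto
  also have "... = (NN y. (NN m. ennreal (pV s (m, y)) * indicator A y))"
   unfolding lborel_prod[symmetric] by (subst lborel_pair.nn_integral_snd[OF m, symmetric]) simp
  also have "... = (NN y. ?q y * indicator A y)" by (intro nn_integral_cong nn_integral_multc) simp
  also have "... = emeasure (density lborel ?q) A" by (subst emeasure_density) auto
  finally show "emeasure (density lborel (%y. ennreal (pX y))) A = emeasure (density lborel ?q) A" .
 qed simp
 hence "AE y in lborel. ennreal (pX y) = ?q y" by (intro sigma_finite_measure.density_unique[OF sigma_finite_lborel]) auto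
 thus ?thesis
 proof eventually_elim
  case (elim y)
  show ?case
  proof
   assume "pX y = 0"
   hence "AE m in lborel. ennreal (pV s (m, y)) = 0" using elim by (subst nn_integral_0_iff_AE[symmetric]) auto
   hence ae: "AE m in lborel. pV s (m, y) = 0"
    by eventually_elim (use pV_nonneg in \<open>auto simp: ennreal_eq_0_iff intro: antisym\<close>)
   \<comment> \<open>Levels with vanishing density exist arbitrarily close above
     \<open>y $ k\<close>, and the trace is the limit of the series along them.\<close>
   have "\<exists>m. y $ k < m \<and> m < y $ k + 1 / real (Suc n) \<and> pV s (m, y) = 0" for n
    by (rule AE_interval_ex[OF ae]) simp
   then obtain m where m: "!!n. y $ k < m n" "!!n. m n < y $ k + 1 / real (Suc n)" "!!n. pV s (m n, y) = 0" by metis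
   have "(%n. y $ k + 1 / real (Suc n)) ----> y $ k + 0" by (intro tendsto_intros LIMSEQ_Suc[OF lim_const_over_n])
   hence ml: "m ----> y $ k"
    by (intro tendsto_sandwich[of "%_. y $ k" m sequentially "%n. y $ k + 1 / real (Suc n)"] always_eventually allI less_imp_le m) simp_all
   have "(%n. par.ps (s, m n, y)) ----> par.ps (s, y $ k, y)"
    using m(1) by (intro par.good_tendsto[OF par.good_ps s] ml tendsto_const) (auto intro: less_imp_le)
   hence "(%n. max 0 (par.ps (s, m n, y))) ----> tr s y" unfolding tr_def by (intro tendsto_intros)
   moreover have "max 0 (par.ps (s, m n, y)) = 0" for n using m(1,3)[of n] s by (simp add: pV_def)
   ultimately show "tr s y = 0" using LIMSEQ_unique[OF _ tendsto_const] by fastforce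
  qed
 qed
qed

end

context diffusion_test begin

lemma generator_measurable [measurable]: "generator B F \<in> borel_measurable borel"
proof -
 have "(%z. F' z (0, B (snd z)) + (\<Sum>i\<in>UNIV. F'' z (0, axis i 1) (0, axis i 1)) / 2) \<in> borel_measurable borel"
  by measurable
 thus ?thesis by (simp add: T.generator_eq[abs_def])
qed

lemma generator_bound: "\<bar>generator B F z\<bar> <= C * L + CARD('d) * C / 2"
proof -
 have "\<bar>F' z (0, B (snd z))\<bar> <= C * L"
  using T.F'_bound[of z "(0, B (snd z))"] mult_left_mono[OF B_bound T.C_nonneg, of "snd z"] by (simp add: norm_prod_def)
 moreover have "\<bar>\<Sum>i\<in>UNIV. F'' z (0, axis i 1) (0, axis i 1)\<bar> <= (\<Sum>i\<in>(UNIV :: 'd set). C)"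
 proof (rule order_trans[OF sum_abs sum_mono])
  show "\<bar>F'' z (0, axis i 1) (0, axis i 1)\<bar> <= C" for i
   using T.F''_bound[of z "(0, axis i 1)" "(0, axis i 1)"] by (simp add: norm_prod_def norm_axis_1)
 qed
 ultimately show ?thesis unfolding T.generator_eq by simp
qed

lemma trace_integrable: assumes s: "0 < s" shows "integrable lborel (%y. F' (y $ k, y) (1, 0) * tr s y)" "\<bar>Tr s\<bar> <= C * Gam s"
proof -
 have b: "\<bar>F' (y $ k, y) (1, 0) * tr s y\<bar> <= C * Gam s * par.Hm s y" for y
 proof -
  have "\<bar>F' (y $ k, y) (1, 0)\<bar> * tr s y <= C * (Gam s * par.Hm s y)"
   using T.F'_bound[of "(y $ k, y)" "(1, 0)"] tr_le[OF s] T.C_nonneg by (intro mult_mono) (auto simp: norm_prod_def tr_def)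
  thus ?thesis by (simp add: abs_mult mult.assoc tr_def)
 qed
 have iH: "integrable lborel (%y. C * Gam s * par.Hm s y)" by (intro integrable_mult_right Hm_integrable s)
 show i: "integrable lborel (%y. F' (y $ k, y) (1, 0) * tr s y)"
  by (rule lint_bound[OF iH], measurable) (rule AE_I2, simp only: real_norm_def, rule order_trans[OF b abs_ge_self])
 have "\<bar>Tr s\<bar> <= (LBINT y. \<bar>F' (y $ k, y) (1, 0) * tr s y\<bar>)"
  unfolding Tr_def using integral_norm_bound[of lborel "%y. F' (y $ k, y) (1, 0) * tr s y"] by simp
 also have "... <= (LBINT y. C * Gam s * par.Hm s y)" by (intro integral_mono integrable_abs i iH b)
 finally show "\<bar>Tr s\<bar> <= C * Gam s" by (simp add: Hm_integral[OF s])
qed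

lemma Tr_measurable [measurable]: "Tr \<in> borel_measurable borel" unfolding Tr_def by measurable

text \<open>Integrating against the law of \<open>X s\<close> multiplies the quotient by
  \<open>pX\<close> again. Where \<open>pX\<close> is 0 the quotient is 0 by convention, and
  \<open>tr_zero\<close> makes the trace 0 there as well.\<close>

lemma conditional_trace:
 assumes s: "0 < s" and pX: "has_density M (X s) pX"
 defines "J \<equiv> %x. partial_m F (X s x $ k, X s x) * (diag_trace k (pV s) (X s x) / pX (X s x))"
 shows "integrable M J" "(LINT x|M. J x) = Tr s"
proof -
 have DX: "distributed M lborel (X s) (%y. ennreal (pX y))" and pX0: "!!y. 0 <= pX y"
  using pX by (simp_all add: has_density_def)
 have "(%y. enn2real (ennreal (pX y))) \<in> borel_measurable borel" using distributed_borel_measurable[OF DX] by simp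
 hence pXm [measurable]: "pX \<in> borel_measurable borel" using pX0 by simp
 let ?j = "%y. F' (y $ k, y) (1, 0) * (tr s y / pX y)"
 have J: "J = (%x. ?j (X s x))" unfolding J_def by (simp add: T.dir_deriv_eq diag_trace_pV[OF s])
 have jm: "?j \<in> borel_measurable lborel" by measurable
 have ae: "AE y in lborel. pX y * ?j y = F' (y $ k, y) (1, 0) * tr s y"
  using tr_zero[OF s pX] by eventually_elim auto
 have m1: "(%y. pX y * ?j y) \<in> borel_measurable lborel" and m2: "(%y. F' (y $ k, y) (1, 0) * tr s y) \<in> borel_measurable lborel" by measurable
 have "integrable lborel (%y. pX y * ?j y)" using integrable_cong_AE[OF m1 m2 ae] trace_integrable(1)[OF s] by simp
 thus "integrable M J" unfolding J using distributed_integrable[OF DX jm] pX0 by simp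
 have "(LINT x|M. J x) = (LBINT y. pX y * ?j y)" unfolding J using distributed_integral[OF DX jm] pX0 by simp
 also have "... = Tr s" unfolding Tr_def by (rule integral_cong_AE[OF m1 m2 ae])
 finally show "(LINT x|M. J x) = Tr s" .
qed

lemma integrable_on_interval:
 assumes t: "0 < t"
 shows "integrable lborel (%s. ind t s * Tr s)"
  and "integrable lborel (%s. ind t s * (LINT x|M. generator B F (MX s x, XX s x)))"
proof -
 have "integrable lborel (%s. C * (ind t s * Gam s))" by (intro integrable_mult_right Gam_integrable t)
 thus "integrable lborel (%s. ind t s * Tr s)"
 proof (rule lint_bound)
  show "AE s in lborel. norm (ind t s * Tr s) <= norm (C * (ind t s * Gam s))"
  proof (rule AE_I2)
   fix s show "norm (ind t s * Tr s) <= norm (C * (ind t s * Gam s))"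
    using trace_integrable(2)[of s] by (auto simp: indicator_def)
  qed
 qed (simp add: indicator_def)
 show "integrable lborel (%s. ind t s * (LINT x|M. generator B F (MX s x, XX s x)))"
 proof (rule abs_integral_interval_le(1)[where K="C * L + CARD('d) * C / 2"])
  show "\<bar>LINT x|M. generator B F (MX s x, XX s x)\<bar> <= C * L + CARD('d) * C / 2" for s
  proof -
   let ?g = "%x. generator B F (MX s x, XX s x)"
   have i: "integrable M ?g" by (rule integrable_const_bound[where B="C * L + CARD('d) * C / 2"]) (use generator_bound in auto)
   have "\<bar>LINT x|M. ?g x\<bar> <= (LINT x|M. \<bar>?g x\<bar>)" using integral_norm_bound[of M ?g] by simp
   also have "... <= C * L + CARD('d) * C / 2" using i generator_bound by (intro integral_le_const integrable_abs) auto
   finally show ?thesis .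
  qed
 qed (use t T.C_nonneg L_nonneg in auto)
qed

lemma ito_formula:
 assumes t: "0 < t"
 shows "(LINT p|M. F (MX t p, XX t p)) = (LINT p|M. F (MX 0 p, XX 0 p))
  + (LBINT s. ind t s * (LINT p|M. generator B F (MX s p, XX s p)))
  + 1 / 2 * (LBINT s. ind t s * Tr s)"
proof -
 define h :: "nat => real" where "h n = 1 / real (Suc n)" for n
 have h: "h ----> 0" "!!n. 0 < h n" "!!n. h n <= 1"
  unfolding h_def[abs_def] by (rule LIMSEQ_Suc[OF lim_const_over_n]) auto
 define g where "g s = (LINT p|M. F (MX s p, XX s p))" for s
 have gm [measurable]: "g \<in> borel_measurable borel" unfolding g_def by measurable
 have iF: "integrable M (%p. F (MX r p, XX s p))" for r s
  by (rule integrable_const_bound[where B=C]) (use T.F_bound in auto)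
 have gb: "\<bar>g s\<bar> <= C" for s
 proof -
  have "\<bar>g s\<bar> <= (LINT p|M. \<bar>F (MX s p, XX s p)\<bar>)" unfolding g_def using integral_norm_bound[of M "%p. F (MX s p, XX s p)"] by simp
  also have "... <= C" using iF T.F_bound by (intro integral_le_const integrable_abs) auto
  finally show ?thesis .
 qed
 have gr: "(g \<longlongrightarrow> g s0) (at_right s0)" for s0
 proof (rule tendsto_at_right_sequentially[where b="s0 + 1"])
  fix S :: "nat => real" assume S: "S ----> s0"
  show "(%n. g (S n)) ----> g s0"
   unfolding g_def
  proof (rule integral_dominated_convergence[where w="%_. C"])
   show "AE p in M. (%n. F (MX (S n) p, XX (S n) p)) ----> F (MX s0 p, XX s0 p)"
    by (intro AE_I2 continuous_on_tendsto_compose[OF T.F_continuous] tendsto_Pair MX_tendsto XX_tendsto S) auto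
  qed (use T.F_bound in auto)
 qed simp
 let ?x = "%n s. (LINT p|M. F (MX s p, XX (s + h n) p) - F (MX s p, XX s p)) / h n"
 let ?m = "%n s. (LINT p|M. F (MX (s + h n) p, XX (s + h n) p) - F (MX s p, XX (s + h n) p)) / h n"
 \<comment> \<open>Move the position first, with the maximum held at its value at time
   \<open>s\<close>, and then the maximum, at the new position.\<close>
 have split: "(g (s + h n) - g s) / h n = ?x n s + ?m n s" for n s
  using iF by (simp add: g_def add_divide_distrib[symmetric])
 let ?G = "%s. \<integral>p. generator B F (MX s p, XX s p) \<partial>M"
 let ?K = "C + (2 * C + C * L) * CD"
 have Gm [measurable]: "?G \<in> borel_measurable borel" by measurable
 have "(%n. \<integral>s. ind t s * ((g (s + h n) - g s) / h n) \<partial>lborel) ----> (LBINT s. ind t s * (?G s + 1 / 2 * Tr s))"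
 \<comment> \<open>The bound on the second part is a multiple of \<open>Gam s\<close>, of order
   \<open>1 / sqrt s\<close> near 0 and therefore integrable in time.\<close>
 proof (rule integral_dominated_convergence[where w="%s. (C * L + T.CS) * ind t s + ?K * (ind t s * Gam s)"])
  show "integrable lborel (%s. (C * L + T.CS) * ind t s + ?K * (ind t s * Gam s))"
   by (intro Bochner_Integration.integrable_add integrable_mult_right integrable_real_indicator Gam_integrable t) (use t in auto)
  show "AE s in lborel. (%n. ind t s * ((g (s + h n) - g s) / h n)) ----> ind t s * (?G s + 1 / 2 * Tr s)"
  proof (rule AE_I2)
   fix s
   show "(%n. ind t s * ((g (s + h n) - g s) / h n)) ----> ind t s * (?G s + 1 / 2 * Tr s)"
   proof (cases "0 < s \<and> s < t")
    case True
    hence s: "0 < s" by simp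
    show ?thesis unfolding split
     by (intro tendsto_mult tendsto_const tendsto_add x_part(1)[OF s h(1,2)] max_part(1)[OF s h])
   qed auto
  qed
  show "AE s in lborel. norm (ind t s * ((g (s + h n) - g s) / h n)) <= (C * L + T.CS) * ind t s + ?K * (ind t s * Gam s)" for n
  proof (rule AE_I2)
   fix s
   show "norm (ind t s * ((g (s + h n) - g s) / h n)) <= (C * L + T.CS) * ind t s + ?K * (ind t s * Gam s)"
   proof (cases "0 < s \<and> s < t")
    case True
    hence s: "0 < s" by simp
    have "\<bar>?x n s + ?m n s\<bar> <= (C * L + T.CS) + ?K * Gam s"
     by (rule order_trans[OF abs_triangle_ineq add_mono[OF x_part(2)[OF s h(1,2)] max_part(2)[OF s h]]])
    thus ?thesis unfolding split using True by simp
   qed auto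
  qed
 qed (simp_all add: indicator_def)
 moreover have "(%n. \<integral>s. ind t s * ((g (s + h n) - g s) / h n) \<partial>lborel) ----> g t - g 0"
  by (rule average_increment_tendsto[where C=C]) (use gm gb gr t h in auto)
 ultimately have "(LBINT s. ind t s * (?G s + 1 / 2 * Tr s)) = g t - g 0" by (rule LIMSEQ_unique)
 moreover have "(LBINT s. ind t s * (?G s + 1 / 2 * Tr s))
   = (LBINT s. ind t s * ?G s) + 1 / 2 * (LBINT s. ind t s * Tr s)"
 proof -
  have "(LBINT s. ind t s * (?G s + 1 / 2 * Tr s)) = (LBINT s. ind t s * ?G s + 1 / 2 * (ind t s * Tr s))"
   by (intro lint_cong) (auto simp: algebra_simps)
  thus ?thesis using integrable_on_interval[OF t] by simp
 qed
 ultimately show ?thesis by (simp add: g_def)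
qed

end

theorem theorem2p4:
  fixes M :: "'w measure" and k :: "'d::finite"
    and B :: "real ^ 'd \<Rightarrow> real ^ 'd"
    and \<mu>0 :: "(real ^ 'd) measure"
    and W X :: "real \<Rightarrow> 'w \<Rightarrow> real ^ 'd"
  assumes "prob_space M"
    and "C1_b B"
    and "prob_space \<mu>0" and "sets \<mu>0 = sets borel"
    and "brownian_motion M W"
    and "sde_solution M B \<mu>0 W X"
  shows "\<exists>pV :: real \<Rightarrow> real \<times> (real ^ 'd) \<Rightarrow> real.
    (\<forall>t>0. has_density M (\<lambda>\<omega>. (running_max k X t \<omega>, X t \<omega>)) (pV t) \<and>
       (\<forall>m x. m < x $ k \<longrightarrow> pV t (m, x) = 0)) \<and>
    (\<forall>T>0.
       (\<lambda>(t, y). SUP u\<in>{0<..}. ennreal (pV t (below_diag k y u)))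
         \<in> borel_measurable (lebesgue_on ({0..T} \<times> UNIV)) \<and>
       (\<integral>\<^sup>+(t, y). (SUP u\<in>{0<..}. ennreal (pV t (below_diag k y u)))
          \<partial>lebesgue_on ({0..T} \<times> UNIV)) < \<infinity>) \<and>
    (\<forall>t>0. AE y in lborel. \<exists>l. ((\<lambda>u. pV t (below_diag k y u)) \<longlongrightarrow> l) (at_right 0)) \<and>
    (\<forall>pX F t.
       (\<forall>s>0. has_density M (X s) (pX s)) \<and> C2_b F \<and> 0 < t \<longrightarrow>
       (let J = (\<lambda>s \<omega>. partial_m F (X s \<omega> $ k, X s \<omega>)
                   * (diag_trace k (pV s) (X s \<omega>) / pX s (X s \<omega>)))
        in (AE s in lebesgue_on {0..t}. integrable M (J s)) \<and>
           integrable (lebesgue_on {0..t}) (\<lambda>s. \<integral>\<omega>. J s \<omega> \<partial>M) \<and>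
           (\<integral>\<omega>. F (running_max k X t \<omega>, X t \<omega>) \<partial>M) =
             (\<integral>\<omega>. F (X 0 \<omega> $ k, X 0 \<omega>) \<partial>M)
             + (\<integral>s. (\<integral>\<omega>. generator B F (running_max k X s \<omega>, X s \<omega>) \<partial>M) \<partial>lebesgue_on {0..t})
             + 1/2 * (\<integral>s. (\<integral>\<omega>. J s \<omega> \<partial>M) \<partial>lebesgue_on {0..t})))"
proof -
 interpret prob_space M by fact
 from \<open>C1_b B\<close> obtain B' where B': "bounded (range B)" "\<forall>x. (B has_derivative blinfun_apply (B' x)) (at x)" "bounded (range B')"
  unfolding C1_b_def by blast
 obtain L K where LK: "!!x. norm (B x) <= L" "!!x. norm (B' x) <= K"
  using B'(1,3) unfolding bounded_iff by auto
 have lip: "norm (B x - B y) <= K * norm (x - y)" for x y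
  by (rule differentiable_bound[OF convex_UNIV, of B "%x. blinfun_apply (B' x)"])
   (use B'(2) LK(2) in \<open>auto intro: has_derivative_at_withinI simp: norm_blinfun.rep_eq[symmetric]\<close>)
 have K: "0 <= K" using LK(2)[of undefined] norm_ge_zero order_trans by blast
 interpret diffusion M k B \<mu>0 W X L K
  by unfold_locales (use assms LK lip K in auto)
 show ?thesis
 proof (intro exI[of _ pV] conjI allI impI)
  show "has_density M (%p. (running_max k X t p, X t p)) (pV t)" if "0 < t" for t by (rule pV_density[OF that])
  show "pV t (m, x) = 0" if "m < x $ k" for t m x using that by (intro pV_zero) simp
  show "(%(t, y). SUP u\<in>{0<..}. ennreal (pV t (below_diag k y u))) \<in> borel_measurable (lebesgue_on ({0..T} \<times> UNIV))" for T
   by (rule sup_density(1))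
  show "(\<integral>\<^sup>+(t, y). (SUP u\<in>{0<..}. ennreal (pV t (below_diag k y u))) \<partial>lebesgue_on ({0..T} \<times> UNIV)) < \<infinity>" if "0 < T" for T
   by (rule sup_density(2)[OF that])
  show "AE y in lborel. \<exists>l. ((%u. pV t (below_diag k y u)) \<longlongrightarrow> l) (at_right 0)" if "0 < t" for t
   using pV_trace_limit[OF that] by blast
  fix pX :: "real => real ^ 'd => real" and F :: "real \<times> (real ^ 'd) => real" and t :: real
  assume A: "(\<forall>s>0. has_density M (X s) (pX s)) \<and> C2_b F \<and> 0 < t"
  then obtain F' F'' C where T: "test_function F F' F'' C" using C2_b_test_function by blast
  interpret diffusion_test M k B \<mu>0 W X L K F F' F'' C
   by (intro diffusion_test.intro vector_test_function.intro T) unfold_locales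
  let ?J = "%s p. partial_m F (X s p $ k, X s p) * (diag_trace k (pV s) (X s p) / pX s (X s p))"
  have t: "0 < t" and J: "!!s. 0 < s ==> integrable M (?J s)" "!!s. 0 < s ==> (LINT p|M. ?J s p) = Tr s"
   using A conditional_trace by auto
  \<comment> \<open>At time 0 nothing is known about the quotient, but a single time is
    null.\<close>
  have "AE s in lebesgue. s \<noteq> (0 :: real)" by (intro AE_completion AE_lborel_singleton)
  hence "AE s in lebesgue. s \<in> {0..t} \<longrightarrow> integrable M (?J s)"
   by eventually_elim (intro impI J(1), simp)
  hence "AE s in lebesgue_on {0..t}. integrable M (?J s)" by (subst AE_restrict_space_iff) auto
  moreover note lebesgue_on_interval[OF integrable_on_interval(1)[OF t], of "%s. \<integral>p. ?J s p \<partial>M", OF J(2)]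
  moreover have "(\<integral>s. (LINT p|M. generator B F (running_max k X s p, X s p)) \<partial>lebesgue_on {0..t})
    = (LBINT s. ind t s * (LINT p|M. generator B F (MX s p, XX s p)))"
   by (rule lebesgue_on_interval(2)[OF integrable_on_interval(2)[OF t]]) (simp add: MX_eq XX_eq)
  moreover have "(LINT p|M. F (MX 0 p, XX 0 p)) = (LINT p|M. F (X 0 p $ k, X 0 p))"
   by (simp add: MX_eq XX_eq running_max_def)
  moreover have "(LINT p|M. F (MX t p, XX t p)) = (LINT p|M. F (running_max k X t p, X t p))"
   using t by (simp add: MX_eq XX_eq)
  ultimately show "let J = ?J
    in (AE s in lebesgue_on {0..t}. integrable M (J s)) \<and>
      integrable (lebesgue_on {0..t}) (%s. \<integral>p. J s p \<partial>M) \<and>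
      (LINT p|M. F (running_max k X t p, X t p)) =
       (LINT p|M. F (X 0 p $ k, X 0 p))
       + (\<integral>s. (LINT p|M. generator B F (running_max k X s p, X s p)) \<partial>lebesgue_on {0..t})
       + 1/2 * (\<integral>s. (LINT p|M. J s p) \<partial>lebesgue_on {0..t})"
   unfolding Let_def using ito_formula[OF t] by simp
 qed
qed

end
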